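(* Let $M$ be a smooth connected manifold of dimension $4$ and let $\Delta$ be a smooth totally nonholonomic distribution of rank $3$ on $M$. Then $\Delta$ satisfies the Sard Conjecture: for every $x\in M$, the set $\mathrm{Abn}_\Delta(x)$ of end-points of singular horizontal paths starting from $x$ has Lebesgue measure zero in $M$.
   Context: A distribution of rank $m$ on $M$ is a subbundle $\Delta\subset TM$ of rank $m$; it is totally nonholonomic (bracket generating) if iterated Lie brackets of its local sections span $T_xM$ at every $x$. Let $\omega$ be the canonical symplectic form on $T^*M$, $\pi:T^*M\to M$ the projection, $\Delta^\perp=\{(x,p)\in T^*M: p\ne0,\ p\cdot v=0\ \forall v\in\Delta(x)\}$, and $\omega^\perp$ the restriction (pullback) of $\omega$ to $\Delta^\perp$. A path $\gamma:[0,1]\to M$ is horizontal if it is absolutely continuous with derivative in $L^2$ and $\dot\gamma(t)\in\Delta(\gamma(t))$ for a.e. $t$. It is singular if it is a critical point of the end-point map on horizontal paths starting at $\gamma(0)$; equivalently, if there is an absolutely continuous $\psi:[0,1]\to\Delta^\perp$ with $\pi\circ\psi=\gamma$ and $\dot\psi(t)\in\ker(\omega^\perp_{\psi(t)})$ for a.e. $t$. *)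

theory Defs
  imports "HOL-Analysis.Analysis" "HOL-Library.Function_Algebras"
begin

text \<open>Pointwise vector space structure on functions; the abelian group part is in
  \<^theory>\<open>HOL-Library.Function_Algebras\<close>.\<close>

instantiation "fun" :: (type, real_vector) real_vector
begin

definition scaleR_fun :: "real \<Rightarrow> ('a \<Rightarrow> 'b) \<Rightarrow> 'a \<Rightarrow> 'b" where
  "scaleR_fun r f = (\<lambda>x. r *\<^sub>R f x)"

instance
  by standard (simp_all add: scaleR_fun_def fun_eq_iff scaleR_add_right scaleR_add_left)

end


section \<open>Calculus in Euclidean spaces\<close>

text \<open>Both notions below are meant for open \<open>S\<close>.\<close>

fun times_cont_differentiable_on ::
  "nat \<Rightarrow> 'a::real_normed_vector set \<Rightarrow> ('a \<Rightarrow> 'b::real_normed_vector) \<Rightarrow> bool" where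
  "times_cont_differentiable_on 0 S f \<longleftrightarrow> continuous_on S f"
| "times_cont_differentiable_on (Suc k) S f \<longleftrightarrow>
     (\<forall>x\<in>S. f differentiable (at x)) \<and>
     (\<forall>v. times_cont_differentiable_on k S (\<lambda>x. frechet_derivative f (at x) v))"

definition smooth_on :: "'a::real_normed_vector set \<Rightarrow> ('a \<Rightarrow> 'b::real_normed_vector) \<Rightarrow> bool" where
  "smooth_on S f \<longleftrightarrow> (\<forall>k. times_cont_differentiable_on k S f)"

text \<open>Absolute continuity on an interval \<open>I\<close>; a pair \<open>(s, t)\<close> in \<open>D\<close> stands for the
  subinterval with end-points \<open>s \<le> t\<close>.\<close>

definition abs_continuous_on :: "real set \<Rightarrow> (real \<Rightarrow> 'a::real_normed_vector) \<Rightarrow> bool" where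
  "abs_continuous_on I f \<longleftrightarrow>
     (\<forall>\<epsilon>>0. \<exists>\<delta>>0. \<forall>D.
        finite D \<and> (\<forall>(s, t)\<in>D. s \<in> I \<and> t \<in> I \<and> s \<le> t) \<and>
        disjoint_family_on (\<lambda>(s, t). {s<..<t}) D \<and> (\<Sum>(s, t)\<in>D. t - s) < \<delta>
        \<longrightarrow> (\<Sum>(s, t)\<in>D. norm (f t - f s)) < \<epsilon>)"


section \<open>Smooth manifolds and tangent vectors\<close>

text \<open>A chart is a domain together with a coordinate map, whose values outside the domain are
  irrelevant.\<close>

type_synonym ('p, 'e) chart = "'p set \<times> ('p \<Rightarrow> 'e)"

definition chart_inv :: "('p, 'e) chart \<Rightarrow> 'e \<Rightarrow> 'p" where
  "chart_inv c = inv_into (fst c) (snd c)"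

definition transition :: "('p, 'e) chart \<Rightarrow> ('p, 'e) chart \<Rightarrow> 'e \<Rightarrow> 'e" where
  "transition c c' = snd c' \<circ> chart_inv c"

definition smooth_atlas :: "('m::topological_space, 'e::euclidean_space) chart set \<Rightarrow> bool" where
  "smooth_atlas A \<longleftrightarrow>
     (\<Union>c\<in>A. fst c) = UNIV \<and>
     (\<forall>c\<in>A. open (fst c) \<and> open (snd c ` fst c) \<and>
        homeomorphism (fst c) (snd c ` fst c) (snd c) (chart_inv c)) \<and>
     (\<forall>c\<in>A. \<forall>c'\<in>A. smooth_on (snd c ` (fst c \<inter> fst c')) (transition c c'))"

text \<open>A tangent vector at \<open>x\<close> is given by its coordinate vectors in all charts around \<open>x\<close>, related
  by the derivatives of the transition maps, and is set to \<open>0\<close> on all other pairs \<open>c\<close>.\<close>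

type_synonym ('p, 'e) tvec = "('p, 'e) chart \<Rightarrow> 'e"

definition tangent_space :: "('p, 'e::euclidean_space) chart set \<Rightarrow> 'p \<Rightarrow> ('p, 'e) tvec set" where
  "tangent_space A x = {v.
     (\<forall>c. c \<notin> A \<or> x \<notin> fst c \<longrightarrow> v c = 0) \<and>
     (\<forall>c\<in>A. \<forall>c'\<in>A. x \<in> fst c \<and> x \<in> fst c' \<longrightarrow>
        v c' = frechet_derivative (transition c c') (at (snd c x)) (v c))}"

definition velocity ::
  "('p, 'e::euclidean_space) chart set \<Rightarrow> (real \<Rightarrow> 'p) \<Rightarrow> real \<Rightarrow> ('p, 'e) tvec" where
  "velocity A \<gamma> t = (\<lambda>c. if c \<in> A \<and> \<gamma> t \<in> fst c
     then vector_derivative (snd c \<circ> \<gamma>) (at t) else 0)"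

text \<open>The tangent space at \<open>q\<close> of a submanifold \<open>S\<close>: velocities at \<open>q\<close> of smooth curves in \<open>S\<close>.\<close>

definition tangent_to ::
  "('p, 'e::euclidean_space) chart set \<Rightarrow> 'p set \<Rightarrow> 'p \<Rightarrow> ('p, 'e) tvec set" where
  "tangent_to A S q = {velocity A \<sigma> 0 | \<sigma>. \<sigma> 0 = q \<and>
     (\<exists>\<epsilon>>0. \<exists>c\<in>A. (\<forall>s\<in>{-\<epsilon><..<\<epsilon>}. \<sigma> s \<in> S \<and> \<sigma> s \<in> fst c) \<and> smooth_on {-\<epsilon><..<\<epsilon>} (snd c \<circ> \<sigma>))}"

text \<open>Lebesgue measure zero in a manifold means measure zero in every chart.\<close>

definition measure_zero :: "('p, 'e::euclidean_space) chart set \<Rightarrow> 'p set \<Rightarrow> bool" where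
  "measure_zero A S \<longleftrightarrow> (\<forall>c\<in>A. negligible (snd c ` (S \<inter> fst c)))"


section \<open>Vector fields and distributions\<close>

definition local_rep ::
  "('p, 'e) chart \<Rightarrow> ('p \<Rightarrow> ('p, 'e) tvec) \<Rightarrow> 'e \<Rightarrow> 'e" where
  "local_rep c X = (\<lambda>z. X (chart_inv c z) c)"

definition smooth_vector_field ::
  "('p, 'e::euclidean_space) chart set \<Rightarrow> 'p set \<Rightarrow> ('p \<Rightarrow> ('p, 'e) tvec) \<Rightarrow> bool" where
  "smooth_vector_field A W X \<longleftrightarrow>
     (\<forall>y\<in>W. X y \<in> tangent_space A y) \<and>
     (\<forall>c\<in>A. smooth_on (snd c ` (W \<inter> fst c)) (local_rep c X))"

text \<open>In every chart, \<open>[X, Y] = DY(X) - DX(Y)\<close>.\<close>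

definition lie_bracket ::
  "('p, 'e::euclidean_space) chart set \<Rightarrow> ('p \<Rightarrow> ('p, 'e) tvec) \<Rightarrow> ('p \<Rightarrow> ('p, 'e) tvec) \<Rightarrow>
   'p \<Rightarrow> ('p, 'e) tvec" where
  "lie_bracket A X Y = (\<lambda>y c. if c \<in> A \<and> y \<in> fst c
     then frechet_derivative (local_rep c Y) (at (snd c y)) (X y c)
        - frechet_derivative (local_rep c X) (at (snd c y)) (Y y c)
     else 0)"

definition distribution ::
  "('m::topological_space, 'e::euclidean_space) chart set \<Rightarrow> nat \<Rightarrow>
   ('m \<Rightarrow> ('m, 'e) tvec set) \<Rightarrow> bool" where
  "distribution A m \<Delta> \<longleftrightarrow>
     (\<forall>x. subspace (\<Delta> x) \<and> \<Delta> x \<subseteq> tangent_space A x \<and> dim (\<Delta> x) = m) \<and>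
     (\<forall>x. \<exists>W X. open W \<and> x \<in> W \<and>
        (\<forall>i<m. smooth_vector_field A W (X i)) \<and>
        (\<forall>y\<in>W. span {X i y | i. i < m} = \<Delta> y))"

definition local_section ::
  "('p, 'e::euclidean_space) chart set \<Rightarrow> ('p \<Rightarrow> ('p, 'e) tvec set) \<Rightarrow> 'p set \<Rightarrow>
   ('p \<Rightarrow> ('p, 'e) tvec) \<Rightarrow> bool" where
  "local_section A \<Delta> W X \<longleftrightarrow> smooth_vector_field A W X \<and> (\<forall>y\<in>W. X y \<in> \<Delta> y)"

inductive_set iterated_brackets ::
  "('p, 'e::euclidean_space) chart set \<Rightarrow> ('p \<Rightarrow> ('p, 'e) tvec set) \<Rightarrow> 'p set \<Rightarrow>
   ('p \<Rightarrow> ('p, 'e) tvec) set"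
  for A \<Delta> W where
  local_sect: "local_section A \<Delta> W X \<Longrightarrow> X \<in> iterated_brackets A \<Delta> W"
| bracket: "\<lbrakk>X \<in> iterated_brackets A \<Delta> W; Y \<in> iterated_brackets A \<Delta> W\<rbrakk>
    \<Longrightarrow> lie_bracket A X Y \<in> iterated_brackets A \<Delta> W"

definition totally_nonholonomic ::
  "('m::topological_space, 'e::euclidean_space) chart set \<Rightarrow> ('m \<Rightarrow> ('m, 'e) tvec set) \<Rightarrow> bool" where
  "totally_nonholonomic A \<Delta> \<longleftrightarrow>
     (\<forall>x. span {X x | X W. open W \<and> x \<in> W \<and> X \<in> iterated_brackets A \<Delta> W} = tangent_space A x)"


section \<open>The cotangent bundle\<close>

text \<open>A covector at \<open>x\<close> is a linear functional on the tangent space at \<open>x\<close>; it is set to \<open>0\<close>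
  elsewhere, so that equality of covectors is equality of functions.\<close>

type_synonym ('p, 'e) covec = "('p, 'e) tvec \<Rightarrow> real"

definition cotangent_space :: "('p, 'e::euclidean_space) chart set \<Rightarrow> 'p \<Rightarrow> ('p, 'e) covec set" where
  "cotangent_space A x = {p.
     (\<forall>v. v \<notin> tangent_space A x \<longrightarrow> p v = 0) \<and>
     (\<forall>v\<in>tangent_space A x. \<forall>w\<in>tangent_space A x. p (v + w) = p v + p w) \<and>
     (\<forall>r. \<forall>v\<in>tangent_space A x. p (r *\<^sub>R v) = r * p v)}"

text \<open>The tangent vector at \<open>x\<close> with coordinate vector \<open>e\<close> in the chart \<open>c\<close>.\<close>

definition coord_vector ::
  "('p, 'e::euclidean_space) chart set \<Rightarrow> ('p, 'e) chart \<Rightarrow> 'p \<Rightarrow> 'e \<Rightarrow> ('p, 'e) tvec" where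
  "coord_vector A c x e = (\<lambda>c'. if c' \<in> A \<and> x \<in> fst c'
     then frechet_derivative (transition c c') (at (snd c x)) e else 0)"

text \<open>The canonical chart of the cotangent bundle over a chart of the base: \<open>(x, p)\<close> is mapped to
  the coordinates of \<open>x\<close> and the vector of the values of \<open>p\<close> on the coordinate vectors. These
  charts form an atlas of the cotangent bundle as a manifold modelled on \<open>'e \<times> 'e\<close>.\<close>

definition cotangent_chart ::
  "('p, 'e::euclidean_space) chart set \<Rightarrow> ('p, 'e) chart \<Rightarrow> ('p \<times> ('p, 'e) covec, 'e \<times> 'e) chart" where
  "cotangent_chart A c =
     ({(x, p). x \<in> fst c \<and> p \<in> cotangent_space A x},
      \<lambda>(x, p). (snd c x, \<Sum>b\<in>Basis. p (coord_vector A c x b) *\<^sub>R b))"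

definition cotangent_atlas ::
  "('p, 'e::euclidean_space) chart set \<Rightarrow> ('p \<times> ('p, 'e) covec, 'e \<times> 'e) chart set" where
  "cotangent_atlas A = cotangent_chart A ` A"

text \<open>The canonical symplectic form \<open>\<Sum>\<^sub>i dx\<^sub>i \<and> dp\<^sub>i\<close>; its expression does not depend on
  the canonical chart chosen.\<close>

definition symplectic_form ::
  "('p, 'e::euclidean_space) chart set \<Rightarrow> 'p \<times> ('p, 'e) covec \<Rightarrow>
   ('p \<times> ('p, 'e) covec, 'e \<times> 'e) tvec \<Rightarrow> ('p \<times> ('p, 'e) covec, 'e \<times> 'e) tvec \<Rightarrow> real" where
  "symplectic_form A q \<xi> \<eta> =
     (let C = (SOME C. C \<in> cotangent_atlas A \<and> q \<in> fst C)
      in fst (\<xi> C) \<bullet> snd (\<eta> C) - snd (\<xi> C) \<bullet> fst (\<eta> C))"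

definition annihilator ::
  "('p, 'e::euclidean_space) chart set \<Rightarrow> ('p \<Rightarrow> ('p, 'e) tvec set) \<Rightarrow>
   ('p \<times> ('p, 'e) covec) set" where
  "annihilator A \<Delta> = {(x, p). p \<in> cotangent_space A x \<and> p \<noteq> 0 \<and> (\<forall>v\<in>\<Delta> x. p v = 0)}"

text \<open>The kernel at \<open>q\<close> of the pullback of the symplectic form to the annihilator.\<close>

definition restricted_kernel ::
  "('p, 'e::euclidean_space) chart set \<Rightarrow> ('p \<Rightarrow> ('p, 'e) tvec set) \<Rightarrow> 'p \<times> ('p, 'e) covec \<Rightarrow>
   ('p \<times> ('p, 'e) covec, 'e \<times> 'e) tvec set" where
  "restricted_kernel A \<Delta> q =
     {\<xi> \<in> tangent_to (cotangent_atlas A) (annihilator A \<Delta>) q.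
        \<forall>\<eta>\<in>tangent_to (cotangent_atlas A) (annihilator A \<Delta>) q. symplectic_form A q \<xi> \<eta> = 0}"


section \<open>Horizontal and singular paths\<close>

text \<open>Paths are parametrized by \<open>[0, 1]\<close>; their values outside this interval are irrelevant.
  Absolute continuity in a manifold is a local condition, expressed in charts; it includes
  continuity. Around each time it suffices to use one chart, since transition maps are smooth.\<close>

definition abs_continuous_path :: "('p, 'e::euclidean_space) chart set \<Rightarrow> (real \<Rightarrow> 'p) \<Rightarrow> bool" where
  "abs_continuous_path A \<gamma> \<longleftrightarrow> (\<forall>t\<in>{0..1}. \<exists>c\<in>A. \<exists>\<epsilon>>0. let I = {0..1} \<inter> {t - \<epsilon>..t + \<epsilon>} in
     \<gamma> ` I \<subseteq> fst c \<and> abs_continuous_on I (snd c \<circ> \<gamma>))"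

definition abs_continuous_L2_path :: "('p, 'e::euclidean_space) chart set \<Rightarrow> (real \<Rightarrow> 'p) \<Rightarrow> bool" where
  "abs_continuous_L2_path A \<gamma> \<longleftrightarrow> (\<forall>t\<in>{0..1}. \<exists>c\<in>A. \<exists>\<epsilon>>0. let I = {0..1} \<inter> {t - \<epsilon>..t + \<epsilon>} in
     \<gamma> ` I \<subseteq> fst c \<and> abs_continuous_on I (snd c \<circ> \<gamma>) \<and>
     set_integrable lebesgue I (\<lambda>s. (norm (vector_derivative (snd c \<circ> \<gamma>) (at s)))\<^sup>2))"

definition horizontal_path ::
  "('p, 'e::euclidean_space) chart set \<Rightarrow> ('p \<Rightarrow> ('p, 'e) tvec set) \<Rightarrow> (real \<Rightarrow> 'p) \<Rightarrow> bool" where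
  "horizontal_path A \<Delta> \<gamma> \<longleftrightarrow> abs_continuous_L2_path A \<gamma> \<and>
     (AE t in lebesgue. t \<in> {0..1} \<longrightarrow> velocity A \<gamma> t \<in> \<Delta> (\<gamma> t))"

text \<open>A horizontal path is a critical point of the end-point map if and only if it has a lift to the
  annihilator that is almost everywhere tangent to the kernel of the restricted symplectic form;
  the latter form of the definition is used.\<close>

definition singular_path ::
  "('p, 'e::euclidean_space) chart set \<Rightarrow> ('p \<Rightarrow> ('p, 'e) tvec set) \<Rightarrow> (real \<Rightarrow> 'p) \<Rightarrow> bool" where
  "singular_path A \<Delta> \<gamma> \<longleftrightarrow> horizontal_path A \<Delta> \<gamma> \<and>
     (\<exists>\<psi>. abs_continuous_path (cotangent_atlas A) \<psi> \<and>
        (\<forall>t\<in>{0..1}. \<psi> t \<in> annihilator A \<Delta> \<and> fst (\<psi> t) = \<gamma> t) \<and>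
        (AE t in lebesgue. t \<in> {0..1} \<longrightarrow>
           velocity (cotangent_atlas A) \<psi> t \<in> restricted_kernel A \<Delta> (\<psi> t)))"

definition Abn ::
  "('p, 'e::euclidean_space) chart set \<Rightarrow> ('p \<Rightarrow> ('p, 'e) tvec set) \<Rightarrow> 'p \<Rightarrow> 'p set" where
  "Abn A \<Delta> x = {\<gamma> 1 | \<gamma>. singular_path A \<Delta> \<gamma> \<and> \<gamma> 0 = x}"

definition sard_conjecture ::
  "('p, 'e::euclidean_space) chart set \<Rightarrow> ('p \<Rightarrow> ('p, 'e) tvec set) \<Rightarrow> bool" where
  "sard_conjecture A \<Delta> \<longleftrightarrow> (\<forall>x. measure_zero A (Abn A \<Delta> x))"

end

theory Submission
  imports Defs
begin

text \<open>Locally \<open>\<Delta>\<close> is the kernel of a one-form \<open>\<alpha>\<close>, and the field \<open>Z\<close> with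
  \<open>i\<^sub>Z vol = \<alpha> \<and> d\<alpha>\<close> lies in \<open>\<Delta>\<close>. Where \<open>Z \<noteq> 0\<close>, a singular path is almost
  everywhere tangent to \<open>Z\<close>, so it stays in one orbit of \<open>Z\<close> as long as it avoids the set
  \<open>Sing\<close> where \<open>Z\<close> vanishes. At almost every point of \<open>Sing\<close> all derivatives of \<open>Z\<close> vanish; no
  iterated bracket leaves \<open>\<Delta>\<close> at such a point, hence \<open>Sing\<close> has measure zero.

  A singular path that ends outside \<open>Sing\<close> either never meets \<open>Sing\<close>, and then stays in one orbit, or
  leaves \<open>Sing\<close> for the last time at some instant, and then its end-point lies on an orbit of finite
  length that tends to a zero of \<open>Z\<close>. The divergence of \<open>Z\<close>, given by \<open>d\<alpha> \<and> d\<alpha>\<close>,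
  is bounded by a multiple of \<open>|Z|\<close>, because \<open>\<alpha>\<close> divides \<open>d\<alpha>\<close> up to an error linear in \<open>Z\<close>.
  So the flow contracts volume along orbits of bounded length by at most a constant factor, whereas it
  moves the points of such orbits into arbitrarily small neighbourhoods of the null set \<open>Sing\<close>: these
  points form a null set. Countably many flow boxes cover the complement of \<open>Sing\<close>, and
  sliding a null set along their orbits produces a null set again.\<close>

section \<open>Absolutely continuous functions\<close>

text \<open>An orbit needs infinite time to reach a zero of Z, so a bounded divergence would control
  nothing; a divergence bounded by C |Z| integrates to C times the length, which is finite because
  the path is absolutely continuous. The volume estimate is made for Euler polygons instead of the
  flow: their derivative is an explicit product of matrices \<open>mat 1 + h *\<^sub>R J\<close>,
  and the flow itself only has to be Lipschitz in the initial point. A singular path follows Z only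
  at almost every time and with arbitrary speed, possibly stopping or turning back, so it is
  compared with the orbits by a first integral, \<open>plaque\<close>, that is constant along it.
  Where the path or its lift has no derivative, \<open>vector_derivative\<close> is an unspecified
  value and the condition on the velocity says nothing; hence Lebesgue's theorem on monotone
  functions. The form \<alpha> is determined only up to a nonvanishing factor, and Z scales with its
  square. Independent of the choice is the notion of a characteristic vector, by which
  \<open>Sing\<close> is defined.\<close>

lemma emeasure_intervals:
  fixes f :: "real \<Rightarrow> real"
  assumes "mono f" "countable C" "\<And>u v. (u,v) \<in> C \<Longrightarrow> u < v"
    and "pairwise (\<lambda>(u,v) (u',v'). disjnt {u..v} {u'..v'}) C"
  shows "emeasure lborel (\<Union>(u,v)\<in>C. {f u<..<f v}) = (\<integral>\<^sup>+(u,v). ennreal (f v - f u) \<partial>count_space C)"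
proof -
  have dis: "disjoint_family_on (\<lambda>(u,v). {f u<..<f v}) C"
    unfolding disjoint_family_on_def
  proof (intro ballI impI)
    fix i j assume ij: "i \<in> C" "j \<in> C" "i \<noteq> j"
    obtain a b c d where i: "i = (a,b)" and j: "j = (c,d)" by fastforce
    have *: "(a,b) \<in> C" "(c,d) \<in> C" "\<not> (a = c \<and> b = d)" using ij i j by auto
    then have "disjnt {a..b} {c..d}" using assms(4) unfolding pairwise_def by fastforce
    moreover have "a < b" "c < d" using * assms(3) by auto
    ultimately have "b < c \<or> d < a"
      unfolding disjnt_iff using not_le by (metis atLeastAtMost_iff order.strict_implies_order order_refl linorder_linear)
    then show "(case i of (u,v) \<Rightarrow> {f u<..<f v}) \<inter> (case j of (u,v) \<Rightarrow> {f u<..<f v}) = {}"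
      unfolding i j using monoD[OF assms(1), of b c] monoD[OF assms(1), of d a] by auto
  qed
  have "emeasure lborel (\<Union>i\<in>C. (\<lambda>(u,v). {f u<..<f v}) i)
      = (\<integral>\<^sup>+i. emeasure lborel ((\<lambda>(u,v). {f u<..<f v}) i) \<partial>count_space C)"
    using assms(2) dis by (intro emeasure_UN_countable) (auto split: prod.splits)
  also have "\<dots> = (\<integral>\<^sup>+(u,v). ennreal (f v - f u) \<partial>count_space C)"
    by (intro nn_integral_cong) (use assms(1,3) in \<open>auto simp: emeasure_lborel_Ioo monoD less_imp_le split: prod.splits\<close>)
  finally show ?thesis by simp
qed

text \<open>Vitali's covering theorem for balls, with the point anywhere in the interval instead of
  at its centre. The end-points of countably many intervals form a null set, so the open intervals
  cover almost all of \<open>S\<close> too; their openness is what the nested covering below relies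
  on.\<close>

lemma Vitali_intervals:
  fixes P :: "real \<Rightarrow> real \<Rightarrow> bool"
  assumes "open U" "S \<subseteq> U"
    and fine: "\<And>x d. x \<in> S \<Longrightarrow> d > 0 \<Longrightarrow> \<exists>u v. u \<le> x \<and> x \<le> v \<and> u < v \<and> v - u < d \<and> P u v"
  obtains C where "countable C" "\<And>u v. (u,v) \<in> C \<Longrightarrow> u < v \<and> P u v \<and> {u..v} \<subseteq> U"
    "pairwise (\<lambda>(u,v) (u',v'). disjnt {u..v} {u'..v'}) C"
    "negligible (S - (\<Union>(u,v)\<in>C. {u<..<v}))"
proof -
  define K where "K = {(u,v). u < v \<and> P u v \<and> {u..v} \<subseteq> U}"
  have cb: "cball ((fst i + snd i)/2) ((snd i - fst i)/2) = {fst i..snd i}" for i :: "real \<times> real"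
    unfolding cball_eq_atLeastAtMost by (auto simp: field_simps)
  have 1: "0 < (snd i - fst i)/2" if "i \<in> K" for i using that by (auto simp: K_def)
  have 2: "\<exists>i. i \<in> K \<and> x \<in> cball ((fst i + snd i)/2) ((snd i - fst i)/2) \<and> (snd i - fst i)/2 < d"
    if "x \<in> S" "0 < d" for x d
  proof -
    obtain e where e: "e > 0" "ball x e \<subseteq> U" using assms(1,2) \<open>x \<in> S\<close> by (meson openE subsetD)
    obtain u v where uv: "u \<le> x" "x \<le> v" "u < v" "v - u < min d e" "P u v"
      using fine[of x "min d e"] \<open>x \<in> S\<close> \<open>0 < d\<close> e by auto
    have "{u..v} \<subseteq> ball x e" using uv by (auto simp: dist_real_def)
    then have "(u,v) \<in> K" using uv e by (auto simp: K_def)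
    then show ?thesis unfolding cb using uv by (intro exI[of _ "(u,v)"]) auto
  qed
  obtain C where C: "countable C" "C \<subseteq> K"
    "pairwise (\<lambda>i j. disjnt (cball ((fst i + snd i)/2) ((snd i - fst i)/2)) (cball ((fst j + snd j)/2) ((snd j - fst j)/2))) C"
    "negligible (S - (\<Union>i\<in>C. cball ((fst i + snd i)/2) ((snd i - fst i)/2)))"
    by (rule Vitali_covering_theorem_cballs[OF 1 2])
  have "negligible (fst ` C \<union> snd ` C)" using C(1) by (auto simp: negligible_iff_null_sets intro!: null_sets_completionI countable_imp_null_set_lborel)
  then have "negligible ((S - (\<Union>i\<in>C. {fst i..snd i})) \<union> (fst ` C \<union> snd ` C))"
    using C(4) unfolding cb by (rule negligible_Un[rotated])
  moreover have "S - (\<Union>(u,v)\<in>C. {u<..<v}) \<subseteq> (S - (\<Union>i\<in>C. {fst i..snd i})) \<union> (fst ` C \<union> snd ` C)"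
  proof
    fix x assume x: "x \<in> S - (\<Union>(u,v)\<in>C. {u<..<v})"
    show "x \<in> (S - (\<Union>i\<in>C. {fst i..snd i})) \<union> (fst ` C \<union> snd ` C)"
    proof (rule ccontr)
      assume "\<not> ?thesis"
      then obtain i where i: "i \<in> C" "x \<in> {fst i..snd i}" and ii: "x \<noteq> fst i" "x \<noteq> snd i" using x by blast
      then have "x \<in> (case i of (u,v) \<Rightarrow> {u<..<v})" by (cases i) auto
      with i x show False by blast
    qed
  qed
  ultimately have "negligible (S - (\<Union>(u,v)\<in>C. {u<..<v}))" by (rule negligible_subset)
  moreover have "pairwise (\<lambda>(u,v) (u',v'). disjnt {u..v} {u'..v'}) C" using C(3) unfolding cb
    by (simp add: case_prod_unfold)
  ultimately show ?thesis using C(1,2) by (intro that[of C]) (auto simp: K_def)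
qed

section \<open>Derivates of monotone functions and Lebesgue's differentiation theorem\<close>

definition upper_derivate_set :: "(real \<Rightarrow> real) \<Rightarrow> real \<Rightarrow> real set" where
  "upper_derivate_set f q = {x. \<forall>d>0. \<exists>u v. u \<le> x \<and> x \<le> v \<and> u < v \<and> v - u < d \<and> q * (v - u) < f v - f u}"

text \<open>As in the upper set, slopes are taken over short intervals that contain
  \<open>x\<close>, not only over those that end at \<open>x\<close>.\<close>

definition lower_derivate_set :: "(real \<Rightarrow> real) \<Rightarrow> real \<Rightarrow> real set" where
  "lower_derivate_set f p = {x. \<forall>d>0. \<exists>u v. u \<le> x \<and> x \<le> v \<and> u < v \<and> v - u < d \<and> f v - f u < p * (v - u)}"

text \<open>Derivate sets are not known to be measurable, so their size is estimated by outer
  measure.\<close>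

lemma outer_measure_le_negligible:
  assumes "negligible (A - B)" "B \<in> sets lebesgue"
  shows "outer_measure_of lebesgue A \<le> emeasure lebesgue B"
proof -
  have n: "A - B \<in> null_sets lebesgue" using assms(1) by (simp add: negligible_iff_null_sets)
  have "outer_measure_of lebesgue A \<le> outer_measure_of lebesgue (B \<union> (A - B))"
    by (intro outer_measure_of_mono) auto
  also have "\<dots> = emeasure lebesgue (B \<union> (A - B))"
    using n assms(2) by (intro outer_measure_of_eq sets.Un) auto
  also have "\<dots> = emeasure lebesgue B" using n assms(2) by (rule emeasure_Un_null_set[rotated])
  finally show ?thesis .
qed

text \<open>Vitali intervals of slope more than \<open>q\<close> are disjoint, so the intervals
  between the values of \<open>f\<close> at their ends have total length at least \<open>q\<close>
  times the measure of what they cover, which is almost all of \<open>A\<close>.\<close>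

lemma upper_derivate_outer:
  fixes f :: "real \<Rightarrow> real"
  assumes "mono f" "q \<ge> 0" "open W" "A \<subseteq> W" "A \<subseteq> upper_derivate_set f q"
  obtains C where "countable C" "\<And>u v. (u,v) \<in> C \<Longrightarrow> u < v \<and> {u..v} \<subseteq> W"
    "ennreal q * outer_measure_of lebesgue A \<le> emeasure lborel (\<Union>(u,v)\<in>C. {f u<..<f v})"
proof -
  obtain C where C: "countable C" "\<And>u v. (u,v) \<in> C \<Longrightarrow> u < v \<and> q * (v - u) < f v - f u \<and> {u..v} \<subseteq> W"
    "pairwise (\<lambda>(u,v) (u',v'). disjnt {u..v} {u'..v'}) C"
    "negligible (A - (\<Union>(u,v)\<in>C. {u<..<v}))"
    by (rule Vitali_intervals[of W A "\<lambda>u v. q * (v - u) < f v - f u"])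
       (use assms in \<open>auto simp: upper_derivate_set_def\<close>)
  have op: "open (\<Union>(u,v)\<in>C. {u<..<v})" by auto
  have "outer_measure_of lebesgue A \<le> emeasure lborel (\<Union>(u,v)\<in>C. {u<..<v})"
    using outer_measure_le_negligible[OF C(4)] op by (simp add: borel_open)
  then have "ennreal q * outer_measure_of lebesgue A \<le> ennreal q * emeasure lborel (\<Union>(u,v)\<in>C. {u<..<v})"
    by (rule mult_left_mono) simp
  also have "\<dots> = (\<integral>\<^sup>+(u,v). ennreal q * ennreal (v - u) \<partial>count_space C)"
    using emeasure_intervals[of "\<lambda>x. x" C] C by (simp add: mono_def nn_integral_cmult[symmetric] case_prod_unfold)
  also have "\<dots> \<le> (\<integral>\<^sup>+(u,v). ennreal (f v - f u) \<partial>count_space C)"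
    by (intro nn_integral_mono) (use C(2) assms(2) in \<open>auto simp: ennreal_mult'[symmetric] intro!: ennreal_leI dest!: C(2) split: prod.splits\<close>)
  also have "\<dots> = emeasure lborel (\<Union>(u,v)\<in>C. {f u<..<f v})"
    using emeasure_intervals[OF assms(1) C(1)] C by simp
  finally show ?thesis using C by (intro that[of C]) auto
qed

lemma outer_measure_zero_negligible:
  assumes "outer_measure_of lebesgue A = 0" shows "negligible A"
proof -
  obtain B where B: "B \<in> sets lebesgue" "A \<subseteq> B" "emeasure lebesgue B = outer_measure_of lebesgue A"
    using outer_measure_of_attain[of A lebesgue] by auto
  then have "negligible B" using assms by (auto simp: negligible_iff_null_sets null_sets_def)
  then show ?thesis using B negligible_subset by blast
qed

lemma outer_measure_open:
  assumes "outer_measure_of lebesgue A < \<infinity>" "e > 0"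
  obtains U :: "real set" where "open U" "A \<subseteq> U" "emeasure lborel U \<le> outer_measure_of lebesgue A + ennreal e"
proof -
  obtain B where B: "B \<in> sets lebesgue" "A \<subseteq> B" "emeasure lebesgue B = outer_measure_of lebesgue A"
    using outer_measure_of_attain[of A lebesgue] by auto
  obtain U where U: "open U" "B \<subseteq> U" "emeasure lebesgue (U - B) < ennreal e" "U - B \<in> lmeasurable"
    using sets_lebesgue_outer_open[OF B(1) assms(2)] by metis
  have "emeasure lebesgue U \<le> emeasure lebesgue B + emeasure lebesgue (U - B)"
    using B U by (metis Un_Diff_cancel Un_absorb1 emeasure_subadditive fmeasurableD)
  also have "\<dots> \<le> outer_measure_of lebesgue A + ennreal e" using B U by (intro add_mono) auto
  finally show ?thesis using U B by (intro that[of U]) (auto simp: borel_open)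
qed

text \<open>Let m be the outer measure of the set. It is covered, up to a null set, by intervals of
  slope below \<open>p\<close> inside an open set of measure at most m + e; the covered part is
  covered once more by intervals of slope above \<open>q\<close> inside the first ones. As
  \<open>f\<close> is monotone, it grows on the second family by no more than on the first, so q m
  \<le> p (m + e). Letting e tend to 0 forces m = 0.\<close>

lemma derivate_sets_negligible:
  fixes f :: "real \<Rightarrow> real"
  assumes "mono f" "0 \<le> p" "p < q"
  shows "negligible (upper_derivate_set f q \<inter> lower_derivate_set f p \<inter> {a<..<b})"
proof -
  define A where "A = upper_derivate_set f q \<inter> lower_derivate_set f p \<inter> {a<..<b}"
  define m where "m = outer_measure_of lebesgue A"
  have "m \<le> outer_measure_of lebesgue {a<..<b}" unfolding m_def by (rule outer_measure_of_mono) (auto simp: A_def)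
  also have "\<dots> = emeasure lborel {a<..<b}" by (simp add: outer_measure_of_eq)
  also have "\<dots> < \<infinity>" by (cases "a \<le> b") (auto)
  finally have mfin: "m < \<infinity>" .
  have key: "ennreal q * m \<le> ennreal p * (m + ennreal e)" if e0: "e > 0" for e
  proof -
    obtain U where U: "open U" "A \<subseteq> U" "emeasure lborel U \<le> m + ennreal e"
      by (rule outer_measure_open[of A e]) (use mfin e0 in \<open>auto simp: m_def\<close>)
    obtain C where C: "countable C" "\<And>u v. (u,v) \<in> C \<Longrightarrow> u < v \<and> f v - f u < p * (v - u) \<and> {u..v} \<subseteq> U"
      "pairwise (\<lambda>(u,v) (u',v'). disjnt {u..v} {u'..v'}) C"
      "negligible (A - (\<Union>(u,v)\<in>C. {u<..<v}))"
      by (rule Vitali_intervals[of U A "\<lambda>u v. f v - f u < p * (v - u)"])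
       (use U in \<open>auto simp: lower_derivate_set_def A_def less_imp_le\<close>)
    define W where "W = (\<Union>(u,v)\<in>C. {u<..<v})"
    have oW: "open W" by (auto simp: W_def)
    \<comment> \<open>The part of \<open>A\<close> outside \<open>W\<close> is null; since
      \<open>A\<close> need not be measurable, the comparison passes through a measurable hull
      \<open>B\<close> of \<open>A \<inter> W\<close>.\<close>
    have mW: "m \<le> outer_measure_of lebesgue (A \<inter> W)"
    proof -
      obtain B where B: "B \<in> sets lebesgue" "A \<inter> W \<subseteq> B" "emeasure lebesgue B = outer_measure_of lebesgue (A \<inter> W)"
        using outer_measure_of_attain[of "A \<inter> W" lebesgue] by auto
      have "negligible (A - B)" using C(4) by (rule negligible_subset) (use B in \<open>auto simp: W_def\<close>)
      then show ?thesis using outer_measure_le_negligible[of A B] B by (simp add: m_def)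
    qed
    obtain D where D: "countable D" "\<And>u v. (u,v) \<in> D \<Longrightarrow> u < v \<and> {u..v} \<subseteq> W"
      "ennreal q * outer_measure_of lebesgue (A \<inter> W) \<le> emeasure lborel (\<Union>(u,v)\<in>D. {f u<..<f v})"
      by (rule upper_derivate_outer[OF assms(1) _ oW, of q "A \<inter> W"]) (use assms in \<open>auto simp: A_def\<close>)
    have sub: "(\<Union>(u,v)\<in>D. {f u<..<f v}) \<subseteq> (\<Union>(u,v)\<in>C. {f u<..<f v})"
    proof
      fix y assume "y \<in> (\<Union>(u,v)\<in>D. {f u<..<f v})"
      then obtain u v where uv: "(u,v) \<in> D" "f u < y" "y < f v" by auto
      then have "{u..v} \<subseteq> W" "u < v" using D by auto
      then have "u \<in> W" by auto
      then obtain s t where st: "(s,t) \<in> C" "s < u" "u < t" by (auto simp: W_def)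
      \<comment> \<open>By disjointness the right end \<open>t\<close> of an interval of
        \<open>C\<close> lies in no open interval of \<open>C\<close>, so an interval inside
        \<open>W\<close> cannot reach past it.\<close>
      have "v \<le> t"
      proof (rule ccontr)
        assume "\<not> v \<le> t"
        then have "t \<in> W" using st \<open>{u..v} \<subseteq> W\<close> by auto
        then obtain s' t' where "(s',t') \<in> C" "s' < t" "t < t'" by (auto simp: W_def)
        moreover from this have "disjnt {s..t} {s'..t'}"
          using pairwiseD[OF C(3) st(1), of "(s',t')"] by auto
        moreover have "t \<in> {s..t}" using st by auto
        moreover have "t \<in> {s'..t'}" using \<open>s' < t\<close> \<open>t < t'\<close> by auto
        ultimately show False unfolding disjnt_iff by blast
      qed
      then have "f s \<le> f u" "f v \<le> f t" using st assms(1) by (auto simp: monoD)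
      then have "f s < y" "y < f t" using uv by auto
      then show "y \<in> (\<Union>(u,v)\<in>C. {f u<..<f v})" using st(1) by force
    qed
    have "ennreal q * m \<le> ennreal q * outer_measure_of lebesgue (A \<inter> W)" using mW by (rule mult_left_mono) simp
    also have "\<dots> \<le> emeasure lborel (\<Union>(u,v)\<in>C. {f u<..<f v})"
    proof -
      have "open (\<Union>(u,v)\<in>C. {f u<..<f v})" by auto
      then show ?thesis using D(3) emeasure_mono[OF sub, of lborel] by (simp add: borel_open order_trans)
    qed
    also have "\<dots> = (\<integral>\<^sup>+(u,v). ennreal (f v - f u) \<partial>count_space C)"
      using emeasure_intervals[OF assms(1) C(1)] C by simp
    also have "\<dots> \<le> (\<integral>\<^sup>+(u,v). ennreal p * ennreal (v - u) \<partial>count_space C)"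
      by (intro nn_integral_mono) (use assms(2) in \<open>auto simp: ennreal_mult'[symmetric] intro!: ennreal_leI dest!: C(2) split: prod.splits\<close>)
    also have "\<dots> = ennreal p * emeasure lborel W"
      using emeasure_intervals[of "\<lambda>x. x" C] C by (simp add: W_def mono_def nn_integral_cmult[symmetric] case_prod_unfold)
    also have "\<dots> \<le> ennreal p * emeasure lborel U"
    proof (intro mult_left_mono emeasure_mono)
      show "W \<subseteq> U" unfolding W_def
      proof (rule UN_least)
        fix i assume "i \<in> C"
        then show "(case i of (u,v) \<Rightarrow> {u<..<v}) \<subseteq> U" using C(2)[of "fst i" "snd i"] by (cases i) auto
      qed
    qed (use U(1) in auto)
    also have "\<dots> \<le> ennreal p * (m + ennreal e)" using U(3) by (rule mult_left_mono) simp
    finally show ?thesis .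
  qed
  obtain r where r: "m = ennreal r" "r \<ge> 0" using mfin by (cases m) auto
  have "q * r \<le> p * (r + e)" if "e > 0" for e
  proof -
    have "ennreal (q * r) \<le> ennreal (p * (r + e))"
      using key[OF that] r assms that by (simp add: ennreal_mult')
    then show ?thesis using r assms that by (simp add: ennreal_le_iff)
  qed
  note qr = this
  have "q * r \<le> p * r"
  proof (rule field_le_epsilon)
    fix e :: real assume e: "e > 0"
    have "q * r \<le> p * (r + e / (p + 1))" using qr[of "e / (p + 1)"] e assms by simp
    also have "\<dots> \<le> p * r + e" using e assms by (simp add: field_simps)
    finally show "q * r \<le> p * r + e" .
  qed
  then have "r = 0" using r assms mult_le_cancel_right[of q r p] by linarith
  then show ?thesis using outer_measure_zero_negligible r by (simp add: m_def A_def)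
qed

text \<open>Slopes above \<open>n\<close> on disjoint intervals inside the open interval from
  \<open>a\<close> to \<open>b\<close> force n m \<le> f b - f a for every \<open>n\<close>, where m
  is the outer measure of the set.\<close>

lemma derivate_infinite_negligible:
  fixes f :: "real \<Rightarrow> real"
  assumes "mono f" "a < b"
  shows "negligible ((\<Inter>n::nat. upper_derivate_set f (real n)) \<inter> {a<..<b})"
proof -
  define A where "A = (\<Inter>n::nat. upper_derivate_set f (real n)) \<inter> {a<..<b}"
  define m where "m = outer_measure_of lebesgue A"
  have key: "ennreal (real n) * m \<le> ennreal (f b - f a)" for n
  proof -
    obtain D where D: "countable D" "\<And>u v. (u,v) \<in> D \<Longrightarrow> u < v \<and> {u..v} \<subseteq> {a<..<b}"
      "ennreal (real n) * m \<le> emeasure lborel (\<Union>(u,v)\<in>D. {f u<..<f v})"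
      unfolding m_def
      by (rule upper_derivate_outer[OF assms(1), of "real n" "{a<..<b}" A]) (auto simp: A_def)
    have "emeasure lborel (\<Union>(u,v)\<in>D. {f u<..<f v}) \<le> emeasure lborel {f a..f b}"
    proof (rule emeasure_mono)
      show "(\<Union>(u,v)\<in>D. {f u<..<f v}) \<subseteq> {f a..f b}"
      proof
        fix y assume "y \<in> (\<Union>(u,v)\<in>D. {f u<..<f v})"
        then obtain u v where uv: "(u,v) \<in> D" "f u < y" "y < f v" by auto
        have "u \<in> {u..v}" "v \<in> {u..v}" using D(2)[OF uv(1)] by auto
        then have "a \<le> u" "v \<le> b" using D(2)[OF uv(1)] by (meson greaterThanLessThan_iff less_imp_le subsetD)+
        then show "y \<in> {f a..f b}" using uv monoD[OF assms(1)] by (meson atLeastAtMost_iff less_imp_le order_trans)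
      qed
    qed auto
    then show ?thesis using D(3) assms by (simp add: monoD)
  qed
  have "m < \<infinity>" using key[of 1] by (simp add: order_le_less_trans)
  then obtain r where r: "m = ennreal r" "r \<ge> 0" by (cases m) auto
  have "real n * r \<le> f b - f a" for n
    using key[of n] r assms by (simp add: ennreal_mult'[symmetric] monoD)
  then have "r = 0" using r by (metis not_less reals_Archimedean3 order_le_less)
  then show ?thesis using outer_measure_zero_negligible r by (simp add: m_def A_def)
qed

lemma upper_derivate_antimono: "q \<le> q' \<Longrightarrow> upper_derivate_set f q' \<subseteq> upper_derivate_set f q"
  unfolding upper_derivate_set_def
proof (rule Collect_mono, intro impI allI, drule spec, drule mp, assumption, elim exE)
  fix x d u v assume "q \<le> q'" "u \<le> x \<and> x \<le> v \<and> u < v \<and> v - u < d \<and> q' * (v - u) < f v - f u"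
  then show "\<exists>u v. u \<le> x \<and> x \<le> v \<and> u < v \<and> v - u < d \<and> q * (v - u) < f v - f u"
    by (intro exI[of _ u] exI[of _ v]) (smt (verit) mult_right_mono)
qed

text \<open>The derivative is the infimum \<open>D\<close> of the slopes \<open>q \<ge> 0\<close>
  that are not exceeded near \<open>x\<close>. A lower derivate below \<open>D\<close> would leave
  room for rationals p < q < D, which \<open>pq\<close> excludes; slopes below 0 cannot occur
  because \<open>f\<close> is monotone.\<close>

lemma differentiable_if_derivates:
  fixes f :: "real \<Rightarrow> real"
  assumes "mono f" and n: "x \<notin> upper_derivate_set f (real n)"
    and pq: "\<And>p q. p \<in> \<rat> \<Longrightarrow> q \<in> \<rat> \<Longrightarrow> 0 \<le> p \<Longrightarrow> p < q \<Longrightarrow> x \<notin> upper_derivate_set f q \<inter> lower_derivate_set f p"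
  shows "f differentiable (at x)"
proof -
  define Q where "Q = {q. 0 \<le> q \<and> x \<notin> upper_derivate_set f q}"
  define D where "D = Inf Q"
  have Qne: "Q \<noteq> {}" using n by (auto simp: Q_def intro!: exI[of _ "real n"])
  have bdd: "bdd_below Q" by (auto simp: Q_def bdd_below_def)
  have D0: "D \<ge> 0" unfolding D_def using Qne by (intro cInf_greatest) (auto simp: Q_def)
  have up: "x \<notin> upper_derivate_set f q" if q: "q > D" for q
  proof -
    obtain q' where "q' \<in> Q" "q' < q" using q cInf_lessD[OF Qne] D_def by auto
    then show ?thesis using upper_derivate_antimono[of q' q f] by (auto simp: Q_def)
  qed
  have lo: "x \<notin> lower_derivate_set f p" if p: "p < D" "0 \<le> p" "p \<in> \<rat>" for p
  proof -
    obtain q where q: "q \<in> \<rat>" "p < q" "q < D" using Rats_dense_in_real[OF p(1)] by auto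
    have "q \<notin> Q" using cInf_lower[OF _ bdd, of q] q by (auto simp: D_def)
    then have "x \<in> upper_derivate_set f q" using q p by (auto simp: Q_def)
    then show ?thesis using pq[OF p(3) q(1) p(2) q(2)] by auto
  qed
  have "\<exists>d>0. \<forall>u v. u \<le> x \<longrightarrow> x \<le> v \<longrightarrow> u < v \<longrightarrow> v - u < d \<longrightarrow> \<bar>(f v - f u) - D * (v - u)\<bar> \<le> e * (v - u)" if e: "e > 0" for e
  proof -
    have "x \<notin> upper_derivate_set f (D + e)" using up e by simp
    then obtain d1 where d1: "d1 > 0" "\<And>u v. u \<le> x \<Longrightarrow> x \<le> v \<Longrightarrow> u < v \<Longrightarrow> v - u < d1 \<Longrightarrow> f v - f u \<le> (D + e) * (v - u)"
      unfolding upper_derivate_set_def using not_less by fastforce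
    have "\<exists>d>0. \<forall>u v. u \<le> x \<longrightarrow> x \<le> v \<longrightarrow> u < v \<longrightarrow> v - u < d \<longrightarrow> f v - f u \<ge> (D - e) * (v - u)"
    proof (cases "D - e < 0")
      case True
      have "f v - f u \<ge> (D - e) * (v - u)" if "u < v" for u v
        using monoD[OF assms(1), of u v] that True mult_neg_pos[of "D - e" "v - u"] by linarith
      then show ?thesis by (intro exI[of _ 1]) auto
    next
      case False
      obtain p where p: "p \<in> \<rat>" "D - e < p" "p < D" using Rats_dense_in_real[of "D - e" D] e by auto
      have "x \<notin> lower_derivate_set f p" using lo[OF p(3) _ p(1)] p False by auto
      then obtain d2 where d2: "d2 > 0" "\<And>u v. u \<le> x \<Longrightarrow> x \<le> v \<Longrightarrow> u < v \<Longrightarrow> v - u < d2 \<Longrightarrow> f v - f u \<ge> p * (v - u)"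
        unfolding lower_derivate_set_def using not_less by fastforce
      have "f v - f u \<ge> (D - e) * (v - u)" if "u \<le> x" "x \<le> v" "u < v" "v - u < d2" for u v
        using d2(2)[OF that] p that mult_right_mono[of "D - e" p "v - u"] by linarith
      then show ?thesis using d2 by auto
    qed
    then obtain d2 where d2: "d2 > 0" "\<And>u v. u \<le> x \<Longrightarrow> x \<le> v \<Longrightarrow> u < v \<Longrightarrow> v - u < d2 \<Longrightarrow> f v - f u \<ge> (D - e) * (v - u)"
      by auto
    show ?thesis
    proof (intro exI[of _ "min d1 d2"] conjI allI impI)
      show "min d1 d2 > 0" using d1 d2 by simp
      fix u v assume uv: "u \<le> x" "x \<le> v" "u < v" "v - u < min d1 d2"
      show "\<bar>(f v - f u) - D * (v - u)\<bar> \<le> e * (v - u)"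
        using d1(2)[OF uv(1-3)] d2(2)[OF uv(1-3)] uv(4) by (simp add: abs_le_iff algebra_simps)
    qed
  qed
  note main = this
  have "(f has_derivative (\<lambda>h. h * D)) (at x)"
    unfolding has_derivative_at_alt
  proof (intro conjI allI impI)
    show "bounded_linear (\<lambda>h. h * D)" by (rule bounded_linear_mult_left)
    fix e :: real assume "e > 0"
    then obtain d where d: "d > 0" "\<And>u v. u \<le> x \<Longrightarrow> x \<le> v \<Longrightarrow> u < v \<Longrightarrow> v - u < d \<Longrightarrow> \<bar>(f v - f u) - D * (v - u)\<bar> \<le> e * (v - u)"
      using main by metis
    show "\<exists>d>0. \<forall>y. norm (y - x) < d \<longrightarrow> norm (f y - f x - (y - x) * D) \<le> e * norm (y - x)"
    proof (intro exI[of _ d] conjI allI impI d(1))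
      fix y assume y: "norm (y - x) < d"
      consider "y < x" | "y = x" | "y > x" by linarith
      then show "norm (f y - f x - (y - x) * D) \<le> e * norm (y - x)"
      proof cases
        case 1 then show ?thesis using d(2)[of y x] y by (simp add: algebra_simps abs_le_iff)
      next
        case 3 then show ?thesis using d(2)[of x y] y by (simp add: algebra_simps abs_le_iff)
      qed auto
    qed
  qed
  then show ?thesis by (auto simp: differentiable_def)
qed

theorem mono_differentiable_ae:
  fixes f :: "real \<Rightarrow> real"
  assumes "mono f"
  shows "negligible {x. \<not> f differentiable (at x)}"
proof -
  define P where "P = {(p,q). p \<in> \<rat> \<and> q \<in> \<rat> \<and> (0::real) \<le> p \<and> p < q}"
  define B where "B = (\<Union>k::nat. (\<Inter>n::nat. upper_derivate_set f (real n)) \<inter> {- real k - 1<..<real k + 1})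
     \<union> (\<Union>k::nat. \<Union>(p,q)\<in>P. upper_derivate_set f q \<inter> lower_derivate_set f p \<inter> {- real k - 1<..<real k + 1})"
  have cP: "countable P" unfolding P_def
    by (rule countable_subset[of _ "\<rat> \<times> \<rat>"]) (auto intro: countable_rat)
  have "negligible B" unfolding B_def
  proof (rule negligible_Un)
    show "negligible (\<Union>k::nat. (\<Inter>n::nat. upper_derivate_set f (real n)) \<inter> {- real k - 1<..<real k + 1})"
      by (intro negligible_countable_Union) (auto intro!: derivate_infinite_negligible assms)
    show "negligible (\<Union>k::nat. \<Union>(p,q)\<in>P. upper_derivate_set f q \<inter> lower_derivate_set f p \<inter> {- real k - 1<..<real k + 1})"
    proof (intro negligible_countable_Union)
      fix S assume "S \<in> range (\<lambda>k::nat. \<Union>(p,q)\<in>P. upper_derivate_set f q \<inter> lower_derivate_set f p \<inter> {- real k - 1<..<real k + 1})"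
      then obtain k :: nat where S: "S = (\<Union>(p,q)\<in>P. upper_derivate_set f q \<inter> lower_derivate_set f p \<inter> {- real k - 1<..<real k + 1})" by auto
      show "negligible S" unfolding S
        by (intro negligible_countable_Union countable_image cP)
           (auto simp: P_def intro!: derivate_sets_negligible assms)
    qed auto
  qed
  moreover have "{x. \<not> f differentiable (at x)} \<subseteq> B"
  proof
    fix x assume x: "x \<in> {x. \<not> f differentiable (at x)}"
    obtain k :: nat where k: "\<bar>x\<bar> < real k" using reals_Archimedean2 by blast
    then have xk: "x \<in> {- real k - 1<..<real k + 1}" by auto
    show "x \<in> B"
    proof (rule ccontr)
      assume nB: "x \<notin> B"
      obtain n :: nat where n: "x \<notin> upper_derivate_set f (real n)" using nB xk by (auto simp: B_def)
      have "f differentiable (at x)"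
        by (rule differentiable_if_derivates[OF assms n]) (use nB xk in \<open>force simp: B_def P_def\<close>)
      then show False using x by simp
    qed
  qed
  ultimately show ?thesis by (rule negligible_subset)
qed

section \<open>Bounded variation and absolute continuity\<close>

lemma sum_disjoint_intervals_le:
  fixes D :: "(real \<times> real) set"
  assumes "finite D" "\<And>s t. (s,t) \<in> D \<Longrightarrow> s \<le> t \<and> {s<..<t} \<subseteq> U"
    and "disjoint_family_on (\<lambda>(s, t). {s<..<t}) D" "U \<in> lmeasurable"
  shows "(\<Sum>(s, t)\<in>D. t - s) \<le> measure lebesgue U"
proof -
  have "(\<Sum>(s, t)\<in>D. t - s) = (\<Sum>i\<in>D. measure lebesgue ((\<lambda>(s, t). {s<..<t}) i))"
    using assms(2) by (intro sum.cong) auto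
  also have "\<dots> = measure lebesgue (\<Union>i\<in>D. (\<lambda>(s, t). {s<..<t}) i)"
    by (intro measure_finite_Union[symmetric] assms) (use assms(2) in \<open>auto simp: emeasure_lborel_Ioo\<close>)
  also have "\<dots> \<le> measure lebesgue U"
    using assms(2,4) by (intro measure_mono_fmeasurable) (auto intro!: sets.finite_UN assms(1))
  finally show ?thesis .
qed

text \<open>Jordan decomposition: the variation function \<open>v\<close> and the function
  \<open>v - g\<close> are both monotone, and \<open>g\<close> is their difference.\<close>

lemma variation_bound_differentiable_ae:
  fixes g :: "real \<Rightarrow> real"
  assumes "c < d"
    and bd: "\<And>D. finite D \<Longrightarrow> (\<forall>(s, t)\<in>D. c \<le> s \<and> t \<le> d \<and> s \<le> t) \<Longrightarrow>
        disjoint_family_on (\<lambda>(s, t). {s<..<t}) D \<Longrightarrow> (\<Sum>(s, t)\<in>D. \<bar>g t - g s\<bar>) \<le> 1"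
  shows "negligible {t\<in>{c<..<d}. \<not> g differentiable (at t)}"
proof -
  define F where "F x = {D :: (real \<times> real) set. finite D \<and> (\<forall>(s, t)\<in>D. c \<le> s \<and> t \<le> x \<and> s \<le> t) \<and>
     disjoint_family_on (\<lambda>(s, t). {s<..<t}) D}" for x
  define S where "S D = (\<Sum>(s, t)\<in>D. \<bar>g t - g s\<bar>)" for D
  define v where "v x = Sup (S ` F x)" for x
  have bdd: "bdd_above (S ` F x)" if "x \<le> d" for x
  proof (rule bdd_aboveI[of _ 1])
    fix r assume "r \<in> S ` F x"
    then obtain D where D: "D \<in> F x" "r = S D" by auto
    have "S D \<le> 1" unfolding S_def
      by (rule bd) (use D(1) that in \<open>auto simp: F_def\<close>)
    then show "r \<le> 1" using D by simp
  qed
  have ne: "{} \<in> F x" for x by (auto simp: F_def disjoint_family_on_def)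
  have step: "v x + \<bar>g y - g x\<bar> \<le> v y" if xy: "c \<le> x" "x \<le> y" "y \<le> d" for x y
  proof (cases "x = y")
    case False
    have "S D \<le> v y - \<bar>g y - g x\<bar>" if D: "D \<in> F x" for D
    proof -
      have nin: "(x,y) \<notin> D" using D xy False by (auto simp: F_def)
      have "insert (x,y) D \<in> F y"
      proof -
        have fin: "finite D" and D1: "\<And>s t. (s,t) \<in> D \<Longrightarrow> c \<le> s \<and> t \<le> x \<and> s \<le> t"
          and dis: "disjoint_family_on (\<lambda>(s, t). {s<..<t}) D" using D by (auto simp: F_def)
        have "(\<Union>i\<in>D. case i of (s,t) \<Rightarrow> {s<..<t}) \<inter> {x<..<y} = {}" using D1 by fastforce
        then have "disjoint_family_on (\<lambda>(s, t). {s<..<t}) (insert (x,y) D)"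
          using dis nin by (subst disjoint_family_on_insert) auto
        moreover have "\<forall>(s, t)\<in>insert (x,y) D. c \<le> s \<and> t \<le> y \<and> s \<le> t" using D1 xy by fastforce
        ultimately show ?thesis using fin by (simp add: F_def)
      qed
      then have "S (insert (x,y) D) \<le> v y" unfolding v_def using bdd[OF xy(3)] by (intro cSup_upper) auto
      moreover have "S (insert (x,y) D) = \<bar>g y - g x\<bar> + S D" using D nin by (auto simp: S_def F_def)
      ultimately show ?thesis by simp
    qed
    then have "v x \<le> v y - \<bar>g y - g x\<bar>" unfolding v_def[of x] using ne by (intro cSup_least) auto
    then show ?thesis by simp
  qed simp
  \<comment> \<open>Clamping the argument to the interval from \<open>c\<close> to \<open>d\<close>
    makes both functions monotone on the whole line and changes nothing inside.\<close>
  define cl where "cl x = max c (min d x)" for x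
  have cl: "c \<le> cl x" "cl x \<le> d" for x using assms(1) by (auto simp: cl_def)
  have clm: "x \<le> y \<Longrightarrow> cl x \<le> cl y" for x y by (auto simp: cl_def)
  have m1: "mono (\<lambda>x. v (cl x))"
  proof (rule monoI)
    fix x y :: real assume "x \<le> y"
    then show "v (cl x) \<le> v (cl y)" using step[of "cl x" "cl y"] cl clm by fastforce
  qed
  have m2: "mono (\<lambda>x. v (cl x) - g (cl x))"
  proof (rule monoI)
    fix x y :: real assume "x \<le> y"
    then show "v (cl x) - g (cl x) \<le> v (cl y) - g (cl y)" using step[of "cl x" "cl y"] cl clm by fastforce
  qed
  have "negligible ({x. \<not> (\<lambda>x. v (cl x)) differentiable (at x)} \<union> {x. \<not> (\<lambda>x. v (cl x) - g (cl x)) differentiable (at x)})"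
    by (intro negligible_Un mono_differentiable_ae m1 m2)
  moreover have "{t\<in>{c<..<d}. \<not> g differentiable (at t)} \<subseteq>
     {x. \<not> (\<lambda>x. v (cl x)) differentiable (at x)} \<union> {x. \<not> (\<lambda>x. v (cl x) - g (cl x)) differentiable (at x)}"
  proof (rule ccontr)
    assume "\<not> ?thesis"
    then obtain t where t: "c < t" "t < d" "\<not> g differentiable (at t)" "(\<lambda>x. v (cl x)) differentiable (at t)"
      "(\<lambda>x. v (cl x) - g (cl x)) differentiable (at t)" by auto
    have "(\<lambda>x. v (cl x) - (v (cl x) - g (cl x))) differentiable (at t)"
      by (rule differentiable_diff[OF t(4,5)])
    moreover have "(\<lambda>x. v (cl x) - (v (cl x) - g (cl x))) = (\<lambda>x. g (cl x))" by (rule ext) simp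
    ultimately have "(\<lambda>x. g (cl x)) differentiable (at t)" by metis
    then obtain L where L: "((\<lambda>x. g (cl x)) has_derivative L) (at t)" by (auto simp: differentiable_def)
    have "(g has_derivative L) (at t)"
      by (rule has_derivative_transform_within_open[OF L, of "{c<..<d}"]) (use t in \<open>auto simp: cl_def\<close>)
    then show False using t by (auto simp: differentiable_def)
  qed
  ultimately show ?thesis by (rule negligible_subset)
qed

lemma abs_continuous_onE:
  assumes "abs_continuous_on I f" "e > 0"
  obtains \<delta> where "\<delta> > 0" "\<forall>D. finite D \<and> (\<forall>(s, t)\<in>D. s \<in> I \<and> t \<in> I \<and> s \<le> t) \<and>
        disjoint_family_on (\<lambda>(s, t). {s<..<t}) D \<and> (\<Sum>(s, t)\<in>D. t - s) < \<delta>
        \<longrightarrow> (\<Sum>(s, t)\<in>D. norm (f t - f s)) < e"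
proof -
  from assms(1)[unfolded abs_continuous_on_def, THEN spec, THEN mp, OF assms(2)]
  obtain \<delta> where "\<delta> > 0" and d: "\<forall>D. finite D \<and> (\<forall>(s, t)\<in>D. s \<in> I \<and> t \<in> I \<and> s \<le> t) \<and>
        disjoint_family_on (\<lambda>(s, t). {s<..<t}) D \<and> (\<Sum>(s, t)\<in>D. t - s) < \<delta>
        \<longrightarrow> (\<Sum>(s, t)\<in>D. norm (f t - f s)) < e" by (elim exE conjE)
  show ?thesis by (rule that[OF \<open>\<delta> > 0\<close> d])
qed

lemma abs_continuous_on_subset:
  assumes "abs_continuous_on I f" "J \<subseteq> I"
  shows "abs_continuous_on J f"
  unfolding abs_continuous_on_def
proof (intro allI impI)
  fix e :: real assume "e > 0"
  obtain \<delta> where d0: "\<delta> > 0" "\<forall>D. finite D \<and> (\<forall>(s, t)\<in>D. s \<in> I \<and> t \<in> I \<and> s \<le> t) \<and>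
        disjoint_family_on (\<lambda>(s, t). {s<..<t}) D \<and> (\<Sum>(s, t)\<in>D. t - s) < \<delta>
        \<longrightarrow> (\<Sum>(s, t)\<in>D. norm (f t - f s)) < e" by (rule abs_continuous_onE[OF assms(1) \<open>e > 0\<close>])
  note d = d0(1) d0(2)[THEN spec, THEN mp]
  show "\<exists>\<delta>>0. \<forall>D. finite D \<and> (\<forall>(s, t)\<in>D. s \<in> J \<and> t \<in> J \<and> s \<le> t) \<and>
        disjoint_family_on (\<lambda>(s, t). {s<..<t}) D \<and> (\<Sum>(s, t)\<in>D. t - s) < \<delta>
        \<longrightarrow> (\<Sum>(s, t)\<in>D. norm (f t - f s)) < e"
    using d(1) by (intro exI[of _ \<delta>] conjI allI impI d(2)) (use assms(2) in auto)
qed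

text \<open>Applied to transition maps, which are Lipschitz on small balls, this moves absolute
  continuity from one chart to another; applied to \<open>plaque\<close>, it makes the first
  integral absolutely continuous along a path.\<close>

lemma abs_continuous_on_dominated:
  fixes f :: "real \<Rightarrow> 'a::real_normed_vector" and g :: "real \<Rightarrow> 'b::real_normed_vector"
  assumes "abs_continuous_on I f"
    and "\<And>s t. s \<in> I \<Longrightarrow> t \<in> I \<Longrightarrow> s \<le> t \<Longrightarrow> norm (g t - g s) \<le> C * norm (f t - f s)"
  shows "abs_continuous_on I g"
  unfolding abs_continuous_on_def
proof (intro allI impI)
  fix e :: real assume e: "e > 0"
  have C: "\<bar>C\<bar> + 1 > 0" by simp
  obtain \<delta> where d0: "\<delta> > 0" "\<forall>D. finite D \<and> (\<forall>(s, t)\<in>D. s \<in> I \<and> t \<in> I \<and> s \<le> t) \<and>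
        disjoint_family_on (\<lambda>(s, t). {s<..<t}) D \<and> (\<Sum>(s, t)\<in>D. t - s) < \<delta>
        \<longrightarrow> (\<Sum>(s, t)\<in>D. norm (f t - f s)) < e / (\<bar>C\<bar> + 1)"
    by (rule abs_continuous_onE[OF assms(1) divide_pos_pos[OF e C]])
  note d = d0(1) d0(2)[THEN spec, THEN mp]
  show "\<exists>\<delta>>0. \<forall>D. finite D \<and> (\<forall>(s, t)\<in>D. s \<in> I \<and> t \<in> I \<and> s \<le> t) \<and>
        disjoint_family_on (\<lambda>(s, t). {s<..<t}) D \<and> (\<Sum>(s, t)\<in>D. t - s) < \<delta>
        \<longrightarrow> (\<Sum>(s, t)\<in>D. norm (g t - g s)) < e"
  proof (intro exI[of _ \<delta>] conjI d(1) allI impI)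
    fix D :: "(real \<times> real) set"
    assume D: "finite D \<and> (\<forall>(s, t)\<in>D. s \<in> I \<and> t \<in> I \<and> s \<le> t) \<and>
        disjoint_family_on (\<lambda>(s, t). {s<..<t}) D \<and> (\<Sum>(s, t)\<in>D. t - s) < \<delta>"
    have "norm (g t - g s) \<le> (\<bar>C\<bar> + 1) * norm (f t - f s)" if "(s,t) \<in> D" for s t
    proof -
      have "norm (g t - g s) \<le> C * norm (f t - f s)" using assms(2) D that by auto
      also have "\<dots> \<le> (\<bar>C\<bar> + 1) * norm (f t - f s)" by (intro mult_right_mono) auto
      finally show ?thesis .
    qed
    then have "(\<Sum>(s, t)\<in>D. norm (g t - g s)) \<le> (\<Sum>(s, t)\<in>D. (\<bar>C\<bar> + 1) * norm (f t - f s))"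
      by (intro sum_mono) auto
    also have "\<dots> = (\<bar>C\<bar> + 1) * (\<Sum>(s, t)\<in>D. norm (f t - f s))"
      by (simp add: sum_distrib_left case_prod_unfold)
    also have "\<dots> < (\<bar>C\<bar> + 1) * (e / (\<bar>C\<bar> + 1))" using d(2)[OF D] C by (intro mult_strict_left_mono) auto
    also have "\<dots> = e" using C by simp
    finally show "(\<Sum>(s, t)\<in>D. norm (g t - g s)) < e" .
  qed
qed

text \<open>On a short interval absolute continuity bounds the sums over all finite disjoint
  families at once. With \<open>e = 1\<close> this gives the bounded variation behind
  differentiability, and later the bound on the length of a path just after it leaves
  \<open>Sing\<close>.\<close>

lemma abs_continuous_on_short_variation:
  assumes "abs_continuous_on I f" "e > 0"
  obtains \<delta> where "\<delta> > 0" "\<forall>c d D. {c..d} \<subseteq> I \<longrightarrow> c \<le> d \<longrightarrow> d - c < \<delta> \<longrightarrow> finite D \<longrightarrow> (\<forall>(s, t)\<in>D. c \<le> s \<and> t \<le> d \<and> s \<le> t) \<longrightarrow>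
        disjoint_family_on (\<lambda>(s, t). {s<..<t}) D \<longrightarrow> (\<Sum>(s, t)\<in>D. norm (f t - f s)) < e"
proof -
  obtain \<delta> where d0: "\<delta> > 0" "\<forall>D. finite D \<and> (\<forall>(s, t)\<in>D. s \<in> I \<and> t \<in> I \<and> s \<le> t) \<and>
        disjoint_family_on (\<lambda>(s, t). {s<..<t}) D \<and> (\<Sum>(s, t)\<in>D. t - s) < \<delta>
        \<longrightarrow> (\<Sum>(s, t)\<in>D. norm (f t - f s)) < e"
    by (rule abs_continuous_onE[OF assms])
  note d = d0(1) d0(2)[THEN spec, THEN mp]
  show ?thesis
  proof (rule that[OF d(1)], intro allI impI)
    fix c e' D assume *: "{c..e'} \<subseteq> I" "c \<le> e'" "e' - c < \<delta>" "finite D" "\<forall>(s, t)\<in>D. c \<le> s \<and> t \<le> e' \<and> s \<le> t"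
      "disjoint_family_on (\<lambda>(s, t). {s<..<t}) D"
    have "(\<Sum>(s, t)\<in>D. t - s) \<le> measure lebesgue {c..e'}"
    proof (rule sum_disjoint_intervals_le[OF *(4) _ *(6)])
      fix s t assume "(s,t) \<in> D"
      then have "c \<le> s" "t \<le> e'" "s \<le> t" using *(5) by auto
      then show "s \<le> t \<and> {s<..<t} \<subseteq> {c..e'}" by auto
    qed auto
    then have "(\<Sum>(s, t)\<in>D. t - s) < \<delta>" using * by simp
    moreover have "\<forall>(s, t)\<in>D. s \<in> I \<and> t \<in> I \<and> s \<le> t"
    proof clarify
      fix s t assume "(s,t) \<in> D"
      then have "c \<le> s" "t \<le> e'" "s \<le> t" using *(5) by auto
      then show "s \<in> I \<and> t \<in> I \<and> s \<le> t" using *(1) by (auto simp: subset_iff)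
    qed
    ultimately show "(\<Sum>(s, t)\<in>D. norm (f t - f s)) < e" using * d(2) by blast
  qed
qed

lemma abs_continuous_on_continuous:
  assumes "abs_continuous_on {a..b} f" shows "continuous_on {a..b} f"
  unfolding continuous_on_iff
proof (intro ballI allI impI)
  fix x e :: real assume x: "x \<in> {a..b}" and e: "e > 0"
  obtain \<delta> where d0: "\<delta> > 0" "\<forall>c d D. {c..d} \<subseteq> {a..b} \<longrightarrow> c \<le> d \<longrightarrow> d - c < \<delta> \<longrightarrow> finite D \<longrightarrow> (\<forall>(s, t)\<in>D. c \<le> s \<and> t \<le> d \<and> s \<le> t) \<longrightarrow>
        disjoint_family_on (\<lambda>(s, t). {s<..<t}) D \<longrightarrow> (\<Sum>(s, t)\<in>D. norm (f t - f s)) < e"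
    by (rule abs_continuous_on_short_variation[OF assms e])
  note d = d0(1) d0(2)[rule_format]
  have 1: "norm (f t - f s) < e" if "s \<in> {a..b}" "t \<in> {a..b}" "s \<le> t" "t - s < \<delta>" for s t
    using d(2)[of s t "{(s,t)}"] that by (auto simp: disjoint_family_on_def)
  show "\<exists>d>0. \<forall>x'\<in>{a..b}. dist x' x < d \<longrightarrow> dist (f x') (f x) < e"
  proof (intro exI[of _ \<delta>] conjI d(1) ballI impI)
    fix y assume y: "y \<in> {a..b}" "dist y x < \<delta>"
    show "dist (f y) (f x) < e"
      using 1[of x y] 1[of y x] x y by (cases "x \<le> y") (auto simp: dist_norm norm_minus_commute)
  qed
qed

lemma abs_continuous_differentiable_ae_real:
  fixes g :: "real \<Rightarrow> real"
  assumes "abs_continuous_on {a..b} g"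
  shows "negligible {t\<in>{a<..<b}. \<not> g differentiable (at t)}"
proof -
  obtain \<delta> where d0: "\<delta> > 0" "\<forall>c d D. {c..d} \<subseteq> {a..b} \<longrightarrow> c \<le> d \<longrightarrow> d - c < \<delta> \<longrightarrow> finite D \<longrightarrow> (\<forall>(s, t)\<in>D. c \<le> s \<and> t \<le> d \<and> s \<le> t) \<longrightarrow>
        disjoint_family_on (\<lambda>(s, t). {s<..<t}) D \<longrightarrow> (\<Sum>(s, t)\<in>D. norm (g t - g s)) < 1"
    by (rule abs_continuous_on_short_variation[OF assms zero_less_one])
  note d = d0(1) d0(2)[rule_format]
  define P where "P = {(c,d). c \<in> \<rat> \<and> d \<in> \<rat> \<and> a \<le> c \<and> c < d \<and> d \<le> b \<and> d - c < \<delta>}"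
  have cP: "countable P" unfolding P_def
    by (rule countable_subset[of _ "\<rat> \<times> \<rat>"]) (auto intro: countable_rat)
  have "negligible (\<Union>(c,d)\<in>P. {t\<in>{c<..<d}. \<not> g differentiable (at t)})"
  proof (intro negligible_countable_Union countable_image cP)
    fix S assume "S \<in> (\<lambda>(c,d). {t\<in>{c<..<d}. \<not> g differentiable (at t)}) ` P"
    then obtain c e where ce: "(c,e) \<in> P" "S = {t\<in>{c<..<e}. \<not> g differentiable (at t)}" by auto
    show "negligible S" unfolding ce(2)
      by (rule variation_bound_differentiable_ae) (use ce(1) d0(2)[THEN spec[of _ c], THEN spec[of _ e]] in \<open>auto simp: P_def intro: less_imp_le\<close>)
  qed
  moreover have "{t\<in>{a<..<b}. \<not> g differentiable (at t)} \<subseteq> (\<Union>(c,d)\<in>P. {t\<in>{c<..<d}. \<not> g differentiable (at t)})"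
  proof
    fix t assume t: "t \<in> {t\<in>{a<..<b}. \<not> g differentiable (at t)}"
    obtain c where c: "c \<in> \<rat>" "max a (t - \<delta>/2) < c" "c < t"
      using Rats_dense_in_real[of "max a (t - \<delta>/2)" t] t d(1) by auto
    obtain e where e: "e \<in> \<rat>" "t < e" "e < min b (t + \<delta>/2)"
      using Rats_dense_in_real[of t "min b (t + \<delta>/2)"] t d(1) by auto
    have "(c,e) \<in> P" using c e by (auto simp: P_def)
    then show "t \<in> (\<Union>(c,d)\<in>P. {t\<in>{c<..<d}. \<not> g differentiable (at t)})" using t c e by force
  qed
  ultimately show ?thesis by (rule negligible_subset)
qed

theorem abs_continuous_differentiable_ae:
  fixes f :: "real \<Rightarrow> 'a::euclidean_space"
  assumes "abs_continuous_on {a..b} f"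
  shows "negligible {t\<in>{a<..<b}. \<not> f differentiable (at t)}"
proof -
  have "negligible (\<Union>i\<in>(Basis::'a set). {t\<in>{a<..<b}. \<not> (\<lambda>t. f t \<bullet> i) differentiable (at t)})"
  proof (intro negligible_Union finite_imageI finite_Basis, clarify)
    fix i :: 'a assume i: "i \<in> Basis"
    have "abs_continuous_on {a..b} (\<lambda>t. f t \<bullet> i)"
      by (rule abs_continuous_on_dominated[OF assms, of _ 1])
        (metis Basis_le_norm i inner_diff_left mult_1 real_norm_def)
    then show "negligible {t\<in>{a<..<b}. \<not> (\<lambda>t. f t \<bullet> i) differentiable (at t)}"
      by (rule abs_continuous_differentiable_ae_real)
  qed
  moreover have "{t\<in>{a<..<b}. \<not> f differentiable (at t)} \<subseteq> (\<Union>i\<in>(Basis::'a set). {t\<in>{a<..<b}. \<not> (\<lambda>t. f t \<bullet> i) differentiable (at t)})"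
    using differentiable_componentwise_within[of f _ UNIV] by auto
  ultimately show ?thesis by (rule negligible_subset)
qed

text \<open>The gauge is of two kinds: at tags in the null set an open set of measure less than
  \<delta>, at other tags a ball on which \<open>f\<close> moves by at most \<open>e\<close> times
  the distance. In a fine tagged division the first kind contributes at most \<open>e\<close> by
  absolute continuity, the second at most \<open>e * (b - a)\<close>.\<close>

theorem abs_continuous_derivative_zero_const:
  fixes f :: "real \<Rightarrow> 'a::euclidean_space"
  assumes ac: "abs_continuous_on {a..b} f" and "a \<le> b" and N: "negligible N"
    and der0: "\<And>t. t \<in> {a<..<b} - N \<Longrightarrow> (f has_vector_derivative 0) (at t)"
  shows "f b = f a"
proof -
  have "norm (f b - f a) \<le> e * (1 + (b - a))" if e: "e > 0" for e
  proof -
    obtain \<delta> where d0: "\<delta> > 0" "\<forall>D. finite D \<and> (\<forall>(s, t)\<in>D. s \<in> {a..b} \<and> t \<in> {a..b} \<and> s \<le> t) \<and>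
        disjoint_family_on (\<lambda>(s, t). {s<..<t}) D \<and> (\<Sum>(s, t)\<in>D. t - s) < \<delta>
        \<longrightarrow> (\<Sum>(s, t)\<in>D. norm (f t - f s)) < e"
      by (rule abs_continuous_onE[OF ac e])
  note d = d0(1) d0(2)[THEN spec, THEN mp]
    \<comment> \<open>The end-points join the null set because the derivative is known only inside
      the interval.\<close>
    define N' where "N' = N \<union> {a,b}"
    have N': "negligible N'" using N by (auto simp: N'_def)
    then have nz: "N' \<in> lmeasurable" "measure lebesgue N' = 0"
      by (auto simp: negligible_iff_measure)
    obtain U where U: "open U" "N' \<subseteq> U" "U - N' \<in> lmeasurable" "emeasure lebesgue (U - N') < ennreal \<delta>"
      by (rule sets_lebesgue_outer_open[OF fmeasurableD[OF nz(1)] d(1)])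
    have Um: "U \<in> lmeasurable" "measure lebesgue U < \<delta>"
    proof -
      have "U = N' \<union> (U - N')" using U by auto
      then show 1: "U \<in> lmeasurable" using U(3) nz(1) by (metis fmeasurable.Un)
      have "measure lebesgue U \<le> measure lebesgue N' + measure lebesgue (U - N')"
        using \<open>U = N' \<union> (U - N')\<close> U(3) nz(1) by (metis fmeasurableD measure_Un_le)
      also have "measure lebesgue (U - N') < \<delta>"
        using U(3,4) d(1) by (metis emeasure_eq_measure2 ennreal_less_iff measure_nonneg)
      finally show "measure lebesgue U < \<delta>" using nz by simp
    qed
    have "\<exists>r>0. \<forall>y. \<bar>y - x\<bar> < r \<longrightarrow> norm (f y - f x) \<le> e * \<bar>y - x\<bar>" if "x \<in> {a..b}" "x \<notin> N'" for x
    proof -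
      have "x \<in> {a<..<b} - N" using that by (auto simp: N'_def)
      then have "(f has_derivative (\<lambda>h. 0)) (at x)" using der0[of x] by (simp add: has_vector_derivative_def)
      then show ?thesis using e unfolding has_derivative_at_alt by (auto simp: )
    qed
    then obtain r where r: "\<And>x. x \<in> {a..b} \<Longrightarrow> x \<notin> N' \<Longrightarrow> r x > 0"
      "\<And>x y. x \<in> {a..b} \<Longrightarrow> x \<notin> N' \<Longrightarrow> \<bar>y - x\<bar> < r x \<Longrightarrow> norm (f y - f x) \<le> e * \<bar>y - x\<bar>"
      by metis
    define \<gamma> where "\<gamma> x = (if x \<in> N' then U else if x \<in> {a..b} then ball x (r x) else ball x 1)" for x
    have "gauge \<gamma>" unfolding gauge_def \<gamma>_def using U r by auto
    then obtain p where p: "p tagged_division_of {a..b}" "\<gamma> fine p"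
      using fine_division_exists_real by metis
    note pp = tagged_division_ofD[OF p(1)]
    have K: "\<exists>u v. k = {u..v} \<and> u \<le> v \<and> u \<le> x \<and> x \<le> v \<and> a \<le> u \<and> v \<le> b" if xkp: "(x,k) \<in> p" for x k
    proof -
      obtain u v where "k = cbox u v" using pp(4)[OF xkp] by auto
      moreover have "x \<in> k" "k \<subseteq> {a..b}" using pp(2,3)[OF xkp] by auto
      ultimately show ?thesis by (intro exI[of _ u] exI[of _ v]) auto
    qed
    have tele: "(\<Sum>(x,k)\<in>p. f (Sup k) - f (Inf k)) = f b - f a"
      using additive_tagged_division_1[OF assms(2) p(1)] by simp
    \<comment> \<open>Degenerate intervals with tags in \<open>N'\<close> are set apart in
      \<open>p3\<close>: they contribute 0, and without them distinct members of \<open>p1\<close>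
      have distinct intervals.\<close>
    define p1 where "p1 = {(x,k)\<in>p. x \<in> N' \<and> interior k \<noteq> {}}"
    define p2 where "p2 = {(x,k)\<in>p. x \<notin> N'}"
    define p3 where "p3 = {(x,k)\<in>p. x \<in> N' \<and> interior k = {}}"
    have fin: "finite p1" "finite p2" "finite p3"
      unfolding p1_def p2_def p3_def by (auto intro: finite_subset[OF _ pp(1)])
    have "p = p1 \<union> (p2 \<union> p3)" "p1 \<inter> (p2 \<union> p3) = {}" "p2 \<inter> p3 = {}" by (auto simp: p1_def p2_def p3_def)
    then have "f b - f a = (\<Sum>(x,k)\<in>p1. f (Sup k) - f (Inf k)) + ((\<Sum>(x,k)\<in>p2. f (Sup k) - f (Inf k)) + (\<Sum>(x,k)\<in>p3. f (Sup k) - f (Inf k)))"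
      using fin unfolding tele[symmetric] by (simp add: sum.union_disjoint)
    moreover have "(\<Sum>(x,k)\<in>p3. f (Sup k) - f (Inf k)) = 0"
    proof (intro sum.neutral ballI, clarify)
      fix x k assume xk: "(x,k) \<in> p3"
      then obtain u v where "k = {u..v}" "u \<le> v" using K[of x k] by (auto simp: p3_def)
      moreover from this have "\<not> u < v" using xk by (auto simp: p3_def)
      ultimately show "f (Sup k) - f (Inf k) = 0" by auto
    qed
    moreover have "norm (\<Sum>(x,k)\<in>p2. f (Sup k) - f (Inf k)) \<le> e * (b - a)"
    proof -
      have "norm (\<Sum>(x,k)\<in>p2. f (Sup k) - f (Inf k)) \<le> (\<Sum>(x,k)\<in>p2. e * (Sup k - Inf k))"
      proof (rule sum_norm_le, clarify)
        fix x k assume xk: "(x,k) \<in> p2"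
        obtain u v where uv: "k = {u..v}" "u \<le> v" "u \<le> x" "x \<le> v" "a \<le> u" "v \<le> b" using K[of x k] xk by (auto simp: p2_def)
        have "k \<subseteq> \<gamma> x" using p(2) xk by (auto simp: fine_def p2_def)
        then have "u \<in> \<gamma> x" "v \<in> \<gamma> x" using uv by auto
        then have b: "\<bar>u - x\<bar> < r x" "\<bar>v - x\<bar> < r x" using xk uv by (auto simp: \<gamma>_def p2_def dist_real_def)
        have x: "x \<in> {a..b}" "x \<notin> N'" using xk uv by (auto simp: p2_def)
        have "norm (f v - f u) \<le> norm (f v - f x) + norm (f u - f x)"
          using norm_triangle_ineq4[of "f v - f x" "f u - f x"] by simp
        also have "\<dots> \<le> e * \<bar>v - x\<bar> + e * \<bar>u - x\<bar>" using r(2)[OF x b(1)] r(2)[OF x b(2)] by simp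
        also have "\<dots> = e * (v - u)" using uv by (simp add: algebra_simps)
        finally show "norm (f (Sup k) - f (Inf k)) \<le> e * (Sup k - Inf k)" using uv by simp
      qed
      also have "\<dots> \<le> (\<Sum>(x,k)\<in>p. e * (Sup k - Inf k))"
      proof (intro sum_mono2 pp(1))
        show "p2 \<subseteq> p" by (auto simp: p2_def)
        fix i assume "i \<in> p - p2"
        then show "0 \<le> (case i of (x,k) \<Rightarrow> e * (Sup k - Inf k))" using K[of "fst i" "snd i"] e by (cases i) auto
      qed
      also have "\<dots> = e * (\<Sum>(x,k)\<in>p. Sup k - Inf k)" by (simp add: sum_distrib_left case_prod_unfold)
      also have "(\<Sum>(x,k)\<in>p. Sup k - Inf k) = b - a"
        using additive_tagged_division_1[where f="\<lambda>x. x", OF assms(2) p(1)] by simp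
      finally show ?thesis .
    qed
    moreover have "norm (\<Sum>(x,k)\<in>p1. f (Sup k) - f (Inf k)) \<le> e"
    proof -
      define h where "h = (\<lambda>(x::real,k::real set). (Inf k, Sup k))"
      define D where "D = h ` p1"
      have inj: "inj_on h p1"
      proof (rule inj_onI)
        fix i j assume ij: "i \<in> p1" "j \<in> p1" "h i = h j"
        obtain x k y l where i: "i = (x,k)" and j: "j = (y,l)" by fastforce
        have xk: "(x,k) \<in> p" "(y,l) \<in> p" "interior k \<noteq> {}" using ij i j by (auto simp: p1_def)
        obtain u v where k: "k = {u..v}" "u \<le> v" using K[OF xk(1)] by auto
        obtain u' v' where l: "l = {u'..v'}" "u' \<le> v'" using K[OF xk(2)] by auto
        have "k = l" using ij(3) k l by (simp add: h_def i j)
        then show "i = j" using pp(5)[OF xk(1,2)] xk(3) i j by auto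
      qed
      have Dprop: "\<exists>x k. (x,k) \<in> p \<and> x \<in> N' \<and> interior k = {s<..<t} \<and> k = {s..t} \<and> s < t \<and> a \<le> s \<and> t \<le> b \<and> k \<subseteq> U"
        if st: "(s,t) \<in> D" for s t
      proof -
        obtain x k where xk: "(x,k) \<in> p1" "s = Inf k" "t = Sup k" using st by (auto simp: D_def h_def)
        then obtain u v where uv: "k = {u..v}" "u \<le> v" "a \<le> u" "v \<le> b" using K[of x k] by (auto simp: p1_def)
        have "u < v" using xk(1) uv by (auto simp: p1_def)
        have "k \<subseteq> \<gamma> x" using p(2) xk by (auto simp: fine_def p1_def)
        then show ?thesis using xk uv \<open>u < v\<close> by (intro exI[of _ x] exI[of _ k]) (auto simp: p1_def \<gamma>_def interior_atLeastAtMost_real)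
      qed
      have dis: "disjoint_family_on (\<lambda>(s, t). {s<..<t}) D"
        unfolding disjoint_family_on_def
      proof (intro ballI impI)
        fix i j assume ij: "i \<in> D" "j \<in> D" "i \<noteq> j"
        obtain s t s' t' where i: "i = (s,t)" and j: "j = (s',t')" by fastforce
        obtain x k where 1: "(x,k) \<in> p" "interior k = {s<..<t}" "k = {s..t}" "s < t" using Dprop ij(1) i by blast
        obtain y l where 2: "(y,l) \<in> p" "interior l = {s'<..<t'}" "l = {s'..t'}" "s' < t'" using Dprop ij(2) j by blast
        have "k \<noteq> l" using ij(3) 1 2 i j by auto
        then show "(case i of (s,t) \<Rightarrow> {s<..<t}) \<inter> (case j of (s,t) \<Rightarrow> {s<..<t}) = {}"
          using pp(5)[OF 1(1) 2(1)] 1 2 i j by auto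
      qed
      have finD: "finite D" using fin by (simp add: D_def)
      have "(\<Sum>(s, t)\<in>D. t - s) \<le> measure lebesgue U"
      proof (rule sum_disjoint_intervals_le[OF finD _ dis Um(1)])
        fix s t assume "(s,t) \<in> D"
        from Dprop[OF this] show "s \<le> t \<and> {s<..<t} \<subseteq> U" by auto
      qed
      then have "(\<Sum>(s, t)\<in>D. norm (f t - f s)) < e"
      proof (intro d(2) conjI finD dis)
        show "\<forall>(s, t)\<in>D. s \<in> {a..b} \<and> t \<in> {a..b} \<and> s \<le> t"
        proof clarify
          fix s t assume "(s,t) \<in> D"
          from Dprop[OF this] show "s \<in> {a..b} \<and> t \<in> {a..b} \<and> s \<le> t" by auto
        qed
      qed (use Um(2) in simp)
      moreover have "(\<Sum>(s, t)\<in>D. norm (f t - f s)) = (\<Sum>(x,k)\<in>p1. norm (f (Sup k) - f (Inf k)))"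
        unfolding D_def by (subst sum.reindex[OF inj]) (simp add: h_def case_prod_unfold)
      moreover have "norm (\<Sum>(x,k)\<in>p1. f (Sup k) - f (Inf k)) \<le> (\<Sum>(x,k)\<in>p1. norm (f (Sup k) - f (Inf k)))"
        by (rule order_trans[OF norm_sum]) (simp add: case_prod_unfold)
      ultimately show ?thesis by simp
    qed
    ultimately have "norm (f b - f a) \<le> e + (e * (b - a) + 0)"
      using norm_triangle_ineq[of "\<Sum>(x,k)\<in>p1. f (Sup k) - f (Inf k)" "\<Sum>(x,k)\<in>p2. f (Sup k) - f (Inf k)"] by simp
    then show ?thesis by (simp add: algebra_simps)
  qed
  note bound = this
  have "norm (f b - f a) \<le> 0"
  proof (rule field_le_epsilon)
    fix e :: real assume e: "e > 0"
    have "norm (f b - f a) \<le> (e / (1 + (b - a))) * (1 + (b - a))" using assms(2) e by (intro bound) auto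
    then show "norm (f b - f a) \<le> 0 + e" using assms(2) by simp
  qed
  then show ?thesis by simp
qed

section \<open>Flows of bounded Lipschitz fields\<close>

text \<open>The integral from 0 to \<open>t\<close> for either sign of \<open>t\<close>: one of the
  two intervals is empty or a single point, and the integral over it is 0.\<close>

definition signed_integral :: "(real \<Rightarrow> 'a::euclidean_space) \<Rightarrow> real \<Rightarrow> 'a" where
  "signed_integral f t = integral {0..t} f - integral {t..0} f"

lemma signed_integral_has_vector_derivative:
  fixes f :: "real \<Rightarrow> 'a::euclidean_space"
  assumes "continuous_on UNIV f"
  shows "(signed_integral f has_vector_derivative f t) (at t)"
proof -
  define a b where "a = min t 0 - 1" and "b = max t 0 + 1"
  have ab: "a < t" "t < b" "a < 0" "0 < b" by (auto simp: a_def b_def)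
  have c: "continuous_on S f" for S using assms continuous_on_subset by blast
  have i: "f integrable_on {x..y}" for x y using c by (rule integrable_continuous_interval)
  have "((\<lambda>u. integral {a..u} f) has_vector_derivative f t) (at t within {a..b})"
    by (rule integral_has_vector_derivative[OF c]) (use ab in auto)
  then have "((\<lambda>u. integral {a..u} f) has_vector_derivative f t) (at t)"
    using ab by (simp add: at_within_Icc_at)
  then have 1: "((\<lambda>u. integral {a..u} f - integral {a..0} f) has_vector_derivative f t) (at t)"
    by (auto intro!: derivative_eq_intros)
  show ?thesis
  proof (rule has_vector_derivative_transform_within_open[OF 1, of "{a<..<b}"])
    fix u assume u: "u \<in> {a<..<b}"
    show "integral {a..u} f - integral {a..0} f = signed_integral f u"
    proof (cases "u \<ge> 0")
      case True
      have "integral {a..0} f + integral {0..u} f = integral {a..u} f"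
        by (rule Henstock_Kurzweil_Integration.integral_combine) (use True ab i in auto)
      moreover have "integral {u..0} f = 0" using True by (cases "u = 0") auto
      ultimately show ?thesis by (simp add: signed_integral_def algebra_simps)
    next
      case False
      have "integral {a..u} f + integral {u..0} f = integral {a..0} f"
        by (rule Henstock_Kurzweil_Integration.integral_combine) (use False u i in auto)
      then show ?thesis using False by (simp add: signed_integral_def algebra_simps)
    qed
  qed (use ab in auto)
qed

lemma signed_integral_0 [simp]: "signed_integral f 0 = 0"
  by (simp add: signed_integral_def)

text \<open>The exponential weight reproduces itself under integration up to the factor
  \<open>1 / c\<close>. With \<open>c = 2 * L\<close>, against the Lipschitz constant
  \<open>L\<close>, this gives the contraction factor 1/2 of Picard iteration.\<close>

lemma integral_exp_bound:
  fixes h :: "real \<Rightarrow> 'a::euclidean_space"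
  assumes "continuous_on UNIV h" "c > 0" "K \<ge> 0" "\<And>s. norm (h s) \<le> K * exp (c * \<bar>s\<bar>)"
  shows "norm (signed_integral h t) \<le> K / c * exp (c * \<bar>t\<bar>)"
proof -
  have i: "h integrable_on {x..y}" for x y
    using assms(1) continuous_on_subset integrable_continuous_interval by blast
  show ?thesis
  proof (cases "t \<ge> 0")
    case True
    have "((\<lambda>s. K * exp (c * s)) has_integral (K / c * exp (c * t) - K / c * exp (c * 0))) {0..t}"
      by (rule fundamental_theorem_of_calculus[OF True])
        (auto intro!: derivative_eq_intros simp: has_real_derivative_iff_has_vector_derivative[symmetric] assms(2)[THEN less_imp_neq, symmetric])
    then have I: "integral {0..t} (\<lambda>s. K * exp (c * s)) = K / c * exp (c * t) - K / c"
      "(\<lambda>s. K * exp (c * s)) integrable_on {0..t}" by (auto simp: has_integral_iff)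
    have "norm (integral {0..t} h) \<le> integral {0..t} (\<lambda>s. K * exp (c * s))"
    proof (rule integral_norm_bound_integral[OF i I(2)])
      fix s assume "s \<in> {0..t}" then show "norm (h s) \<le> K * exp (c * s)" using assms(4)[of s] by simp
    qed
    moreover have "integral {t..0} h = 0" using True by (cases "t = 0") auto
    moreover have "K / c \<ge> 0" using assms by simp
    ultimately show ?thesis using I True by (simp add: signed_integral_def)
  next
    case False
    have "((\<lambda>s. K * exp (- c * s)) has_integral (- K / c * exp (- c * 0) - (- K / c * exp (- c * t)))) {t..0}"
      using False by (intro fundamental_theorem_of_calculus)
        (auto intro!: derivative_eq_intros simp: has_real_derivative_iff_has_vector_derivative[symmetric] assms(2)[THEN less_imp_neq, symmetric])
    then have I: "integral {t..0} (\<lambda>s. K * exp (- c * s)) = K / c * exp (- c * t) - K / c"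
      "(\<lambda>s. K * exp (- c * s)) integrable_on {t..0}" by (auto simp: has_integral_iff)
    have "norm (integral {t..0} h) \<le> integral {t..0} (\<lambda>s. K * exp (- c * s))"
    proof (rule integral_norm_bound_integral[OF i I(2)])
      fix s assume "s \<in> {t..0}" then show "norm (h s) \<le> K * exp (- c * s)" using assms(4)[of s] by simp
    qed
    moreover have "K / c \<ge> 0" using assms by simp
    ultimately show ?thesis using I False by (simp add: signed_integral_def)
  qed
qed

text \<open>Global bounds give a flow for all times at once. The fields of the proof satisfy them
  after composition with the projection onto a ball.\<close>

locale lipschitz_field =
  fixes V :: "'a::euclidean_space \<Rightarrow> 'a" and L M :: real
  assumes L_pos: "L > 0"
    and lip: "norm (V x - V y) \<le> L * norm (x - y)"
    and bnd: "norm (V x) \<le> M"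
begin

lemma M_nonneg: "M \<ge> 0" using bnd[of 0] norm_ge_zero order_trans by blast

lemma V_continuous: "continuous_on S V"
proof -
  have "L-lipschitz_on S V" using L_pos lip by (intro lipschitz_onI) (auto simp: dist_norm)
  then show ?thesis by (rule lipschitz_on_continuous_on)
qed

text \<open>Picard iteration is a contraction on all of \<open>\<real>\<close> at once for the norm
  weighted by \<open>exp (-2 L |t|)\<close>.\<close>

lemma flow_exists: "\<exists>u. u 0 = y \<and> (\<forall>t. (u has_vector_derivative V (u t)) (at t))"
proof -
  define E where "E t = exp (2 * L * \<bar>t\<bar>)" for t :: real
  have E: "E t > 0" for t by (simp add: E_def)
  have cE: "continuous_on UNIV E" unfolding E_def by (intro continuous_intros)
  \<comment> \<open>The unknown is the bounded function \<open>w\<close> in the curve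
    \<open>y + E s *\<^sub>R w s\<close>; \<open>I w\<close> is the integral of the field along this
    curve.\<close>
  define I where "I w = signed_integral (\<lambda>s. V (y + E s *\<^sub>R apply_bcontfun w s))" for w :: "real \<Rightarrow>\<^sub>C 'a"
  have cw: "continuous_on UNIV (\<lambda>s. V (y + E s *\<^sub>R apply_bcontfun w s))" for w :: "real \<Rightarrow>\<^sub>C 'a"
    by (rule continuous_on_compose2[OF V_continuous[of UNIV]])
       (auto intro!: continuous_intros cE)
  have Id: "(I w has_vector_derivative V (y + E t *\<^sub>R apply_bcontfun w t)) (at t)" for w t
    unfolding I_def by (rule signed_integral_has_vector_derivative[OF cw])
  have cI: "continuous_on UNIV (I w)" for w
    by (rule continuous_at_imp_continuous_on) (use Id has_vector_derivative_continuous in blast)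
  have bI: "norm (inverse (E t) *\<^sub>R I w t) \<le> M / (2 * L)" for w t
  proof -
    have "norm (I w t) \<le> M / (2 * L) * exp (2 * L * \<bar>t\<bar>)" unfolding I_def
    proof (rule integral_exp_bound[OF cw])
      fix s
      have "norm (V (y + E s *\<^sub>R apply_bcontfun w s)) \<le> M * 1" using bnd by simp
      also have "\<dots> \<le> M * exp (2 * L * \<bar>s\<bar>)" using M_nonneg L_pos by (intro mult_left_mono) auto
      finally show "norm (V (y + E s *\<^sub>R apply_bcontfun w s)) \<le> M * exp (2 * L * \<bar>s\<bar>)" .
    qed (use L_pos M_nonneg in auto)
    then show ?thesis using E[of t] L_pos by (simp add: E_def field_simps)
  qed
  define P where "P w = Bcontfun (\<lambda>t. inverse (E t) *\<^sub>R I w t)" for w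
  have inb: "(\<lambda>t. inverse (E t) *\<^sub>R I w t) \<in> bcontfun" for w
    by (rule bcontfun_normI[OF _ bI]) (intro continuous_intros cE cI, use E in \<open>auto simp: less_imp_neq[symmetric]\<close>)
  have Pw: "apply_bcontfun (P w) t = inverse (E t) *\<^sub>R I w t" for w t
    unfolding P_def by (simp add: Bcontfun_inverse[OF inb])
  have contr: "dist (P w) (P w') \<le> 1/2 * dist w w'" for w w'
  proof (rule dist_bound)
    fix t
    have "I w t - I w' t = signed_integral (\<lambda>s. V (y + E s *\<^sub>R apply_bcontfun w s) - V (y + E s *\<^sub>R apply_bcontfun w' s)) t"
    proof -
      have "(\<lambda>s. V (y + E s *\<^sub>R apply_bcontfun v s)) integrable_on {a..b}" for v a b
        using cw continuous_on_subset integrable_continuous_interval by blast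
      then show ?thesis by (simp add: I_def signed_integral_def Henstock_Kurzweil_Integration.integral_diff)
    qed
    moreover have "norm \<dots> \<le> (L * dist w w') / (2 * L) * exp (2 * L * \<bar>t\<bar>)"
    proof (rule integral_exp_bound)
      fix s
      have "norm (V (y + E s *\<^sub>R apply_bcontfun w s) - V (y + E s *\<^sub>R apply_bcontfun w' s)) \<le>
        L * norm ((y + E s *\<^sub>R apply_bcontfun w s) - (y + E s *\<^sub>R apply_bcontfun w' s))" by (rule lip)
      also have "\<dots> = L * (E s * dist (apply_bcontfun w s) (apply_bcontfun w' s))"
        using E[of s] by (simp add: dist_norm scaleR_diff_right[symmetric])
      also have "\<dots> \<le> L * (E s * dist w w')" using L_pos E[of s] by (intro mult_left_mono dist_bounded) auto
      finally show "norm (V (y + E s *\<^sub>R apply_bcontfun w s) - V (y + E s *\<^sub>R apply_bcontfun w' s)) \<le> L * dist w w' * exp (2 * L * \<bar>s\<bar>)"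
        by (simp add: E_def algebra_simps)
    qed (use L_pos cw in \<open>auto intro!: continuous_intros\<close>)
    ultimately have "norm (I w t - I w' t) \<le> (1/2 * dist w w') * E t" using L_pos by (simp add: E_def)
    then have "inverse (E t) * norm (I w t - I w' t) \<le> 1/2 * dist w w'"
      using E[of t] by (simp add: field_simps)
    then show "dist (apply_bcontfun (P w) t) (apply_bcontfun (P w') t) \<le> 1/2 * dist w w'"
      using E[of t] by (simp add: Pw dist_norm scaleR_diff_right[symmetric])
  qed
  then obtain w where w: "P w = w" using banach_fix_type[of "1/2" P] by auto
  have eq: "E t *\<^sub>R apply_bcontfun w t = I w t" for t
    using Pw[of w t] E[of t] by (simp add: w)
  show ?thesis
  proof (intro exI[of _ "\<lambda>t. y + I w t"] conjI allI)
    show "y + I w 0 = y" by (simp add: I_def)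
    fix t show "((\<lambda>t. y + I w t) has_vector_derivative V (y + I w t)) (at t)"
      using Id[of w t] by (auto intro!: derivative_eq_intros simp: eq)
  qed
qed

definition flow :: "real \<Rightarrow> 'a \<Rightarrow> 'a" where
  "flow t y = (SOME u. u 0 = y \<and> (\<forall>t. (u has_vector_derivative V (u t)) (at t))) t"

lemma flow_0 [simp]: "flow 0 y = y"
  unfolding flow_def using someI_ex[OF flow_exists[of y]] by simp

lemma flow_deriv: "((\<lambda>t. flow t y) has_vector_derivative V (flow t y)) (at t)"
  unfolding flow_def using someI_ex[OF flow_exists[of y]] by simp

text \<open>The squared distance \<open>D\<close> of two solutions satisfies
  \<open>\<bar>D' t\<bar> \<le> 2 * L * D t\<close>, so \<open>D t * exp (- 2 * L * t)\<close> does
  not increase and \<open>D t * exp (2 * L * t)\<close> does not decrease. The second bound serves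
  negative times.\<close>

lemma gronwall_le:
  assumes "a \<le> b"
    and u: "\<And>t. t \<in> {a..b} \<Longrightarrow> (u has_vector_derivative V (u t)) (at t within {a..b})"
    and w: "\<And>t. t \<in> {a..b} \<Longrightarrow> (w has_vector_derivative V (w t)) (at t within {a..b})"
  shows "norm (u b - w b) \<le> exp (L * (b - a)) * norm (u a - w a)"
    and "norm (u a - w a) \<le> exp (L * (b - a)) * norm (u b - w b)"
proof -
  define D where "D t = (u t - w t) \<bullet> (u t - w t)" for t
  define D' where "D' t = 2 * ((u t - w t) \<bullet> (V (u t) - V (w t)))" for t
  have D: "(D has_real_derivative D' t) (at t within {a..b})" if "t \<in> {a..b}" for t
    using u[OF that] w[OF that] unfolding D_def D'_def has_real_derivative_iff_has_vector_derivative has_vector_derivative_def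
    by (auto intro!: derivative_eq_intros simp: inner_commute algebra_simps)
  have D'b: "\<bar>D' t\<bar> \<le> 2 * L * D t" for t
  proof -
    have "\<bar>D' t\<bar> \<le> 2 * (norm (u t - w t) * norm (V (u t) - V (w t)))"
      unfolding D'_def using Cauchy_Schwarz_ineq2[of "u t - w t" "V (u t) - V (w t)"] by (simp add: abs_mult)
    also have "\<dots> \<le> 2 * (norm (u t - w t) * (L * norm (u t - w t)))"
      using lip by (intro mult_left_mono) auto
    finally show ?thesis by (simp add: D_def dot_square_norm power2_eq_square algebra_simps)
  qed
  have mono1: "D b * exp (- 2 * L * b) \<le> D a * exp (- 2 * L * a)"
  proof (rule DERIV_nonpos_imp_decreasing_open[OF assms(1)])
    fix x assume x: "a < x" "x < b"
    have "(D has_real_derivative D' x) (at x)" using D[of x] x by (simp add: at_within_Icc_at)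
    then have "((\<lambda>t. D t * exp (- 2 * L * t)) has_real_derivative (D' x - 2 * L * D x) * exp (- 2 * L * x)) (at x)"
      by (auto intro!: derivative_eq_intros simp: algebra_simps)
    moreover have "(D' x - 2 * L * D x) * exp (- 2 * L * x) \<le> 0" using D'b[of x] by (intro mult_nonpos_nonneg) auto
    ultimately show "\<exists>y. ((\<lambda>t. D t * exp (- 2 * L * t)) has_real_derivative y) (at x) \<and> y \<le> 0" by blast
  next
    show "continuous_on {a..b} (\<lambda>t. D t * exp (- 2 * L * t))"
      by (intro continuous_intros) (metis D DERIV_continuous_on)
  qed
  have mono2: "D a * exp (2 * L * a) \<le> D b * exp (2 * L * b)"
  proof (rule DERIV_nonneg_imp_increasing_open[OF assms(1)])
    fix x assume x: "a < x" "x < b"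
    have "(D has_real_derivative D' x) (at x)" using D[of x] x by (simp add: at_within_Icc_at)
    then have "((\<lambda>t. D t * exp (2 * L * t)) has_real_derivative (D' x + 2 * L * D x) * exp (2 * L * x)) (at x)"
      by (auto intro!: derivative_eq_intros simp: algebra_simps)
    moreover have "(D' x + 2 * L * D x) * exp (2 * L * x) \<ge> 0" using D'b[of x] by (intro mult_nonneg_nonneg) auto
    ultimately show "\<exists>y. ((\<lambda>t. D t * exp (2 * L * t)) has_real_derivative y) (at x) \<and> y \<ge> 0" by blast
  next
    show "continuous_on {a..b} (\<lambda>t. D t * exp (2 * L * t))"
      by (intro continuous_intros) (metis D DERIV_continuous_on)
  qed
  have sq: "D t = (norm (u t - w t))\<^sup>2" for t by (simp add: D_def dot_square_norm)
  have e: "exp (L * (b - a)) ^ 2 = exp (2 * L * b) * exp (- 2 * L * a)"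
    by (simp add: exp_double[symmetric] mult_exp_exp algebra_simps)
  have "(norm (u b - w b))\<^sup>2 \<le> (exp (L * (b - a)) * norm (u a - w a))\<^sup>2"
  proof -
    have "D b = (D b * exp (- 2 * L * b)) * exp (2 * L * b)" by (simp add: mult_exp_exp mult.assoc)
    also have "\<dots> \<le> (D a * exp (- 2 * L * a)) * exp (2 * L * b)" using mono1 by (rule mult_right_mono) simp
    finally show ?thesis unfolding sq power_mult_distrib e by (simp only: mult_ac)
  qed
  then show "norm (u b - w b) \<le> exp (L * (b - a)) * norm (u a - w a)"
    by (rule power2_le_imp_le) simp
  have "(norm (u a - w a))\<^sup>2 \<le> (exp (L * (b - a)) * norm (u b - w b))\<^sup>2"
  proof -
    have "D a = (D a * exp (2 * L * a)) * exp (- 2 * L * a)" by (simp add: mult_exp_exp mult.assoc)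
    also have "\<dots> \<le> (D b * exp (2 * L * b)) * exp (- 2 * L * a)" using mono2 by (rule mult_right_mono) simp
    finally show ?thesis unfolding sq power_mult_distrib e by (simp only: mult_ac)
  qed
  then show "norm (u a - w a) \<le> exp (L * (b - a)) * norm (u b - w b)"
    by (rule power2_le_imp_le) simp
qed

lemma flow_deriv_within: "((\<lambda>t. flow t y) has_vector_derivative V (flow t y)) (at t within S)"
  using flow_deriv has_vector_derivative_at_within by blast

lemma flow_lip: "norm (flow t x - flow t y) \<le> exp (L * \<bar>t\<bar>) * norm (x - y)"
proof (cases "t \<ge> 0")
  case True
  show ?thesis using gronwall_le(1)[OF True, of "\<lambda>t. flow t x" "\<lambda>t. flow t y"] True flow_deriv_within by simp
next
  case False
  then show ?thesis using gronwall_le(2)[of t 0 "\<lambda>t. flow t x" "\<lambda>t. flow t y"] flow_deriv_within by simp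
qed

lemma flow_unique:
  assumes u: "\<And>s. s \<in> {min 0 t..max 0 t} \<Longrightarrow> (u has_vector_derivative V (u s)) (at s within {min 0 t..max 0 t})"
  shows "u t = flow t (u 0)"
proof (cases "t \<ge> 0")
  case True
  then show ?thesis using gronwall_le(1)[OF True, of u "\<lambda>s. flow s (u 0)"] flow_deriv_within u by simp
next
  case False
  then show ?thesis using gronwall_le(2)[of t 0 u "\<lambda>s. flow s (u 0)"] flow_deriv_within u by simp
qed

lemma flow_add: "flow (s + t) y = flow s (flow t y)"
proof -
  have "((\<lambda>s. flow (s + t) y) has_vector_derivative V (flow (r + t) y)) (at r within S)" for r S
  proof -
    have "((\<lambda>t. flow t y) \<circ> (\<lambda>s. s + t) has_vector_derivative 1 *\<^sub>R V (flow (r + t) y)) (at r within S)"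
      by (rule vector_diff_chain_within) (auto intro!: derivative_eq_intros flow_deriv_within)
    then show ?thesis by (simp add: o_def)
  qed
  from flow_unique[of s "\<lambda>s. flow (s + t) y", OF this] show ?thesis by simp
qed

lemma flow_inverse: "flow (- t) (flow t y) = y" "flow t (flow (- t) y) = y"
  using flow_add[of "-t" t y] flow_add[of t "-t" y] by simp_all

lemma flow_time_lip: "norm (flow t y - flow s y) \<le> M * \<bar>t - s\<bar>"
proof -
  have "norm (flow t y - flow s y) \<le> M * norm (t - s)"
  proof (rule differentiable_bound[of UNIV "\<lambda>t. flow t y" "\<lambda>t h. h *\<^sub>R V (flow t y)"])
    fix x show "((\<lambda>t. flow t y) has_derivative (\<lambda>h. h *\<^sub>R V (flow x y))) (at x within UNIV)"
      using flow_deriv[of y x] by (simp add: has_vector_derivative_def)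
    have "norm (h *\<^sub>R V (flow x y)) \<le> M * norm h" for h
      using mult_left_mono[OF bnd[of "flow x y"], of "\<bar>h\<bar>"] by (simp add: mult.commute)
    then show "onorm (\<lambda>h. h *\<^sub>R V (flow x y)) \<le> M" by (rule onorm_le)
  qed auto
  then show ?thesis by simp
qed

lemma flow_joint_lip: "norm (flow t y - flow s x) \<le> M * \<bar>t - s\<bar> + exp (L * \<bar>s\<bar>) * norm (y - x)"
  using flow_time_lip[of t y s] flow_lip[of s y x] norm_triangle_ineq[of "flow t y - flow s y" "flow s y - flow s x"] by simp

text \<open>Along the orbit the field changes by at most \<open>L\<close> times the distance
  travelled, and this distance is at most \<open>M * \<bar>t\<bar>\<close>.\<close>

lemma flow_first_order: "norm (flow t y - y - t *\<^sub>R V y) \<le> L * M * t\<^sup>2"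
proof -
  define g where "g s = flow s y - s *\<^sub>R V y" for s
  have gd: "(g has_derivative (\<lambda>h. h *\<^sub>R (V (flow s y) - V y))) (at s within {min 0 t..max 0 t})" for s
    unfolding g_def using flow_deriv_within[of y s] by (auto simp: has_vector_derivative_def scaleR_diff_right intro!: derivative_eq_intros)
  have "norm (g t - g 0) \<le> (L * (M * \<bar>t\<bar>)) * norm (t - 0)"
  proof (rule differentiable_bound[OF _ gd])
    fix s assume s: "s \<in> {min 0 t..max 0 t}"
    have "norm (V (flow s y) - V y) \<le> L * norm (flow s y - y)" by (rule lip)
    also have "\<dots> \<le> L * (M * \<bar>s\<bar>)" using flow_time_lip[of s y 0] L_pos by (intro mult_left_mono) auto
    also have "\<dots> \<le> L * (M * \<bar>t\<bar>)" using s L_pos M_nonneg by (intro mult_left_mono) auto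
    finally have "norm (h *\<^sub>R (V (flow s y) - V y)) \<le> L * (M * \<bar>t\<bar>) * norm h" for h
      by (metis abs_ge_zero mult.commute mult_left_mono norm_scaleR real_norm_def)
    then show "onorm (\<lambda>h. h *\<^sub>R (V (flow s y) - V y)) \<le> L * (M * \<bar>t\<bar>)" by (rule onorm_le)
  qed auto
  moreover have "flow t y - t *\<^sub>R V y - y = flow t y - y - t *\<^sub>R V y" by simp
  ultimately show ?thesis by (simp add: g_def power2_eq_square mult.assoc)
qed

text \<open>Each step adds an error of at most \<open>L * M * h\<^sup>2\<close> and expands the
  earlier error by at most \<open>1 + h * L \<le> exp (L * h)\<close>.\<close>

lemma euler_error:
  assumes "h \<ge> 0"
  shows "norm (((\<lambda>y. y + h *\<^sub>R V y) ^^ n) y - flow (real n * h) y) \<le> real n * (L * M * h\<^sup>2) * exp (L * h * real n)"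
proof (induction n)
  case (Suc n)
  define G where "G = (\<lambda>y. y + h *\<^sub>R V y)"
  define e where "e = norm ((G ^^ n) y - flow (real n * h) y)"
  let ?w = "flow (real n * h) y"
  have LM: "L * M * h\<^sup>2 \<ge> 0" using L_pos M_nonneg by simp
  have "norm ((G ^^ Suc n) y - flow (real (Suc n) * h) y) = norm ((G ((G ^^ n) y) - G ?w) - (flow h ?w - ?w - h *\<^sub>R V ?w))"
    by (simp add: flow_add[symmetric] G_def algebra_simps)
  also have "\<dots> \<le> norm (G ((G ^^ n) y) - G ?w) + norm (flow h ?w - ?w - h *\<^sub>R V ?w)" by (rule norm_triangle_ineq4)
  also have "\<dots> \<le> (1 + h * L) * e + L * M * h\<^sup>2"
  proof (rule add_mono[OF _ flow_first_order])
    have "G ((G ^^ n) y) - G ?w = ((G ^^ n) y - ?w) + h *\<^sub>R (V ((G ^^ n) y) - V ?w)" by (simp add: G_def algebra_simps)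
    then have "norm (G ((G ^^ n) y) - G ?w) \<le> e + norm (h *\<^sub>R (V ((G ^^ n) y) - V ?w))"
      unfolding e_def by (metis norm_triangle_ineq)
    also have "\<dots> \<le> e + h * (L * e)" using assms lip[of "(G ^^ n) y" ?w] by (auto simp: e_def intro!: mult_left_mono)
    finally show "norm (G ((G ^^ n) y) - G ?w) \<le> (1 + h * L) * e" by (simp add: algebra_simps)
  qed
  also have "\<dots> \<le> exp (L * h) * (real n * (L * M * h\<^sup>2) * exp (L * h * real n)) + L * M * h\<^sup>2"
  proof (intro add_mono mult_mono)
    show "1 + h * L \<le> exp (L * h)" using exp_ge_add_one_self[of "L * h"] by (simp add: mult.commute)
    show "e \<le> real n * (L * M * h\<^sup>2) * exp (L * h * real n)" using Suc by (simp add: e_def G_def)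
  qed (use L_pos M_nonneg in \<open>auto simp: e_def\<close>)
  also have "\<dots> \<le> exp (L * h) * (real n * (L * M * h\<^sup>2) * exp (L * h * real n)) + (L * M * h\<^sup>2) * exp (L * h * real (Suc n))"
  proof -
    have "1 \<le> exp (L * h * real (Suc n))" using L_pos assms by simp
    then have "(L * M * h\<^sup>2) * 1 \<le> (L * M * h\<^sup>2) * exp (L * h * real (Suc n))" using LM by (rule mult_left_mono)
    then show ?thesis by simp
  qed
  also have "\<dots> = real (Suc n) * (L * M * h\<^sup>2) * exp (L * h * real (Suc n))"
    by (simp add: algebra_simps mult_exp_exp)
  finally show ?case by (simp add: G_def)
qed simp

lemma flow_zero: "V y = 0 \<Longrightarrow> flow t y = y"
  using flow_unique[of t "\<lambda>_. y"] by (auto intro!: derivative_eq_intros)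

lemma flow_continuous_time: "continuous_on S (\<lambda>t. flow t y)"
  using flow_deriv by (intro continuous_at_imp_continuous_on) (auto intro: has_vector_derivative_continuous)

lemma flow_continuous: "continuous_on S (flow t)"
proof -
  have "(exp (L * \<bar>t\<bar>))-lipschitz_on S (flow t)"
  proof (rule lipschitz_onI)
    fix x y show "dist (flow t x) (flow t y) \<le> exp (L * \<bar>t\<bar>) * dist x y"
      using flow_lip[of t x y] by (simp add: dist_norm)
  qed simp
  then show ?thesis by (rule lipschitz_on_continuous_on)
qed

lemma flow_negligible: "negligible S \<Longrightarrow> negligible (flow t ` S)"
proof (rule negligible_locally_Lipschitz_image)
  fix x assume "x \<in> S"
  show "\<exists>T B. open T \<and> x \<in> T \<and> (\<forall>y\<in>S \<inter> T. norm (flow t y - flow t x) \<le> B * norm (y - x))"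
    using flow_lip by (intro exI[of _ UNIV] exI[of _ "exp (L * \<bar>t\<bar>)"]) auto
qed auto

end

lemma lipschitz_field_uminus:
  assumes "lipschitz_field V L M" shows "lipschitz_field (\<lambda>x. - V x) L M"
proof -
  interpret lipschitz_field V L M by fact
  show ?thesis
  proof
    fix x y show "norm (- V x - - V y) \<le> L * norm (x - y)" using lip[of y x] by (simp add: norm_minus_commute)
  qed (use L_pos bnd in auto)
qed

text \<open>An orbit may tend to a zero in backward time; the forward statements are then applied to
  \<open>- V\<close>.\<close>

lemma flow_uminus:
  assumes "lipschitz_field V L M"
  shows "lipschitz_field.flow (\<lambda>x. - V x) t y = lipschitz_field.flow V (- t) y"
proof -
  interpret f: lipschitz_field V L M by fact
  interpret g: lipschitz_field "\<lambda>x. - V x" L M by (rule lipschitz_field_uminus) fact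
  have "((\<lambda>s. f.flow (- s) y) has_vector_derivative - V (f.flow (- r) y)) (at r within S)" for r S
  proof -
    have "((\<lambda>t. f.flow t y) \<circ> uminus has_vector_derivative (-1) *\<^sub>R V (f.flow (- r) y)) (at r within S)"
      by (rule vector_diff_chain_within) (auto intro!: derivative_eq_intros f.flow_deriv_within)
    then show ?thesis by (simp add: o_def)
  qed
  from g.flow_unique[of t "\<lambda>s. f.flow (- s) y", OF this] show ?thesis by simp
qed

section \<open>Volume along orbits of bounded length\<close>

text \<open>The constant depends only on \<open>a\<close> and the index set, which makes the
  determinant bound uniform over all points and step sizes.\<close>

lemma prod_one_plus_expansion:
  fixes a :: real
  assumes "finite S" "a \<ge> 0"
  shows "\<exists>c\<ge>0. \<forall>x h. (\<forall>i\<in>S. \<bar>x i\<bar> \<le> a) \<longrightarrow> 0 \<le> h \<longrightarrow> h \<le> 1 \<longrightarrow>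
     \<bar>(\<Prod>i\<in>S. 1 + h * x i) - 1 - h * (\<Sum>i\<in>S. x i)\<bar> \<le> c * h\<^sup>2"
  using assms(1)
proof (induction S)
  case empty show ?case by (intro exI[of _ 0]) auto
next
  case (insert j S)
  then obtain c where c: "c \<ge> 0" "\<And>x h. (\<forall>i\<in>S. \<bar>x i\<bar> \<le> a) \<Longrightarrow> 0 \<le> h \<Longrightarrow> h \<le> 1 \<Longrightarrow>
     \<bar>(\<Prod>i\<in>S. 1 + h * x i) - 1 - h * (\<Sum>i\<in>S. x i)\<bar> \<le> c * h\<^sup>2" by auto
  define k where "k = real (card S) * a"
  have k0: "k \<ge> 0" using assms by (simp add: k_def)
  show ?case
  proof (intro exI[of _ "c + a * (k + c)"] conjI allI impI)
    show "0 \<le> c + a * (k + c)" using c k0 assms by simp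
    fix x h assume x: "\<forall>i\<in>insert j S. \<bar>x i\<bar> \<le> a" and h: "0 \<le> h" "h \<le> (1::real)"
    define P where "P = (\<Prod>i\<in>S. 1 + h * x i)"
    define T where "T = (\<Sum>i\<in>S. x i)"
    have 1: "\<bar>P - 1 - h * T\<bar> \<le> c * h\<^sup>2" using c(2)[of x h] x h by (simp add: P_def T_def)
    have "\<bar>T\<bar> \<le> (\<Sum>i\<in>S. a)" unfolding T_def using x by (intro order_trans[OF sum_abs] sum_mono) auto
    then have T: "\<bar>T\<bar> \<le> k" by (simp add: k_def)
    have "\<bar>h * T\<bar> \<le> h * k" using T h by (simp add: abs_mult mult_left_mono)
    moreover have "c * h\<^sup>2 \<le> c * h" using h c(1) by (intro mult_left_mono) (auto simp: power2_eq_square mult_left_le)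
    ultimately have P1: "\<bar>P - 1\<bar> \<le> h * (k + c)" using 1 by (simp add: algebra_simps)
    have "\<bar>h * x j * (P - 1)\<bar> \<le> h * a * (h * (k + c))"
      unfolding abs_mult using x h P1 k0 c(1) by (intro mult_mono) auto
    moreover have "(\<Prod>i\<in>insert j S. 1 + h * x i) - 1 - h * (\<Sum>i\<in>insert j S. x i) = (P - 1 - h * T) + h * x j * (P - 1)"
      using insert by (simp add: P_def T_def algebra_simps)
    ultimately have "\<bar>(\<Prod>i\<in>insert j S. 1 + h * x i) - 1 - h * (\<Sum>i\<in>insert j S. x i)\<bar> \<le> c * h\<^sup>2 + h * a * (h * (k + c))"
      using 1 by linarith
    then show "\<bar>(\<Prod>i\<in>insert j S. 1 + h * x i) - 1 - h * (\<Sum>i\<in>insert j S. x i)\<bar> \<le> (c + a * (k + c)) * h\<^sup>2"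
      by (simp add: algebra_simps power2_eq_square)
  qed
qed

text \<open>To first order in \<open>h\<close> only the identity permutation contributes. Every
  other one moves at least two indices, so its term has two off-diagonal factors, each at most
  \<open>h * a\<close> in modulus.\<close>

lemma det_perturbation_of_identity:
  fixes a :: real
  assumes "a \<ge> 0"
  obtains c where "c \<ge> 0" "\<And>(A :: real^'n::finite^'n) h. (\<forall>i j. \<bar>A$i$j\<bar> \<le> a) \<Longrightarrow> 0 \<le> h \<Longrightarrow> h \<le> 1 \<Longrightarrow>
     det (mat 1 + h *\<^sub>R A) \<ge> 1 + h * trace A - c * h\<^sup>2"
proof -
  obtain c0 where c0: "c0 \<ge> 0" "\<And>x h. (\<forall>i\<in>(UNIV::'n set). \<bar>x i\<bar> \<le> a) \<Longrightarrow> 0 \<le> h \<Longrightarrow> h \<le> 1 \<Longrightarrow>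
     \<bar>(\<Prod>i\<in>UNIV. 1 + h * x i) - 1 - h * (\<Sum>i\<in>UNIV. x i)\<bar> \<le> c0 * h\<^sup>2"
    using prod_one_plus_expansion[of "UNIV :: 'n set" a] assms by auto
  define Q where "Q = {p. p permutes (UNIV :: 'n set)}"
  have finQ: "finite Q" unfolding Q_def by (rule finite_permutations) simp
  define c1 where "c1 = a * a * (1 + a) ^ CARD('n)"
  have c1: "c1 \<ge> 0" using assms by (simp add: c1_def)
  show ?thesis
  proof (rule that[of "c0 + real (card Q) * c1"])
    show "0 \<le> c0 + real (card Q) * c1" using c0 c1 by simp
    fix A :: "real^'n^'n" and h :: real assume A: "\<forall>i j. \<bar>A$i$j\<bar> \<le> a" and h: "0 \<le> h" "h \<le> 1"
    define B where "B = mat 1 + h *\<^sub>R A"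
    have Bij: "B$i$j = (if i = j then 1 else 0) + h * A$i$j" for i j by (simp add: B_def mat_def)
    define f where "f p = of_int (sign p) * (\<Prod>i\<in>UNIV. B$i$p i)" for p :: "'n \<Rightarrow> 'n"
    have fp: "\<bar>f p\<bar> \<le> c1 * h\<^sup>2" if p: "p \<in> Q - {id}" for p
    proof -
      obtain i where i: "p i \<noteq> i" using p by (auto simp: fun_eq_iff)
      have inj: "inj p" using p permutes_inj by (auto simp: Q_def)
      \<comment> \<open>A second moved index: \<open>p j = j\<close> would contradict the
        injectivity of \<open>p\<close>.\<close>
      define j where "j = p i"
      have j: "p j \<noteq> j" "j \<noteq> i" using i inj by (auto simp: j_def inj_def)
      have off: "\<bar>B$k$p k\<bar> \<le> h * a" if "p k \<noteq> k" for k
        using that A h by (auto simp: Bij abs_mult intro: mult_left_mono)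
      have gen: "\<bar>B$k$l\<bar> \<le> 1 + a" for k l
      proof -
        have "\<bar>h * A$k$l\<bar> \<le> 1 * a" unfolding abs_mult using A h by (intro mult_mono) auto
        then show ?thesis unfolding Bij using assms by (auto intro: abs_triangle_ineq[THEN order_trans])
      qed
      have "\<bar>f p\<bar> = (\<Prod>k\<in>UNIV. \<bar>B$k$p k\<bar>)"
        by (simp add: f_def abs_mult abs_prod sign_def)
      also have "\<dots> = (\<Prod>k\<in>{i,j}. \<bar>B$k$p k\<bar>) * (\<Prod>k\<in>UNIV - {i,j}. \<bar>B$k$p k\<bar>)"
        by (simp add: prod.subset_diff[of "{i,j}" UNIV] mult.commute)
      also have "\<dots> \<le> ((h * a) * (h * a)) * ((1 + a) ^ CARD('n))"
      proof (intro mult_mono)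
        show "(\<Prod>k\<in>{i,j}. \<bar>B$k$p k\<bar>) \<le> (h * a) * (h * a)"
          using j off[OF i] off[OF j(1)] h assms by (auto intro!: mult_mono)
        have "(\<Prod>k\<in>UNIV - {i,j}. \<bar>B$k$p k\<bar>) \<le> (\<Prod>k\<in>UNIV - {i,j}. 1 + a)"
          using gen by (intro prod_mono) auto
        also have "\<dots> \<le> (1 + a) ^ CARD('n)"
          using assms by (simp add: card_Diff_subset power_increasing)
        finally show "(\<Prod>k\<in>UNIV - {i,j}. \<bar>B$k$p k\<bar>) \<le> (1 + a) ^ CARD('n)" .
      qed (use h assms in \<open>auto intro!: prod_nonneg\<close>)
      also have "\<dots> = c1 * h\<^sup>2" by (simp add: c1_def power2_eq_square algebra_simps)
      finally show ?thesis .
    qed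
    have "id \<in> Q" by (simp add: Q_def permutes_id)
    have "det B = f id + (\<Sum>p\<in>Q - {id}. f p)"
      unfolding det_def f_def[symmetric] Q_def[symmetric] using finQ \<open>id \<in> Q\<close> by (rule sum.remove)
    moreover have "\<bar>\<Sum>p\<in>Q - {id}. f p\<bar> \<le> real (card Q) * c1 * h\<^sup>2"
    proof -
      have "\<bar>\<Sum>p\<in>Q - {id}. f p\<bar> \<le> (\<Sum>p\<in>Q - {id}. c1 * h\<^sup>2)"
        using fp by (intro order_trans[OF sum_abs] sum_mono) auto
      also have "\<dots> \<le> (\<Sum>p\<in>Q. c1 * h\<^sup>2)" using c1 finQ by (intro sum_mono2) auto
      finally show ?thesis by simp
    qed
    moreover have "f id = (\<Prod>i\<in>UNIV. 1 + h * A$i$i)" by (simp add: f_def Bij)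
    moreover have "\<bar>(\<Prod>i\<in>UNIV. 1 + h * A$i$i) - 1 - h * trace A\<bar> \<le> c0 * h\<^sup>2"
      using c0(2)[of "\<lambda>i. A$i$i" h] A h by (simp add: trace_def)
    ultimately show "det (mat 1 + h *\<^sub>R A) \<ge> 1 + h * trace A - (c0 + real (card Q) * c1) * h\<^sup>2"
      unfolding B_def[symmetric] by (simp add: algebra_simps abs_le_iff)
  qed
qed

text \<open>Turns a product of one-step determinants into the exponential of a sum, at the price of
  a factor 2 and of steps so short that \<open>x \<le> 1/2\<close>.\<close>

lemma exp_neg_double_le:
  fixes x :: real assumes "0 \<le> x" "x \<le> 1/2" shows "exp (- (2 * x)) \<le> 1 - x"
proof -
  have "exp (- (2 * x)) = inverse (exp (2 * x))" by (simp add: exp_minus)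
  also have "\<dots> \<le> inverse (1 + 2 * x)" using assms exp_ge_add_one_self[of "2*x"] by (intro le_imp_inverse_le) auto
  also have "\<dots> \<le> 1 - x"
  proof -
    have "x * (2 * x) \<le> x * 1" using assms by (intro mult_left_mono) auto
    then have "1 \<le> (1 - x) * (1 + 2 * x)" by (simp add: algebra_simps)
    then show ?thesis using assms by (simp add: field_simps)
  qed
  finally show ?thesis .
qed

lemma compact_cball_neighbourhood:
  fixes K :: "'a::euclidean_space set"
  assumes "compact K" shows "compact (\<Union>x\<in>K. cball x \<eta>)"
proof -
  have "(\<Union>x\<in>K. cball x \<eta>) = (\<Union>x\<in>K. \<Union>y\<in>cball 0 \<eta>. {x + y})"
    by (force simp: dist_norm norm_minus_commute image_iff)
  also have "\<dots> = {x + y | x y. x \<in> K \<and> y \<in> cball 0 \<eta>}" by blast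
  finally have eq: "(\<Union>x\<in>K. cball x \<eta>) = {x + y | x y. x \<in> K \<and> y \<in> cball 0 \<eta>}" .
  show ?thesis unfolding eq by (rule compact_sums[OF assms compact_cball])
qed

text \<open>Derivative and divergence bound are assumed on \<open>B\<close> only. Orbits will be
  kept in the compact set \<open>K\<close>, and the room left between \<open>K\<close> and the
  boundary of \<open>B\<close> accommodates the Euler polygons.\<close>

locale C1_lipschitz_field = lipschitz_field V L M
  for V :: "real^'n::{finite,wellorder} \<Rightarrow> real^'n::_" and L M +
  fixes B K :: "(real^'n::_) set" and J :: "real^'n::_ \<Rightarrow> real^'n::_^'n::_" and C :: real
  assumes B_open: "open B" and K_compact: "compact K" and K_sub: "K \<subseteq> B"
    and der: "x \<in> B \<Longrightarrow> (V has_derivative (*v) (J x)) (at x)"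
    and J_cont: "continuous_on B J"
    and C_nonneg: "C \<ge> 0"
    and div_bound: "x \<in> B \<Longrightarrow> \<bar>trace (J x)\<bar> \<le> C * norm (V x)"
    and zero_negligible: "negligible {x\<in>B. V x = 0}"
begin

text \<open>Polygons stand in for the flow because they are iterates of a map that is differentiable
  on \<open>B\<close>, with the explicit Jacobian \<open>euler_jac\<close>.\<close>

definition euler :: "real \<Rightarrow> nat \<Rightarrow> real^'n::_ \<Rightarrow> real^'n::_" where
  "euler h n = ((\<lambda>y. y + h *\<^sub>R V y) ^^ n)"

lemma euler_Suc: "euler h (Suc n) y = euler h n y + h *\<^sub>R V (euler h n y)" and euler_0 [simp]: "euler h 0 y = y"
  by (simp_all add: euler_def)

primrec euler_jac :: "real \<Rightarrow> nat \<Rightarrow> real^'n::_ \<Rightarrow> real^'n::_^'n::_" where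
  "euler_jac h 0 y = mat 1"
| "euler_jac h (Suc n) y = (mat 1 + h *\<^sub>R J (euler h n y)) ** euler_jac h n y"

lemma euler_has_derivative:
  assumes "\<And>k. k < n \<Longrightarrow> euler h k y \<in> B"
  shows "(euler h n has_derivative (*v) (euler_jac h n y)) (at y)"
  using assms
proof (induction n)
  case 0
  have "euler h 0 = (\<lambda>y. y)" by (simp add: fun_eq_iff)
  then show ?case by (auto intro!: derivative_eq_intros simp: fun_eq_iff)
next
  case (Suc n)
  have IH: "(euler h n has_derivative (*v) (euler_jac h n y)) (at y)" using Suc by simp
  have "((\<lambda>z. z + h *\<^sub>R V z) has_derivative (*v) (mat 1 + h *\<^sub>R J (euler h n y))) (at (euler h n y))"
    using der[of "euler h n y"] Suc.prems
    by (auto intro!: derivative_eq_intros simp: fun_eq_iff matrix_vector_mult_add_rdistrib scaleR_matrix_vector_assoc)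
  from diff_chain_at[OF IH this] have "((\<lambda>z. z + h *\<^sub>R V z) \<circ> euler h n has_derivative
      (*v) (mat 1 + h *\<^sub>R J (euler h n y)) \<circ> (*v) (euler_jac h n y)) (at y)" .
  moreover have "(\<lambda>z. z + h *\<^sub>R V z) \<circ> euler h n = euler h (Suc n)" by (simp add: fun_eq_iff euler_Suc)
  moreover have "(*v) (mat 1 + h *\<^sub>R J (euler h n y)) \<circ> (*v) (euler_jac h n y) = (*v) (euler_jac h (Suc n) y)"
    by (simp add: fun_eq_iff matrix_vector_mul_assoc)
  ultimately show ?case by simp
qed

lemma euler_continuous: "continuous_on S (euler h n)"
proof (induction n)
  case 0
  have "euler h 0 = (\<lambda>y. y)" by (simp add: fun_eq_iff)
  then show ?case by simp
next
  case (Suc n)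
  have "euler h (Suc n) = (\<lambda>y. euler h n y + h *\<^sub>R V (euler h n y))" by (simp add: fun_eq_iff euler_Suc)
  moreover have "continuous_on S (\<lambda>y. V (euler h n y))"
    by (rule continuous_on_compose2[OF V_continuous[of UNIV] Suc]) auto
  ultimately show ?case using Suc by (simp add: continuous_on_add continuous_on_scaleR)
qed

lemma euler_det_continuous:
  assumes "\<And>k y. y \<in> S \<Longrightarrow> k < n \<Longrightarrow> euler h k y \<in> B"
  shows "continuous_on S (\<lambda>y. det (euler_jac h n y))"
  using assms
proof (induction n)
  case (Suc n)
  have "continuous_on S (\<lambda>y. J (euler h n y))"
    by (rule continuous_on_compose2[OF J_cont euler_continuous]) (use Suc.prems in auto)
  then have "continuous_on S (\<lambda>y. det (mat 1 + h *\<^sub>R J (euler h n y)))"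
    unfolding det_def by (intro continuous_intros)
  then show ?case using Suc by (auto simp: det_mul intro!: continuous_intros)
qed simp

text \<open>One step is the identity perturbed by \<open>h *\<^sub>R V\<close>, which is a
  contraction when \<open>h * L < 1\<close>.\<close>

lemma euler_inj:
  assumes "h \<ge> 0" "h * L < 1" shows "inj (euler h n)"
proof (induction n)
  case 0 then show ?case by (simp add: inj_def)
next
  case (Suc n)
  have key: "x = y" if "x + h *\<^sub>R V x = y + h *\<^sub>R V y" for x y
  proof -
    have "x - y = (x + h *\<^sub>R V x) - y - h *\<^sub>R V x" by simp
    then have "x - y = h *\<^sub>R (V y - V x)" unfolding that by (simp add: scaleR_diff_right)
    then have "norm (x - y) = h * norm (V y - V x)" using assms(1) by simp
    also have "\<dots> \<le> h * (L * norm (y - x))" by (rule mult_left_mono[OF lip assms(1)])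
    also have "norm (y - x) = norm (x - y)" by (rule norm_minus_commute)
    finally have "norm (x - y) \<le> h * (L * norm (x - y))" .
    then have "(1 - h * L) * norm (x - y) \<le> 0" by (simp add: algebra_simps)
    then show ?thesis using assms(2) by (simp add: mult_le_0_iff)
  qed
  show ?case
  proof (rule injI)
    fix x y assume "euler h (Suc n) x = euler h (Suc n) y"
    then have "euler h n x = euler h n y" unfolding euler_Suc by (rule key)
    then show "x = y" using Suc by (rule injD[rotated])
  qed
qed

lemma euler_error': "h \<ge> 0 \<Longrightarrow> real N * h = T \<Longrightarrow> k \<le> N \<Longrightarrow> norm (euler h k y - flow (real k * h) y) \<le> T * L * M * exp (L * T) * h"
proof -
  assume h: "h \<ge> 0" "real N * h = T" "k \<le> N"
  have kh: "real k * h \<le> T" using h by (metis mult_right_mono of_nat_le_iff)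
  have "norm (euler h k y - flow (real k * h) y) \<le> real k * (L * M * h\<^sup>2) * exp (L * h * real k)"
    unfolding euler_def by (rule euler_error[OF h(1)])
  also have "\<dots> = (real k * h) * L * M * exp (L * (real k * h)) * h" by (simp add: power2_eq_square algebra_simps)
  also have "\<dots> \<le> T * L * M * exp (L * T) * h"
  proof (intro mult_right_mono mult_mono)
    show "exp (L * (real k * h)) \<le> exp (L * T)" using kh L_pos by simp
  qed (use kh h L_pos M_nonneg in \<open>auto simp: mult_nonneg_nonneg\<close>)
  finally show ?thesis .
qed

text \<open>Length is measured by polygons with equal time steps: this suits the comparison with
  Euler polygons, and it makes the set an intersection of closed conditions.\<close>

definition trapped :: "real \<Rightarrow> (real^'n::_) set" where
  "trapped l = {y. (\<forall>t\<ge>0. flow t y \<in> K) \<and>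
     (\<forall>h>0. \<forall>N::nat. (\<Sum>i<N. norm (flow (real (Suc i) * h) y - flow (real i * h) y)) \<le> l)}"

lemma trapped_compact: "compact (trapped l)"
proof -
  have c: "continuous_on UNIV (flow t)" for t by (rule flow_continuous)
  have 1: "closed (\<Inter>t\<in>{0..}. flow t -` K)"
    by (intro closed_INT ballI closed_vimage compact_imp_closed K_compact c)
  have 2: "closed (\<Inter>h\<in>{0<..}. \<Inter>N::nat. {y. (\<Sum>i<N. norm (flow (real (Suc i) * h) y - flow (real i * h) y)) \<le> l})"
    by (intro closed_INT ballI closed_Collect_le continuous_intros c)
  have eq: "trapped l = (\<Inter>t\<in>{0..}. flow t -` K) \<inter> (\<Inter>h\<in>{0<..}. \<Inter>N::nat. {y. (\<Sum>i<N. norm (flow (real (Suc i) * h) y - flow (real i * h) y)) \<le> l})"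
    by (auto simp: trapped_def)
  have "closed (trapped l)" unfolding eq using 1 2 by (rule closed_Int)
  moreover have "trapped l \<subseteq> K" unfolding trapped_def using flow_0 by (metis (mono_tags, lifting) mem_Collect_eq order_refl subsetI)
  ultimately show ?thesis using K_compact by (metis compact_Int_closed inf.absorb_iff2 inf.commute)
qed

text \<open>One step changes the volume by a factor of at least
  \<open>1 + h * trace J - c * h\<^sup>2\<close>, and \<open>h * \<bar>trace J\<bar>\<close> is at
  most \<open>C\<close> times \<open>h * norm V\<close>, about the length of the step. Multiplied
  along the orbit this leaves at least \<open>exp (- (2 * (C * l + 1)))\<close>: the 1 absorbs all
  discretisation errors, the 2 comes from \<open>exp_neg_double_le\<close>. Of the
  \<open>2 * e\<close> in the target set, one \<open>e\<close> is the hypothesis at time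
  \<open>n\<close> and the other bounds the Euler error.\<close>

lemma trapped_measure:
  assumes "l \<ge> 0" "\<eta> > 0" "(\<Union>x\<in>K. cball x \<eta>) \<subseteq> B" "e > 0" "n > 0"
    and S: "compact S" "S \<subseteq> trapped l" "\<And>y. y \<in> S \<Longrightarrow> norm (V (flow (real n) y)) \<le> e"
  shows "measure lebesgue S \<le> exp (2 * (C * l + 1)) * measure lebesgue {x \<in> (\<Union>x\<in>K. cball x \<eta>). norm (V x) \<le> 2 * e}"
proof -
  define K2 where "K2 = (\<Union>x\<in>K. cball x \<eta>)"
  have K2: "compact K2" unfolding K2_def by (rule compact_cball_neighbourhood[OF K_compact])
  define R where "R = {x \<in> K2. norm (V x) \<le> 2 * e}"
  have Rc: "compact R"
  proof -
    have "closed {x. norm (V x) \<le> 2 * e}" by (intro closed_Collect_le continuous_intros V_continuous)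
    then have "compact (K2 \<inter> {x. norm (V x) \<le> 2 * e})" using K2 by (intro compact_Int_closed)
    moreover have "R = K2 \<inter> {x. norm (V x) \<le> 2 * e}" by (auto simp: R_def)
    ultimately show ?thesis by simp
  qed
  have JK2: "continuous_on K2 J" using J_cont assms(3) continuous_on_subset unfolding K2_def by blast
  obtain a where a: "\<And>x. x \<in> K2 \<Longrightarrow> norm (J x) \<le> a" "a > 0"
    using compact_imp_bounded[OF compact_continuous_image[OF JK2 K2]] unfolding bounded_pos by auto
  have Jij: "\<bar>J x $ i $ j\<bar> \<le> a" if "x \<in> K2" for x i j
    using a(1)[OF that] component_le_norm_cart[of "J x $ i" j] Finite_Cartesian_Product.norm_nth_le[of "J x" i] by simp
  obtain c where c: "c \<ge> 0" "\<And>(A :: real^'n::_^'n::_) h. (\<forall>i j. \<bar>A$i$j\<bar> \<le> a) \<Longrightarrow> 0 \<le> h \<Longrightarrow> h \<le> 1 \<Longrightarrow>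
     det (mat 1 + h *\<^sub>R A) \<ge> 1 + h * trace A - c * h\<^sup>2"
    by (rule det_perturbation_of_identity[of a]) (use a in auto)
  define T where "T = real n"
  have T: "T > 0" using assms by (simp add: T_def)
  define E where "E = T * L * M * exp (L * T)"
  have E: "E \<ge> 0" using L_pos M_nonneg T by (simp add: E_def)
  text \<open>All error terms are at most a constant times the step size \<open>T / N\<close>.\<close>
  obtain N :: nat where N: "N > 0" "T / real N * L < 1" "T / real N \<le> 1" "E * (T / real N) \<le> \<eta>" "L * E * (T / real N) \<le> e"
     "(C * T * L * M + C * T * L * E + c * T) * (T / real N) \<le> 1" "(C * M + c) * (T / real N) \<le> 1 / 2"
  proof -
    have lim: "(\<lambda>N. q * (T / real N)) \<longlonglongrightarrow> 0" for q :: real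
      by (rule tendsto_mult_right_zero) (rule tendsto_divide_0[OF tendsto_const], rule filterlim_at_top_imp_at_infinity, rule filterlim_real_sequentially)
    have ev: "\<forall>\<^sub>F N in sequentially. q * (T / real N) < r" if "r > 0" for q r :: real
      using order_tendstoD(2)[OF lim that] .
    have "\<forall>\<^sub>F N in sequentially. N > 0 \<and> L * (T / real N) < 1 \<and> 1 * (T / real N) < 1 \<and> E * (T / real N) < \<eta> \<and> (L * E) * (T / real N) < e
      \<and> (C * T * L * M + C * T * L * E + c * T) * (T / real N) < 1 \<and> (C * M + c) * (T / real N) < 1 / 2"
      by (intro eventually_conj ev eventually_gt_at_top) (use assms in auto)
    then obtain N where "N > 0 \<and> L * (T / real N) < 1 \<and> 1 * (T / real N) < 1 \<and> E * (T / real N) < \<eta> \<and> (L * E) * (T / real N) < e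
      \<and> (C * T * L * M + C * T * L * E + c * T) * (T / real N) < 1 \<and> (C * M + c) * (T / real N) < 1 / 2"
      using eventually_happens trivial_limit_sequentially by blast
    then show ?thesis by (intro that[of N]) (auto simp: mult.commute)
  qed
  define h where "h = T / real N"
  have h: "h > 0" "real N * h = T" using N T by (auto simp: h_def)
  note N' = N[folded h_def]
  have err: "norm (euler h k y - flow (real k * h) y) \<le> E * h" if "k \<le> N" for k y
    unfolding E_def by (rule euler_error') (use h that in auto)
  have flK: "flow (real k * h) y \<in> K" if "y \<in> S" for k y
    using S(2) that h unfolding trapped_def by auto
  have inK2: "euler h k y \<in> K2" if "y \<in> S" "k \<le> N" for k y
    unfolding K2_def using flK[OF that(1), of k] err[OF that(2), of y] N'(4) by (auto simp: dist_norm norm_minus_commute intro!: bexI[of _ "flow (real k * h) y"])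
  then have inB: "euler h k y \<in> B" if "y \<in> S" "k \<le> N" for k y using that assms(3) unfolding K2_def by blast
  have detb: "det (euler_jac h k y) \<ge> exp (- (2 * (\<Sum>i<k. C * h * norm (V (euler h i y)) + c * h\<^sup>2)))"
    if "y \<in> S" "k \<le> N" for k y
    using that(2)
  proof (induction k)
    case (Suc k)
    let ?z = "euler h k y"
    have z: "?z \<in> K2" "?z \<in> B" using inK2 inB Suc.prems that(1) by auto
    define x where "x = C * h * norm (V ?z) + c * h\<^sup>2"
    have x0: "x \<ge> 0" using C_nonneg h c by (simp add: x_def)
    have "C * h * norm (V ?z) \<le> C * h * M" using bnd C_nonneg h by (intro mult_left_mono) auto
    moreover have "c * h\<^sup>2 \<le> c * h" using c(1) h N'(3) by (intro mult_left_mono) (auto simp: power2_eq_square mult_left_le)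
    ultimately have x1: "x \<le> 1/2" using N'(7) by (simp add: x_def algebra_simps)
    have "h * \<bar>trace (J ?z)\<bar> \<le> h * (C * norm (V ?z))" using div_bound[OF z(2)] h by (intro mult_left_mono) auto
    moreover have "- (h * \<bar>trace (J ?z)\<bar>) \<le> h * trace (J ?z)"
      using h by (metis abs_ge_minus_self abs_mult abs_of_pos minus_le_iff)
    ultimately have "1 - x \<le> 1 + h * trace (J ?z) - c * h\<^sup>2"
      by (simp add: x_def algebra_simps)
    also have "\<dots> \<le> det (mat 1 + h *\<^sub>R J ?z)" using c(2)[of "J ?z" h] Jij[OF z(1)] h N'(3) by simp
    finally have 1: "exp (- (2 * x)) \<le> det (mat 1 + h *\<^sub>R J ?z)" using exp_neg_double_le[OF x0 x1] by linarith
    have 2: "det (euler_jac h k y) \<ge> exp (- (2 * (\<Sum>i<k. C * h * norm (V (euler h i y)) + c * h\<^sup>2)))" using Suc by simp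
    have "exp (- (2 * (\<Sum>i<Suc k. C * h * norm (V (euler h i y)) + c * h\<^sup>2))) = exp (- (2 * x)) * exp (- (2 * (\<Sum>i<k. C * h * norm (V (euler h i y)) + c * h\<^sup>2)))"
      by (simp add: x_def mult_exp_exp algebra_simps)
    also have "\<dots> \<le> det (mat 1 + h *\<^sub>R J ?z) * det (euler_jac h k y)"
    proof (rule mult_mono[OF 1 2])
      show "0 \<le> det (mat 1 + h *\<^sub>R J ?z)" using 1 by (rule order_trans[rotated]) simp
    qed simp
    finally show ?case by (simp add: det_mul)
  qed simp
  have len: "(\<Sum>i<N. C * h * norm (V (euler h i y)) + c * h\<^sup>2) \<le> C * l + 1" if y: "y \<in> S" for y
  proof -
    \<comment> \<open>The velocity on the polygon is replaced by the velocity on the orbit, and this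
      by the chord of the orbit; either error is of order \<open>h\<^sup>2\<close>.\<close>
    have st: "h * norm (V (euler h i y)) \<le> norm (flow (real (Suc i) * h) y - flow (real i * h) y) + L * M * h\<^sup>2 + h * (L * (E * h))" if i: "i < N" for i
    proof -
      let ?w = "flow (real i * h) y"
      have "norm (V (euler h i y) - V ?w) \<le> L * (E * h)"
        using lip[of "euler h i y" ?w] err[of i y] i L_pos by (meson less_imp_le mult_left_mono order_trans)
      then have 1: "norm (V (euler h i y)) \<le> norm (V ?w) + L * (E * h)"
        using norm_triangle_sub[of "V (euler h i y)" "V ?w"] by linarith
      have f: "flow (real (Suc i) * h) y = flow h ?w" by (simp add: flow_add[symmetric] algebra_simps)
      have "h *\<^sub>R V ?w = (flow h ?w - ?w) - (flow h ?w - ?w - h *\<^sub>R V ?w)" by simp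
      then have "norm (h *\<^sub>R V ?w) \<le> norm (flow h ?w - ?w) + norm (flow h ?w - ?w - h *\<^sub>R V ?w)"
        by (metis norm_triangle_ineq4)
      then have "h * norm (V ?w) \<le> norm (flow h ?w - ?w) + L * M * h\<^sup>2" using flow_first_order[of h ?w] h by simp
      moreover have "h * norm (V (euler h i y)) \<le> h * (norm (V ?w) + L * (E * h))" using 1 h by (intro mult_left_mono) auto
      ultimately show ?thesis using f by (simp add: algebra_simps)
    qed
    have "(\<Sum>i<N. C * h * norm (V (euler h i y)) + c * h\<^sup>2) \<le>
      (\<Sum>i<N. C * norm (flow (real (Suc i) * h) y - flow (real i * h) y) + (C * (L * M * h\<^sup>2 + h * (L * (E * h))) + c * h\<^sup>2))"
    proof (intro sum_mono)
      fix i assume "i \<in> {..<N}"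
      then have "C * (h * norm (V (euler h i y))) \<le> C * (norm (flow (real (Suc i) * h) y - flow (real i * h) y) + L * M * h\<^sup>2 + h * (L * (E * h)))"
        using st C_nonneg by (intro mult_left_mono) auto
      then show "C * h * norm (V (euler h i y)) + c * h\<^sup>2 \<le> C * norm (flow (real (Suc i) * h) y - flow (real i * h) y) + (C * (L * M * h\<^sup>2 + h * (L * (E * h))) + c * h\<^sup>2)"
        by (simp add: algebra_simps)
    qed
    also have "\<dots> = C * (\<Sum>i<N. norm (flow (real (Suc i) * h) y - flow (real i * h) y)) + real N * (C * (L * M * h\<^sup>2 + h * (L * (E * h))) + c * h\<^sup>2)"
      by (simp add: sum.distrib sum_distrib_left)
    finally have A: "(\<Sum>i<N. C * h * norm (V (euler h i y)) + c * h\<^sup>2) \<le>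
      C * (\<Sum>i<N. norm (flow (real (Suc i) * h) y - flow (real i * h) y)) + real N * (C * (L * M * h\<^sup>2 + h * (L * (E * h))) + c * h\<^sup>2)" .
    have "real N * (C * (L * M * h\<^sup>2 + h * (L * (E * h))) + c * h\<^sup>2) = (real N * h) * (C * L * M + C * L * E + c) * h"
      by (simp add: power2_eq_square algebra_simps)
    also have "\<dots> = (C * T * L * M + C * T * L * E + c * T) * h" unfolding h(2) by (simp add: algebra_simps)
    also have "\<dots> \<le> 1" by (rule N'(6))
    finally have B: "real N * (C * (L * M * h\<^sup>2 + h * (L * (E * h))) + c * h\<^sup>2) \<le> 1" .
    have "(\<Sum>i<N. norm (flow (real (Suc i) * h) y - flow (real i * h) y)) \<le> l"
      using S(2) y h unfolding trapped_def by blast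
    then have "C * (\<Sum>i<N. norm (flow (real (Suc i) * h) y - flow (real i * h) y)) \<le> C * l"
      using C_nonneg by (rule mult_left_mono)
    then show ?thesis using A B by linarith
  qed
  have SL: "S \<in> sets lebesgue" "S \<in> lmeasurable" using S(1) by (auto intro: lmeasurable_compact fmeasurableD)
  have dS: "(euler h N has_derivative (*v) (euler_jac h N y)) (at y within S)" if "y \<in> S" for y
    by (rule has_derivative_at_withinI[OF euler_has_derivative], rule inB[OF that]) simp
  have cont: "continuous_on S (\<lambda>y. \<bar>det (matrix ((*v) (euler_jac h N y)))\<bar>)"
    unfolding matrix_of_matrix_vector_mul
    by (intro continuous_on_rabs euler_det_continuous inB) auto
  have int: "(\<lambda>y. \<bar>det (matrix ((*v) (euler_jac h N y)))\<bar>) integrable_on S"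
  proof -
    have "set_integrable lborel S (\<lambda>y. \<bar>det (matrix ((*v) (euler_jac h N y)))\<bar>)"
      unfolding set_integrable_def by (rule borel_integrable_compact[OF S(1) cont])
    then show ?thesis by (rule set_borel_integral_eq_integral(1))
  qed
  have inj: "inj_on (euler h N) S" by (rule inj_on_subset[OF euler_inj]) (use h N' in auto)
  have eq: "measure lebesgue (euler h N ` S) = integral S (\<lambda>y. \<bar>det (matrix ((*v) (euler_jac h N y)))\<bar>)"
    by (rule measure_differentiable_image_eq[OF SL(1) dS inj int])
  define q where "q = exp (- (2 * (C * l + 1)))"
  have "integral S (\<lambda>y. q) \<le> integral S (\<lambda>y. \<bar>det (matrix ((*v) (euler_jac h N y)))\<bar>)"
  proof (rule integral_le[OF _ int])
    show "(\<lambda>y. q) integrable_on S" using SL(2) integrable_on_const by blast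
    fix y assume y: "y \<in> S"
    have "q \<le> exp (- (2 * (\<Sum>i<N. C * h * norm (V (euler h i y)) + c * h\<^sup>2)))"
      unfolding q_def using len[OF y] by simp
    also have "\<dots> \<le> det (euler_jac h N y)" using detb[OF y] by simp
    finally show "q \<le> \<bar>det (matrix ((*v) (euler_jac h N y)))\<bar>" by simp
  qed
  then have 1: "q * measure lebesgue S \<le> measure lebesgue (euler h N ` S)"
  proof -
    have "integral S (\<lambda>y. q) = q * integral S (\<lambda>y. 1)"
      using Henstock_Kurzweil_Integration.integral_mult_right[of S q "\<lambda>y. 1"] by simp
    also have "integral S (\<lambda>y. 1) = measure lebesgue S" by (rule lmeasure_integral[OF SL(2), symmetric])
    finally show ?thesis using \<open>integral S (\<lambda>y. q) \<le> _\<close> unfolding eq by simp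
  qed
  have "euler h N ` S \<subseteq> R"
  proof
    fix z assume "z \<in> euler h N ` S"
    then obtain y where y: "y \<in> S" "z = euler h N y" by auto
    have w: "norm (V (flow T y)) \<le> e" using S(3)[OF y(1)] by (simp add: T_def)
    have "norm (V z - V (flow T y)) \<le> L * (E * h)"
    proof (rule order_trans[OF lip mult_left_mono])
      show "norm (z - flow T y) \<le> E * h" using err[of N y] y h(2) by simp
    qed (use L_pos in simp)
    then have "norm (V z) \<le> 2 * e" using w N'(5) norm_triangle_sub[of "V z" "V (flow T y)"] by (simp add: mult.assoc)
    then show "z \<in> R" using inK2[OF y(1), of N] y by (simp add: R_def)
  qed
  moreover have "euler h N ` S \<in> sets lebesgue"
    using compact_continuous_image[OF euler_continuous S(1)] by (intro fmeasurableD lmeasurable_compact)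
  ultimately have "measure lebesgue (euler h N ` S) \<le> measure lebesgue R"
    using Rc by (intro measure_mono_fmeasurable lmeasurable_compact)
  with 1 have "q * measure lebesgue S \<le> measure lebesgue R" by simp
  then have le: "exp (2 * (C * l + 1)) * (q * measure lebesgue S) \<le> exp (2 * (C * l + 1)) * measure lebesgue R"
    by (rule mult_left_mono) simp
  have "exp (2 * (C * l + 1)) * q = 1" unfolding q_def mult_exp_exp by simp
  then have "measure lebesgue S = exp (2 * (C * l + 1)) * (q * measure lebesgue S)"
    by (simp only: mult.assoc[symmetric] mult_1_left)
  also note le
  finally show ?thesis unfolding R_def K2_def .
qed

text \<open>For fixed \<open>e\<close> the compact sets \<open>S e n\<close> grow with
  \<open>n\<close> and together cover the set, while the bound on their measure does not depend on
  \<open>n\<close>. As \<open>e\<close> tends to 0, \<open>R e\<close> shrinks to the zeros of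
  \<open>V\<close> in the neighbourhood \<open>K2\<close> of \<open>K\<close>, a null set.\<close>

theorem trapped_negligible: "negligible {y \<in> trapped l. ((\<lambda>t. V (flow t y)) \<longlongrightarrow> 0) at_top}"
proof (cases "trapped l = {}")
  case False
  have l0: "l \<ge> 0"
  proof -
    obtain y where "y \<in> trapped l" using False by auto
    then have "(\<Sum>i<(0::nat). norm (flow (real (Suc i) * 1) y - flow (real i * 1) y)) \<le> l" unfolding trapped_def using zero_less_one by blast
    then show ?thesis by simp
  qed
  have "K \<noteq> {}" using False by (auto simp: trapped_def)
  obtain \<eta> where \<eta>: "\<eta> > 0" "(\<Union>x\<in>K. cball x \<eta>) \<subseteq> B"
    using compact_subset_open_imp_cball_epsilon_subset[OF K_compact B_open K_sub] by blast
  define K2 where "K2 = (\<Union>x\<in>K. cball x \<eta>)"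
  define Ez where "Ez = {y \<in> trapped l. ((\<lambda>t. V (flow t y)) \<longlongrightarrow> 0) at_top}"
  define S where "S e n = {y \<in> trapped l. \<forall>m\<ge>n. norm (V (flow (real (m::nat)) y)) \<le> e}" for e n
  have cS: "compact (S e n)" for e n
  proof -
    have "continuous_on UNIV (\<lambda>y. V (flow t y))" for t
      by (rule continuous_on_compose2[OF V_continuous[of UNIV] flow_continuous]) auto
    then have "closed (\<Inter>m\<in>{n..}. {y. norm (V (flow (real m) y)) \<le> e})"
      by (intro closed_INT ballI closed_Collect_le continuous_intros) auto
    then have "compact (trapped l \<inter> (\<Inter>m\<in>{n..}. {y. norm (V (flow (real m) y)) \<le> e}))"
      using trapped_compact by (intro compact_Int_closed)
    moreover have "S e n = trapped l \<inter> (\<Inter>m\<in>{n..}. {y. norm (V (flow (real m) y)) \<le> e})" by (auto simp: S_def)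
    ultimately show ?thesis by simp
  qed
  have cov: "Ez \<subseteq> (\<Union>n. S e (Suc n))" if "e > 0" for e
  proof
    fix y assume y: "y \<in> Ez"
    then have "\<forall>\<^sub>F t in at_top. dist (V (flow t y)) 0 < e" using that by (auto simp: Ez_def dest: tendstoD)
    then obtain t0 where t0: "\<And>t. t \<ge> t0 \<Longrightarrow> norm (V (flow t y)) < e" unfolding eventually_at_top_linorder by auto
    obtain n :: nat where "t0 \<le> real n" using real_arch_simple by blast
    then have "y \<in> S e (Suc n)" using y t0 by (auto simp: S_def Ez_def intro!: less_imp_le)
    then show "y \<in> (\<Union>n. S e (Suc n))" by auto
  qed
  define q where "q = exp (2 * (C * l + 1))"
  define R where "R e = {x \<in> K2. norm (V x) \<le> 2 * e}" for e
  have K2: "compact K2" unfolding K2_def by (rule compact_cball_neighbourhood[OF K_compact])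
  have Rm: "R e \<in> lmeasurable" for e
  proof -
    have "closed {x. norm (V x) \<le> 2 * e}" by (intro closed_Collect_le continuous_intros V_continuous)
    then have "compact (K2 \<inter> {x. norm (V x) \<le> 2 * e})" using K2 by (intro compact_Int_closed)
    moreover have "R e = K2 \<inter> {x. norm (V x) \<le> 2 * e}" by (auto simp: R_def)
    ultimately show ?thesis by (simp add: lmeasurable_compact)
  qed
  have bound: "emeasure lebesgue (\<Union>n. S e (Suc n)) \<le> ennreal (q * measure lebesgue (R e))" if "e > 0" for e
  proof (rule LIMSEQ_le_const2[OF Lim_emeasure_incseq])
    show "range (\<lambda>n. S e (Suc n)) \<subseteq> sets lebesgue" using cS by (auto intro: fmeasurableD lmeasurable_compact)
    show "incseq (\<lambda>n. S e (Suc n))" by (intro incseq_SucI) (auto simp: S_def)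
    have "emeasure lebesgue (S e (Suc n)) \<le> ennreal (q * measure lebesgue (R e))" for n
    proof -
      have "measure lebesgue (S e (Suc n)) \<le> q * measure lebesgue (R e)"
        unfolding q_def R_def K2_def
        by (rule trapped_measure[OF l0 \<eta> that, of "Suc n"]) (use cS in \<open>auto simp: S_def\<close>)
      then show ?thesis using lmeasurable_compact[OF cS[of e "Suc n"]]
        by (simp add: emeasure_eq_measure2 ennreal_leI)
    qed
    then show "\<exists>N. \<forall>n\<ge>N. emeasure lebesgue (S e (Suc n)) \<le> ennreal (q * measure lebesgue (R e))" by blast
  qed
  have Rlim: "(\<lambda>k. measure lebesgue (R (1 / real (Suc k)))) \<longlonglongrightarrow> 0"
  proof -
    have "(\<lambda>k. measure lebesgue (R (1 / real (Suc k)))) \<longlonglongrightarrow> measure lebesgue (\<Inter>k. R (1 / real (Suc k)))"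
    proof (rule Lim_measure_decseq)
      show "range (\<lambda>k. R (1 / real (Suc k))) \<subseteq> sets lebesgue" using Rm by auto
      show "decseq (\<lambda>k. R (1 / real (Suc k)))"
      proof (rule decseq_SucI)
        fix k
        have "2 * (1 / real (Suc (Suc k))) \<le> 2 * (1 / real (Suc k))" by (intro mult_left_mono frac_le) auto
        then show "R (1 / real (Suc (Suc k))) \<subseteq> R (1 / real (Suc k))" unfolding R_def by (auto intro: order_trans)
      qed
      show "\<And>i. emeasure lebesgue (R (1 / real (Suc i))) \<noteq> \<infinity>" using Rm by (metis fmeasurableD2 infinity_ennreal_def)
    qed
    moreover have "(\<Inter>k. R (1 / real (Suc k))) \<subseteq> {x\<in>B. V x = 0}"
    proof
      fix x assume x: "x \<in> (\<Inter>k. R (1 / real (Suc k)))"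
      then have "x \<in> K2" "\<And>k. norm (V x) \<le> 2 * (1 / real (Suc k))" by (auto simp: R_def)
      moreover have "(\<lambda>k. 2 * (1 / real (Suc k))) \<longlonglongrightarrow> 2 * 0"
        by (intro tendsto_mult tendsto_const LIMSEQ_ignore_initial_segment[of _ 0 1, simplified] ) (use lim_1_over_n LIMSEQ_Suc in blast)
      ultimately have "norm (V x) \<le> 2 * 0" by (intro LIMSEQ_le_const) auto
      moreover have "x \<in> B" using \<open>x \<in> K2\<close> \<eta>(2) unfolding K2_def by blast
      ultimately show "x \<in> {x\<in>B. V x = 0}" by simp
    qed
    then have "negligible (\<Inter>k. R (1 / real (Suc k)))" using zero_negligible negligible_subset by blast
    then have "measure lebesgue (\<Inter>k. R (1 / real (Suc k))) = 0" by (simp add: negligible_imp_measure0)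
    ultimately show ?thesis by simp
  qed
  have "negligible Ez"
  proof -
    \<comment> \<open>A measurable superset of \<open>Ez\<close> is estimated, so that measurability
      of \<open>Ez\<close> itself does not come up.\<close>
    define W where "W = (\<Inter>k. \<Union>n. S (1 / real (Suc k)) (Suc n))"
    have Sm: "S e n \<in> sets lebesgue" for e n using cS by (intro fmeasurableD lmeasurable_compact)
    then have Wm: "W \<in> sets lebesgue" unfolding W_def by (intro sets.countable_INT'' sets.countable_UN) auto
    have le: "emeasure lebesgue W \<le> ennreal (q * measure lebesgue (R (1 / real (Suc k))))" for k
    proof -
      have "emeasure lebesgue W \<le> emeasure lebesgue (\<Union>n. S (1 / real (Suc k)) (Suc n))"
        unfolding W_def using Sm by (intro emeasure_mono sets.countable_UN) auto
      also have "\<dots> \<le> ennreal (q * measure lebesgue (R (1 / real (Suc k))))" by (rule bound) simp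
      finally show ?thesis .
    qed
    have "(\<lambda>k. ennreal (q * measure lebesgue (R (1 / real (Suc k))))) \<longlonglongrightarrow> ennreal (q * 0)"
      by (intro tendsto_ennrealI tendsto_mult tendsto_const Rlim)
    then have "emeasure lebesgue W \<le> ennreal (q * 0)" using le by (intro LIMSEQ_le_const) auto
    then have "negligible W" using Wm by (simp add: negligible_iff_null_sets null_sets_def)
    moreover have "Ez \<subseteq> W" unfolding W_def by (intro INT_greatest cov) simp
    ultimately show ?thesis by (rule negligible_subset)
  qed
  then show ?thesis by (simp add: Ez_def)
qed simp

end

section \<open>Smooth maps\<close>

abbreviation "tcd \<equiv> times_cont_differentiable_on"

lemma frechet_derivative_eqI:
  "(f has_derivative f') (at x) \<Longrightarrow> frechet_derivative f (at x) = f'"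
  using frechet_derivative_at by metis

lemma frechet_derivative_cong_open:
  assumes "open S" "x \<in> S" "\<And>y. y \<in> S \<Longrightarrow> f y = g y"
  shows "frechet_derivative f (at x) = frechet_derivative g (at x)"
proof -
  have "(f has_derivative f') (at x) \<longleftrightarrow> (g has_derivative f') (at x)" for f'
    using has_derivative_transform_within_open[of f f' x UNIV S g] has_derivative_transform_within_open[of g f' x UNIV S f] assms
    by auto
  then show ?thesis unfolding frechet_derivative_def by simp
qed

lemma tcd_cong:
  assumes "open S" "\<And>x. x \<in> S \<Longrightarrow> f x = g x" "tcd k S f"
  shows "tcd k S g"
  using assms(2,3)
proof (induction k arbitrary: f g)
  case 0
  then show ?case using continuous_on_cong[of S S f g] by simp
next
  case (Suc k)
  have d: "frechet_derivative f (at x) = frechet_derivative g (at x)" if "x \<in> S" for x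
    by (rule frechet_derivative_cong_open[OF assms(1) that Suc.prems(1)])
  have "g differentiable (at x)" if x: "x \<in> S" for x
  proof -
    obtain D where "(f has_derivative D) (at x)" using Suc.prems(2) x by (auto simp: differentiable_def)
    from has_derivative_transform_within_open[OF this assms(1) x Suc.prems(1)]
    show ?thesis by (auto simp: differentiable_def)
  qed
  moreover have "tcd k S (\<lambda>x. frechet_derivative g (at x) v)" for v
    by (rule Suc.IH[of "\<lambda>x. frechet_derivative f (at x) v"]) (use d Suc.prems in auto)
  ultimately show ?case by simp
qed

text \<open>The recursive definition refers to \<open>frechet_derivative\<close>; this rule accepts
  any formula for the derivative and drives the inductions that follow.\<close>

lemma tcd_SucI:
  assumes "open S" "\<And>x. x \<in> S \<Longrightarrow> (f has_derivative f' x) (at x)" "\<And>v. tcd k S (\<lambda>x. f' x v)"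
  shows "tcd (Suc k) S f"
proof -
  have "tcd k S (\<lambda>x. frechet_derivative f (at x) v)" for v
    by (rule tcd_cong[OF assms(1) _ assms(3)[of v]]) (simp add: frechet_derivative_eqI[OF assms(2)])
  then show ?thesis using assms(2) by (auto simp: differentiable_def)
qed

lemma tcd_has_derivative:
  "tcd (Suc k) S f \<Longrightarrow> x \<in> S \<Longrightarrow> (f has_derivative frechet_derivative f (at x)) (at x)"
  by (simp add: frechet_derivative_works)

lemma tcd_derivative: "tcd (Suc k) S f \<Longrightarrow> tcd k S (\<lambda>x. frechet_derivative f (at x) v)"
  by simp

lemma tcd_mono_Suc: "tcd (Suc k) S f \<Longrightarrow> tcd k S f"
proof (induction k arbitrary: f)
  case 0
  then show ?case
    by (auto intro!: continuous_at_imp_continuous_on differentiable_imp_continuous_within)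
next
  case (Suc k)
  then show ?case by (metis times_cont_differentiable_on.simps(2))
qed

lemma tcd_subset: "tcd k S f \<Longrightarrow> T \<subseteq> S \<Longrightarrow> tcd k T f"
  by (induction k arbitrary: f) (auto intro: continuous_on_subset)

lemma tcd_const: "tcd k S (\<lambda>x. c)"
  by (induction k arbitrary: c) (auto)

lemma tcd_bounded_linear:
  assumes "open S" "bounded_linear L" "tcd k S f"
  shows "tcd k S (\<lambda>x. L (f x))"
  using assms(3)
proof (induction k arbitrary: f)
  case 0
  then show ?case using bounded_linear.continuous_on[OF assms(2)] by simp
next
  case (Suc k)
  show ?case
    by (rule tcd_SucI[OF assms(1) bounded_linear.has_derivative[OF assms(2) tcd_has_derivative[OF Suc.prems]]])
      (auto intro: Suc.IH tcd_derivative[OF Suc.prems])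
qed

lemma tcd_add:
  assumes "open S" "tcd k S f" "tcd k S g"
  shows "tcd k S (\<lambda>x. f x + g x)"
  using assms(2,3)
proof (induction k arbitrary: f g)
  case 0
  then show ?case by (simp add: continuous_on_add)
next
  case (Suc k)
  show ?case
    by (rule tcd_SucI[OF assms(1) has_derivative_add[OF tcd_has_derivative[OF Suc.prems(1)] tcd_has_derivative[OF Suc.prems(2)]]])
      (auto intro: Suc.IH tcd_derivative[OF Suc.prems(1)] tcd_derivative[OF Suc.prems(2)])
qed

lemma tcd_bilinear:
  assumes "open S" "bounded_bilinear B" "tcd k S f" "tcd k S g"
  shows "tcd k S (\<lambda>x. B (f x) (g x))"
  using assms(3,4)
proof (induction k arbitrary: f g)
  case 0
  then show ?case using bounded_bilinear.continuous_on[OF assms(2)] by simp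
next
  case (Suc k)
  have 1: "tcd k S (\<lambda>x. B (f x) (frechet_derivative g (at x) v) + B (frechet_derivative f (at x) v) (g x))" for v
    by (intro tcd_add[OF assms(1)] Suc.IH tcd_derivative[OF Suc.prems(1)] tcd_derivative[OF Suc.prems(2)] tcd_mono_Suc[OF Suc.prems(1)] tcd_mono_Suc[OF Suc.prems(2)])
  show ?case
    by (rule tcd_SucI[OF assms(1) bounded_bilinear.FDERIV[OF assms(2) tcd_has_derivative[OF Suc.prems(1)] tcd_has_derivative[OF Suc.prems(2)]]])
      (auto intro: 1)
qed

lemma tcd_sum:
  assumes "open S" "\<And>i. i \<in> I \<Longrightarrow> tcd k S (f i)"
  shows "tcd k S (\<lambda>x. \<Sum>i\<in>I. f i x)"
  using assms(2)
proof (induction I rule: infinite_finite_induct)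
  case (insert i I) then show ?case by (auto intro!: tcd_add[OF assms(1)])
qed (auto intro: tcd_const)

text \<open>Used for the curves in the annihilator, which are drawn over straight lines in a
  chart.\<close>

lemma tcd_affine_line:
  fixes f :: "'a::real_normed_vector \<Rightarrow> 'b::real_normed_vector"
  assumes "open T" "open S" "\<And>s::real. s \<in> S \<Longrightarrow> y + s *\<^sub>R w \<in> T" "tcd k T f"
  shows "tcd k S (\<lambda>s. f (y + s *\<^sub>R w))"
  using assms(4)
proof (induction k arbitrary: f)
  case 0
  then have "continuous_on T f" by simp
  then have "continuous_on S (\<lambda>s. f (y + s *\<^sub>R w))"
    by (rule continuous_on_compose2) (auto intro!: continuous_intros assms(3))
  then show ?case by simp
next
  case (Suc k)
  show ?case
  proof (rule tcd_SucI[OF assms(2)])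
    fix s assume s: "s \<in> S"
    have "((\<lambda>s. f (y + s *\<^sub>R w)) has_derivative (\<lambda>h. frechet_derivative f (at (y + s *\<^sub>R w)) (h *\<^sub>R w))) (at s)"
      by (rule has_derivative_compose[where g = f and f = "\<lambda>s. y + s *\<^sub>R w", OF _ tcd_has_derivative[OF Suc.prems assms(3)[OF s]]])
        (auto intro!: derivative_eq_intros)
    moreover have "linear (frechet_derivative f (at (y + s *\<^sub>R w)))"
      using tcd_has_derivative[OF Suc.prems assms(3)[OF s]] has_derivative_linear by blast
    ultimately show "((\<lambda>s. f (y + s *\<^sub>R w)) has_derivative (\<lambda>h. h *\<^sub>R frechet_derivative f (at (y + s *\<^sub>R w)) w)) (at s)"
      by (simp add: linear_scale)
  next
    fix v :: real
    show "tcd k S (\<lambda>s. v *\<^sub>R frechet_derivative f (at (y + s *\<^sub>R w)) w)"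
      by (intro tcd_bounded_linear[OF assms(2) bounded_linear_scaleR_right] Suc.IH tcd_derivative[OF Suc.prems])
  qed
qed

lemma smooth_on_cong: "open S \<Longrightarrow> (\<And>x. x \<in> S \<Longrightarrow> f x = g x) \<Longrightarrow> smooth_on S f \<Longrightarrow> smooth_on S g"
  unfolding smooth_on_def using tcd_cong by blast

lemma smooth_on_subset: "smooth_on S f \<Longrightarrow> T \<subseteq> S \<Longrightarrow> smooth_on T f"
  unfolding smooth_on_def using tcd_subset by blast

lemma smooth_on_const: "smooth_on S (\<lambda>x. c)"
  unfolding smooth_on_def using tcd_const by blast

lemma smooth_on_bounded_linear: "open S \<Longrightarrow> bounded_linear L \<Longrightarrow> smooth_on S f \<Longrightarrow> smooth_on S (\<lambda>x. L (f x))"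
  unfolding smooth_on_def using tcd_bounded_linear by blast

lemma smooth_on_add: "open S \<Longrightarrow> smooth_on S f \<Longrightarrow> smooth_on S g \<Longrightarrow> smooth_on S (\<lambda>x. f x + g x)"
  unfolding smooth_on_def using tcd_add by blast

lemma smooth_on_uminus: "open S \<Longrightarrow> smooth_on S f \<Longrightarrow> smooth_on S (\<lambda>x. - f x)"
  by (rule smooth_on_bounded_linear[OF _ bounded_linear_minus[OF bounded_linear_ident]])

lemma smooth_on_diff: "open S \<Longrightarrow> smooth_on S f \<Longrightarrow> smooth_on S g \<Longrightarrow> smooth_on S (\<lambda>x. f x - g x)"
  using smooth_on_add[of S f "\<lambda>x. - g x"] smooth_on_uminus[of S g] by simp

lemma smooth_on_mult:
  fixes f g :: "'a::real_normed_vector \<Rightarrow> real"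
  shows "open S \<Longrightarrow> smooth_on S f \<Longrightarrow> smooth_on S g \<Longrightarrow> smooth_on S (\<lambda>x. f x * g x)"
  unfolding smooth_on_def using tcd_bilinear[OF _ bounded_bilinear_mult] by blast

lemma smooth_on_scaleR: "open S \<Longrightarrow> smooth_on S f \<Longrightarrow> smooth_on S g \<Longrightarrow> smooth_on S (\<lambda>x. f x *\<^sub>R g x)"
  unfolding smooth_on_def using tcd_bilinear[OF _ bounded_bilinear_scaleR] by blast

lemma smooth_on_inner: "open S \<Longrightarrow> smooth_on S f \<Longrightarrow> smooth_on S g \<Longrightarrow> smooth_on S (\<lambda>x. f x \<bullet> g x)"
  unfolding smooth_on_def using tcd_bilinear[OF _ bounded_bilinear_inner] by blast

lemma smooth_on_sum: "open S \<Longrightarrow> (\<And>i. i \<in> I \<Longrightarrow> smooth_on S (f i)) \<Longrightarrow> smooth_on S (\<lambda>x. \<Sum>i\<in>I. f i x)"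
  unfolding smooth_on_def using tcd_sum[of S I] by blast

lemma smooth_on_affine_line:
  "open T \<Longrightarrow> open S \<Longrightarrow> (\<And>s::real. s \<in> S \<Longrightarrow> y + s *\<^sub>R w \<in> T) \<Longrightarrow> smooth_on T f \<Longrightarrow> smooth_on S (\<lambda>s. f (y + s *\<^sub>R w))"
  unfolding smooth_on_def using tcd_affine_line by blast

lemma smooth_on_has_derivative: "smooth_on S f \<Longrightarrow> x \<in> S \<Longrightarrow> (f has_derivative frechet_derivative f (at x)) (at x)"
  unfolding smooth_on_def using tcd_has_derivative[of 0 S f x] by blast

lemma smooth_on_derivative: "smooth_on S f \<Longrightarrow> smooth_on S (\<lambda>x. frechet_derivative f (at x) v)"
  unfolding smooth_on_def using tcd_derivative by blast

lemma smooth_on_continuous: "smooth_on S f \<Longrightarrow> continuous_on S f"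
  unfolding smooth_on_def by (metis times_cont_differentiable_on.simps(1))

lemma smooth_on_component:
  fixes f :: "'a::real_normed_vector \<Rightarrow> real^'n"
  shows "open S \<Longrightarrow> smooth_on S f \<Longrightarrow> smooth_on S (\<lambda>x. f x $ i)"
  by (rule smooth_on_bounded_linear[OF _ bounded_linear_vec_nth])

lemma smooth_on_euclidean:
  fixes f :: "'a::real_normed_vector \<Rightarrow> 'b::euclidean_space"
  assumes "open S" "\<And>b. b \<in> Basis \<Longrightarrow> smooth_on S (\<lambda>x. f x \<bullet> b)"
  shows "smooth_on S f"
proof -
  have "smooth_on S (\<lambda>x. \<Sum>b\<in>Basis. (f x \<bullet> b) *\<^sub>R b)"
    by (intro smooth_on_sum smooth_on_scaleR assms smooth_on_const)
  then show ?thesis by (simp add: euclidean_representation)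
qed

lemma smooth_on_vec:
  fixes f :: "'a::real_normed_vector \<Rightarrow> real^'n"
  assumes "open S" "\<And>i. smooth_on S (\<lambda>x. f x $ i)"
  shows "smooth_on S f"
  by (rule smooth_on_euclidean[OF assms(1)]) (auto simp: Basis_vec_def inner_axis assms(2))

text \<open>Smoothness is defined through derivatives in constant directions; a variable direction
  is expanded in the basis.\<close>

lemma smooth_on_derivative_along:
  fixes f :: "'a::euclidean_space \<Rightarrow> 'b::real_normed_vector"
  assumes "open S" "smooth_on S f" "smooth_on S X"
  shows "smooth_on S (\<lambda>x. frechet_derivative f (at x) (X x))"
proof -
  have 1: "smooth_on S (\<lambda>x. \<Sum>b\<in>Basis. (X x \<bullet> b) *\<^sub>R frechet_derivative f (at x) b)"
    by (intro smooth_on_sum smooth_on_scaleR smooth_on_inner assms smooth_on_const smooth_on_derivative)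
  show ?thesis
  proof (rule smooth_on_cong[OF assms(1) _ 1])
    fix x assume "x \<in> S"
    then have l: "linear (frechet_derivative f (at x))"
      using smooth_on_has_derivative[OF assms(2)] has_derivative_linear by blast
    have "frechet_derivative f (at x) (X x) = frechet_derivative f (at x) (\<Sum>b\<in>Basis. (X x \<bullet> b) *\<^sub>R b)"
      by (simp add: euclidean_representation)
    also have "\<dots> = (\<Sum>b\<in>Basis. (X x \<bullet> b) *\<^sub>R frechet_derivative f (at x) b)"
      using l by (simp add: linear_sum linear_scale)
    finally show "(\<Sum>b\<in>Basis. (X x \<bullet> b) *\<^sub>R frechet_derivative f (at x) b) = frechet_derivative f (at x) (X x)" by simp
  qed
qed

section \<open>Symmetry of second derivatives\<close>

lemma second_difference_mvt:
  fixes f :: "'a::real_normed_vector \<Rightarrow> real"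
  assumes h: "h > 0" and S: "\<And>s t. s \<in> {0..h} \<Longrightarrow> t \<in> {0..h} \<Longrightarrow> z + s *\<^sub>R v + t *\<^sub>R w \<in> S"
    and f: "\<And>x. x \<in> S \<Longrightarrow> (f has_derivative f' x) (at x)"
    and f': "\<And>x. x \<in> S \<Longrightarrow> ((\<lambda>x. f' x v) has_derivative f'' x) (at x)"
  shows "\<exists>s\<in>{0..h}. \<exists>t\<in>{0..h}. f (z + h *\<^sub>R v + h *\<^sub>R w) - f (z + h *\<^sub>R v) - f (z + h *\<^sub>R w) + f z = h * h * f'' (z + s *\<^sub>R v + t *\<^sub>R w) w"
proof -
  define g where "g s = f (z + s *\<^sub>R v + h *\<^sub>R w) - f (z + s *\<^sub>R v)" for s
  have S0: "z + s *\<^sub>R v \<in> S" if "s \<in> {0..h}" for s using S[of s 0] that h by simp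
  have dg: "(g has_real_derivative (f' (z + s *\<^sub>R v + h *\<^sub>R w) v - f' (z + s *\<^sub>R v) v)) (at s)" if "s \<in> {0..h}" for s
  proof -
    have a: "((\<lambda>s. f (z + s *\<^sub>R v + h *\<^sub>R w)) has_derivative (\<lambda>r. f' (z + s *\<^sub>R v + h *\<^sub>R w) (r *\<^sub>R v))) (at s)"
      by (rule has_derivative_compose[OF _ f]) (use S that h in \<open>auto intro!: derivative_eq_intros\<close>)
    have b: "((\<lambda>s. f (z + s *\<^sub>R v)) has_derivative (\<lambda>r. f' (z + s *\<^sub>R v) (r *\<^sub>R v))) (at s)"
      by (rule has_derivative_compose[OF _ f]) (use S0 that h in \<open>auto intro!: derivative_eq_intros\<close>)
    have l: "linear (f' (z + s *\<^sub>R v + h *\<^sub>R w))" "linear (f' (z + s *\<^sub>R v))"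
      using f[OF S[of s h]] f[OF S0[of s]] that h has_derivative_linear by auto
    show ?thesis unfolding g_def has_field_derivative_def
      by (rule has_derivative_eq_rhs[OF has_derivative_diff[OF a b]])
        (use l in \<open>simp add: fun_eq_iff linear_scale algebra_simps\<close>)
  qed
  obtain s where s: "0 < s" "s < h" "g h - g 0 = (h - 0) * (f' (z + s *\<^sub>R v + h *\<^sub>R w) v - f' (z + s *\<^sub>R v) v)"
    using MVT2[OF h, of g "\<lambda>s. f' (z + s *\<^sub>R v + h *\<^sub>R w) v - f' (z + s *\<^sub>R v) v"] dg by auto
  define k where "k t = f' (z + s *\<^sub>R v + t *\<^sub>R w) v" for t
  have dk: "(k has_real_derivative (f'' (z + s *\<^sub>R v + t *\<^sub>R w) w)) (at t)" if "t \<in> {0..h}" for t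
  proof -
    have a: "(k has_derivative (\<lambda>r. f'' (z + s *\<^sub>R v + t *\<^sub>R w) (r *\<^sub>R w))) (at t)" unfolding k_def
      by (rule has_derivative_compose[OF _ f']) (use S that s in \<open>auto intro!: derivative_eq_intros\<close>)
    have l: "linear (f'' (z + s *\<^sub>R v + t *\<^sub>R w))" using f'[OF S[of s t]] that s has_derivative_linear by auto
    show ?thesis unfolding has_field_derivative_def
      by (rule has_derivative_eq_rhs[OF a]) (use l in \<open>simp add: fun_eq_iff linear_scale\<close>)
  qed
  obtain t where t: "0 < t" "t < h" "k h - k 0 = (h - 0) * f'' (z + s *\<^sub>R v + t *\<^sub>R w) w"
    using MVT2[OF h, of k "\<lambda>t. f'' (z + s *\<^sub>R v + t *\<^sub>R w) w"] dk by auto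
  have "f (z + h *\<^sub>R v + h *\<^sub>R w) - f (z + h *\<^sub>R v) - f (z + h *\<^sub>R w) + f z = g h - g 0" by (simp add: g_def)
  also have "\<dots> = h * (k h - k 0)" unfolding s(3) by (simp add: k_def)
  also have "\<dots> = h * h * f'' (z + s *\<^sub>R v + t *\<^sub>R w) w" unfolding t(3) by simp
  finally show ?thesis by (rule bexI[of _ s, OF bexI[of _ t]]) (use s t in auto)
qed

text \<open>The second difference over a small parallelogram is symmetric in \<open>v\<close> and
  \<open>w\<close>. Two applications of the mean value theorem, in either order, express it by each
  of the mixed derivatives at nearby points, and continuity makes them agree at
  \<open>z\<close>.\<close>

lemma second_derivative_symmetric_real:
  fixes f :: "'a::real_normed_vector \<Rightarrow> real"
  assumes "open S" "z \<in> S" "tcd 2 S f"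
  shows "frechet_derivative (\<lambda>x. frechet_derivative f (at x) v) (at z) w = frechet_derivative (\<lambda>x. frechet_derivative f (at x) w) (at z) v"
proof -
  have t2: "tcd (Suc (Suc 0)) S f" using assms(3) by (simp only: numeral_2_eq_2)
  define F where "F v w x = frechet_derivative (\<lambda>x. frechet_derivative f (at x) v) (at x) w" for v w x
  have cF: "continuous_on S (F v w)" for v w using t2 by (simp add: F_def)
  have d1: "x \<in> S \<Longrightarrow> (f has_derivative frechet_derivative f (at x)) (at x)" for x by (rule tcd_has_derivative[OF t2])
  have d2: "x \<in> S \<Longrightarrow> ((\<lambda>x. frechet_derivative f (at x) v) has_derivative frechet_derivative (\<lambda>x. frechet_derivative f (at x) v) (at x)) (at x)" for x v
    by (rule tcd_has_derivative[OF tcd_derivative[OF t2]])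
  show ?thesis
  proof (rule ccontr)
    assume ne: "\<not> ?thesis"
    define e where "e = \<bar>F v w z - F w v z\<bar> / 2"
    have e: "e > 0" using ne by (simp add: e_def F_def)
    obtain r1 where r1: "r1 > 0" "\<And>x. x \<in> S \<Longrightarrow> dist x z < r1 \<Longrightarrow> dist (F v w x) (F v w z) < e"
      using cF[of v w, unfolded continuous_on_iff] assms(2) e by blast
    obtain r2 where r2: "r2 > 0" "\<And>x. x \<in> S \<Longrightarrow> dist x z < r2 \<Longrightarrow> dist (F w v x) (F w v z) < e"
      using cF[of w v, unfolded continuous_on_iff] assms(2) e by blast
    obtain r3 where r3: "r3 > 0" "ball z r3 \<subseteq> S" using assms(1,2) openE by blast
    define r where "r = min r1 (min r2 r3)"
    have r: "r > 0" using r1 r2 r3 by (simp add: r_def)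
    define n where "n = norm v + norm w + 1"
    define h where "h = r / (2 * n)"
    have np: "n > 0" unfolding n_def using norm_ge_zero[of v] norm_ge_zero[of w] by linarith
    have h: "h > 0" using r np by (simp add: h_def)
    have "h * n < r" using r np by (simp add: h_def)
    then have hb: "h * (norm v + norm w + 1) < r" by (simp add: n_def)
    have near: "dist (z + s *\<^sub>R v + t *\<^sub>R w) z < r" if "s \<in> {0..h}" "t \<in> {0..h}" for s t
    proof -
      have "dist (z + s *\<^sub>R v + t *\<^sub>R w) z \<le> s * norm v + t * norm w"
        using that norm_triangle_ineq[of "s *\<^sub>R v" "t *\<^sub>R w"] by (simp add: dist_norm)
      also have "\<dots> \<le> h * norm v + h * norm w" using that by (intro add_mono mult_right_mono) auto
      also have "\<dots> < r" using hb h by (simp add: algebra_simps)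
      finally show ?thesis .
    qed
    have near': "dist (z + s *\<^sub>R w + t *\<^sub>R v) z < r" if "s \<in> {0..h}" "t \<in> {0..h}" for s t
      using near[OF that(2,1)] by (simp add: add.assoc add.commute[of "s *\<^sub>R w"])
    have inS: "x \<in> S" if "dist x z < r" for x using that r3 by (auto simp: r_def dist_commute)
    obtain s t where 1: "s \<in> {0..h}" "t \<in> {0..h}" "f (z + h *\<^sub>R v + h *\<^sub>R w) - f (z + h *\<^sub>R v) - f (z + h *\<^sub>R w) + f z = h * h * F v w (z + s *\<^sub>R v + t *\<^sub>R w)"
      using second_difference_mvt[OF h _ d1 d2, of z v w S] inS near unfolding F_def by meson
    obtain s' t' where 2: "s' \<in> {0..h}" "t' \<in> {0..h}" "f (z + h *\<^sub>R w + h *\<^sub>R v) - f (z + h *\<^sub>R w) - f (z + h *\<^sub>R v) + f z = h * h * F w v (z + s' *\<^sub>R w + t' *\<^sub>R v)"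
      using second_difference_mvt[OF h _ d1 d2, of z w v S] inS near' unfolding F_def by meson
    have zz: "z + h *\<^sub>R w + h *\<^sub>R v = z + h *\<^sub>R v + h *\<^sub>R w" by simp
    have "h * h * F v w (z + s *\<^sub>R v + t *\<^sub>R w) = h * h * F w v (z + s' *\<^sub>R w + t' *\<^sub>R v)"
      using 1(3) 2(3)[unfolded zz] by linarith
    then have eq: "F v w (z + s *\<^sub>R v + t *\<^sub>R w) = F w v (z + s' *\<^sub>R w + t' *\<^sub>R v)" using h by simp
    have "dist (F v w (z + s *\<^sub>R v + t *\<^sub>R w)) (F v w z) < e"
      using r1(2) inS near[OF 1(1,2)] by (auto simp: r_def)
    moreover have "dist (F w v (z + s' *\<^sub>R w + t' *\<^sub>R v)) (F w v z) < e"
      using r2(2) inS near'[OF 2(1,2)] by (auto simp: r_def)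
    ultimately have "\<bar>F v w z - F w v z\<bar> < 2 * e" unfolding eq dist_real_def by linarith
    then show False by (simp add: e_def)
  qed
qed

lemma second_derivative_symmetric:
  fixes f :: "'a::real_normed_vector \<Rightarrow> 'b::euclidean_space"
  assumes "open S" "z \<in> S" "tcd 2 S f"
  shows "frechet_derivative (\<lambda>x. frechet_derivative f (at x) v) (at z) w = frechet_derivative (\<lambda>x. frechet_derivative f (at x) w) (at z) v"
proof (rule euclidean_eqI)
  fix b :: 'b assume "b \<in> Basis"
  have t2: "tcd (Suc (Suc 0)) S f" using assms(3) by (simp only: numeral_2_eq_2)
  define g where "g x = f x \<bullet> b" for x
  have g2: "tcd 2 S g" unfolding g_def by (rule tcd_bounded_linear[OF assms(1) bounded_linear_inner_left assms(3)])
  have 1: "frechet_derivative g (at x) u = frechet_derivative f (at x) u \<bullet> b" if "x \<in> S" for x u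
    using frechet_derivative_eqI[OF bounded_linear.has_derivative[OF bounded_linear_inner_left tcd_has_derivative[OF t2 that]], of b]
    by (simp add: g_def[abs_def])
  have 2: "frechet_derivative (\<lambda>x. frechet_derivative g (at x) u) (at z) u' = frechet_derivative (\<lambda>x. frechet_derivative f (at x) u) (at z) u' \<bullet> b" for u u'
  proof -
    have "frechet_derivative (\<lambda>x. frechet_derivative g (at x) u) (at z) = frechet_derivative (\<lambda>x. frechet_derivative f (at x) u \<bullet> b) (at z)"
      by (rule frechet_derivative_cong_open[OF assms(1,2) 1])
    also have "\<dots> = (\<lambda>u'. frechet_derivative (\<lambda>x. frechet_derivative f (at x) u) (at z) u' \<bullet> b)"
      by (rule frechet_derivative_eqI, rule bounded_linear.has_derivative[OF bounded_linear_inner_left])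
        (rule tcd_has_derivative[OF tcd_derivative[OF t2] assms(2)])
    finally show ?thesis by simp
  qed
  show "frechet_derivative (\<lambda>x. frechet_derivative f (at x) v) (at z) w \<bullet> b = frechet_derivative (\<lambda>x. frechet_derivative f (at x) w) (at z) v \<bullet> b"
    using second_derivative_symmetric_real[OF assms(1,2) g2, of v w] by (simp add: 2)
qed

section \<open>Algebra of a one-form on four-space\<close>

text \<open>A one-form is given by its coefficient vector \<open>a\<close> and the matrix \<open>A\<close> of its derivative
  (\<open>A $ j $ i\<close> is the \<open>i\<close>-th partial derivative of the \<open>j\<close>-th coefficient).\<close>

definition dform :: "real^4^4 \<Rightarrow> real^4 \<Rightarrow> real^4 \<Rightarrow> real" where
  "dform A v w = (A *v v) \<bullet> w - (A *v w) \<bullet> v"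

text \<open>The radical of d\<alpha> restricted to the hyperplane on which \<alpha>
  vanishes.\<close>

definition characteristic :: "real^4 \<Rightarrow> real^4^4 \<Rightarrow> real^4 \<Rightarrow> bool" where
  "characteristic a A v \<longleftrightarrow> a \<bullet> v = 0 \<and> (\<forall>w. a \<bullet> w = 0 \<longrightarrow> dform A v w = 0)"

definition curl :: "real^4^4 \<Rightarrow> 4 \<Rightarrow> 4 \<Rightarrow> real" where
  "curl A i j = A $ j $ i - A $ i $ j"

text \<open>The vector \<open>Z\<close> with \<open>i\<^sub>Z vol = \<alpha> \<and> d\<alpha>\<close>.\<close>

definition charvec :: "real^4 \<Rightarrow> real^4^4 \<Rightarrow> real^4" where
  "charvec a A = vector
    [a$2 * curl A 3 4 - a$3 * curl A 2 4 + a$4 * curl A 2 3,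
     - (a$1 * curl A 3 4 - a$3 * curl A 1 4 + a$4 * curl A 1 3),
     a$1 * curl A 2 4 - a$2 * curl A 1 4 + a$4 * curl A 1 2,
     - (a$1 * curl A 2 3 - a$2 * curl A 1 3 + a$3 * curl A 1 2)]"

lemma vector_4 [simp]:
  "(vector [w,x,y,z] ::('a::zero)^4) $ 1 = w"
  "(vector [w,x,y,z] ::('a::zero)^4) $ 2 = x"
  "(vector [w,x,y,z] ::('a::zero)^4) $ 3 = y"
  "(vector [w,x,y,z] ::('a::zero)^4) $ 4 = z"
  unfolding vector_def by simp_all

lemma inner_4: "(x::real^4) \<bullet> y = x$1*y$1 + x$2*y$2 + x$3*y$3 + x$4*y$4"
  by (simp add: inner_vec_def sum_4)

lemma charvec_nth:
  "charvec a A $ 1 = a$2 * curl A 3 4 - a$3 * curl A 2 4 + a$4 * curl A 2 3"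
  "charvec a A $ 2 = - (a$1 * curl A 3 4 - a$3 * curl A 1 4 + a$4 * curl A 1 3)"
  "charvec a A $ 3 = a$1 * curl A 2 4 - a$2 * curl A 1 4 + a$4 * curl A 1 2"
  "charvec a A $ 4 = - (a$1 * curl A 2 3 - a$2 * curl A 1 3 + a$3 * curl A 1 2)"
  by (simp_all add: charvec_def)

lemma dform_curl:
  "dform A v w = curl A 1 2 * (v$1*w$2 - v$2*w$1) + curl A 1 3 * (v$1*w$3 - v$3*w$1)
     + curl A 1 4 * (v$1*w$4 - v$4*w$1) + curl A 2 3 * (v$2*w$3 - v$3*w$2)
     + curl A 2 4 * (v$2*w$4 - v$4*w$2) + curl A 3 4 * (v$3*w$4 - v$4*w$3)"
  by (simp add: dform_def curl_def inner_4 matrix_vector_mult_def sum_4 algebra_simps)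

lemma inner_charvec: "a \<bullet> charvec a A = 0"
  by (simp add: inner_4 charvec_nth algebra_simps)

text \<open>The Pfaffian of the antisymmetric matrix of d\<alpha>: d\<alpha> \<and> d\<alpha> is
  twice this number times the volume form.\<close>

definition pfaffian :: "real^4^4 \<Rightarrow> real" where
  "pfaffian A = curl A 1 2 * curl A 3 4 - curl A 1 3 * curl A 2 4 + curl A 1 4 * curl A 2 3"

text \<open>Contracting d\<alpha> with Z gives the Pfaffian times \<alpha>. Hence Z is
  characteristic; and evaluation on the coefficient vector of \<alpha> expresses the Pfaffian, which
  is half the divergence of Z, linearly in Z.\<close>

lemma dform_charvec: "dform A (charvec a A) w = pfaffian A * (a \<bullet> w)"
  by (simp add: dform_curl charvec_nth pfaffian_def inner_4 algebra_simps)

lemma characteristic_charvec: "characteristic a A (charvec a A)"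
  by (simp add: characteristic_def inner_charvec dform_charvec)

text \<open>This is \<alpha> \<and> d\<alpha> evaluated on (a, v, w) and equated to the determinant
  of (Z, a, v, w), expanded along Z. It says that \<alpha> divides d\<alpha> up to terms linear in
  Z.\<close>

lemma dform_rep:
  "(a \<bullet> a) * dform A v w = (a \<bullet> v) * dform A a w - (a \<bullet> w) * dform A a v
    + charvec a A $ 1 * ((a$2*(v$3*w$4-v$4*w$3)) - a$3*(v$2*w$4-v$4*w$2) + a$4*(v$2*w$3-v$3*w$2))
    - charvec a A $ 2 * ((a$1*(v$3*w$4-v$4*w$3)) - a$3*(v$1*w$4-v$4*w$1) + a$4*(v$1*w$3-v$3*w$1))
    + charvec a A $ 3 * ((a$1*(v$2*w$4-v$4*w$2)) - a$2*(v$1*w$4-v$4*w$1) + a$4*(v$1*w$2-v$2*w$1))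
    - charvec a A $ 4 * ((a$1*(v$2*w$3-v$3*w$2)) - a$2*(v$1*w$3-v$3*w$1) + a$3*(v$1*w$2-v$2*w$1))"
  unfolding dform_curl charvec_nth inner_4 by algebra

lemma dform_scaleR_right: "dform A v (r *\<^sub>R w) = r * dform A v w"
  and dform_scaleR_left: "dform A (r *\<^sub>R v) w = r * dform A v w"
  and dform_diff_right: "dform A v (w - w') = dform A v w - dform A v w'"
  by (simp_all add: dform_curl algebra_simps)

text \<open>If \<open>v\<close> is characteristic then \<open>d\<alpha>(v, \<cdot>)\<close> is a multiple of \<open>\<alpha>\<close>, so contracting
  \<open>\<alpha> \<and> d\<alpha>\<close> with \<open>v\<close> gives \<open>0\<close>.\<close>

lemma characteristic_parallel:
  assumes "characteristic a A v" "a \<noteq> 0"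
  shows "v $ i * charvec a A $ j = v $ j * charvec a A $ i"
proof -
  have av: "a \<bullet> v = 0" and vw: "\<And>w. a \<bullet> w = 0 \<Longrightarrow> dform A v w = 0"
    using assms(1) by (auto simp: characteristic_def)
  define m where "m = dform A v a / (a \<bullet> a)"
  have aa: "a \<bullet> a \<noteq> 0" using assms(2) by simp
  have k: "dform A v w = m * (a \<bullet> w)" for w
  proof -
    have "a \<bullet> ((a \<bullet> a) *\<^sub>R w - (a \<bullet> w) *\<^sub>R a) = 0" by (simp add: inner_diff_right)
    from vw[OF this] have "(a \<bullet> a) * dform A v w = (a \<bullet> w) * dform A v a"
      by (simp add: dform_diff_right dform_scaleR_right)
    then show ?thesis using aa by (simp add: m_def field_simps)
  qed
  have e: "dform A v (axis 1 1) = m * a$1" "dform A v (axis 2 1) = m * a$2" "dform A v (axis 3 1) = m * a$3" "dform A v (axis 4 1) = m * a$4"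
    by (simp_all add: k inner_axis)
  have av4: "a$1 * v$1 + a$2 * v$2 + a$3 * v$3 + a$4 * v$4 = 0" using av by (simp add: inner_4)
  have e1: "- curl A 1 2 * v$2 - curl A 1 3 * v$3 - curl A 1 4 * v$4 = m * a$1"
   and e2: "curl A 1 2 * v$1 - curl A 2 3 * v$3 - curl A 2 4 * v$4 = m * a$2"
   and e3: "curl A 1 3 * v$1 + curl A 2 3 * v$2 - curl A 3 4 * v$4 = m * a$3"
   and e4: "curl A 1 4 * v$1 + curl A 2 4 * v$2 + curl A 3 4 * v$3 = m * a$4"
    using e by (simp_all add: dform_curl axis_def)
  have "v$1 * charvec a A $ 2 = v$2 * charvec a A $ 1" "v$1 * charvec a A $ 3 = v$3 * charvec a A $ 1"
    "v$1 * charvec a A $ 4 = v$4 * charvec a A $ 1" "v$2 * charvec a A $ 3 = v$3 * charvec a A $ 2"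
    "v$2 * charvec a A $ 4 = v$4 * charvec a A $ 2" "v$3 * charvec a A $ 4 = v$4 * charvec a A $ 3"
    unfolding charvec_nth using av4 e1 e2 e3 e4 by algebra+
  then show ?thesis using exhaust_4[of i] exhaust_4[of j] by auto
qed

lemma characteristic_multiple:
  assumes "characteristic a A v" "a \<noteq> 0" "charvec a A $ l \<noteq> 0"
  shows "v = (v $ l / charvec a A $ l) *\<^sub>R charvec a A"
  using characteristic_parallel[OF assms(1,2), of _ l] assms(3)
  by (simp add: vec_eq_iff field_simps)

text \<open>If Z = 0, \<open>dform_rep\<close> makes d\<alpha> vanish on the kernel of \<alpha>. If
  Z is nonzero, all characteristic vectors are multiples of Z, whereas the kernel has dimension
  3.\<close>

lemma charvec_zero_iff:
  assumes "a \<noteq> 0"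
  shows "charvec a A = 0 \<longleftrightarrow> (\<forall>v. a \<bullet> v = 0 \<longrightarrow> characteristic a A v)"
proof
  assume "charvec a A = 0"
  then have "(a \<bullet> a) * dform A v w = 0" if "a \<bullet> v = 0" "a \<bullet> w = 0" for v w
    using dform_rep[of a A v w] that by simp
  then show "\<forall>v. a \<bullet> v = 0 \<longrightarrow> characteristic a A v" using assms by (auto simp: characteristic_def)
next
  assume *: "\<forall>v. a \<bullet> v = 0 \<longrightarrow> characteristic a A v"
  show "charvec a A = 0"
  proof (rule ccontr)
    assume "charvec a A \<noteq> 0"
    then obtain l where l: "charvec a A $ l \<noteq> 0" by (auto simp: vec_eq_iff)
    have "{v. a \<bullet> v = 0} \<subseteq> span {charvec a A}"
    proof
      fix v assume "v \<in> {v. a \<bullet> v = 0}"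
      then have "v = (v $ l / charvec a A $ l) *\<^sub>R charvec a A"
        using * characteristic_multiple[OF _ assms l] by blast
      then show "v \<in> span {charvec a A}" by (metis span_base span_scale singletonI)
    qed
    then have "dim {v. a \<bullet> v = 0} \<le> dim (span {charvec a A})" by (rule dim_subset)
    also have "\<dots> \<le> 1" using dim_le_card'[of "{charvec a A}"] by simp
    finally show False using dim_hyperplane[OF assms] by simp
  qed
qed

text \<open>\<open>cross4 x y z \<bullet> w\<close> is the determinant with rows w, x, y, z. The
  vector therefore holds the coefficients of a one-form that vanishes on x, y and z.\<close>

definition cross4 :: "real^4 \<Rightarrow> real^4 \<Rightarrow> real^4 \<Rightarrow> real^4" where
  "cross4 x y z = vector
    [x$2*(y$3*z$4-y$4*z$3) - x$3*(y$2*z$4-y$4*z$2) + x$4*(y$2*z$3-y$3*z$2),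
     - (x$1*(y$3*z$4-y$4*z$3) - x$3*(y$1*z$4-y$4*z$1) + x$4*(y$1*z$3-y$3*z$1)),
     x$1*(y$2*z$4-y$4*z$2) - x$2*(y$1*z$4-y$4*z$1) + x$4*(y$1*z$2-y$2*z$1),
     - (x$1*(y$2*z$3-y$3*z$2) - x$2*(y$1*z$3-y$3*z$1) + x$3*(y$1*z$2-y$2*z$1))]"

lemma cross4_orthogonal: "cross4 x y z \<bullet> x = 0" "cross4 x y z \<bullet> y = 0" "cross4 x y z \<bullet> z = 0"
  unfolding cross4_def inner_4 vector_4 by algebra+

text \<open>The right-hand side is the Gram determinant of x, y, z.\<close>

lemma cross4_gram:
  "cross4 x y z \<bullet> cross4 x y z = (x \<bullet> x) * ((y \<bullet> y) * (z \<bullet> z) - (y \<bullet> z)\<^sup>2) - (x \<bullet> y) * ((x \<bullet> y) * (z \<bullet> z) - (y \<bullet> z) * (x \<bullet> z))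
     + (x \<bullet> z) * ((x \<bullet> y) * (y \<bullet> z) - (y \<bullet> y) * (x \<bullet> z))"
  unfolding cross4_def inner_4 vector_4 by algebra

text \<open>Orthogonalising \<open>x, y, z\<close> does not change the cross product, whose length is then the product
  of the lengths.\<close>

lemma cross4_nonzero:
  assumes "x \<noteq> 0" "y \<notin> span {x}" "z \<notin> span {x, y}"
  shows "cross4 x y z \<noteq> 0"
proof -
  define y' where "y' = y - ((x \<bullet> y) / (x \<bullet> x)) *\<^sub>R x"
  have xx: "x \<bullet> x \<noteq> 0" using assms by simp
  have y'0: "y' \<noteq> 0"
  proof
    assume "y' = 0"
    then have "y = ((x \<bullet> y) / (x \<bullet> x)) *\<^sub>R x" by (simp add: y'_def)
    then show False using assms(2) by (metis span_base span_scale singletonI)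
  qed
  have xy': "x \<bullet> y' = 0" using xx by (simp add: y'_def inner_diff_right)
  define z' where "z' = z - ((x \<bullet> z) / (x \<bullet> x)) *\<^sub>R x - ((y' \<bullet> z) / (y' \<bullet> y')) *\<^sub>R y'"
  have y'y': "y' \<bullet> y' \<noteq> 0" using y'0 by simp
  have y's: "y' \<in> span {x, y}" unfolding y'_def by (intro span_diff span_scale span_base) auto
  have z'0: "z' \<noteq> 0"
  proof
    assume "z' = 0"
    then have "z = ((x \<bullet> z) / (x \<bullet> x)) *\<^sub>R x + ((y' \<bullet> z) / (y' \<bullet> y')) *\<^sub>R y'" by (simp add: z'_def algebra_simps)
    moreover have "\<dots> \<in> span {x, y}" by (intro span_add span_scale y's span_base) auto
    ultimately show False using assms(3) by simp
  qed
  have xz': "x \<bullet> z' = 0" using xx xy' by (simp add: z'_def inner_diff_right)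
  have yz': "y' \<bullet> z' = 0" using y'y' xy' by (simp add: z'_def inner_diff_right inner_commute)
  have "cross4 x y' z' \<bullet> cross4 x y' z' = (x \<bullet> x) * (y' \<bullet> y') * (z' \<bullet> z')"
    by (simp add: cross4_gram xy' xz' yz')
  then have n: "cross4 x y' z' \<noteq> 0" using xx y'y' z'0 by auto
  have lin: "cross4 x (y + r *\<^sub>R x) z = cross4 x y z" "cross4 x y (z + r *\<^sub>R x + s *\<^sub>R y) = cross4 x y z" for x y z :: "real^4" and r s
    by (simp_all add: cross4_def vec_eq_iff forall_4 algebra_simps)
  have "cross4 x y z = cross4 x y' z"
    using lin(1)[of x y "- ((x \<bullet> y) / (x \<bullet> x))" z] by (simp add: y'_def)
  also have "\<dots> = cross4 x y' z'"
    using lin(2)[of x y' z "- ((x \<bullet> z) / (x \<bullet> x))" "- ((y' \<bullet> z) / (y' \<bullet> y'))"] by (simp add: z'_def)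
  finally show ?thesis using n by simp
qed

section \<open>The characteristic field of a one-form\<close>

definition jac :: "(real^4 \<Rightarrow> real^4) \<Rightarrow> real^4 \<Rightarrow> real^4^4" where
  "jac f z = matrix (frechet_derivative f (at z))"

definition charfield :: "(real^4 \<Rightarrow> real^4) \<Rightarrow> real^4 \<Rightarrow> real^4" where
  "charfield f z = charvec (f z) (jac f z)"

lemma jac_mult:
  assumes "smooth_on S f" "z \<in> S"
  shows "jac f z *v v = frechet_derivative f (at z) v"
  unfolding jac_def
  using fun_cong[OF matrix_vector_mul(2)[OF has_derivative_linear[OF smooth_on_has_derivative[OF assms]]], of v] by simp

lemma jac_has_derivative:
  assumes "smooth_on S f" "z \<in> S"
  shows "(f has_derivative (*v) (jac f z)) (at z)"
proof -
  have "frechet_derivative f (at z) = (*v) (jac f z)" by (rule ext) (simp add: jac_mult[OF assms])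
  then show ?thesis using smooth_on_has_derivative[OF assms] by simp
qed

lemma jac_nth: "jac f z $ j $ i = frechet_derivative f (at z) (axis i 1) $ j"
  by (simp add: jac_def matrix_def)

lemma smooth_on_jac_nth:
  assumes "open S" "smooth_on S f"
  shows "smooth_on S (\<lambda>z. jac f z $ j $ i)"
  unfolding jac_nth by (intro smooth_on_component smooth_on_derivative assms)

lemma smooth_on_curl:
  assumes "open S" "smooth_on S f"
  shows "smooth_on S (\<lambda>z. curl (jac f z) i j)"
  unfolding curl_def by (intro smooth_on_diff smooth_on_jac_nth assms)

lemma smooth_on_charfield:
  assumes "open S" "smooth_on S f"
  shows "smooth_on S (charfield f)"
proof (rule smooth_on_vec[OF assms(1)])
  have c: "smooth_on S (\<lambda>z. f z $ i * curl (jac f z) j k)" for i j k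
    by (rule smooth_on_mult[OF assms(1) smooth_on_component[OF assms] smooth_on_curl[OF assms]])
  have p: "smooth_on S (\<lambda>z. f z $ i * curl (jac f z) j k - f z $ i' * curl (jac f z) j' k' + f z $ i'' * curl (jac f z) j'' k'')" for i j k i' j' k' i'' j'' k''
    by (rule smooth_on_add[OF assms(1) smooth_on_diff[OF assms(1) c c] c])
  have n: "smooth_on S (\<lambda>z. - (f z $ i * curl (jac f z) j k - f z $ i' * curl (jac f z) j' k' + f z $ i'' * curl (jac f z) j'' k''))" for i j k i' j' k' i'' j'' k''
    by (rule smooth_on_uminus[OF assms(1) p])
  have "smooth_on S (\<lambda>x. charfield f x $ 1)" "smooth_on S (\<lambda>x. charfield f x $ 2)"
    "smooth_on S (\<lambda>x. charfield f x $ 3)" "smooth_on S (\<lambda>x. charfield f x $ 4)"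
    unfolding charfield_def charvec_nth by (rule p n)+
  then show "smooth_on S (\<lambda>x. charfield f x $ i)" for i using exhaust_4[of i] by auto
qed

lemma jac_continuous:
  assumes "open S" "smooth_on S f" shows "continuous_on S (jac f)"
proof -
  have "continuous_on S (\<lambda>z. \<chi> j. \<chi> i. jac f z $ j $ i)"
    by (intro continuous_on_vec_lambda smooth_on_continuous smooth_on_jac_nth assms)
  then show ?thesis by simp
qed

section \<open>Divergence of the characteristic field\<close>

definition partial :: "4 \<Rightarrow> (real^4 \<Rightarrow> real) \<Rightarrow> real^4 \<Rightarrow> real" where
  "partial i f z = frechet_derivative f (at z) (axis i 1)"

lemma partial_simps:
  assumes "open S" "z \<in> S" "smooth_on S f" "smooth_on S g"
  shows "partial i (\<lambda>z. f z + g z) z = partial i f z + partial i g z"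
    and "partial i (\<lambda>z. f z - g z) z = partial i f z - partial i g z"
    and "partial i (\<lambda>z. f z * g z) z = f z * partial i g z + partial i f z * g z"
    and "partial i (\<lambda>z. - f z) z = - partial i f z"
proof -
  note d = smooth_on_has_derivative[OF assms(3,2)] smooth_on_has_derivative[OF assms(4,2)]
  show "partial i (\<lambda>z. f z + g z) z = partial i f z + partial i g z"
    unfolding partial_def by (simp add: frechet_derivative_eqI[OF has_derivative_add[OF d]])
  show "partial i (\<lambda>z. f z - g z) z = partial i f z - partial i g z"
    unfolding partial_def by (simp add: frechet_derivative_eqI[OF has_derivative_diff[OF d]])
  show "partial i (\<lambda>z. f z * g z) z = f z * partial i g z + partial i f z * g z"
    unfolding partial_def by (simp add: frechet_derivative_eqI[OF has_derivative_mult[OF d]])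
  show "partial i (\<lambda>z. - f z) z = - partial i f z"
    unfolding partial_def by (simp add: frechet_derivative_eqI[OF has_derivative_minus[OF d(1)]])
qed

lemma partial_component:
  assumes "smooth_on S f" "z \<in> S"
  shows "partial i (\<lambda>z. f z $ j) z = jac f z $ j $ i"
  unfolding partial_def jac_nth
  by (simp add: frechet_derivative_eqI[OF bounded_linear.has_derivative[OF bounded_linear_vec_nth smooth_on_has_derivative[OF assms]]])

lemma partial_jac_commute:
  assumes "open S" "smooth_on S f" "z \<in> S"
  shows "partial i (\<lambda>z. jac f z $ k $ j) z = partial j (\<lambda>z. jac f z $ k $ i) z"
proof -
  have 1: "partial i (\<lambda>z. jac f z $ k $ j) z = frechet_derivative (\<lambda>z. frechet_derivative f (at z) (axis j 1)) (at z) (axis i 1) $ k" for i j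
    unfolding partial_def jac_nth
    by (simp add: frechet_derivative_eqI[OF bounded_linear.has_derivative[OF bounded_linear_vec_nth smooth_on_has_derivative[OF smooth_on_derivative[OF assms(2)] assms(3)]]])
  show ?thesis unfolding 1
    using second_derivative_symmetric[OF assms(1,3), of f] assms(2) by (simp add: smooth_on_def)
qed

text \<open>Coordinate form of d(\<alpha> \<and> d\<alpha>) = d\<alpha> \<and> d\<alpha>. The terms
  with second derivatives of \<alpha> cancel by their symmetry, which is recorded for
  \<open>h\<close>.\<close>

lemma charfield_divergence:
  assumes "open S" "smooth_on S f" "z \<in> S"
  shows "trace (jac (charfield f) z) = 2 * pfaffian (jac f z)"
proof -
  have sZ: "smooth_on S (charfield f)" by (rule smooth_on_charfield[OF assms(1,2)])
  define c where "c i j z = curl (jac f z) i j" for i j z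
  define b where "b i z = f z $ i" for i z
  have sc: "smooth_on S (c i j)" for i j unfolding c_def[abs_def] by (rule smooth_on_curl[OF assms(1,2)])
  have sb: "smooth_on S (b i)" for i unfolding b_def[abs_def] by (rule smooth_on_component[OF assms(1,2)])
  have Z: "(\<lambda>z. charfield f z $ 1) = (\<lambda>z. b 2 z * c 3 4 z - b 3 z * c 2 4 z + b 4 z * c 2 3 z)"
    "(\<lambda>z. charfield f z $ 2) = (\<lambda>z. - (b 1 z * c 3 4 z - b 3 z * c 1 4 z + b 4 z * c 1 3 z))"
    "(\<lambda>z. charfield f z $ 3) = (\<lambda>z. b 1 z * c 2 4 z - b 2 z * c 1 4 z + b 4 z * c 1 2 z)"
    "(\<lambda>z. charfield f z $ 4) = (\<lambda>z. - (b 1 z * c 2 3 z - b 2 z * c 1 3 z + b 3 z * c 1 2 z))"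
    by (simp_all add: fun_eq_iff charfield_def charvec_nth b_def c_def)
  note sm = smooth_on_add smooth_on_diff smooth_on_mult smooth_on_uminus assms(1) sb sc
  note ps = partial_simps[OF assms(1,3)]
  have D: "partial i (b j) z = jac f z $ j $ i" for i j
    unfolding b_def[abs_def] by (rule partial_component[OF assms(2,3)])
  define h where "h i j k = partial i (\<lambda>z. jac f z $ k $ j) z" for i j k
  have h: "h i j k = h j i k" for i j k unfolding h_def by (rule partial_jac_commute[OF assms])
  have C: "partial i (c j k) z = h i j k - h i k j" for i j k
    unfolding c_def[abs_def] curl_def h_def
    by (rule partial_simps(2)[OF assms(1,3)]) (intro smooth_on_jac_nth assms)+
  have t: "trace (jac (charfield f) z) = partial 1 (\<lambda>z. charfield f z $ 1) z + partial 2 (\<lambda>z. charfield f z $ 2) z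
     + partial 3 (\<lambda>z. charfield f z $ 3) z + partial 4 (\<lambda>z. charfield f z $ 4) z"
    by (simp add: trace_def sum_4 partial_component[OF sZ assms(3)])
  have P: "partial i (\<lambda>z. b j z * c k l z - b m z * c n p z + b q z * c r s z) z
     = (b j z * partial i (c k l) z + partial i (b j) z * c k l z) - (b m z * partial i (c n p) z + partial i (b m) z * c n p z)
       + (b q z * partial i (c r s) z + partial i (b q) z * c r s z)" for i j k l m n p q r s
  proof -
    have "partial i (\<lambda>z. b j z * c k l z - b m z * c n p z + b q z * c r s z) z
      = partial i (\<lambda>z. b j z * c k l z - b m z * c n p z) z + partial i (\<lambda>z. b q z * c r s z) z"
      by (rule ps(1)) (intro sm)+
    also have "partial i (\<lambda>z. b j z * c k l z - b m z * c n p z) z = partial i (\<lambda>z. b j z * c k l z) z - partial i (\<lambda>z. b m z * c n p z) z"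
      by (rule ps(2)) (intro sm)+
    finally show ?thesis by (simp add: ps(3)[OF sb sc])
  qed
  have U: "partial i (\<lambda>z. - (b j z * c k l z - b m z * c n p z + b q z * c r s z)) z
     = - partial i (\<lambda>z. b j z * c k l z - b m z * c n p z + b q z * c r s z) z" for i j k l m n p q r s
    by (rule partial_simps(4)[OF assms(1,3) _ sb[of 1]]) (intro sm)+
  show ?thesis
    unfolding t Z U P D C using h[of 2 1] h[of 3 1] h[of 4 1] h[of 3 2] h[of 4 2] h[of 4 3]
    by (simp add: c_def curl_def pfaffian_def algebra_simps)
qed

lemma dform_inner_axis: "dform A v w = v \<bullet> (\<chi> i. dform A (axis i 1) w)"
  by (simp add: dform_curl inner_4 axis_def algebra_simps)

lemma charfield_divergence_bound:
  assumes "open S" "smooth_on S f" "\<And>z. z \<in> S \<Longrightarrow> f z \<noteq> 0" "compact K" "K \<subseteq> S"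
  obtains C where "C \<ge> 0" "\<And>z. z \<in> K \<Longrightarrow> \<bar>trace (jac (charfield f) z)\<bar> \<le> C * norm (charfield f z)"
proof -
  \<comment> \<open>By \<open>dform_charvec\<close> on the vector \<open>f z\<close>, the Pfaffian
    times \<open>f z \<bullet> f z\<close> is linear in the field with these coefficients; the 2
    turns the Pfaffian into the divergence.\<close>
  define \<beta> where "\<beta> z = (2 / (f z \<bullet> f z)) *\<^sub>R (\<chi> i. dform (jac f z) (axis i 1) (f z))" for z
  have cf: "continuous_on K f" using smooth_on_continuous[OF assms(2)] assms(5) continuous_on_subset by blast
  have fz: "f z \<bullet> f z \<noteq> 0" if "z \<in> K" for z using assms(3,5) that by auto
  have "continuous_on K (\<lambda>z. dform (jac f z) (axis i 1) (f z))" for i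
  proof -
    have 1: "smooth_on S (\<lambda>x. frechet_derivative f (at x) (axis i 1) \<bullet> f x - frechet_derivative f (at x) (f x) \<bullet> axis i 1)"
      by (intro smooth_on_diff smooth_on_inner smooth_on_derivative smooth_on_derivative_along smooth_on_const assms)
    have "smooth_on S (\<lambda>z. dform (jac f z) (axis i 1) (f z))"
      by (rule smooth_on_cong[OF assms(1) _ 1]) (simp add: dform_def jac_mult[OF assms(2)])
    then show ?thesis using smooth_on_continuous assms(5) continuous_on_subset by blast
  qed
  then have cb: "continuous_on K \<beta>" unfolding \<beta>_def
    by (intro continuous_on_scaleR continuous_on_divide continuous_on_const continuous_on_inner cf continuous_on_vec_lambda) (use fz in auto)
  obtain C where C: "C > 0" "\<And>z. z \<in> K \<Longrightarrow> norm (\<beta> z) \<le> C"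
    using compact_imp_bounded[OF compact_continuous_image[OF cb assms(4)], unfolded bounded_pos] by auto
  show ?thesis
  proof (rule that[of C])
    fix z assume z: "z \<in> K"
    have "dform (jac f z) (charfield f z) (f z) = charfield f z \<bullet> (\<chi> i. dform (jac f z) (axis i 1) (f z))"
      by (rule dform_inner_axis)
    moreover have "dform (jac f z) (charfield f z) (f z) = pfaffian (jac f z) * (f z \<bullet> f z)"
      unfolding charfield_def by (rule dform_charvec)
    ultimately have "2 * pfaffian (jac f z) = charfield f z \<bullet> \<beta> z"
      using fz[OF z] by (simp add: \<beta>_def field_simps)
    then have "\<bar>trace (jac (charfield f) z)\<bar> = \<bar>charfield f z \<bullet> \<beta> z\<bar>"
      using charfield_divergence[OF assms(1,2)] z assms(5) by auto
    also have "\<dots> \<le> norm (charfield f z) * norm (\<beta> z)" by (rule Cauchy_Schwarz_ineq2)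
    also have "\<dots> \<le> norm (charfield f z) * C" using C(2)[OF z] by (intro mult_left_mono) auto
    finally show "\<bar>trace (jac (charfield f) z)\<bar> \<le> C * norm (charfield f z)" by (simp add: mult.commute)
  qed (use C in simp)
qed

section \<open>Functions vanishing to infinite order\<close>

fun vanishes :: "nat \<Rightarrow> 'a::euclidean_space \<Rightarrow> ('a \<Rightarrow> real) \<Rightarrow> bool" where
  "vanishes 0 z h \<longleftrightarrow> h z = 0"
| "vanishes (Suc k) z h \<longleftrightarrow> h z = 0 \<and> (\<forall>b\<in>Basis. vanishes k z (\<lambda>x. frechet_derivative h (at x) b))"

definition flat :: "'a::euclidean_space \<Rightarrow> ('a \<Rightarrow> real) \<Rightarrow> bool" where
  "flat z h \<longleftrightarrow> (\<forall>k. vanishes k z h)"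

lemma vanishes_0: "vanishes k z h \<Longrightarrow> h z = 0"
  by (cases k) auto

lemma flat_0: "flat z h \<Longrightarrow> h z = 0"
  unfolding flat_def using vanishes_0 by blast

lemma vanishes_Suc: "vanishes (Suc k) z h \<Longrightarrow> vanishes k z h"
proof (induction k arbitrary: h)
  case (Suc k)
  have "vanishes k z (\<lambda>x. frechet_derivative h (at x) b)" if "b \<in> Basis" for b
    by (rule Suc.IH) (use Suc.prems that in auto)
  then show ?case using Suc.prems by auto
qed simp

lemma vanishes_cong:
  assumes "open S" "z \<in> S" "\<And>x. x \<in> S \<Longrightarrow> f x = g x" "vanishes k z f"
  shows "vanishes k z g"
  using assms(3,4)
proof (induction k arbitrary: f g)
  case (Suc k)
  have "vanishes k z (\<lambda>x. frechet_derivative g (at x) b)" if "b \<in> Basis" for b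
  proof (rule Suc.IH)
    show "frechet_derivative f (at x) b = frechet_derivative g (at x) b" if "x \<in> S" for x
      using frechet_derivative_cong_open[OF assms(1) that Suc.prems(1)] by simp
    show "vanishes k z (\<lambda>x. frechet_derivative f (at x) b)" using Suc.prems \<open>b \<in> Basis\<close> by simp
  qed
  then show ?case using Suc.prems assms(2) by auto
qed (use assms(2) in auto)

lemma vanishes_zero: "vanishes k z (\<lambda>x. 0)"
  by (induction k) auto

lemma vanishes_add:
  assumes S: "open S" "z \<in> S" and "smooth_on S f" "smooth_on S g" "vanishes k z f" "vanishes k z g"
  shows "vanishes k z (\<lambda>x. f x + g x)"
  using assms(3-)
proof (induction k arbitrary: f g)
  case (Suc k)
  have "vanishes k z (\<lambda>x. frechet_derivative (\<lambda>x. f x + g x) (at x) b)" if b: "b \<in> Basis" for b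
  proof (rule vanishes_cong[OF S])
    show "vanishes k z (\<lambda>x. frechet_derivative f (at x) b + frechet_derivative g (at x) b)"
      using Suc.prems b by (intro Suc.IH smooth_on_derivative) auto
    show "frechet_derivative f (at x) b + frechet_derivative g (at x) b = frechet_derivative (\<lambda>x. f x + g x) (at x) b" if "x \<in> S" for x
      using frechet_derivative_eqI[OF has_derivative_add[OF smooth_on_has_derivative[OF Suc.prems(1) that] smooth_on_has_derivative[OF Suc.prems(2) that]]]
      by simp
  qed
  then show ?case using Suc.prems by simp
qed simp

lemma vanishes_mult:
  assumes S: "open S" "z \<in> S" and "smooth_on S f" "smooth_on S g" "vanishes k z f"
  shows "vanishes k z (\<lambda>x. f x * g x)"
  using assms(3-)
proof (induction k arbitrary: f g)
  case (Suc k)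
  have "vanishes k z (\<lambda>x. frechet_derivative (\<lambda>x. f x * g x) (at x) b)" if b: "b \<in> Basis" for b
  proof (rule vanishes_cong[OF S])
    show "vanishes k z (\<lambda>x. f x * frechet_derivative g (at x) b + frechet_derivative f (at x) b * g x)"
      by (rule vanishes_add[OF S])
        (use Suc.prems b S in \<open>auto intro!: Suc.IH smooth_on_mult smooth_on_derivative vanishes_Suc[OF Suc.prems(3)]\<close>)
    show "f x * frechet_derivative g (at x) b + frechet_derivative f (at x) b * g x = frechet_derivative (\<lambda>x. f x * g x) (at x) b" if "x \<in> S" for x
      using frechet_derivative_eqI[OF has_derivative_mult[OF smooth_on_has_derivative[OF Suc.prems(1) that] smooth_on_has_derivative[OF Suc.prems(2) that]]]
      by simp
  qed
  then show ?case using Suc.prems by simp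
qed simp

lemma vanishes_uminus:
  assumes S: "open S" "z \<in> S" and "smooth_on S f" "vanishes k z f"
  shows "vanishes k z (\<lambda>x. - f x)"
  using vanishes_mult[OF S assms(3) smooth_on_const[of S "-1"] assms(4)] by simp

text \<open>The product rule gives f' g = (f g)' - f g'. Both terms on the right vanish to order
  \<open>k\<close>, the second because \<open>f\<close> does so by the induction hypothesis, and the
  hypothesis is then applied to f'.\<close>

lemma vanishes_cancel:
  assumes S: "open S" "z \<in> S" and "smooth_on S f" "smooth_on S g" "vanishes k z (\<lambda>x. f x * g x)" "g z \<noteq> 0"
  shows "vanishes k z f"
  using assms(3-)
proof (induction k arbitrary: f)
  case (Suc k)
  have f: "vanishes k z f" by (rule Suc.IH[OF Suc.prems(1,2) vanishes_Suc[OF Suc.prems(3)] Suc.prems(4)])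
  have "vanishes k z (\<lambda>x. frechet_derivative f (at x) b)" if b: "b \<in> Basis" for b
  proof (rule Suc.IH)
    have 1: "vanishes k z (\<lambda>x. frechet_derivative (\<lambda>x. f x * g x) (at x) b + - (f x * frechet_derivative g (at x) b))"
      by (rule vanishes_add[OF S])
        (use Suc.prems b S f in \<open>auto intro!: vanishes_uminus[OF S] vanishes_mult[OF S] smooth_on_mult smooth_on_uminus smooth_on_derivative\<close>)
    show "vanishes k z (\<lambda>x. frechet_derivative f (at x) b * g x)"
    proof (rule vanishes_cong[OF S _ 1])
      fix x assume x: "x \<in> S"
      show "frechet_derivative (\<lambda>x. f x * g x) (at x) b + - (f x * frechet_derivative g (at x) b) = frechet_derivative f (at x) b * g x"
        using frechet_derivative_eqI[OF has_derivative_mult[OF smooth_on_has_derivative[OF Suc.prems(1) x] smooth_on_has_derivative[OF Suc.prems(2) x]]]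
        by simp
    qed
  qed (use Suc.prems in \<open>auto intro: smooth_on_derivative\<close>)
  then show ?case using Suc.prems by simp
qed simp

lemma vanishes_sum:
  assumes S: "open S" "z \<in> S" and "\<And>i. i \<in> I \<Longrightarrow> smooth_on S (f i)" "\<And>i. i \<in> I \<Longrightarrow> vanishes k z (f i)"
  shows "vanishes k z (\<lambda>x. \<Sum>i\<in>I. f i x)"
  using assms(3,4)
proof (induction I rule: infinite_finite_induct)
  case (insert i I)
  have "vanishes k z (\<lambda>x. f i x + (\<Sum>i\<in>I. f i x))"
    by (rule vanishes_add[OF S]) (use insert in \<open>auto intro!: smooth_on_sum S(1)\<close>)
  then show ?case using insert by simp
qed (auto intro: vanishes_zero)

lemma flat_cong: "open S \<Longrightarrow> z \<in> S \<Longrightarrow> (\<And>x. x \<in> S \<Longrightarrow> f x = g x) \<Longrightarrow> flat z f \<Longrightarrow> flat z g"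
  unfolding flat_def using vanishes_cong by blast

lemma flat_add: "open S \<Longrightarrow> z \<in> S \<Longrightarrow> smooth_on S f \<Longrightarrow> smooth_on S g \<Longrightarrow> flat z f \<Longrightarrow> flat z g \<Longrightarrow> flat z (\<lambda>x. f x + g x)"
  unfolding flat_def using vanishes_add by blast

lemma flat_mult: "open S \<Longrightarrow> z \<in> S \<Longrightarrow> smooth_on S f \<Longrightarrow> smooth_on S g \<Longrightarrow> flat z f \<Longrightarrow> flat z (\<lambda>x. f x * g x)"
  unfolding flat_def using vanishes_mult by blast

lemma flat_diff: "open S \<Longrightarrow> z \<in> S \<Longrightarrow> smooth_on S f \<Longrightarrow> smooth_on S g \<Longrightarrow> flat z f \<Longrightarrow> flat z g \<Longrightarrow> flat z (\<lambda>x. f x - g x)"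
  using flat_add[of S z f "\<lambda>x. - g x"] vanishes_uminus[of S z g] smooth_on_uminus[of S g] unfolding flat_def by simp

lemma flat_cancel: "open S \<Longrightarrow> z \<in> S \<Longrightarrow> smooth_on S f \<Longrightarrow> smooth_on S g \<Longrightarrow> flat z (\<lambda>x. f x * g x) \<Longrightarrow> g z \<noteq> 0 \<Longrightarrow> flat z f"
  unfolding flat_def using vanishes_cancel by blast

lemma flat_zero: "flat z (\<lambda>x. 0)"
  unfolding flat_def using vanishes_zero by blast

lemma flat_derivative_along:
  assumes S: "open S" "z \<in> S" and f: "smooth_on S f" "flat z f" and X: "smooth_on S X"
  shows "flat z (\<lambda>x. frechet_derivative f (at x) (X x))"
proof -
  have D: "vanishes k z (\<lambda>x. frechet_derivative f (at x) b)" if "b \<in> Basis" for k b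
    using f(2) that unfolding flat_def by (metis vanishes.simps(2))
  have 1: "vanishes k z (\<lambda>x. \<Sum>b\<in>Basis. frechet_derivative f (at x) b * (X x \<bullet> b))" for k
    by (rule vanishes_sum[OF S])
      (auto intro!: vanishes_mult[OF S] smooth_on_mult S(1) smooth_on_derivative f(1) smooth_on_inner X smooth_on_const D)
  have 2: "(\<Sum>b\<in>Basis. frechet_derivative f (at x) b * (X x \<bullet> b)) = frechet_derivative f (at x) (X x)" if "x \<in> S" for x
  proof -
    have l: "linear (frechet_derivative f (at x))"
      using smooth_on_has_derivative[OF f(1) that] has_derivative_linear by blast
    have "frechet_derivative f (at x) (X x) = frechet_derivative f (at x) (\<Sum>b\<in>Basis. (X x \<bullet> b) *\<^sub>R b)"
      by (simp add: euclidean_representation)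
    also have "\<dots> = (\<Sum>b\<in>Basis. frechet_derivative f (at x) b * (X x \<bullet> b))"
      using l by (simp add: linear_sum linear_scale mult.commute)
    finally show ?thesis by simp
  qed
  show ?thesis unfolding flat_def using vanishes_cong[OF S 2 1] by blast
qed

text \<open>Exchanging the coordinate along \<open>b\<close> for the value of \<open>f\<close> gives
  a map \<open>F\<close> whose derivative is injective at these points and which sends the zeros of
  \<open>f\<close> into a coordinate hyperplane.\<close>

lemma zero_regular_negligible:
  fixes f :: "'a::euclidean_space \<Rightarrow> real"
  assumes "smooth_on S f" "b \<in> Basis"
  shows "negligible {z\<in>S. f z = 0 \<and> frechet_derivative f (at z) b \<noteq> 0}"
proof -
  define R where "R = {z\<in>S. frechet_derivative f (at z) b \<noteq> 0}"
  define F where "F z = z + (f z - z \<bullet> b) *\<^sub>R b" for z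
  define F' where "F' z h = h + (frechet_derivative f (at z) h - h \<bullet> b) *\<^sub>R b" for z h
  have bb: "b \<bullet> b = 1" using assms(2) by (simp add: inner_Basis)
  have "negligible {z\<in>R. F z \<in> {x. x \<bullet> b = 0}}"
  proof (rule negligible_differentiable_vimage)
    show "negligible {x. x \<bullet> b = 0}" by (rule negligible_standard_hyperplane[OF assms(2)])
    fix z assume z: "z \<in> R"
    then have d: "(f has_derivative frechet_derivative f (at z)) (at z)"
      using smooth_on_has_derivative[OF assms(1)] by (simp add: R_def)
    have "(F has_derivative F' z) (at z)"
      unfolding F_def[abs_def] F'_def[abs_def] using d by (auto intro!: derivative_eq_intros)
    then show "(F has_derivative F' z) (at z within R)" by (rule has_derivative_at_withinI)
    then have lin: "linear (F' z)" by (rule has_derivative_linear)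
    have lf: "linear (frechet_derivative f (at z))" using d by (rule has_derivative_linear)
    show "inj (F' z)" unfolding linear_injective_0[OF lin]
    proof (intro allI impI)
      fix h assume h: "F' z h = 0"
      define c where "c = h \<bullet> b - frechet_derivative f (at z) h"
      have hc: "h = c *\<^sub>R b" using h by (simp add: F'_def c_def algebra_simps eq_neg_iff_add_eq_0)
      have "c = c - c * frechet_derivative f (at z) b"
        using c_def bb by (simp add: hc linear_scale[OF lf])
      then show "h = 0" using z hc by (simp add: R_def)
    qed
  qed
  moreover have "{z\<in>S. f z = 0 \<and> frechet_derivative f (at z) b \<noteq> 0} \<subseteq> {z\<in>R. F z \<in> {x. x \<bullet> b = 0}}"
    by (auto simp: R_def F_def inner_add_left bb)
  ultimately show ?thesis by (rule negligible_subset)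
qed

fun iterated_derivative :: "'a::euclidean_space list \<Rightarrow> ('a \<Rightarrow> real) \<Rightarrow> 'a \<Rightarrow> real" where
  "iterated_derivative [] f = f"
| "iterated_derivative (b # bs) f = iterated_derivative bs (\<lambda>x. frechet_derivative f (at x) b)"

lemma iterated_derivative_snoc:
  "iterated_derivative (bs @ [b]) f = (\<lambda>x. frechet_derivative (iterated_derivative bs f) (at x) b)"
  by (induction bs arbitrary: f) auto

lemma smooth_on_iterated_derivative: "smooth_on S f \<Longrightarrow> smooth_on S (iterated_derivative bs f)"
  by (induction bs arbitrary: f) (auto intro: smooth_on_derivative)

lemma vanishes_iterated:
  assumes "\<And>bs. set bs \<subseteq> Basis \<Longrightarrow> iterated_derivative bs f z = 0"
  shows "vanishes k z f"
  using assms
proof (induction k arbitrary: f)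
  case 0
  then show ?case using 0[of "[]"] by simp
next
  case (Suc k)
  have "vanishes k z (\<lambda>x. frechet_derivative f (at x) b)" if "b \<in> Basis" for b
    by (rule Suc.IH) (use Suc.prems[of "b # _"] that in simp)
  then show ?case using Suc.prems[of "[]"] by simp
qed

text \<open>At a zero that is not flat, some iterated derivative vanishes while one of its own
  partial derivatives does not. There are countably many lists of directions, and each of them gives
  a null set by \<open>zero_regular_negligible\<close>.\<close>

lemma zero_not_flat_negligible:
  fixes f :: "'a::euclidean_space \<Rightarrow> real"
  assumes "smooth_on S f"
  shows "negligible {z\<in>S. f z = 0 \<and> \<not> flat z f}"
proof -
  define L where "L = lists (Basis :: 'a set)"
  have cL: "countable L" unfolding L_def by (rule countable_lists) (rule countable_finite[OF finite_Basis])
  define N where "N = (\<Union>(bs,b)\<in>L \<times> Basis. {z\<in>S. iterated_derivative bs f z = 0 \<and> frechet_derivative (iterated_derivative bs f) (at z) b \<noteq> 0})"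
  have "negligible N" unfolding N_def
  proof (intro negligible_countable_Union countable_image)
    show "countable (L \<times> (Basis :: 'a set))" using cL countable_finite[OF finite_Basis] by (rule countable_SIGMA)
  qed (auto intro!: zero_regular_negligible smooth_on_iterated_derivative assms)
  moreover have "{z\<in>S. f z = 0 \<and> \<not> flat z f} \<subseteq> N"
  proof
    fix z assume z: "z \<in> {z\<in>S. f z = 0 \<and> \<not> flat z f}"
    show "z \<in> N"
    proof (rule ccontr)
      assume nN: "z \<notin> N"
      have "iterated_derivative bs f z = 0" if "set bs \<subseteq> Basis" for bs
        using that
      proof (induction bs rule: rev_induct)
        case (snoc b bs)
        then have "iterated_derivative bs f z = 0" "bs \<in> L" "b \<in> Basis" by (auto simp: L_def)
        then show ?case using nN z by (auto simp: N_def iterated_derivative_snoc)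
      qed (use z in simp)
      then have "flat z f" unfolding flat_def using vanishes_iterated by blast
      then show False using z by simp
    qed
  qed
  ultimately show ?thesis by (rule negligible_subset)
qed

text \<open>Cartan's formula \<alpha>([X, Y]) = X(\<alpha>(Y)) - Y(\<alpha>(X)) - d\<alpha>(X, Y).
  Derivatives of flat functions are flat. The last term is flat because \<open>dform_rep\<close>
  writes \<open>al x \<bullet> al x\<close> times it through \<alpha>(X), \<alpha>(Y) and the
  components of Z, and the nonzero factor can be cancelled. Flatness, unlike vanishing to a finite
  order, is not lost from one bracket to the next.\<close>

lemma bracket_flat:
  fixes al X Y :: "real^4 \<Rightarrow> real^4"
  assumes S: "open S" "z \<in> S" and sm: "smooth_on S al" "smooth_on S X" "smooth_on S Y"
    and nz: "al z \<noteq> 0" and Z: "\<And>i. flat z (\<lambda>x. charfield al x $ i)"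
    and fX: "flat z (\<lambda>x. al x \<bullet> X x)" and fY: "flat z (\<lambda>x. al x \<bullet> Y x)"
  shows "flat z (\<lambda>x. al x \<bullet> (frechet_derivative Y (at x) (X x) - frechet_derivative X (at x) (Y x)))"
proof -
  define u where "u x = al x \<bullet> X x" for x
  define w where "w x = al x \<bullet> Y x" for x
  define d where "d v w x = dform (jac al x) (v x) (w x)" for v w :: "real^4 \<Rightarrow> real^4" and x
  have su: "smooth_on S u" and sw: "smooth_on S w" unfolding u_def[abs_def] w_def[abs_def] by (intro smooth_on_inner sm S(1))+
  have sd: "smooth_on S (d v w)" if "smooth_on S v" "smooth_on S w" for v w
  proof -
    have 1: "smooth_on S (\<lambda>x. frechet_derivative al (at x) (v x) \<bullet> w x - frechet_derivative al (at x) (w x) \<bullet> v x)"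
      by (intro smooth_on_diff smooth_on_inner smooth_on_derivative_along sm that S(1))
    show ?thesis by (rule smooth_on_cong[OF S(1) _ 1]) (simp add: d_def dform_def jac_mult[OF sm(1)])
  qed
  have sZ: "smooth_on S (\<lambda>x. charfield al x $ i)" for i by (intro smooth_on_component smooth_on_charfield sm S(1))
  have fd: "flat z (d X Y)"
  proof (rule flat_cancel[OF S])
    show "smooth_on S (\<lambda>x. al x \<bullet> al x)" by (intro smooth_on_inner sm S(1))
    show "al z \<bullet> al z \<noteq> 0" using nz by simp
    show "smooth_on S (d X Y)" using sd sm by blast
    note si = smooth_on_diff smooth_on_add smooth_on_mult sd su sw sZ sm S(1) smooth_on_component
    have "flat z (\<lambda>x. u x * d al Y x - w x * d al X x
      + charfield al x $ 1 * ((al x$2*(X x$3*Y x$4-X x$4*Y x$3)) - al x$3*(X x$2*Y x$4-X x$4*Y x$2) + al x$4*(X x$2*Y x$3-X x$3*Y x$2))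
      - charfield al x $ 2 * ((al x$1*(X x$3*Y x$4-X x$4*Y x$3)) - al x$3*(X x$1*Y x$4-X x$4*Y x$1) + al x$4*(X x$1*Y x$3-X x$3*Y x$1))
      + charfield al x $ 3 * ((al x$1*(X x$2*Y x$4-X x$4*Y x$2)) - al x$2*(X x$1*Y x$4-X x$4*Y x$1) + al x$4*(X x$1*Y x$2-X x$2*Y x$1))
      - charfield al x $ 4 * ((al x$1*(X x$2*Y x$3-X x$3*Y x$2)) - al x$2*(X x$1*Y x$3-X x$3*Y x$1) + al x$3*(X x$1*Y x$2-X x$2*Y x$1)))"
      by (intro flat_diff[OF S] flat_add[OF S] flat_mult[OF S] Z fX[folded u_def] fY[folded w_def] si)
    then show "flat z (\<lambda>x. d X Y x * (al x \<bullet> al x))"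
    proof (rule flat_cong[OF S, rotated])
      fix x assume "x \<in> S"
      show "u x * d al Y x - w x * d al X x
      + charfield al x $ 1 * ((al x$2*(X x$3*Y x$4-X x$4*Y x$3)) - al x$3*(X x$2*Y x$4-X x$4*Y x$2) + al x$4*(X x$2*Y x$3-X x$3*Y x$2))
      - charfield al x $ 2 * ((al x$1*(X x$3*Y x$4-X x$4*Y x$3)) - al x$3*(X x$1*Y x$4-X x$4*Y x$1) + al x$4*(X x$1*Y x$3-X x$3*Y x$1))
      + charfield al x $ 3 * ((al x$1*(X x$2*Y x$4-X x$4*Y x$2)) - al x$2*(X x$1*Y x$4-X x$4*Y x$1) + al x$4*(X x$1*Y x$2-X x$2*Y x$1))
      - charfield al x $ 4 * ((al x$1*(X x$2*Y x$3-X x$3*Y x$2)) - al x$2*(X x$1*Y x$3-X x$3*Y x$1) + al x$3*(X x$1*Y x$2-X x$2*Y x$1))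
       = d X Y x * (al x \<bullet> al x)"
        unfolding u_def w_def d_def charfield_def using dform_rep[of "al x" "jac al x" "X x" "Y x"] by (simp only: mult.commute[of "dform (jac al x) (X x) (Y x)"])
    qed
  qed
  have fw: "flat z (\<lambda>x. frechet_derivative w (at x) (X x))" by (rule flat_derivative_along[OF S sw fY[folded w_def] sm(2)])
  have fu: "flat z (\<lambda>x. frechet_derivative u (at x) (Y x))" by (rule flat_derivative_along[OF S su fX[folded u_def] sm(3)])
  have "flat z (\<lambda>x. frechet_derivative w (at x) (X x) - frechet_derivative u (at x) (Y x) - d X Y x)"
    by (intro flat_diff[OF S] fw fu fd smooth_on_diff smooth_on_derivative_along su sw sm S(1) sd)
  then show ?thesis
  proof (rule flat_cong[OF S, rotated])
    fix x assume x: "x \<in> S"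
    note D = smooth_on_has_derivative[OF sm(1) x] smooth_on_has_derivative[OF sm(2) x] smooth_on_has_derivative[OF sm(3) x]
    have "frechet_derivative w (at x) h = al x \<bullet> frechet_derivative Y (at x) h + frechet_derivative al (at x) h \<bullet> Y x" for h
      unfolding w_def[abs_def] using frechet_derivative_eqI[OF has_derivative_inner[OF D(1,3)]] by simp
    moreover have "frechet_derivative u (at x) h = al x \<bullet> frechet_derivative X (at x) h + frechet_derivative al (at x) h \<bullet> X x" for h
      unfolding u_def[abs_def] using frechet_derivative_eqI[OF has_derivative_inner[OF D(1,2)]] by simp
    ultimately show "frechet_derivative w (at x) (X x) - frechet_derivative u (at x) (Y x) - d X Y x =
      al x \<bullet> (frechet_derivative Y (at x) (X x) - frechet_derivative X (at x) (Y x))"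
      by (simp add: d_def dform_def jac_mult[OF sm(1) x] inner_diff_right)
  qed
qed

section \<open>Lipschitz bounds on balls and change of coordinates\<close>

lemma smooth_on_ident: "smooth_on S (\<lambda>x. x)"
proof -
  have "tcd k S (\<lambda>x. x)" for k by (cases k) (auto intro: tcd_const)
  then show ?thesis by (simp add: smooth_on_def)
qed

lemma smooth_on_Pair:
  assumes "open S" "smooth_on S f" "smooth_on S g"
  shows "smooth_on S (\<lambda>x. (f x, g x))"
proof -
  have l: "bounded_linear (\<lambda>u::'b. (u, 0::'c))" "bounded_linear (\<lambda>u::'c. (0::'b, u))"
    by (intro bounded_linear_Pair bounded_linear_ident bounded_linear_zero)+
  have "smooth_on S (\<lambda>x. (f x, 0) + (0, g x))"
    by (intro smooth_on_add[OF assms(1)] smooth_on_bounded_linear[OF assms(1) l(1) assms(2)] smooth_on_bounded_linear[OF assms(1) l(2) assms(3)])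
  then show ?thesis by simp
qed

lemma smooth_on_tcd2: "smooth_on S f \<Longrightarrow> tcd 2 S f"
  unfolding smooth_on_def by (rule spec)

lemma smooth_on_lipschitz_cball:
  fixes f :: "'a::euclidean_space \<Rightarrow> 'b::real_normed_vector"
  assumes "smooth_on S f" "cball z r \<subseteq> S"
  obtains B where "B > 0" "\<forall>x\<in>cball z r. \<forall>y\<in>cball z r. norm (f x - f y) \<le> B * norm (x - y)"
proof -
  have "\<exists>B. \<forall>x\<in>cball z r. norm (frechet_derivative f (at x) b) \<le> B" for b
  proof -
    have "continuous_on (cball z r) (\<lambda>x. frechet_derivative f (at x) b)"
      using smooth_on_continuous[OF smooth_on_derivative[OF assms(1)]] assms(2) continuous_on_subset by blast
    then have "bounded ((\<lambda>x. frechet_derivative f (at x) b) ` cball z r)"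
      by (intro compact_imp_bounded compact_continuous_image compact_cball)
    then show ?thesis unfolding bounded_iff by auto
  qed
  then obtain Bb where Bb: "\<And>b x. x \<in> cball z r \<Longrightarrow> norm (frechet_derivative f (at x) b) \<le> Bb b" by metis
  define B where "B = (\<Sum>b\<in>Basis. \<bar>Bb b\<bar>) + 1"
  have B: "B > 0" unfolding B_def by (intro add_nonneg_pos sum_nonneg) auto
  show ?thesis
  proof (rule that[OF B], intro ballI)
    fix x y assume xy: "x \<in> cball z r" "y \<in> cball z r"
    show "norm (f x - f y) \<le> B * norm (x - y)"
    proof (rule differentiable_bound[OF convex_cball _ _ xy(1) xy(2)])
      fix u assume u: "u \<in> cball z r"
      have d: "(f has_derivative frechet_derivative f (at u)) (at u)"
        using smooth_on_has_derivative[OF assms(1)] u assms(2) by auto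
      then show "(f has_derivative frechet_derivative f (at u)) (at u within cball z r)" by (rule has_derivative_at_withinI)
      have l: "linear (frechet_derivative f (at u))" using d by (rule has_derivative_linear)
      have "norm (frechet_derivative f (at u) h) \<le> B * norm h" for h
      proof -
        have "frechet_derivative f (at u) h = frechet_derivative f (at u) (\<Sum>b\<in>Basis. (h \<bullet> b) *\<^sub>R b)"
          by (simp add: euclidean_representation)
        also have "\<dots> = (\<Sum>b\<in>Basis. (h \<bullet> b) *\<^sub>R frechet_derivative f (at u) b)"
          using l by (simp add: linear_sum linear_scale)
        finally have "norm (frechet_derivative f (at u) h) \<le> (\<Sum>b\<in>Basis. norm ((h \<bullet> b) *\<^sub>R frechet_derivative f (at u) b))"
          by (metis norm_sum)
        also have "\<dots> \<le> (\<Sum>b\<in>Basis. norm h * \<bar>Bb b\<bar>)"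
        proof (rule sum_mono)
          fix b :: 'a assume b: "b \<in> Basis"
          have "\<bar>h \<bullet> b\<bar> * norm (frechet_derivative f (at u) b) \<le> norm h * \<bar>Bb b\<bar>"
            using Basis_le_norm[OF b, of h] Bb[OF u, of b] by (intro mult_mono) auto
          then show "norm ((h \<bullet> b) *\<^sub>R frechet_derivative f (at u) b) \<le> norm h * \<bar>Bb b\<bar>" by simp
        qed
        also have "\<dots> = norm h * (\<Sum>b\<in>Basis. \<bar>Bb b\<bar>)" by (simp add: sum_distrib_left)
        also have "\<dots> \<le> norm h * B" by (intro mult_left_mono) (auto simp: B_def)
        finally show ?thesis by (simp add: mult.commute)
      qed
      then show "onorm (frechet_derivative f (at u)) \<le> B" by (rule onorm_le)
    qed
  qed
qed

text \<open>A division-free way to say that \<open>g\<close> is a multiple of \<open>a\<close>; it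
  can be differentiated without discussing the differentiability of the factor.\<close>

lemma inner_zero_imp_parallel:
  fixes g a e :: "'a::real_inner"
  assumes "\<And>e. a \<bullet> e = 0 \<Longrightarrow> g \<bullet> e = 0"
  shows "(a \<bullet> a) * (g \<bullet> e) = (g \<bullet> a) * (a \<bullet> e)"
proof -
  have "a \<bullet> ((a \<bullet> a) *\<^sub>R e - (a \<bullet> e) *\<^sub>R a) = 0" by (simp add: inner_diff_right)
  from assms[OF this] show ?thesis by (simp add: inner_diff_right algebra_simps)
qed

text \<open>If the one-form \<open>\<alpha>'\<close> pulls back along \<open>T\<close> to a multiple of \<open>\<alpha>\<close>, then \<open>d\<alpha>\<close> and
  the pull-back of \<open>d\<alpha>'\<close> are proportional on the kernel of \<open>\<alpha>\<close>.\<close>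

lemma characteristic_transport:
  fixes T al al' :: "real^4 \<Rightarrow> real^4"
  assumes S: "open S" "z \<in> S" and T: "smooth_on S T"
    and S': "T ` S \<subseteq> S'" and al: "smooth_on S al" "smooth_on S' al'"
    and nz: "al z \<noteq> 0"
    and iff: "\<And>y e. y \<in> S \<Longrightarrow> al y \<bullet> e = 0 \<longleftrightarrow> al' (T y) \<bullet> frechet_derivative T (at y) e = 0"
    and surj: "surj (frechet_derivative T (at z))"
    and ch: "characteristic (al z) (jac al z) v"
  shows "characteristic (al' (T z)) (jac al' (T z)) (frechet_derivative T (at z) v)"
proof -
  define DT where "DT y = frechet_derivative T (at y)" for y
  define D2 where "D2 e = frechet_derivative (\<lambda>y. DT y e) (at z)" for e
  have dT: "(T has_derivative DT y) (at y)" if "y \<in> S" for y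
    unfolding DT_def by (rule smooth_on_has_derivative[OF T that])
  have dDT: "((\<lambda>y. DT y e) has_derivative D2 e) (at z)" for e
    unfolding D2_def DT_def by (rule smooth_on_has_derivative[OF smooth_on_derivative[OF T] S(2)])
  have sym: "D2 e h = D2 h e" for e h
    unfolding D2_def DT_def by (rule second_derivative_symmetric[OF S smooth_on_tcd2[OF T]])
  have Tz: "T z \<in> S'" using S' S by auto
  define a' where "a' y = al' (T y)" for y
  have da': "(a' has_derivative (\<lambda>h. jac al' (T z) *v DT z h)) (at z)"
    unfolding a'_def[abs_def] by (rule has_derivative_compose[OF dT[OF S(2)] jac_has_derivative[OF al(2) Tz]])
  have da: "(al has_derivative (*v) (jac al z)) (at z)" by (rule jac_has_derivative[OF al(1) S(2)])
  define g where "g e y = a' y \<bullet> DT y e" for e y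
  have dg: "(g e has_derivative (\<lambda>h. a' z \<bullet> D2 e h + (jac al' (T z) *v DT z h) \<bullet> DT z e)) (at z)" for e
    unfolding g_def[abs_def] by (rule has_derivative_inner[OF da' dDT])
  have glin: "linear (DT y)" if "y \<in> S" for y using dT[OF that] by (rule has_derivative_linear)
  have id: "(al y \<bullet> al y) * g e y = (\<Sum>b\<in>Basis. g b y * (al y \<bullet> b)) * (al y \<bullet> e)" if y: "y \<in> S" for e y
  proof -
    define G where "G = (\<Sum>b\<in>Basis. g b y *\<^sub>R b)"
    have G: "G \<bullet> e = g e y" for e
    proof -
      have "g e y = a' y \<bullet> DT y (\<Sum>b\<in>Basis. (e \<bullet> b) *\<^sub>R b)" by (simp add: g_def euclidean_representation)
      also have "\<dots> = (\<Sum>b\<in>Basis. (e \<bullet> b) * g b y)"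
        using glin[OF y] by (simp add: linear_sum linear_scale inner_sum_right g_def)
      finally show ?thesis by (simp add: G_def inner_sum_right inner_commute[of _ e] mult.commute)
    qed
    have "G \<bullet> e = 0" if "al y \<bullet> e = 0" for e using iff[OF y] that by (simp add: G g_def a'_def DT_def)
    from inner_zero_imp_parallel[of "al y" G e, OF this]
    have "(al y \<bullet> al y) * g e y = (G \<bullet> al y) * (al y \<bullet> e)" by (simp add: G)
    moreover have "G \<bullet> al y = (\<Sum>b\<in>Basis. g b y * (al y \<bullet> b))" by (simp add: G_def inner_sum_right inner_commute[of _ "al y"])
    ultimately show ?thesis by simp
  qed
  \<comment> \<open>The factor between the pulled-back form and \<alpha>, multiplied by
    \<open>al y \<bullet> al y\<close>; as an explicit sum it is visibly differentiable.\<close>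
  define \<mu> where "\<mu> y = (\<Sum>b\<in>Basis. g b y * (al y \<bullet> b))" for y
  have dmu: "\<exists>\<mu>'. (\<mu> has_derivative \<mu>') (at z)"
    unfolding \<mu>_def[abs_def] using dg da by (intro exI) (rule has_derivative_sum, rule has_derivative_mult[OF dg], rule has_derivative_inner_left, rule da)
  then obtain \<mu>' where mu': "(\<mu> has_derivative \<mu>') (at z)" by auto
  \<comment> \<open>For \<open>e\<close> in the kernel of \<alpha> the terms with
    \<open>g e z\<close> and \<open>\<mu>'\<close> drop out. The term with \<open>D2 e h\<close> is
    symmetric in \<open>e\<close> and \<open>h\<close> and disappears when two such equations are
    subtracted to form d\<alpha>.\<close>
  have prop': "(al z \<bullet> al z) * (a' z \<bullet> D2 e h + (jac al' (T z) *v DT z h) \<bullet> DT z e) = \<mu> z * ((jac al z *v h) \<bullet> e)"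
    if e: "al z \<bullet> e = 0" for e h
  proof -
    have ge: "g e z = 0" using iff[OF S(2)] e by (simp add: g_def a'_def DT_def)
    have d1: "((\<lambda>y. (al y \<bullet> al y) * g e y) has_derivative (\<lambda>h. (al z \<bullet> al z) * (a' z \<bullet> D2 e h + (jac al' (T z) *v DT z h) \<bullet> DT z e) + (al z \<bullet> (jac al z *v h) + (jac al z *v h) \<bullet> al z) * g e z)) (at z)"
      by (rule has_derivative_mult[OF has_derivative_inner[OF da da] dg])
    have d2: "((\<lambda>y. \<mu> y * (al y \<bullet> e)) has_derivative (\<lambda>h. \<mu> z * ((jac al z *v h) \<bullet> e) + \<mu>' h * (al z \<bullet> e))) (at z)"
      by (rule has_derivative_mult[OF mu' has_derivative_inner_left[OF da]])
    have d2': "((\<lambda>y. (al y \<bullet> al y) * g e y) has_derivative (\<lambda>h. \<mu> z * ((jac al z *v h) \<bullet> e) + \<mu>' h * (al z \<bullet> e))) (at z)"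
      by (rule has_derivative_transform_within_open[OF d2 S]) (simp add: id \<mu>_def)
    from has_derivative_unique[OF d1 d2'] show ?thesis using ge e by (simp add: fun_eq_iff)
  qed
  have av: "al z \<bullet> v = 0" and dv: "\<And>w. al z \<bullet> w = 0 \<Longrightarrow> dform (jac al z) v w = 0"
    using ch by (auto simp: characteristic_def)
  show ?thesis unfolding characteristic_def DT_def[symmetric]
  proof (intro conjI allI impI)
    show "al' (T z) \<bullet> DT z v = 0" using iff[OF S(2)] av by (simp add: DT_def)
    fix w' assume w': "al' (T z) \<bullet> w' = 0"
    obtain w where w: "w' = DT z w" using surj unfolding DT_def by (metis surjD)
    have aw: "al z \<bullet> w = 0" using iff[OF S(2)] w' w by (simp add: DT_def)
    have "(al z \<bullet> al z) * dform (jac al' (T z)) (DT z v) (DT z w) = \<mu> z * dform (jac al z) v w"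
      using prop'[OF aw, of v] prop'[OF av, of w] sym[of w v] by (simp add: dform_def algebra_simps)
    then show "dform (jac al' (T z)) (DT z v) w' = 0" using dv[OF aw] nz w by simp
  qed
qed

section \<open>Charts\<close>

locale atlas =
  fixes A :: "('m::{t2_space, second_countable_topology}, real^4) chart set"
  assumes atlas: "smooth_atlas A"
begin

lemma chart_open: "c \<in> A \<Longrightarrow> open (fst c)" and chart_image_open: "c \<in> A \<Longrightarrow> open (snd c ` fst c)"
  and chart_homeo: "c \<in> A \<Longrightarrow> homeomorphism (fst c) (snd c ` fst c) (snd c) (chart_inv c)"
  using atlas by (auto simp: smooth_atlas_def)

lemma chart_cover: "\<exists>c\<in>A. x \<in> fst c"
  using atlas by (auto simp: smooth_atlas_def)

lemma chart_inv_chart [simp]: "c \<in> A \<Longrightarrow> x \<in> fst c \<Longrightarrow> chart_inv c (snd c x) = x"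
  using chart_homeo homeomorphism_apply1 by fastforce

lemma chart_inv_in: "c \<in> A \<Longrightarrow> z \<in> snd c ` fst c \<Longrightarrow> chart_inv c z \<in> fst c"
  by auto

lemma chart_cont: "c \<in> A \<Longrightarrow> continuous_on (fst c) (snd c)"
  and chart_inv_cont: "c \<in> A \<Longrightarrow> continuous_on (snd c ` fst c) (chart_inv c)"
  using chart_homeo unfolding homeomorphism_def by auto

lemma chart_image_open_sub:
  assumes "c \<in> A" "open W" shows "open (snd c ` (W \<inter> fst c))"
proof -
  have "snd c ` (W \<inter> fst c) = snd c ` fst c \<inter> chart_inv c -` W"
    using assms(1) by (auto simp: image_iff)
  then show ?thesis
    using continuous_open_preimage[OF chart_inv_cont[OF assms(1)] chart_image_open[OF assms(1)] assms(2)] by simp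
qed

lemma chart_preimage_open:
  assumes "c \<in> A" "open U" shows "open {x \<in> fst c. snd c x \<in> U}"
proof -
  have "{x \<in> fst c. snd c x \<in> U} = fst c \<inter> snd c -` U" by auto
  then show ?thesis using continuous_open_preimage[OF chart_cont[OF assms(1)] chart_open[OF assms(1)] assms(2)] by simp
qed

definition overlap :: "('m, real^4) chart \<Rightarrow> ('m, real^4) chart \<Rightarrow> (real^4) set" where
  "overlap c c' = snd c ` (fst c \<inter> fst c')"

lemma overlap_open: "c \<in> A \<Longrightarrow> c' \<in> A \<Longrightarrow> open (overlap c c')"
  unfolding overlap_def using chart_image_open_sub[of c "fst c'"] chart_open[of c'] by (simp add: Int_commute)

lemma transition_smooth: "c \<in> A \<Longrightarrow> c' \<in> A \<Longrightarrow> smooth_on (overlap c c') (transition c c')"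
  using atlas by (auto simp: smooth_atlas_def overlap_def)

lemma transition_eq: "c \<in> A \<Longrightarrow> x \<in> fst c \<Longrightarrow> transition c c' (snd c x) = snd c' x"
  by (simp add: transition_def)

lemma overlap_in: "x \<in> fst c \<Longrightarrow> x \<in> fst c' \<Longrightarrow> snd c x \<in> overlap c c'"
  by (auto simp: overlap_def)

definition dtrans :: "('m, real^4) chart \<Rightarrow> ('m, real^4) chart \<Rightarrow> 'm \<Rightarrow> real^4 \<Rightarrow> real^4" where
  "dtrans c c' x = frechet_derivative (transition c c') (at (snd c x))"

lemma dtrans_has_derivative:
  "c \<in> A \<Longrightarrow> c' \<in> A \<Longrightarrow> x \<in> fst c \<Longrightarrow> x \<in> fst c' \<Longrightarrow> (transition c c' has_derivative dtrans c c' x) (at (snd c x))"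
  unfolding dtrans_def by (rule smooth_on_has_derivative[OF transition_smooth overlap_in])

lemma dtrans_linear: "c \<in> A \<Longrightarrow> c' \<in> A \<Longrightarrow> x \<in> fst c \<Longrightarrow> x \<in> fst c' \<Longrightarrow> linear (dtrans c c' x)"
  using dtrans_has_derivative has_derivative_linear by blast

lemma dtrans_cocycle:
  assumes "c \<in> A" "c' \<in> A" "c'' \<in> A" "x \<in> fst c" "x \<in> fst c'" "x \<in> fst c''"
  shows "dtrans c' c'' x (dtrans c c' x e) = dtrans c c'' x e"
proof -
  have d: "(transition c' c'' has_derivative dtrans c' c'' x) (at (transition c c' (snd c x)))"
    using dtrans_has_derivative[of c' c'' x] assms by (simp add: transition_eq)
  have 1: "((\<lambda>z. transition c' c'' (transition c c' z)) has_derivative (\<lambda>e. dtrans c' c'' x (dtrans c c' x e))) (at (snd c x))"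
    by (rule has_derivative_compose[OF dtrans_has_derivative d]) (use assms in auto)
  have "open (snd c ` ((fst c' \<inter> fst c'') \<inter> fst c))" using assms by (intro chart_image_open_sub open_Int chart_open)
  then have "(transition c c'' has_derivative (\<lambda>e. dtrans c' c'' x (dtrans c c' x e))) (at (snd c x))"
    by (rule has_derivative_transform_within_open[OF 1]) (use assms in \<open>auto simp: transition_eq\<close>)
  from frechet_derivative_eqI[OF this] show ?thesis by (simp add: dtrans_def)
qed

lemma dtrans_self:
  assumes "c \<in> A" "x \<in> fst c" shows "dtrans c c x e = e"
proof -
  have "(transition c c has_derivative (\<lambda>e. e)) (at (snd c x))"
    by (rule has_derivative_transform_within_open[OF has_derivative_ident chart_image_open[OF assms(1)]])
      (use assms in \<open>auto simp: transition_eq\<close>)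
  from frechet_derivative_eqI[OF this] show ?thesis by (simp add: dtrans_def)
qed

lemma dtrans_surj: "c \<in> A \<Longrightarrow> c' \<in> A \<Longrightarrow> x \<in> fst c \<Longrightarrow> x \<in> fst c' \<Longrightarrow> surj (dtrans c c' x)"
  by (rule surjI[of _ "dtrans c' c x"]) (simp add: dtrans_cocycle dtrans_self)

lemma tangent_transform:
  "v \<in> tangent_space A x \<Longrightarrow> c \<in> A \<Longrightarrow> c' \<in> A \<Longrightarrow> x \<in> fst c \<Longrightarrow> x \<in> fst c' \<Longrightarrow> v c' = dtrans c c' x (v c)"
  unfolding tangent_space_def dtrans_def by blast

lemma tangent_outside: "v \<in> tangent_space A x \<Longrightarrow> c \<notin> A \<or> x \<notin> fst c \<Longrightarrow> v c = 0"
  unfolding tangent_space_def by blast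

lemma tangentI:
  assumes "\<And>c. c \<notin> A \<or> x \<notin> fst c \<Longrightarrow> v c = 0"
    and "\<And>c c'. c \<in> A \<Longrightarrow> c' \<in> A \<Longrightarrow> x \<in> fst c \<Longrightarrow> x \<in> fst c' \<Longrightarrow> v c' = dtrans c c' x (v c)"
  shows "v \<in> tangent_space A x"
  unfolding tangent_space_def dtrans_def[symmetric] using assms by blast

lemma coord_vector_nth: "c' \<in> A \<Longrightarrow> x \<in> fst c' \<Longrightarrow> coord_vector A c x e c' = dtrans c c' x e"
  by (simp add: coord_vector_def dtrans_def)

lemma coord_vector_tangent:
  assumes "c \<in> A" "x \<in> fst c" shows "coord_vector A c x e \<in> tangent_space A x"
proof (rule tangentI)
  fix c' assume "c' \<notin> A \<or> x \<notin> fst c'" then show "coord_vector A c x e c' = 0" unfolding coord_vector_def by auto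
next
  fix c' c'' assume "c' \<in> A" "c'' \<in> A" "x \<in> fst c'" "x \<in> fst c''"
  then show "coord_vector A c x e c'' = dtrans c' c'' x (coord_vector A c x e c')"
    using assms by (simp add: coord_vector_nth dtrans_cocycle)
qed

lemma coord_vector_self: "c \<in> A \<Longrightarrow> x \<in> fst c \<Longrightarrow> coord_vector A c x e c = e"
  by (simp add: coord_vector_nth dtrans_self)

lemma tangent_eqI:
  assumes "v \<in> tangent_space A x" "w \<in> tangent_space A x" "c \<in> A" "x \<in> fst c" "v c = w c"
  shows "v = w"
proof
  fix c'
  show "v c' = w c'"
  proof (cases "c' \<in> A \<and> x \<in> fst c'")
    case True then show ?thesis using tangent_transform[OF assms(1), of c c'] tangent_transform[OF assms(2), of c c'] assms by simp
  next
    case False then show ?thesis using tangent_outside[OF assms(1)] tangent_outside[OF assms(2)] by auto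
  qed
qed

lemma tangent_coord: "v \<in> tangent_space A x \<Longrightarrow> c \<in> A \<Longrightarrow> x \<in> fst c \<Longrightarrow> coord_vector A c x (v c) = v"
  by (rule tangent_eqI[OF coord_vector_tangent]) (auto simp: coord_vector_self)

lemma subspace_tangent: "subspace (tangent_space A x)"
  unfolding subspace_def
proof (intro conjI ballI allI)
  show "0 \<in> tangent_space A x"
    by (rule tangentI) (simp_all add: linear_0[OF dtrans_linear])
  show "v + w \<in> tangent_space A x" if v: "v \<in> tangent_space A x" and w: "w \<in> tangent_space A x" for v w
  proof (rule tangentI)
    fix c assume "c \<notin> A \<or> x \<notin> fst c"
    then show "(v + w) c = 0" using tangent_outside[OF v] tangent_outside[OF w] by simp
  next
    fix c c' assume c: "c \<in> A" "c' \<in> A" "x \<in> fst c" "x \<in> fst c'"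
    show "(v + w) c' = dtrans c c' x ((v + w) c)"
      using tangent_transform[OF v c] tangent_transform[OF w c] by (simp add: linear_add[OF dtrans_linear[OF c]])
  qed
  show "r *\<^sub>R v \<in> tangent_space A x" if v: "v \<in> tangent_space A x" for r v
  proof (rule tangentI)
    fix c assume "c \<notin> A \<or> x \<notin> fst c"
    then show "(r *\<^sub>R v) c = 0" using tangent_outside[OF v] by (simp add: scaleR_fun_def)
  next
    fix c c' assume c: "c \<in> A" "c' \<in> A" "x \<in> fst c" "x \<in> fst c'"
    show "(r *\<^sub>R v) c' = dtrans c c' x ((r *\<^sub>R v) c)"
      using tangent_transform[OF v c] by (simp add: scaleR_fun_def linear_scale[OF dtrans_linear[OF c]])
  qed
qed

lemma curve_chart_change:
  assumes c: "c \<in> A" "c' \<in> A" "\<gamma> t \<in> fst c" "\<gamma> t \<in> fst c'" and ev: "open I" "t \<in> I" "\<And>s. s \<in> I \<Longrightarrow> \<gamma> s \<in> fst c"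
    and d: "((snd c \<circ> \<gamma>) has_vector_derivative w) (at t)"
  shows "((snd c' \<circ> \<gamma>) has_vector_derivative dtrans c c' (\<gamma> t) w) (at t)"
proof -
  have "(transition c c' \<circ> (snd c \<circ> \<gamma>) has_derivative dtrans c c' (\<gamma> t) \<circ> (\<lambda>h. h *\<^sub>R w)) (at t)"
    using d dtrans_has_derivative[OF c] unfolding has_vector_derivative_def by (intro diff_chain_at) auto
  moreover have "dtrans c c' (\<gamma> t) \<circ> (\<lambda>h. h *\<^sub>R w) = (\<lambda>h. h *\<^sub>R dtrans c c' (\<gamma> t) w)"
    by (simp add: fun_eq_iff linear_scale[OF dtrans_linear[OF c]])
  ultimately have "(transition c c' \<circ> (snd c \<circ> \<gamma>) has_vector_derivative dtrans c c' (\<gamma> t) w) (at t)"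
    by (simp add: has_vector_derivative_def)
  then show ?thesis
    by (rule has_vector_derivative_transform_within_open[OF _ ev(1,2)]) (use ev(3) c(1) in \<open>simp add: transition_eq\<close>)
qed

section \<open>The cotangent bundle in coordinates\<close>

definition covec :: "('m, real^4) chart \<Rightarrow> 'm \<Rightarrow> real^4 \<Rightarrow> ('m, real^4) covec" where
  "covec c x q = (\<lambda>v. if v \<in> tangent_space A x then q \<bullet> v c else 0)"

definition covec_coord :: "('m, real^4) chart \<Rightarrow> 'm \<Rightarrow> ('m, real^4) covec \<Rightarrow> real^4" where
  "covec_coord c x p = (\<Sum>b\<in>Basis. p (coord_vector A c x b) *\<^sub>R b)"

lemma cotangent_chart_eq: "snd (cotangent_chart A c) (x, p) = (snd c x, covec_coord c x p)"
  by (simp add: cotangent_chart_def covec_coord_def)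

lemma covec_cotangent: "covec c x q \<in> cotangent_space A x"
proof -
  note [simp] = subspace_add[OF subspace_tangent] subspace_scale[OF subspace_tangent]
  have "covec c x q (v + w) = covec c x q v + covec c x q w" if "v \<in> tangent_space A x" "w \<in> tangent_space A x" for v w
    using that by (simp add: covec_def inner_add_right)
  moreover have "covec c x q (r *\<^sub>R v) = r * covec c x q v" if "v \<in> tangent_space A x" for r v
  proof -
    have "(r *\<^sub>R v) c = r *\<^sub>R v c" by (simp add: scaleR_fun_def)
    then show ?thesis using that by (simp add: covec_def)
  qed
  ultimately show ?thesis unfolding cotangent_space_def by (auto simp: covec_def)
qed

lemma covec_coord_covec:
  assumes "c \<in> A" "x \<in> fst c" shows "covec_coord c x (covec c x q) = q"
  using assms by (simp add: covec_coord_def covec_def coord_vector_tangent coord_vector_self euclidean_representation)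

lemma covec_rep:
  assumes p: "p \<in> cotangent_space A x" and c: "c \<in> A" "x \<in> fst c" and v: "v \<in> tangent_space A x"
  shows "p v = covec_coord c x p \<bullet> v c"
proof -
  have add: "p (v + w) = p v + p w" if "v \<in> tangent_space A x" "w \<in> tangent_space A x" for v w
    using p that by (auto simp: cotangent_space_def)
  have sc: "p (r *\<^sub>R v) = r * p v" if "v \<in> tangent_space A x" for r v
    using p that by (auto simp: cotangent_space_def)
  have cl: "coord_vector A c x (e + f) = coord_vector A c x e + coord_vector A c x f" for e f
    by (rule tangent_eqI[OF coord_vector_tangent[OF c] subspace_add[OF subspace_tangent coord_vector_tangent[OF c] coord_vector_tangent[OF c]] c])
      (simp add: coord_vector_self[OF c])
  have cs: "coord_vector A c x (r *\<^sub>R e) = r *\<^sub>R coord_vector A c x e" for r e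
    by (rule tangent_eqI[OF coord_vector_tangent[OF c] subspace_scale[OF subspace_tangent coord_vector_tangent[OF c]] c])
      (simp add: coord_vector_self[OF c] scaleR_fun_def)
  have "linear (\<lambda>e. p (coord_vector A c x e))"
    by (rule linearI) (simp_all add: cl cs add sc coord_vector_tangent[OF c])
  note l = this
  have "p v = p (coord_vector A c x (\<Sum>b\<in>Basis. (v c \<bullet> b) *\<^sub>R b))"
    by (simp add: euclidean_representation tangent_coord[OF v c])
  also have "\<dots> = (\<Sum>b\<in>Basis. (v c \<bullet> b) * p (coord_vector A c x b))"
    using linear_sum[OF l, of "\<lambda>b. (v c \<bullet> b) *\<^sub>R b" Basis] linear_scale[OF l] by simp
  finally show ?thesis by (simp add: covec_coord_def inner_sum_right inner_commute[of _ "v c"] mult.commute)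
qed

lemma covec_covec_coord:
  assumes p: "p \<in> cotangent_space A x" and c: "c \<in> A" "x \<in> fst c"
  shows "covec c x (covec_coord c x p) = p"
proof
  fix v show "covec c x (covec_coord c x p) v = p v"
    using covec_rep[OF p c, of v] p by (auto simp: covec_def cotangent_space_def)
qed

lemma covec_coord_change:
  assumes p: "p \<in> cotangent_space A x" and c: "c \<in> A" "x \<in> fst c" "c' \<in> A" "x \<in> fst c'"
  shows "covec_coord c x p \<bullet> e = covec_coord c' x p \<bullet> dtrans c c' x e"
proof -
  have "covec_coord c x p \<bullet> e = p (coord_vector A c x e)"
    using covec_rep[OF p c(1,2) coord_vector_tangent[OF c(1,2)], of e] by (simp add: coord_vector_self[OF c(1,2)])
  also have "\<dots> = covec_coord c' x p \<bullet> coord_vector A c x e c'"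
    by (rule covec_rep[OF p c(3,4) coord_vector_tangent[OF c(1,2)]])
  finally show ?thesis using c by (simp add: coord_vector_nth)
qed

end

lemma smooth_on_cross4:
  assumes "open S" "smooth_on S f" "smooth_on S g" "smooth_on S h"
  shows "smooth_on S (\<lambda>z. cross4 (f z) (g z) (h z))"
proof (rule smooth_on_vec[OF assms(1)])
  have m: "smooth_on S (\<lambda>z. f z $ i * (g z $ j * h z $ k - g z $ k * h z $ j))" for i j k
    by (intro smooth_on_mult smooth_on_diff smooth_on_component assms)
  have p: "smooth_on S (\<lambda>z. f z $ i * (g z $ j * h z $ k - g z $ k * h z $ j) - f z $ i' * (g z $ j' * h z $ k' - g z $ k' * h z $ j')
     + f z $ i'' * (g z $ j'' * h z $ k'' - g z $ k'' * h z $ j''))" for i j k i' j' k' i'' j'' k''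
    by (rule smooth_on_add[OF assms(1) smooth_on_diff[OF assms(1) m m] m])
  have "smooth_on S (\<lambda>x. cross4 (f x) (g x) (h x) $ 1)" "smooth_on S (\<lambda>x. cross4 (f x) (g x) (h x) $ 2)"
    "smooth_on S (\<lambda>x. cross4 (f x) (g x) (h x) $ 3)" "smooth_on S (\<lambda>x. cross4 (f x) (g x) (h x) $ 4)"
    unfolding cross4_def vector_4 by (rule p smooth_on_uminus[OF assms(1) p])+
  then show "smooth_on S (\<lambda>x. cross4 (f x) (g x) (h x) $ i)" for i using exhaust_4[of i] by auto
qed

section \<open>Annihilating one-forms in charts\<close>

locale corank_one = atlas A for A :: "('m::{t2_space, second_countable_topology}, real^4) chart set" +
  fixes \<Delta> :: "'m \<Rightarrow> ('m, real^4) tvec set"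
  assumes dist: "distribution A 3 \<Delta>" and nonhol: "totally_nonholonomic A \<Delta>"
begin

text \<open>The form is prescribed only through its kernel, so it is unique up to a nonvanishing
  factor; whatever is built from it has to be shown independent of this factor.\<close>

definition box :: "('m, real^4) chart \<Rightarrow> (real^4) set \<Rightarrow> (real^4 \<Rightarrow> real^4) \<Rightarrow> bool" where
  "box c U al \<longleftrightarrow> c \<in> A \<and> open U \<and> U \<subseteq> snd c ` fst c \<and> smooth_on U al \<and> (\<forall>z\<in>U. al z \<noteq> 0) \<and>
     (\<forall>x v. x \<in> fst c \<longrightarrow> snd c x \<in> U \<longrightarrow> v \<in> tangent_space A x \<longrightarrow> (v \<in> \<Delta> x \<longleftrightarrow> al (snd c x) \<bullet> v c = 0))"

lemma boxD:
  assumes "box c U al"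
  shows "c \<in> A" "open U" "U \<subseteq> snd c ` fst c" "smooth_on U al" "\<And>z. z \<in> U \<Longrightarrow> al z \<noteq> 0"
    and "\<And>x v. x \<in> fst c \<Longrightarrow> snd c x \<in> U \<Longrightarrow> v \<in> tangent_space A x \<Longrightarrow> v \<in> \<Delta> x \<longleftrightarrow> al (snd c x) \<bullet> v c = 0"
  using assms unfolding box_def by auto

lemma delta_tangent: "\<Delta> x \<subseteq> tangent_space A x" and delta_dim: "dim (\<Delta> x) = 3"
  using dist by (auto simp: distribution_def)

text \<open>The form is the cross product of a local frame in coordinates. A tangent vector is
  determined by its coordinates in one chart, and this carries the linear independence of the frame
  over to the coordinate vectors.\<close>

lemma box_exists:
  assumes c: "c \<in> A" "x \<in> fst c"
  obtains U al where "box c U al" "snd c x \<in> U"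
proof -
  obtain W X where W: "open W" "x \<in> W" and X: "\<And>i::nat. i < 3 \<Longrightarrow> smooth_vector_field A W (X i)"
    and sp: "\<And>y. y \<in> W \<Longrightarrow> span {X i y | i. i < 3} = \<Delta> y"
  proof -
    have "\<exists>W X. open W \<and> x \<in> W \<and> (\<forall>i<(3::nat). smooth_vector_field A W (X i)) \<and> (\<forall>y\<in>W. span {X i y | i. i < 3} = \<Delta> y)"
      using dist unfolding distribution_def by (elim conjE allE[of _ x])
    then show ?thesis by (elim exE conjE) (rule that, auto)
  qed
  define U where "U = snd c ` (W \<inter> fst c)"
  have oU: "open U" unfolding U_def by (rule chart_image_open_sub[OF c(1) W(1)])
  define al where "al z = cross4 (local_rep c (X 0) z) (local_rep c (X 1) z) (local_rep c (X 2) z)" for z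
  have sm: "smooth_on U (local_rep c (X i))" if "i < 3" for i
    using X[OF that] c unfolding smooth_vector_field_def U_def by auto
  have sal: "smooth_on U al" unfolding al_def[abs_def] by (intro smooth_on_cross4 oU sm) auto
  have main: "al (snd c y) \<noteq> 0 \<and> (\<forall>v\<in>tangent_space A y. v \<in> \<Delta> y \<longleftrightarrow> al (snd c y) \<bullet> v c = 0)" if y: "y \<in> fst c" "y \<in> W" for y
  proof -
    define a where "a i = X i y" for i
    have at: "a i \<in> tangent_space A y" if "i < 3" for i
      using X[OF that] y unfolding smooth_vector_field_def a_def by auto
    have set3: "{X i y | i. i < 3} = {a 0, a 1, a 2}"
    proof -
      have "{i::nat. i < 3} = {0, 1, 2}" by auto
      moreover have "{X i y | i. i < 3} = a ` {i. i < 3}" unfolding a_def by blast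
      ultimately show ?thesis by simp
    qed
    have spa: "span {a 0, a 1, a 2} = \<Delta> y" using sp[OF y(2)] set3 by simp
    have inj: "v = w" if "v \<in> tangent_space A y" "w \<in> tangent_space A y" "v c = w c" for v w
      by (rule tangent_eqI[OF that(1,2) c(1) y(1) that(3)])
    have two: False if "\<Delta> y \<subseteq> span {p, q}" for p q
    proof -
      have "dim (\<Delta> y) \<le> card {p, q}" by (rule real_vector.dim_le_card[OF that]) simp
      also have "\<dots> \<le> 2" by (simp add: card_insert_if)
      finally show False using delta_dim[of y] by simp
    qed
    have sub: "subspace (tangent_space A y)" by (rule subspace_tangent)
    have x0: "a 0 c \<noteq> 0"
    proof
      assume "a 0 c = 0"
      then have "a 0 = 0" using inj[OF at[of 0] subspace_0[OF sub]] by simp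
      then have "span {a 0, a 1, a 2} = span {a 1, a 2}" by (simp add: span_insert_0)
      then show False using two[of "a 1" "a 2"] spa by simp
    qed
    have y0: "a 1 c \<notin> span {a 0 c}"
    proof
      assume "a 1 c \<in> span {a 0 c}"
      then obtain r where r: "a 1 c = r *\<^sub>R a 0 c" by (auto simp: span_singleton)
      have "a 1 = r *\<^sub>R a 0"
        by (rule inj[OF at[of 1] subspace_scale[OF sub at[of 0]]]) (use r in \<open>simp_all add: scaleR_fun_def\<close>)
      then have "a 1 \<in> span {a 0, a 2}" by (simp add: span_scale span_base)
      then have "span (insert (a 1) {a 0, a 2}) = span {a 0, a 2}" by (rule span_redundant)
      moreover have "insert (a 1) {a 0, a 2} = {a 0, a 1, a 2}" by (rule insert_commute)
      ultimately show False using two[of "a 0" "a 2"] spa by simp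
    qed
    have z0: "a 2 c \<notin> span {a 0 c, a 1 c}"
    proof
      assume "a 2 c \<in> span {a 0 c, a 1 c}"
      then obtain r s where rs: "a 2 c - r *\<^sub>R a 0 c = s *\<^sub>R a 1 c" by (auto simp: span_breakdown_eq span_singleton)
      have "a 2 = r *\<^sub>R a 0 + s *\<^sub>R a 1"
        by (rule inj[OF at[of 2] subspace_add[OF sub subspace_scale[OF sub at[of 0]] subspace_scale[OF sub at[of 1]]]])
          (use rs in \<open>auto simp: scaleR_fun_def algebra_simps\<close>)
      then have "a 2 \<in> span {a 0, a 1}" by (simp add: span_add span_scale span_base)
      then have "span (insert (a 2) {a 0, a 1}) = span {a 0, a 1}" by (rule span_redundant)
      moreover have "insert (a 2) {a 0, a 1} = {a 0, a 1, a 2}" by (simp add: insert_commute)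
      ultimately show False using two[of "a 0" "a 1"] spa by simp
    qed
    have lr: "local_rep c (X i) (snd c y) = a i c" for i using c y by (simp add: local_rep_def a_def)
    have al: "al (snd c y) = cross4 (a 0 c) (a 1 c) (a 2 c)" by (simp add: al_def lr)
    have nz: "al (snd c y) \<noteq> 0" unfolding al by (rule cross4_nonzero[OF x0 y0 z0])
    have iff: "v \<in> \<Delta> y \<longleftrightarrow> al (snd c y) \<bullet> v c = 0" if v: "v \<in> tangent_space A y" for v
    proof
      assume "v \<in> \<Delta> y"
      then have "v \<in> span {a 0, a 1, a 2}" using spa by simp
      then show "al (snd c y) \<bullet> v c = 0"
      proof (induction rule: span_induct_alt)
        case base then show ?case by simp
      next
        case (step r u w)
        then have "al (snd c y) \<bullet> u c = 0" unfolding al using cross4_orthogonal by auto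
        then show ?case using step by (simp add: scaleR_fun_def inner_add_right)
      qed
    next
      assume v0: "al (snd c y) \<bullet> v c = 0"
      let ?S = "span {a 0 c, a 1 c, a 2 c}" and ?H = "{e. al (snd c y) \<bullet> e = 0}"
      have "a 1 c \<noteq> 0" using y0 span_zero by metis
      have d: "dim {a 2 c, a 1 c, a 0 c} = 3"
      proof -
        have "a 2 c \<notin> span {a 1 c, a 0 c}" using z0 unfolding insert_commute[of "a 0 c" "a 1 c" "{}"] .
        then have "dim {a 2 c, a 1 c, a 0 c} = dim {a 1 c, a 0 c} + 1" using dim_insert[of "a 2 c" "{a 1 c, a 0 c}"] by simp
        also have "dim {a 1 c, a 0 c} = dim {a 0 c} + 1" using y0 dim_insert[of "a 1 c" "{a 0 c}"] by simp
        also have "dim {a 0 c} = 1" using x0 dim_insert[of "a 0 c" "{}"] by simp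
        finally show ?thesis by simp
      qed
      have "?S = ?H"
      proof (rule subspace_dim_equal)
        show "?S \<subseteq> ?H"
        proof (rule span_minimal)
          show "{a 0 c, a 1 c, a 2 c} \<subseteq> ?H" unfolding al using cross4_orthogonal by auto
        qed (rule subspace_hyperplane)
        have "{a 0 c, a 1 c, a 2 c} = {a 2 c, a 1 c, a 0 c}" by auto
        then show "dim ?S \<ge> dim ?H" using d dim_hyperplane[OF nz] by simp
      qed (auto simp: subspace_span subspace_hyperplane)
      then have "v c \<in> ?S" using v0 by auto
      then obtain r s t where "v c - r *\<^sub>R a 0 c - s *\<^sub>R a 1 c = t *\<^sub>R a 2 c" by (auto simp: span_breakdown_eq span_singleton)
      then have rst: "v c = r *\<^sub>R a 0 c + s *\<^sub>R a 1 c + t *\<^sub>R a 2 c" by (simp add: algebra_simps)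
      have "v = r *\<^sub>R a 0 + s *\<^sub>R a 1 + t *\<^sub>R a 2"
      proof (rule inj[OF v])
        show "r *\<^sub>R a 0 + s *\<^sub>R a 1 + t *\<^sub>R a 2 \<in> tangent_space A y"
          by (intro subspace_add[OF sub] subspace_scale[OF sub] at) auto
        show "v c = (r *\<^sub>R a 0 + s *\<^sub>R a 1 + t *\<^sub>R a 2) c" unfolding rst by (simp add: scaleR_fun_def)
      qed
      moreover have "\<dots> \<in> span {a 0, a 1, a 2}" by (intro span_add span_scale span_base) auto
      ultimately show "v \<in> \<Delta> y" using spa by simp
    qed
    show ?thesis using nz iff by auto
  qed
  have inW: "y \<in> W" if yc: "y \<in> fst c" and yU: "snd c y \<in> U" for y
  proof -
    obtain y' where "y' \<in> W" "y' \<in> fst c" "snd c y' = snd c y" using yU unfolding U_def by auto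
    then have "y' = y" using chart_inv_chart[OF c(1), of y] chart_inv_chart[OF c(1), of y'] yc by simp
    then show ?thesis using \<open>y' \<in> W\<close> by simp
  qed
  have "box c U al" unfolding box_def
  proof (intro conjI ballI allI impI)
    show "al z \<noteq> 0" if "z \<in> U" for z using that main unfolding U_def by auto
    show "v \<in> \<Delta> y \<longleftrightarrow> al (snd c y) \<bullet> v c = 0" if "y \<in> fst c" "snd c y \<in> U" "v \<in> tangent_space A y" for y v
      using main[OF that(1) inW[OF that(1,2)]] that(3) by blast
  qed (use c oU sal in \<open>auto simp: U_def\<close>)
  moreover have "snd c x \<in> U" using W c by (auto simp: U_def)
  ultimately show ?thesis by (rule that)
qed

text \<open>The kernels of both forms are \<Delta>, so the transition map takes one to the other,
  and \<open>characteristic_transport\<close> applies on the part \<open>S\<close> of the overlap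
  where both forms are available.\<close>

lemma characteristic_box_change:
  assumes b: "box c U al" "box c' U' al'" and x: "x \<in> fst c" "x \<in> fst c'" "snd c x \<in> U" "snd c' x \<in> U'"
    and v: "v \<in> tangent_space A x" and ch: "characteristic (al (snd c x)) (jac al (snd c x)) (v c)"
  shows "characteristic (al' (snd c' x)) (jac al' (snd c' x)) (v c')"
proof -
  note B = boxD[OF b(1)] and B' = boxD[OF b(2)]
  define S where "S = overlap c c' \<inter> U \<inter> transition c c' -` U'"
  have oS: "open S"
  proof -
    have "open (overlap c c' \<inter> U)" using overlap_open[OF B(1) B'(1)] B(2) by (rule open_Int)
    moreover have "continuous_on (overlap c c' \<inter> U) (transition c c')"
      by (rule continuous_on_subset[OF smooth_on_continuous[OF transition_smooth[OF B(1) B'(1)]]]) auto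
    ultimately show ?thesis unfolding S_def by (intro continuous_open_preimage B'(2))
  qed
  have xS: "snd c x \<in> S" using x overlap_in[OF x(1,2)] transition_eq[OF B(1) x(1)] by (simp add: S_def)
  have T: "smooth_on S (transition c c')" by (rule smooth_on_subset[OF transition_smooth[OF B(1) B'(1)]]) (auto simp: S_def)
  have iff: "al y \<bullet> e = 0 \<longleftrightarrow> al' (transition c c' y) \<bullet> frechet_derivative (transition c c') (at y) e = 0" if y: "y \<in> S" for y e
  proof -
    obtain p where p: "p \<in> fst c" "p \<in> fst c'" "y = snd c p" using y by (auto simp: S_def overlap_def)
    have tp: "transition c c' y = snd c' p" using p B(1) by (simp add: transition_eq)
    define w where "w = coord_vector A c p e"
    have w: "w \<in> tangent_space A p" "w c = e" "w c' = dtrans c c' p e"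
      using p B(1) B'(1) by (simp_all add: w_def coord_vector_tangent coord_vector_self coord_vector_nth)
    have "w \<in> \<Delta> p \<longleftrightarrow> al y \<bullet> e = 0" using B(6)[OF p(1) _ w(1)] y p w by (auto simp: S_def)
    moreover have "w \<in> \<Delta> p \<longleftrightarrow> al' (snd c' p) \<bullet> dtrans c c' p e = 0" using B'(6)[OF p(2) _ w(1)] y p w tp by (auto simp: S_def)
    ultimately show ?thesis unfolding tp dtrans_def p(3)[symmetric] by simp
  qed
  have "characteristic (al' (transition c c' (snd c x))) (jac al' (transition c c' (snd c x))) (frechet_derivative (transition c c') (at (snd c x)) (v c))"
  proof (rule characteristic_transport[OF oS xS T _ smooth_on_subset[OF B(4)] B'(4) _ iff _ ch])
    show "transition c c' ` S \<subseteq> U'" "S \<subseteq> U" by (auto simp: S_def)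
    show "al (snd c x) \<noteq> 0" using B(5) x by simp
    show "surj (frechet_derivative (transition c c') (at (snd c x)))"
      using dtrans_surj[OF B(1) B'(1) x(1,2)] by (simp add: dtrans_def)
  qed
  then show ?thesis
    unfolding dtrans_def[symmetric] transition_eq[OF B(1) x(1)] tangent_transform[OF v B(1) B'(1) x(1,2), symmetric] .
qed

text \<open>One box is enough, because \<open>characteristic_box_change\<close> makes the condition
  the same in every box around the point.\<close>

definition char_at :: "'m \<Rightarrow> ('m, real^4) tvec \<Rightarrow> bool" where
  "char_at x v \<longleftrightarrow> v \<in> tangent_space A x \<and> (\<exists>c U al. box c U al \<and> x \<in> fst c \<and> snd c x \<in> U \<and> characteristic (al (snd c x)) (jac al (snd c x)) (v c))"

lemma char_at_iff:
  assumes "box c U al" "x \<in> fst c" "snd c x \<in> U" "v \<in> tangent_space A x"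
  shows "char_at x v \<longleftrightarrow> characteristic (al (snd c x)) (jac al (snd c x)) (v c)"
  using assms characteristic_box_change unfolding char_at_def by blast

text \<open>Stated through characteristic vectors, hence on the manifold and without a choice of
  form; \<open>Sing_iff\<close> identifies it in coordinates with the zeros of the characteristic
  field.\<close>

definition Sing :: "'m set" where
  "Sing = {x. \<forall>v\<in>\<Delta> x. char_at x v}"

lemma Sing_iff:
  assumes b: "box c U al" and x: "x \<in> fst c" "snd c x \<in> U"
  shows "x \<in> Sing \<longleftrightarrow> charfield al (snd c x) = 0"
proof -
  note B = boxD[OF b]
  have "x \<in> Sing \<longleftrightarrow> (\<forall>e. al (snd c x) \<bullet> e = 0 \<longrightarrow> characteristic (al (snd c x)) (jac al (snd c x)) e)"
  proof
    assume s: "x \<in> Sing"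
    show "\<forall>e. al (snd c x) \<bullet> e = 0 \<longrightarrow> characteristic (al (snd c x)) (jac al (snd c x)) e"
    proof (intro allI impI)
      fix e assume e: "al (snd c x) \<bullet> e = 0"
      define w where "w = coord_vector A c x e"
      have w: "w \<in> tangent_space A x" "w c = e" using x B(1) by (simp_all add: w_def coord_vector_tangent coord_vector_self)
      then have "w \<in> \<Delta> x" using B(6)[OF x w(1)] e by simp
      then have "char_at x w" using s by (simp add: Sing_def)
      then show "characteristic (al (snd c x)) (jac al (snd c x)) e" using char_at_iff[OF b x w(1)] w by simp
    qed
  next
    assume *: "\<forall>e. al (snd c x) \<bullet> e = 0 \<longrightarrow> characteristic (al (snd c x)) (jac al (snd c x)) e"
    show "x \<in> Sing" unfolding Sing_def
    proof (intro CollectI ballI)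
      fix v assume v: "v \<in> \<Delta> x"
      then have vt: "v \<in> tangent_space A x" using delta_tangent by auto
      then show "char_at x v" using char_at_iff[OF b x vt] B(6)[OF x vt] v * by simp
    qed
  qed
  also have "\<dots> \<longleftrightarrow> charfield al (snd c x) = 0"
    unfolding charfield_def using charvec_zero_iff[OF B(5)[OF x(2)]] by simp
  finally show ?thesis .
qed

text \<open>Where all derivatives of the characteristic field vanish, no iterated bracket leaves the
  distribution.\<close>

lemma charfield_zero_negligible:
  assumes b: "box c U al"
  shows "negligible {z\<in>U. charfield al z = 0}"
proof -
  note B = boxD[OF b]
  have "negligible (\<Union>i\<in>(UNIV::4 set). {z\<in>U. charfield al z $ i = 0 \<and> \<not> flat z (\<lambda>x. charfield al x $ i)})"
    by (intro negligible_Union finite_imageI finite)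
      (auto intro!: zero_not_flat_negligible smooth_on_component smooth_on_charfield B(2,4))
  moreover have "{z\<in>U. charfield al z = 0} \<subseteq> (\<Union>i\<in>(UNIV::4 set). {z\<in>U. charfield al z $ i = 0 \<and> \<not> flat z (\<lambda>x. charfield al x $ i)})"
  proof
    fix z assume z: "z \<in> {z\<in>U. charfield al z = 0}"
    show "z \<in> (\<Union>i\<in>(UNIV::4 set). {z\<in>U. charfield al z $ i = 0 \<and> \<not> flat z (\<lambda>x. charfield al x $ i)})"
    proof (rule ccontr)
      assume "\<not> ?thesis"
      then have fl: "flat z (\<lambda>x. charfield al x $ i)" for i using z by auto
      define x where "x = chart_inv c z"
      have x: "x \<in> fst c" "snd c x = z" using z B(1,3) unfolding x_def by (auto intro: chart_inv_in)
      have ann: "al z \<bullet> X x c = 0" if W: "open W" "x \<in> W" and X: "X \<in> iterated_brackets A \<Delta> W" for X W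
      proof -
        define S where "S = U \<inter> snd c ` (W \<inter> fst c)"
        have S: "open S" "z \<in> S" "S \<subseteq> U" "S \<subseteq> snd c ` (W \<inter> fst c)"
          using chart_image_open_sub[OF B(1) W(1)] B(2) z W x by (auto simp: S_def)
        have Sx: "chart_inv c y \<in> W" "chart_inv c y \<in> fst c" "snd c (chart_inv c y) = y" if "y \<in> S" for y
          using that B(1) unfolding S_def by auto
        have smal: "smooth_on S al" using B(4) S(3) by (rule smooth_on_subset)
        \<comment> \<open>Smoothness is carried through the induction together with flatness, since
          it is needed to handle the derivatives in the next bracket.\<close>
        from X have "smooth_on S (local_rep c X) \<and> flat z (\<lambda>y. al y \<bullet> local_rep c X y)"
        proof induction
          case (local_sect X)
          then have sv: "smooth_vector_field A W X" and d: "\<And>y. y \<in> W \<Longrightarrow> X y \<in> \<Delta> y" by (auto simp: local_section_def)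
          have "smooth_on (snd c ` (W \<inter> fst c)) (local_rep c X)" using sv B(1) unfolding smooth_vector_field_def by blast
          then have s1: "smooth_on S (local_rep c X)" by (rule smooth_on_subset) (rule S(4))
          have zero: "0 = al y \<bullet> local_rep c X y" if y: "y \<in> S" for y
          proof -
            have "X (chart_inv c y) \<in> \<Delta> (chart_inv c y)" using d Sx[OF y] by simp
            moreover from this have "X (chart_inv c y) \<in> tangent_space A (chart_inv c y)" using delta_tangent by blast
            moreover have "snd c (chart_inv c y) \<in> U" using y S(3) Sx[OF y] by auto
            ultimately have "al (snd c (chart_inv c y)) \<bullet> X (chart_inv c y) c = 0" using B(6)[OF Sx(2)[OF y]] by blast
            then show ?thesis using Sx(3)[OF y] by (simp add: local_rep_def)
          qed
          have "flat z (\<lambda>y. al y \<bullet> local_rep c X y)" by (rule flat_cong[OF S(1,2) zero flat_zero])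
          with s1 show ?case by (rule conjI)
        next
          case (bracket X Y)
          have eq: "frechet_derivative (local_rep c Y) (at y) (local_rep c X y) - frechet_derivative (local_rep c X) (at y) (local_rep c Y y)
            = local_rep c (lie_bracket A X Y) y" if "y \<in> S" for y
          proof -
            have "local_rep c (lie_bracket A X Y) y = lie_bracket A X Y (chart_inv c y) c" by (simp only: local_rep_def)
            also have "\<dots> = frechet_derivative (local_rep c Y) (at y) (X (chart_inv c y) c) - frechet_derivative (local_rep c X) (at y) (Y (chart_inv c y) c)"
              unfolding lie_bracket_def using Sx[OF that] B(1) by simp
            finally show ?thesis unfolding local_rep_def[of c X] local_rep_def[of c Y] by simp
          qed
          have 1: "smooth_on S (\<lambda>y. frechet_derivative (local_rep c Y) (at y) (local_rep c X y) - frechet_derivative (local_rep c X) (at y) (local_rep c Y y))"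
            using bracket.IH by (intro smooth_on_diff smooth_on_derivative_along S(1)) auto
          have 2: "flat z (\<lambda>y. al y \<bullet> (frechet_derivative (local_rep c Y) (at y) (local_rep c X y) - frechet_derivative (local_rep c X) (at y) (local_rep c Y y)))"
            using bracket.IH z by (intro bracket_flat[OF S(1,2) smal] fl B(5)) auto
          show ?case
          proof
            show "smooth_on S (local_rep c (lie_bracket A X Y))" by (rule smooth_on_cong[OF S(1) eq 1])
            show "flat z (\<lambda>y. al y \<bullet> local_rep c (lie_bracket A X Y) y)" by (rule flat_cong[OF S(1,2) _ 2]) (simp add: eq)
          qed
        qed
        then have "al z \<bullet> local_rep c X z = 0" using flat_0 by blast
        then show ?thesis by (simp add: local_rep_def x_def)
      qed
      have "al z \<bullet> v c = 0" if "v \<in> tangent_space A x" for v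
      proof -
        have "v \<in> span {X x | X W. open W \<and> x \<in> W \<and> X \<in> iterated_brackets A \<Delta> W}"
          using nonhol that unfolding totally_nonholonomic_def by blast
        then show ?thesis
        proof (induction rule: span_induct_alt)
          case base then show ?case by simp
        next
          case (step r u w)
          then have "al z \<bullet> u c = 0" using ann by auto
          then show ?case using step by (simp add: scaleR_fun_def inner_add_right)
        qed
      qed
      \<comment> \<open>The brackets span the tangent space, so the form would also annihilate the
        vector with coordinates \<open>al z\<close>.\<close>
      from this[OF coord_vector_tangent[OF B(1) x(1), of "al z"]] have "al z \<bullet> al z = 0"
        by (simp add: coord_vector_self[OF B(1) x(1)])
      then show False using B(5)[of z] z by simp
    qed
  qed
  ultimately show ?thesis by (rule negligible_subset)
qed

section \<open>Singular paths in coordinates\<close>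

lemma annihilator_coord:
  assumes b: "box c U al" and x: "x \<in> fst c" "snd c x \<in> U" and p: "(x, p) \<in> annihilator A \<Delta>"
  shows "al (snd c x) \<bullet> e = 0 \<Longrightarrow> covec_coord c x p \<bullet> e = 0" and "covec_coord c x p \<noteq> 0"
proof -
  note B = boxD[OF b]
  have pc: "p \<in> cotangent_space A x" and p0: "p \<noteq> 0" and pd: "\<And>v. v \<in> \<Delta> x \<Longrightarrow> p v = 0"
    using p by (auto simp: annihilator_def)
  show "covec_coord c x p \<bullet> e = 0" if e: "al (snd c x) \<bullet> e = 0"
  proof -
    define v where "v = coord_vector A c x e"
    have v: "v \<in> tangent_space A x" "v c = e" using x B(1) by (simp_all add: v_def coord_vector_tangent coord_vector_self)
    have "v \<in> \<Delta> x" using B(6)[OF x v(1)] v e by simp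
    then show ?thesis using pd covec_rep[OF pc B(1) x(1) v(1)] v by simp
  qed
  show "covec_coord c x p \<noteq> 0"
  proof
    assume z: "covec_coord c x p = 0"
    have "p v = 0" for v
      using covec_rep[OF pc B(1) x(1), of v] pc z by (cases "v \<in> tangent_space A x") (auto simp: cotangent_space_def)
    then show False using p0 by (simp add: fun_eq_iff)
  qed
qed

text \<open>Over a straight line in a chart, \<open>\<lambda> \<alpha>\<close> is a smooth curve in the annihilator.\<close>

lemma annihilator_tangent:
  assumes b: "box c U al" and x: "x \<in> fst c" "snd c x \<in> U" and p: "(x, p) \<in> annihilator A \<Delta>"
    and l: "covec_coord c x p = l *\<^sub>R al (snd c x)"
  obtains \<eta> where "\<eta> \<in> tangent_to (cotangent_atlas A) (annihilator A \<Delta>) (x, p)"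
    "\<eta> (cotangent_chart A c) = (w, l *\<^sub>R (jac al (snd c x) *v w))"
proof -
  note B = boxD[OF b]
  let ?z = "snd c x"
  have pc: "p \<in> cotangent_space A x" using p by (auto simp: annihilator_def)
  have l0: "l \<noteq> 0" using annihilator_coord(2)[OF b x p] l by auto
  obtain r where r: "r > 0" "ball ?z r \<subseteq> U" using B(2) x(2) openE by blast
  define \<epsilon> where "\<epsilon> = r / (norm w + 1)"
  have nw: "norm w + 1 > 0" using norm_ge_zero[of w] by linarith
  have e: "\<epsilon> > 0" using r nw by (simp add: \<epsilon>_def)
  define I where "I = {- \<epsilon><..<\<epsilon>}"
  define y where "y s = ?z + s *\<^sub>R w" for s
  have yU: "y s \<in> U" if "s \<in> I" for s
  proof -
    have "\<bar>s\<bar> * norm w \<le> \<bar>s\<bar> * (norm w + 1)" by (intro mult_left_mono) auto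
    also have "\<dots> < \<epsilon> * (norm w + 1)" using that nw by (intro mult_strict_right_mono) (auto simp: I_def)
    also have "\<dots> = r" using nw by (simp add: \<epsilon>_def)
    finally have "dist ?z (y s) < r" by (simp add: y_def dist_norm)
    then show ?thesis using r(2) by auto
  qed
  define \<sigma> where "\<sigma> s = (chart_inv c (y s), covec c (chart_inv c (y s)) (l *\<^sub>R al (y s)))" for s
  have ci: "chart_inv c (y s) \<in> fst c" "snd c (chart_inv c (y s)) = y s" if "s \<in> I" for s
    using yU[OF that] B(1,3) by auto
  have sC: "snd (cotangent_chart A c) (\<sigma> s) = (y s, l *\<^sub>R al (y s))" if "s \<in> I" for s
    using ci[OF that] B(1) by (simp add: \<sigma>_def cotangent_chart_eq covec_coord_covec)
  have ann: "\<sigma> s \<in> annihilator A \<Delta>" if s: "s \<in> I" for s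
  proof -
    let ?x = "chart_inv c (y s)"
    let ?p = "covec c ?x (l *\<^sub>R al (y s))"
    have "?p (coord_vector A c ?x (al (y s))) = l * (al (y s) \<bullet> al (y s))"
      using ci[OF s] B(1) by (simp add: covec_def coord_vector_tangent coord_vector_self)
    also have "\<dots> \<noteq> 0" using l0 B(5)[OF yU[OF s]] by simp
    finally have "?p \<noteq> 0" by auto
    moreover have "?p v = 0" if v: "v \<in> \<Delta> ?x" for v
    proof -
      have vt: "v \<in> tangent_space A ?x" using v delta_tangent by auto
      then have "al (y s) \<bullet> v c = 0" using B(6)[of ?x v] ci[OF s] yU[OF s] v by simp
      then show ?thesis by (simp add: covec_def)
    qed
    ultimately show ?thesis using covec_cotangent unfolding \<sigma>_def annihilator_def by auto
  qed
  have \<sigma>0: "\<sigma> 0 = (x, p)"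
  proof -
    have "chart_inv c (y 0) = x" using B(1) x(1) by (simp add: y_def)
    moreover have "covec c x (l *\<^sub>R al (y 0)) = p" using covec_covec_coord[OF pc B(1) x(1)] l by (simp add: y_def)
    ultimately show ?thesis by (simp add: \<sigma>_def)
  qed
  have oI: "open I" "0 \<in> I" using e by (auto simp: I_def)
  have sm: "smooth_on I (snd (cotangent_chart A c) \<circ> \<sigma>)"
  proof (rule smooth_on_cong[OF oI(1)])
    have "smooth_on I (\<lambda>s. ?z + s *\<^sub>R w)"
      by (rule smooth_on_affine_line[OF open_UNIV oI(1) _ smooth_on_ident]) auto
    moreover have "smooth_on I (\<lambda>s. l *\<^sub>R al (?z + s *\<^sub>R w))"
      by (intro smooth_on_scaleR smooth_on_const oI(1) smooth_on_affine_line[OF B(2) oI(1) _ B(4)]) (use yU in \<open>auto simp: y_def\<close>)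
    ultimately show "smooth_on I (\<lambda>s. (?z + s *\<^sub>R w, l *\<^sub>R al (?z + s *\<^sub>R w)))"
      by (rule smooth_on_Pair[OF oI(1)])
  qed (simp add: sC y_def)
  have Cin: "cotangent_chart A c \<in> cotangent_atlas A" using B(1) by (simp add: cotangent_atlas_def)
  have fC: "\<sigma> s \<in> fst (cotangent_chart A c)" if "s \<in> I" for s
    using ci[OF that] covec_cotangent by (simp add: \<sigma>_def cotangent_chart_def)
  define \<eta> where "\<eta> = velocity (cotangent_atlas A) \<sigma> 0"
  have "\<eta> \<in> tangent_to (cotangent_atlas A) (annihilator A \<Delta>) (x, p)"
    unfolding tangent_to_def \<eta>_def
  proof (intro CollectI exI[of _ \<sigma>] conjI refl \<sigma>0)
    show "\<exists>\<epsilon>>0. \<exists>C\<in>cotangent_atlas A. (\<forall>s\<in>{- \<epsilon><..<\<epsilon>}. \<sigma> s \<in> annihilator A \<Delta> \<and> \<sigma> s \<in> fst C) \<and> smooth_on {- \<epsilon><..<\<epsilon>} (snd C \<circ> \<sigma>)"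
      using e Cin ann fC sm unfolding I_def by blast
  qed
  moreover have "\<eta> (cotangent_chart A c) = (w, l *\<^sub>R (jac al ?z *v w))"
  proof -
    have "((\<lambda>s. ?z + s *\<^sub>R w) has_derivative (\<lambda>h. h *\<^sub>R w)) (at 0)" by (auto intro!: derivative_eq_intros)
    moreover have "((\<lambda>s. al (?z + s *\<^sub>R w)) has_derivative (\<lambda>h. jac al ?z *v (h *\<^sub>R w))) (at 0)"
      by (rule has_derivative_compose[where f = "\<lambda>s. ?z + s *\<^sub>R w" and g = al, OF calculation]) (use jac_has_derivative[OF B(4) x(2)] in simp)
    ultimately have "((\<lambda>s. (?z + s *\<^sub>R w, l *\<^sub>R al (?z + s *\<^sub>R w))) has_derivative (\<lambda>h. (h *\<^sub>R w, l *\<^sub>R (jac al ?z *v (h *\<^sub>R w))))) (at 0)"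
      by (intro has_derivative_Pair has_derivative_scaleR_right)
    then have "((\<lambda>s. (?z + s *\<^sub>R w, l *\<^sub>R al (?z + s *\<^sub>R w))) has_vector_derivative (w, l *\<^sub>R (jac al ?z *v w))) (at 0)"
      unfolding has_vector_derivative_def by (simp add: matrix_vector_mult_scaleR mult.commute)
    then have "((snd (cotangent_chart A c) \<circ> \<sigma>) has_vector_derivative (w, l *\<^sub>R (jac al ?z *v w))) (at 0)"
      by (rule has_vector_derivative_transform_within_open[OF _ oI]) (simp add: sC y_def)
    then show ?thesis using Cin fC[OF oI(2)] by (simp add: \<eta>_def velocity_def vector_derivative_at)
  qed
  ultimately show ?thesis by (rule that)
qed

text \<open>At each time the covector of the lift is a multiple of \<alpha>, with factor
  \<open>l\<close> at time \<open>t\<close>. Hence, up to a multiple of \<alpha>, its derivative is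
  \<open>l\<close> times the derivative of \<alpha> along the velocity \<open>v\<close>. For
  \<open>w\<close> in the kernel of \<alpha>, pairing with the tangent vector over \<open>w\<close>
  from \<open>annihilator_tangent\<close> gives - l d\<alpha>(v, w), which must therefore
  vanish.\<close>

lemma lift_velocity_characteristic:
  assumes I: "open I" "t \<in> I"
    and ps: "\<And>s. s \<in> I \<Longrightarrow> \<psi> s \<in> annihilator A \<Delta> \<and> fst (\<psi> s) = \<gamma> s \<and> \<gamma> s \<in> fst c'"
    and c': "c' \<in> A" and diff: "(snd (cotangent_chart A c') \<circ> \<psi>) differentiable (at t)"
    and hor: "velocity A \<gamma> t \<in> \<Delta> (\<gamma> t)"
    and ker: "velocity (cotangent_atlas A) \<psi> t \<in> restricted_kernel A \<Delta> (\<psi> t)"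
  shows "char_at (\<gamma> t) (velocity A \<gamma> t)"
    and "\<And>c. c \<in> A \<Longrightarrow> \<gamma> t \<in> fst c \<Longrightarrow> ((snd c \<circ> \<gamma>) has_vector_derivative velocity A \<gamma> t c) (at t)"
proof -
  define P where "P c s = covec_coord c (\<gamma> s) (snd (\<psi> s))" for c s
  have ann: "(\<gamma> s, snd (\<psi> s)) \<in> annihilator A \<Delta>" if "s \<in> I" for s using ps[OF that] by (cases "\<psi> s") auto
  have cot: "snd (\<psi> s) \<in> cotangent_space A (\<gamma> s)" if "s \<in> I" for s using ann[OF that] by (auto simp: annihilator_def)
  have sC: "snd (cotangent_chart A c) (\<psi> s) = (snd c (\<gamma> s), P c s)" if "s \<in> I" for c s
  proof -
    have "\<psi> s = (\<gamma> s, snd (\<psi> s))" using ps[OF that] by (cases "\<psi> s") auto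
    then have "snd (cotangent_chart A c) (\<psi> s) = snd (cotangent_chart A c) (\<gamma> s, snd (\<psi> s))" by (rule arg_cong)
    also have "\<dots> = (snd c (\<gamma> s), P c s)" unfolding P_def by (rule cotangent_chart_eq)
    finally show ?thesis .
  qed
  obtain D where D: "((\<lambda>s. snd (cotangent_chart A c') (\<psi> s)) has_derivative D) (at t)"
    using diff by (auto simp: differentiable_def o_def)
  have D2: "((\<lambda>s. (snd c' (\<gamma> s), P c' s)) has_derivative D) (at t)"
    by (rule has_derivative_transform_within_open[OF D I]) (simp add: sC)
  have x': "((\<lambda>s. snd c' (\<gamma> s)) has_derivative (\<lambda>h. fst (D h))) (at t)" using has_derivative_fst[OF D2] by simp
  have dP': "((\<lambda>s. P c' s) has_derivative (\<lambda>h. snd (D h))) (at t)" using has_derivative_snd[OF D2] by simp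
  have lD: "linear D" using D by (rule has_derivative_linear)
  have Dh: "D h = h *\<^sub>R D 1" for h using linear_scale[OF lD, of h 1] by simp
  have vx': "((snd c' \<circ> \<gamma>) has_vector_derivative fst (D 1)) (at t)"
    unfolding has_vector_derivative_def o_def
    by (rule has_derivative_eq_rhs[OF x'], rule ext, subst Dh) simp
  have gt: "\<gamma> t \<in> fst c'" using ps I by auto
  show vel: "((snd c \<circ> \<gamma>) has_vector_derivative velocity A \<gamma> t c) (at t)" if c: "c \<in> A" "\<gamma> t \<in> fst c" for c
  proof -
    have "((snd c \<circ> \<gamma>) has_vector_derivative dtrans c' c (\<gamma> t) (fst (D 1))) (at t)"
      by (rule curve_chart_change[OF c' c(1) gt c(2) I _ vx']) (use ps in auto)
    then show ?thesis using c by (simp add: velocity_def vector_derivative_at)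
  qed
  have vt: "velocity A \<gamma> t \<in> tangent_space A (\<gamma> t)" using hor delta_tangent by auto
  \<comment> \<open>The symplectic form is evaluated in an arbitrarily selected chart, in general
    not the one in which the lift is known to be differentiable; \<open>Pdiff\<close> transfers
    differentiability from \<open>c'\<close> to \<open>c\<close>.\<close>
  define C where "C = (SOME C. C \<in> cotangent_atlas A \<and> \<psi> t \<in> fst C)"
  have pt: "\<psi> t = (\<gamma> t, snd (\<psi> t))" using ps[OF I(2)] by (cases "\<psi> t") auto
  have "cotangent_chart A c' \<in> cotangent_atlas A \<and> \<psi> t \<in> fst (cotangent_chart A c')"
    using c' gt cot[OF I(2)] by (subst pt) (auto simp: cotangent_atlas_def cotangent_chart_def)
  then have C: "C \<in> cotangent_atlas A \<and> \<psi> t \<in> fst C" unfolding C_def by (rule someI)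
  then obtain c where c: "c \<in> A" "C = cotangent_chart A c" by (auto simp: cotangent_atlas_def)
  have gc: "\<gamma> t \<in> fst c" using C c(2) ps[OF I(2)] by (auto simp: cotangent_chart_def split: prod.splits)
  obtain U al where b: "box c U al" "snd c (\<gamma> t) \<in> U" by (rule box_exists[OF c(1) gc])
  note B = boxD[OF b(1)]
  let ?z = "snd c (\<gamma> t)"
  define v where "v = velocity A \<gamma> t c"
  have xc: "((\<lambda>s. snd c (\<gamma> s)) has_derivative (\<lambda>h. h *\<^sub>R v)) (at t)"
    using vel[OF c(1) gc] by (simp add: has_vector_derivative_def o_def v_def)
  define I2 where "I2 = I \<inter> {s. s \<in> I \<and> \<gamma> s \<in> fst c \<and> snd c (\<gamma> s) \<in> U}"
  \<comment> \<open>Continuity of \<gamma> at \<open>t\<close> is known through the chart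
    \<open>c'\<close>, so the domain of the box is first expressed in the coordinates of
    \<open>c'\<close>.\<close>
  obtain J where J: "open J" "t \<in> J" "\<And>s. s \<in> J \<Longrightarrow> s \<in> I \<and> \<gamma> s \<in> fst c \<and> snd c (\<gamma> s) \<in> U"
  proof -
    have cont: "isCont (\<lambda>s. snd c' (\<gamma> s)) t" using has_derivative_continuous[OF x'] by simp
    define G where "G = snd c' ` ({x \<in> fst c. snd c x \<in> U} \<inter> fst c')"
    have oG: "open G" unfolding G_def by (intro chart_image_open_sub[OF c'] chart_preimage_open[OF c(1) B(2)])
    have "snd c' (\<gamma> t) \<in> G" using gt gc b(2) by (auto simp: G_def)
    then have "\<exists>J0. open J0 \<and> t \<in> J0 \<and> (\<forall>s\<in>J0. snd c' (\<gamma> s) \<in> G)"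
      using cont[unfolded continuous_at_open, rule_format, of G] oG by simp
    then obtain J0 where J0: "open J0" "t \<in> J0" "\<And>s. s \<in> J0 \<Longrightarrow> snd c' (\<gamma> s) \<in> G" by auto
    show ?thesis
    proof (rule that[of "I \<inter> J0"])
      fix s assume s: "s \<in> I \<inter> J0"
      then obtain x where x: "x \<in> fst c" "snd c x \<in> U" "x \<in> fst c'" "snd c' (\<gamma> s) = snd c' x"
        using J0(3)[of s] by (auto simp: G_def)
      then have "\<gamma> s = x" using ps[of s] s chart_inv_chart[OF c', of x] chart_inv_chart[OF c', of "\<gamma> s"] by auto
      then show "s \<in> I \<and> \<gamma> s \<in> fst c \<and> snd c (\<gamma> s) \<in> U" using x s by auto
    qed (use I J0 in auto)
  qed
  have Pdiff: "\<exists>D'. ((\<lambda>s. P c s) has_derivative D') (at t)"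
  proof -
    have "\<exists>D'. ((\<lambda>s. P c' s \<bullet> frechet_derivative (transition c c') (at (snd c (\<gamma> s))) b) has_derivative D') (at t)" for b
    proof -
      have "((\<lambda>z. frechet_derivative (transition c c') (at z) b) has_derivative frechet_derivative (\<lambda>z. frechet_derivative (transition c c') (at z) b) (at ?z)) (at ?z)"
        by (rule smooth_on_has_derivative[OF smooth_on_derivative[OF transition_smooth[OF c(1) c']] overlap_in[OF gc gt]])
      from has_derivative_inner[OF dP' has_derivative_compose[OF xc this]] show ?thesis by - (rule exI)
    qed
    then have "\<exists>E. \<forall>b. ((\<lambda>s. P c' s \<bullet> frechet_derivative (transition c c') (at (snd c (\<gamma> s))) b) has_derivative E b) (at t)"
      by (intro choice allI)
    then obtain E where E: "((\<lambda>s. P c' s \<bullet> frechet_derivative (transition c c') (at (snd c (\<gamma> s))) b) has_derivative E b) (at t)" for b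
      by (elim exE) (rule that, erule spec)
    have "((\<lambda>s. \<Sum>b\<in>Basis. (P c' s \<bullet> frechet_derivative (transition c c') (at (snd c (\<gamma> s))) b) *\<^sub>R b) has_derivative (\<lambda>h. \<Sum>b\<in>Basis. E b h *\<^sub>R b)) (at t)"
      by (intro has_derivative_sum has_derivative_scaleR_left E)
    then have "((\<lambda>s. P c s) has_derivative (\<lambda>h. \<Sum>b\<in>Basis. E b h *\<^sub>R b)) (at t)"
    proof (rule has_derivative_transform_within_open[OF _ J(1,2)])
      fix s assume s: "s \<in> J"
      have "P c s \<bullet> b = P c' s \<bullet> frechet_derivative (transition c c') (at (snd c (\<gamma> s))) b" for b
        unfolding P_def using covec_coord_change[OF cot c(1) _ c', of s b] J(3)[OF s] ps[of s] by (simp add: dtrans_def)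
      then show "(\<Sum>b\<in>Basis. (P c' s \<bullet> frechet_derivative (transition c c') (at (snd c (\<gamma> s))) b) *\<^sub>R b) = P c s"
        using euclidean_representation[of "P c s"] by simp
    qed
    then show ?thesis by - (rule exI)
  qed
  then obtain D' where D': "((\<lambda>s. P c s) has_derivative D') (at t)" by (elim exE)
  have lD': "linear D'" using D' by (rule has_derivative_linear)
  define p' where "p' = D' 1"
  have "((\<lambda>s. (snd c (\<gamma> s), P c s)) has_derivative (\<lambda>h. (h *\<^sub>R v, D' h))) (at t)" by (rule has_derivative_Pair[OF xc D'])
  moreover have "(\<lambda>h. (h *\<^sub>R v, D' h)) = (\<lambda>h. h *\<^sub>R (v, p'))"
  proof (rule ext)
    fix h
    have "D' h = h *\<^sub>R p'" using linear_scale[OF lD', of h 1] by (simp add: p'_def)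
    then show "(h *\<^sub>R v, D' h) = h *\<^sub>R (v, p')" by simp
  qed
  ultimately have "((\<lambda>s. (snd c (\<gamma> s), P c s)) has_vector_derivative (v, p')) (at t)" by (simp add: has_vector_derivative_def)
  then have "((snd C \<circ> \<psi>) has_vector_derivative (v, p')) (at t)"
    by (rule has_vector_derivative_transform_within_open[OF _ I]) (simp add: sC c(2))
  then have xi: "velocity (cotangent_atlas A) \<psi> t C = (v, p')" using C by (simp add: velocity_def vector_derivative_at)
  have av: "al ?z \<bullet> v = 0" unfolding v_def using B(6)[OF gc b(2) vt] hor by simp
  have par: "(al (snd c (\<gamma> s)) \<bullet> al (snd c (\<gamma> s))) * (P c s \<bullet> e) = (P c s \<bullet> al (snd c (\<gamma> s))) * (al (snd c (\<gamma> s)) \<bullet> e)"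
    if s: "s \<in> J" for s e
    unfolding P_def
    by (rule inner_zero_imp_parallel, rule annihilator_coord(1)[OF b(1) _ _ ann]) (use J(3)[OF s] in auto)
  have da: "((\<lambda>s. al (snd c (\<gamma> s))) has_derivative (\<lambda>h. jac al ?z *v (h *\<^sub>R v))) (at t)"
    by (rule has_derivative_compose[OF xc jac_has_derivative[OF B(4) b(2)]])
  have aa: "al ?z \<bullet> al ?z \<noteq> 0" using B(5)[OF b(2)] by simp
  define l where "l = (P c t \<bullet> al ?z) / (al ?z \<bullet> al ?z)"
  have Pl: "P c t = l *\<^sub>R al ?z"
  proof (rule vector_eq_rdot[THEN iffD1], rule allI)
    fix e show "P c t \<bullet> e = (l *\<^sub>R al ?z) \<bullet> e" using par[OF J(2), of e] aa by (simp add: l_def field_simps)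
  qed
  have l0: "l \<noteq> 0"
    using annihilator_coord(2)[OF b(1) gc b(2) ann[OF I(2)]] Pl unfolding P_def by auto
  \<comment> \<open>The relation \<open>par\<close> is differentiated at \<open>t\<close>. The other
    terms of the product rule carry a factor \<open>P c t \<bullet> e\<close> or
    \<open>al ?z \<bullet> e\<close>, and both are 0.\<close>
  have p'e: "p' \<bullet> e = l * ((jac al ?z *v v) \<bullet> e)" if e: "al ?z \<bullet> e = 0" for e
  proof -
    have Pe: "P c t \<bullet> e = 0" using Pl e by simp
    note a2 = has_derivative_inner[OF da da]
    note d1 = has_derivative_mult[OF a2 has_derivative_inner_left[OF D', of e]]
    note d2 = has_derivative_mult[OF has_derivative_inner[OF D' da] has_derivative_inner_left[OF da, of e]]
    have d2': "((\<lambda>s. (al (snd c (\<gamma> s)) \<bullet> al (snd c (\<gamma> s))) * (P c s \<bullet> e)) has_derivative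
      (\<lambda>h. (P c t \<bullet> al ?z) * ((jac al ?z *v (h *\<^sub>R v)) \<bullet> e) + (P c t \<bullet> (jac al ?z *v (h *\<^sub>R v)) + D' h \<bullet> al ?z) * (al ?z \<bullet> e))) (at t)"
      by (rule has_derivative_transform_within_open[OF d2 J(1,2)]) (simp add: par)
    from fun_cong[OF has_derivative_unique[OF d1 d2'], of 1]
    have "(al ?z \<bullet> al ?z) * (p' \<bullet> e) = (P c t \<bullet> al ?z) * ((jac al ?z *v v) \<bullet> e)"
      by (simp add: Pe e p'_def)
    then show ?thesis using aa by (simp add: l_def field_simps)
  qed
  have "dform (jac al ?z) v w = 0" if w: "al ?z \<bullet> w = 0" for w
  proof -
    obtain \<eta> where eta: "\<eta> \<in> tangent_to (cotangent_atlas A) (annihilator A \<Delta>) (\<gamma> t, snd (\<psi> t))"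
      "\<eta> (cotangent_chart A c) = (w, l *\<^sub>R (jac al ?z *v w))"
      by (rule annihilator_tangent[OF b(1) gc b(2) ann[OF I(2)] Pl[unfolded P_def]])
    have "symplectic_form A (\<psi> t) (velocity (cotangent_atlas A) \<psi> t) \<eta> = 0"
      using ker eta(1) pt unfolding restricted_kernel_def by auto
    then have "v \<bullet> (l *\<^sub>R (jac al ?z *v w)) - p' \<bullet> w = 0"
      unfolding symplectic_form_def C_def[symmetric] Let_def xi using eta(2) c(2) by simp
    then have "l * (v \<bullet> (jac al ?z *v w)) = l * ((jac al ?z *v v) \<bullet> w)" using p'e[OF w] by simp
    then show ?thesis using l0 by (simp add: dform_def inner_commute)
  qed
  then have "characteristic (al ?z) (jac al ?z) v" using av by (simp add: characteristic_def)
  then show "char_at (\<gamma> t) (velocity A \<gamma> t)" using char_at_iff[OF b(1) gc b(2) vt] by (simp add: v_def)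
qed

text \<open>The hypothesis provides absolute continuity in charts that cannot be prescribed, for the
  path and for the lift. The path is moved to the given chart by a Lipschitz bound on the transition
  map, and \<open>N\<close> collects the times at which the lift has no derivative or one of the two
  almost-everywhere conditions fails.\<close>

lemma singular_path_local:
  assumes sing: "singular_path A \<Delta> \<gamma>" and s: "s \<in> {0..1}" and c: "c \<in> A" "\<gamma> s \<in> fst c"
    and G: "open G" "snd c (\<gamma> s) \<in> G"
  obtains \<delta> N where "\<delta> > 0" "negligible N"
    "\<And>t. t \<in> {0..1} \<Longrightarrow> \<bar>t - s\<bar> \<le> \<delta> \<Longrightarrow> \<gamma> t \<in> fst c \<and> snd c (\<gamma> t) \<in> G"
    "abs_continuous_on ({0..1} \<inter> {s - \<delta>..s + \<delta>}) (snd c \<circ> \<gamma>)"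
    "\<And>t. 0 < t \<Longrightarrow> t < 1 \<Longrightarrow> \<bar>t - s\<bar> < \<delta> \<Longrightarrow> t \<notin> N \<Longrightarrow>
       ((snd c \<circ> \<gamma>) has_vector_derivative velocity A \<gamma> t c) (at t) \<and> char_at (\<gamma> t) (velocity A \<gamma> t)"
proof -
  have hor: "horizontal_path A \<Delta> \<gamma>" using sing by (simp add: singular_path_def)
  obtain \<psi> where psi: "abs_continuous_path (cotangent_atlas A) \<psi>"
    "\<And>t. t \<in> {0..1} \<Longrightarrow> \<psi> t \<in> annihilator A \<Delta> \<and> fst (\<psi> t) = \<gamma> t"
    "AE t in lebesgue. t \<in> {0..1} \<longrightarrow> velocity (cotangent_atlas A) \<psi> t \<in> restricted_kernel A \<Delta> (\<psi> t)"
    using sing unfolding singular_path_def by (elim conjE exE) blast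
  have "AE t in lebesgue. t \<in> {0..1} \<longrightarrow> velocity A \<gamma> t \<in> \<Delta> (\<gamma> t)" using hor by (simp add: horizontal_path_def)
  then obtain N1 where N1: "N1 \<in> null_sets lebesgue" "{t. \<not> (t \<in> {0..1} \<longrightarrow> velocity A \<gamma> t \<in> \<Delta> (\<gamma> t))} \<subseteq> N1"
    by (auto simp: eventually_ae_filter)
  obtain N2 where N2: "N2 \<in> null_sets lebesgue" "{t. \<not> (t \<in> {0..1} \<longrightarrow> velocity (cotangent_atlas A) \<psi> t \<in> restricted_kernel A \<Delta> (\<psi> t))} \<subseteq> N2"
    using psi(3) by (auto simp: eventually_ae_filter)
  obtain C e2 where C: "C \<in> cotangent_atlas A" and e2: "e2 > 0" "\<psi> ` ({0..1} \<inter> {s - e2..s + e2}) \<subseteq> fst C"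
    "abs_continuous_on ({0..1} \<inter> {s - e2..s + e2}) (snd C \<circ> \<psi>)"
    using bspec[OF psi(1)[unfolded abs_continuous_path_def Let_def] s] by (elim bexE exE conjE)
  obtain c' where c': "c' \<in> A" "C = cotangent_chart A c'" using C by (auto simp: cotangent_atlas_def)
  obtain c0 e0 where c0: "c0 \<in> A" and e0: "e0 > 0" "\<gamma> ` ({0..1} \<inter> {s - e0..s + e0}) \<subseteq> fst c0"
    "abs_continuous_on ({0..1} \<inter> {s - e0..s + e0}) (snd c0 \<circ> \<gamma>)"
    using bspec[OF conjunct1[OF hor[unfolded horizontal_path_def abs_continuous_L2_path_def Let_def]] s] by (elim bexE exE conjE)
  have Ic: "{0..1} \<inter> {s - e..s + e} = {max 0 (s - e)..min 1 (s + e)}" for e :: real by auto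
  have g0: "\<gamma> s \<in> fst c0" using e0 s by auto
  define f where "f = snd c0 \<circ> \<gamma>"
  define T where "T = transition c0 c"
  have cf: "continuous_on ({0..1} \<inter> {s - e0..s + e0}) f"
    unfolding Ic f_def by (rule abs_continuous_on_continuous) (use e0(3) in \<open>simp add: Ic\<close>)
  \<comment> \<open>The coordinates in \<open>c0\<close> of the points whose coordinates in
    \<open>c\<close> lie in \<open>G\<close>.\<close>
  define W where "W = overlap c0 c \<inter> T -` G"
  have sT: "smooth_on (overlap c0 c) T" unfolding T_def by (rule transition_smooth[OF c0 c(1)])
  have oW: "open W" unfolding W_def
    by (rule continuous_open_preimage[OF smooth_on_continuous[OF sT] overlap_open[OF c0 c(1)] G(1)])
  have "f s \<in> W" using overlap_in[OF g0 c(2)] transition_eq[OF c0 g0] G(2) by (simp add: W_def f_def T_def)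
  then obtain r where r: "r > 0" "cball (f s) r \<subseteq> W" using oW open_contains_cball by blast
  have "cball (f s) r \<subseteq> overlap c0 c" using r(2) by (auto simp: W_def)
  then obtain B where B: "B > 0" "\<forall>x\<in>cball (f s) r. \<forall>y\<in>cball (f s) r. norm (T x - T y) \<le> B * norm (x - y)"
    by (rule smooth_on_lipschitz_cball[OF sT])
  have sI: "s \<in> {0..1} \<inter> {s - e0..s + e0}" using s e0 by auto
  obtain d where d: "d > 0" "\<And>t. t \<in> {0..1} \<inter> {s - e0..s + e0} \<Longrightarrow> dist t s < d \<Longrightarrow> dist (f t) (f s) < r"
    using cf[unfolded continuous_on_iff, rule_format, OF sI r(1)] by blast
  define \<delta> where "\<delta> = min (min e0 e2) (d / 2)"
  have \<delta>: "\<delta> > 0" "\<delta> \<le> e0" "\<delta> \<le> e2" "\<delta> < d" using e0 e2 d by (auto simp: \<delta>_def)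
  have ball: "f t \<in> cball (f s) r" if "t \<in> {0..1}" "\<bar>t - s\<bar> \<le> \<delta>" for t
  proof -
    have "t \<in> {0..1} \<inter> {s - e0..s + e0}" using that \<delta> by (auto simp: abs_le_iff)
    moreover have "dist t s < d" using that \<delta> by (simp add: dist_real_def)
    ultimately have "dist (f t) (f s) < r" by (rule d(2))
    then show ?thesis by (simp add: dist_commute)
  qed
  have g0t: "\<gamma> t \<in> fst c0" if "t \<in> {0..1}" "\<bar>t - s\<bar> \<le> \<delta>" for t
  proof -
    have "t \<in> {0..1} \<inter> {s - e0..s + e0}" using that \<delta> by (auto simp: abs_le_iff)
    then show ?thesis using e0(2) by blast
  qed
  have inc: "\<gamma> t \<in> fst c \<and> snd c (\<gamma> t) \<in> G" if "t \<in> {0..1}" "\<bar>t - s\<bar> \<le> \<delta>" for t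
  proof -
    have w: "f t \<in> W" by (rule subsetD[OF r(2) ball[OF that]])
    then obtain x where x: "x \<in> fst c0" "x \<in> fst c" "f t = snd c0 x" by (auto simp: W_def overlap_def)
    have "chart_inv c0 (f t) = \<gamma> t" using chart_inv_chart[OF c0 g0t[OF that]] by (simp add: f_def)
    moreover have "chart_inv c0 (f t) = x" unfolding x(3) by (rule chart_inv_chart[OF c0 x(1)])
    ultimately have gx: "\<gamma> t = x" by simp
    have "T (f t) \<in> G" using w by (simp add: W_def)
    then have "snd c x \<in> G" unfolding x(3) T_def using transition_eq[OF c0 x(1), of c] by simp
    then show ?thesis unfolding gx using x(2) by (rule conjI[rotated])
  qed
  have Tf: "(snd c \<circ> \<gamma>) t = T (f t)" if "t \<in> {0..1}" "\<bar>t - s\<bar> \<le> \<delta>" for t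
    using transition_eq[OF c0 g0t[OF that], of c] by (simp add: T_def f_def)
  have ac: "abs_continuous_on ({0..1} \<inter> {s - \<delta>..s + \<delta>}) (snd c \<circ> \<gamma>)"
  proof (rule abs_continuous_on_dominated)
    show "abs_continuous_on ({0..1} \<inter> {s - \<delta>..s + \<delta>}) f"
      unfolding f_def by (rule abs_continuous_on_subset[OF e0(3)]) (use \<delta> in auto)
    fix u t assume "u \<in> {0..1} \<inter> {s - \<delta>..s + \<delta>}" "t \<in> {0..1} \<inter> {s - \<delta>..s + \<delta>}"
    then have "u \<in> {0..1}" "\<bar>u - s\<bar> \<le> \<delta>" "t \<in> {0..1}" "\<bar>t - s\<bar> \<le> \<delta>" by (auto simp: abs_le_iff)
    then show "norm ((snd c \<circ> \<gamma>) t - (snd c \<circ> \<gamma>) u) \<le> B * norm (f t - f u)"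
      using B(2) ball Tf by simp
  qed
  define N where "N = {t \<in> {max 0 (s - e2)<..<min 1 (s + e2)}. \<not> (snd C \<circ> \<psi>) differentiable (at t)} \<union> (N1 \<union> N2)"
  have "negligible {t \<in> {max 0 (s - e2)<..<min 1 (s + e2)}. \<not> (snd C \<circ> \<psi>) differentiable (at t)}"
    by (rule abs_continuous_differentiable_ae) (use e2(3) in \<open>simp only: Ic\<close>)
  moreover have "negligible N1" "negligible N2" using N1(1) N2(1) by (simp_all add: negligible_iff_null_sets)
  ultimately have nN: "negligible N" unfolding N_def by (intro negligible_Un)
  have main: "((snd c \<circ> \<gamma>) has_vector_derivative velocity A \<gamma> t c) (at t) \<and> char_at (\<gamma> t) (velocity A \<gamma> t)"
    if t: "0 < t" "t < 1" "\<bar>t - s\<bar> < \<delta>" "t \<notin> N" for t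
  proof -
    define I where "I = {max 0 (s - \<delta>)<..<min 1 (s + \<delta>)}"
    have tI: "open I" "t \<in> I" using t by (auto simp: I_def abs_less_iff)
    have Is: "u \<in> {0..1}" "\<bar>u - s\<bar> \<le> \<delta>" "u \<in> {0..1} \<inter> {s - e2..s + e2}" if "u \<in> I" for u
      using that \<delta> by (auto simp: I_def abs_le_iff)
    have ps: "\<psi> u \<in> annihilator A \<Delta> \<and> fst (\<psi> u) = \<gamma> u \<and> \<gamma> u \<in> fst c'" if u: "u \<in> I" for u
    proof -
      have "\<psi> u \<in> fst C" using e2(2) Is(3)[OF u] by blast
      then have "fst (\<psi> u) \<in> fst c'" unfolding c'(2) cotangent_chart_def by auto
      then show ?thesis using psi(2)[OF Is(1)[OF u]] by auto
    qed
    have df: "(snd (cotangent_chart A c') \<circ> \<psi>) differentiable (at t)"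
      using t \<delta> unfolding N_def c'(2) by (auto simp: abs_less_iff)
    have tt: "t \<in> {0..1}" using t by auto
    have h: "velocity A \<gamma> t \<in> \<Delta> (\<gamma> t)"
    proof -
      have "t \<notin> N1" using t(4) by (simp add: N_def)
      then show ?thesis using N1(2) tt by auto
    qed
    have k: "velocity (cotangent_atlas A) \<psi> t \<in> restricted_kernel A \<Delta> (\<psi> t)"
    proof -
      have "t \<notin> N2" using t(4) by (simp add: N_def)
      then show ?thesis using N2(2) tt by auto
    qed
    have gt: "\<gamma> t \<in> fst c" using inc[OF tt] t by auto
    have "char_at (\<gamma> t) (velocity A \<gamma> t)"
      by (rule lift_velocity_characteristic(1)[OF tI _ c'(1) df h k]) (rule ps)
    moreover have "((snd c \<circ> \<gamma>) has_vector_derivative velocity A \<gamma> t c) (at t)"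
      by (rule lift_velocity_characteristic(2)[OF tI _ c'(1) df h k c(1) gt]) (rule ps)
    ultimately show ?thesis by simp
  qed
  show ?thesis by (rule that[OF \<delta>(1) nN inc ac main])
qed

end

lemma smooth_on_inverse:
  fixes f :: "'a::real_normed_vector \<Rightarrow> real"
  assumes "open S" "smooth_on S f" "\<And>x. x \<in> S \<Longrightarrow> f x \<noteq> 0"
  shows "smooth_on S (\<lambda>x. inverse (f x))"
proof -
  have "tcd k S (\<lambda>x. inverse (f x))" for k
  proof (induction k)
    case 0
    then show ?case using smooth_on_continuous[OF assms(2)] assms(3) by (auto intro: continuous_intros)
  next
    case (Suc k)
    have f: "tcd k S (\<lambda>x. frechet_derivative f (at x) v)" for v
      using smooth_on_derivative[OF assms(2)] by (simp add: smooth_on_def)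
    have 1: "tcd k S (\<lambda>x. - ((inverse (f x) * frechet_derivative f (at x) v) * inverse (f x)))" for v
      by (intro tcd_bounded_linear[OF assms(1) bounded_linear_minus[OF bounded_linear_ident]] tcd_bilinear[OF assms(1) bounded_bilinear_mult] Suc f)
    show ?case
      by (rule tcd_SucI[OF assms(1) Deriv.has_derivative_inverse[OF assms(3) smooth_on_has_derivative[OF assms(2)]] 1])
  qed
  then show ?thesis by (simp add: smooth_on_def)
qed

section \<open>Restricting a smooth field to a ball\<close>

text \<open>The projection onto a ball is 1-Lipschitz with values in the ball, so composing with it
  extends the field to the whole space with the bounds it has on the ball.\<close>

lemma closest_point_field:
  fixes V :: "'a::euclidean_space \<Rightarrow> 'a"
  assumes "smooth_on S V" "cball p r \<subseteq> S" "r > 0"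
  obtains L M where "lipschitz_field (\<lambda>x. V (closest_point (cball p r) x)) L M"
proof -
  obtain L where L: "L > 0" "\<forall>x\<in>cball p r. \<forall>y\<in>cball p r. norm (V x - V y) \<le> L * norm (x - y)"
    by (rule smooth_on_lipschitz_cball[OF assms(1,2)])
  have "bounded (V ` cball p r)"
    using smooth_on_continuous[OF assms(1)] assms(2) by (intro compact_imp_bounded compact_continuous_image compact_cball) (rule continuous_on_subset)
  then obtain M where M: "\<forall>x\<in>cball p r. norm (V x) \<le> M" unfolding bounded_iff by auto
  have ne: "cball p r \<noteq> {}" using assms(3) by simp
  have cp: "closest_point (cball p r) x \<in> cball p r" for x by (rule closest_point_in_set[OF closed_cball ne])
  have "lipschitz_field (\<lambda>x. V (closest_point (cball p r) x)) L M"
  proof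
    fix x y
    have "norm (V (closest_point (cball p r) x) - V (closest_point (cball p r) y)) \<le> L * norm (closest_point (cball p r) x - closest_point (cball p r) y)"
      using L(2) cp by blast
    also have "\<dots> \<le> L * norm (x - y)"
      using closest_point_lipschitz[OF convex_cball closed_cball ne, of x y] L(1) by (intro mult_left_mono) (auto simp: dist_norm)
    finally show "norm (V (closest_point (cball p r) x) - V (closest_point (cball p r) y)) \<le> L * norm (x - y)" .
  qed (use L M cp in auto)
  then show ?thesis by (rule that)
qed

section \<open>Flow boxes\<close>

text \<open>A field with constant unit component in the direction \<open>l\<close>, obtained from \<open>Z\<close> by rescaling on a
  ball. Its orbits are graphs over the \<open>l\<close>-th coordinate, and \<open>plaque y\<close> is the point
  where the orbit of \<open>y\<close> meets the hyperplane on which this coordinate vanishes.\<close>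

locale flow_box = lipschitz_field U L M for U :: "real^4 \<Rightarrow> real^4" and L M +
  fixes l :: 4
  assumes unit: "U x $ l = 1"
begin

definition plaque :: "real^4 \<Rightarrow> real^4" where
  "plaque y = flow (- (y $ l)) y"

lemma flow_coordinate: "flow t y $ l = y $ l + t"
proof -
  have d: "((\<lambda>t. flow t y $ l - t) has_derivative (\<lambda>h. 0)) (at t within UNIV)" for t
  proof -
    have "((\<lambda>t. flow t y $ l) has_derivative (\<lambda>h. (h *\<^sub>R U (flow t y)) $ l)) (at t)"
      using flow_deriv[of y t] unfolding has_vector_derivative_def by (rule bounded_linear.has_derivative[OF bounded_linear_vec_nth])
    then show ?thesis by (auto intro!: derivative_eq_intros simp: unit)
  qed
  have "flow t y $ l - t = flow 0 y $ l - 0"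
    by (rule has_derivative_zero_unique[OF convex_UNIV d]) auto
  then show ?thesis by simp
qed

lemma plaque_flow: "plaque (flow t y) = plaque y"
  unfolding plaque_def by (simp add: flow_coordinate flow_add[symmetric])

lemma flow_plaque: "flow (y $ l) (plaque y) = y"
  unfolding plaque_def by (rule flow_inverse)

lemma plaque_eq_imp: "plaque y = plaque w \<Longrightarrow> y = flow (y $ l - w $ l) w"
  using flow_plaque[of y] flow_plaque[of w] flow_add[of "y $ l - w $ l" "w $ l" "plaque w"] by simp

lemma plaque_lipschitz:
  assumes "\<bar>x $ l\<bar> \<le> R" "\<bar>y $ l\<bar> \<le> R"
  shows "norm (plaque x - plaque y) \<le> (M + exp (L * R)) * norm (x - y)"
proof -
  have "norm (plaque x - plaque y) \<le> M * \<bar>x $ l - y $ l\<bar> + exp (L * \<bar>y $ l\<bar>) * norm (x - y)"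
    using flow_joint_lip[of "- (x $ l)" x "- (y $ l)" y] by (simp add: plaque_def abs_minus_commute)
  also have "\<dots> \<le> M * norm (x - y) + exp (L * R) * norm (x - y)"
  proof (intro add_mono mult_left_mono mult_right_mono)
    show "\<bar>x $ l - y $ l\<bar> \<le> norm (x - y)" using component_le_norm_cart[of "x - y" l] by simp
  qed (use M_nonneg assms L_pos in auto)
  finally show ?thesis by (simp add: algebra_simps)
qed

text \<open>At time 0 a Lipschitz field already makes the flow differentiable jointly in time and
  initial point.\<close>

lemma flow_joint_derivative_zero:
  "((\<lambda>q. flow (- fst q) (snd q)) has_derivative (\<lambda>q. snd q - fst q *\<^sub>R U y)) (at (0, y))"
  unfolding has_derivative_at_alt
proof (intro conjI allI impI)
  show "bounded_linear (\<lambda>q. snd q - fst q *\<^sub>R U y)"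
    by (intro bounded_linear_sub bounded_linear_snd bounded_linear_scaleR_left[THEN bounded_linear_compose] bounded_linear_fst)
  fix e :: real assume e: "e > 0"
  define B where "B = L + L * M + 1"
  have B: "B > 0" using L_pos M_nonneg by (simp add: B_def add_nonneg_pos)
  show "\<exists>d>0. \<forall>q. norm (q - (0, y)) < d \<longrightarrow> norm (flow (- fst q) (snd q) - flow (- fst (0::real, y)) (snd (0::real, y)) -
      (snd (q - (0, y)) - fst (q - (0, y)) *\<^sub>R U y)) \<le> e * norm (q - (0, y))"
  proof (intro exI[of _ "e / B"] conjI allI impI)
    show "e / B > 0" using e B by simp
    fix q :: "real \<times> (real^4)" assume q: "norm (q - (0, y)) < e / B"
    obtain d k where dk: "q = (d, y + k)" by (metis add.commute diff_add_cancel surj_pair)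
    define n where "n = norm (q - (0, y))"
    have n: "\<bar>d\<bar> \<le> n" "norm k \<le> n" "n \<ge> 0" "n < e / B"
      using norm_fst_le[of d k] norm_snd_le[of k d] q by (auto simp: n_def dk)
    define a where "a = flow (- d) (y + k) - (y + k) - (- d) *\<^sub>R U (y + k)"
    have eq: "flow (- d) (y + k) - y - (k - d *\<^sub>R U y) = a - d *\<^sub>R (U (y + k) - U y)"
      by (simp add: a_def algebra_simps)
    have "norm a \<le> L * M * (- d)\<^sup>2" unfolding a_def by (rule flow_first_order)
    moreover have "norm (d *\<^sub>R (U (y + k) - U y)) \<le> \<bar>d\<bar> * (L * norm k)"
      using mult_left_mono[OF lip[of "y + k" y], of "\<bar>d\<bar>"] by simp
    ultimately have "norm (flow (- d) (y + k) - y - (k - d *\<^sub>R U y)) \<le> L * M * (- d)\<^sup>2 + \<bar>d\<bar> * (L * norm k)"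
      unfolding eq using norm_triangle_ineq4[of a "d *\<^sub>R (U (y + k) - U y)"] by linarith
    also have "\<dots> \<le> L * M * n\<^sup>2 + n * (L * n)"
    proof (intro add_mono mult_left_mono mult_mono)
      show "(- d)\<^sup>2 \<le> n\<^sup>2" using n(1) by (simp add: abs_le_square_iff[symmetric])
    qed (use n L_pos M_nonneg in auto)
    also have "\<dots> = (L + L * M) * n * n" by (simp add: power2_eq_square algebra_simps)
    also have "\<dots> \<le> B * n * n" using n by (intro mult_right_mono) (auto simp: B_def)
    also have "\<dots> \<le> e * n" using n B by (intro mult_right_mono) (auto simp: field_simps)
    finally show "norm (flow (- fst q) (snd q) - flow (- fst (0::real, y)) (snd (0::real, y)) - (snd (q - (0, y)) - fst (q - (0, y)) *\<^sub>R U y)) \<le> e * norm (q - (0, y))"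
      by (simp add: dk n_def)
  qed
qed

text \<open>Let \<tau> be the \<open>l\<close>-th coordinate of \<open>f t\<close>. Writing
  \<open>plaque (f s)\<close> as \<open>flow (- \<tau>) (g s)\<close> leaves a flow time near 0
  inside \<open>g\<close>, where the joint derivative is available and shows that \<open>g\<close>
  has derivative 0 at \<open>t\<close>. The outer map is Lipschitz, and a Lipschitz map preserves a
  zero derivative.\<close>

lemma plaque_derivative_zero:
  assumes f: "(f has_vector_derivative v) (at t)" and v: "v = (v $ l) *\<^sub>R U (f t)"
  shows "((\<lambda>s. plaque (f s)) has_vector_derivative 0) (at t)"
proof -
  define \<tau> where "\<tau> = f t $ l"
  have fd: "(f has_derivative (\<lambda>h. h *\<^sub>R v)) (at t)" using f by (simp add: has_vector_derivative_def)
  have 1: "((\<lambda>s. (f s $ l - \<tau>, f s)) has_derivative (\<lambda>h. (h * v $ l, h *\<^sub>R v))) (at t)"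
    by (rule has_derivative_eq_rhs[OF has_derivative_Pair[OF has_derivative_diff[OF bounded_linear.has_derivative[OF bounded_linear_vec_nth fd] has_derivative_const] fd]]) simp
  have 2: "((\<lambda>s. flow (- (f s $ l - \<tau>)) (f s)) has_derivative (\<lambda>h. h *\<^sub>R v - (h * v $ l) *\<^sub>R U (f t))) (at t)"
    using has_derivative_compose[OF 1, of "\<lambda>q. flow (- fst q) (snd q)" "\<lambda>q. snd q - fst q *\<^sub>R U (f t)"] flow_joint_derivative_zero[of "f t"]
    by (simp add: \<tau>_def)
  have "h *\<^sub>R v - (h * v $ l) *\<^sub>R U (f t) = 0" for h
  proof -
    have "h *\<^sub>R v = h *\<^sub>R ((v $ l) *\<^sub>R U (f t))" using v by simp
    then show ?thesis by simp
  qed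
  then have 3: "((\<lambda>s. flow (- (f s $ l - \<tau>)) (f s)) has_derivative (\<lambda>h. 0)) (at t)" using 2 by simp
  define g where "g s = flow (- (f s $ l - \<tau>)) (f s)" for s
  have g: "plaque (f s) = flow (- \<tau>) (g s)" for s
    by (simp add: plaque_def g_def flow_add[symmetric])
  show ?thesis unfolding has_vector_derivative_def g has_derivative_at_alt
  proof (intro conjI allI impI)
    show "bounded_linear (\<lambda>h::real. h *\<^sub>R (0::real^4))" by simp
    fix e :: real assume e: "e > 0"
    then have "e / exp (L * \<bar>\<tau>\<bar>) > 0" by simp
    then obtain d where d: "d > 0" "\<And>s. norm (s - t) < d \<Longrightarrow> norm (g s - g t - 0) \<le> e / exp (L * \<bar>\<tau>\<bar>) * norm (s - t)"
      using 3[folded g_def, unfolded has_derivative_at_alt] by blast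
    show "\<exists>d>0. \<forall>s. norm (s - t) < d \<longrightarrow> norm (flow (- \<tau>) (g s) - flow (- \<tau>) (g t) - (s - t) *\<^sub>R 0) \<le> e * norm (s - t)"
    proof (intro exI[of _ d] conjI allI impI d(1))
      fix s assume s: "norm (s - t) < d"
      have "norm (flow (- \<tau>) (g s) - flow (- \<tau>) (g t)) \<le> exp (L * \<bar>\<tau>\<bar>) * norm (g s - g t)" using flow_lip[of "- \<tau>"] by simp
      also have "\<dots> \<le> exp (L * \<bar>\<tau>\<bar>) * (e / exp (L * \<bar>\<tau>\<bar>) * norm (s - t))" using d(2)[OF s] by (intro mult_left_mono) auto
      finally show "norm (flow (- \<tau>) (g s) - flow (- \<tau>) (g t) - (s - t) *\<^sub>R 0) \<le> e * norm (s - t)" by simp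
    qed
  qed
qed

text \<open>This plays the part of uniqueness of solutions: a curve tangent to the field at almost
  all times, with speed of any size and sign, stays in one orbit.\<close>

lemma plaque_constant:
  assumes ac: "abs_continuous_on {a..b} f" and ab: "a \<le> b" and N: "negligible N"
    and d: "\<And>t. t \<in> {a<..<b} - N \<Longrightarrow> \<exists>v. (f has_vector_derivative v) (at t) \<and> v = (v $ l) *\<^sub>R U (f t)"
  shows "plaque (f b) = plaque (f a)"
proof -
  have "bounded (f ` {a..b})"
    by (intro compact_imp_bounded compact_continuous_image abs_continuous_on_continuous[OF ac] compact_Icc)
  then obtain R where R: "\<forall>t\<in>{a..b}. norm (f t) \<le> R" unfolding bounded_iff by auto
  have Rl: "\<bar>f t $ l\<bar> \<le> R" if "t \<in> {a..b}" for t using bspec[OF R that] component_le_norm_cart[of "f t" l] by simp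
  show ?thesis
  proof (rule abs_continuous_derivative_zero_const[OF _ ab N])
    show "abs_continuous_on {a..b} (\<lambda>t. plaque (f t))"
      by (rule abs_continuous_on_dominated[OF ac, of _ "M + exp (L * R)"]) (intro plaque_lipschitz Rl)
    fix t assume "t \<in> {a<..<b} - N"
    then obtain v where "(f has_vector_derivative v) (at t)" "v = (v $ l) *\<^sub>R U (f t)" using d by blast
    then show "((\<lambda>t. plaque (f t)) has_vector_derivative 0) (at t)" by (rule plaque_derivative_zero)
  qed
qed

lemma plaque_constant_deriv:
  assumes ab: "a \<le> b" and d: "\<And>t. t \<in> {a..b} \<Longrightarrow> \<exists>v. (f has_vector_derivative v) (at t) \<and> v = (v $ l) *\<^sub>R U (f t)"
  shows "plaque (f b) = plaque (f a)"
proof -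
  have "((\<lambda>t. plaque (f t)) has_derivative (\<lambda>h. 0)) (at t within {a..b})" if tab: "t \<in> {a..b}" for t
  proof -
    obtain v where "(f has_vector_derivative v) (at t)" "v = (v $ l) *\<^sub>R U (f t)" using d[OF tab] by blast
    then have "((\<lambda>t. plaque (f t)) has_vector_derivative 0) (at t)" by (rule plaque_derivative_zero)
    then show ?thesis by (simp add: has_vector_derivative_def has_derivative_at_withinI)
  qed
  then show ?thesis by (rule has_derivative_zero_unique[OF convex_real_interval(5)]) (use ab in auto)
qed

text \<open>If \<open>S\<close> contains a piece of orbit around each of its points, rational times suffice to
  saturate it.\<close>

lemma saturation_negligible:
  assumes S: "negligible S" and loc: "\<And>u. u \<in> S \<Longrightarrow> \<exists>\<delta>>0. \<forall>t. \<bar>t\<bar> < \<delta> \<longrightarrow> flow t u \<in> S"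
  shows "negligible {w. \<exists>u\<in>S. plaque w = plaque u}"
proof -
  have "negligible (\<Union>q\<in>\<rat>. flow q ` S)"
    by (intro negligible_countable_Union countable_image countable_rat) (auto intro: flow_negligible S)
  moreover have "{w. \<exists>u\<in>S. plaque w = plaque u} \<subseteq> (\<Union>q\<in>\<rat>. flow q ` S)"
  proof clarify
    fix w u assume u: "u \<in> S" and eq: "plaque w = plaque u"
    define t where "t = w $ l - u $ l"
    have w: "w = flow t u" unfolding t_def by (rule plaque_eq_imp[OF eq])
    obtain \<delta> where d: "\<delta> > 0" "\<And>t. \<bar>t\<bar> < \<delta> \<Longrightarrow> flow t u \<in> S" using loc[OF u] by blast
    obtain q where q: "q \<in> \<rat>" "t < q" "q < t + \<delta>" using Rats_dense_in_real[of t "t + \<delta>"] d(1) by auto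
    have "flow (t - q) u \<in> S" using d(2)[of "t - q"] q by simp
    moreover have "w = flow q (flow (t - q) u)" by (simp add: w flow_add[symmetric])
    ultimately show "w \<in> (\<Union>q\<in>\<rat>. flow q ` S)" using q by blast
  qed
  ultimately show ?thesis by (rule negligible_subset)
qed

text \<open>A plaque is contained in a differentiable curve, and a curve is a null set in dimension
  4.\<close>

lemma orbit_negligible: "negligible {w. plaque w = plaque u}"
proof (rule negligible_subset)
  show "{w. plaque w = plaque u} \<subseteq> (\<lambda>t. flow t u) ` UNIV" using plaque_eq_imp by blast
  show "negligible ((\<lambda>t. flow t u) ` UNIV)"
  proof (rule negligible_differentiable_image_lowdim)
    show "(\<lambda>t. flow t u) differentiable_on UNIV"
      using flow_deriv[of u] unfolding differentiable_on_def has_vector_derivative_def differentiable_def by auto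
  qed simp
qed

end

section \<open>Orbits of finite length ending at a zero\<close>

context lipschitz_field
begin

text \<open>Lengths are taken over all nondecreasing sequences of times, so that a shift of time
  preserves the condition; equal steps starting at 0, as in \<open>trapped\<close>, are then a
  special case.\<close>

definition short_trapped :: "'a set \<Rightarrow> real \<Rightarrow> 'a set" where
  "short_trapped K l = {y. (\<forall>t\<ge>0. flow t y \<in> K) \<and>
     (\<forall>\<tau>::nat \<Rightarrow> real. mono \<tau> \<longrightarrow> \<tau> 0 \<ge> 0 \<longrightarrow> (\<forall>N. (\<Sum>i<N. norm (flow (\<tau> (Suc i)) y - flow (\<tau> i) y)) \<le> l))}"

text \<open>Confinement and the length bound are required only from some integer time on, which
  makes the notion invariant under the flow in both time directions.\<close>

definition ends :: "'a set \<Rightarrow> 'a \<Rightarrow> bool" where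
  "ends K y \<longleftrightarrow> (\<exists>n l::nat. flow (real n) y \<in> short_trapped K (real l)) \<and> ((\<lambda>t. V (flow t y)) \<longlongrightarrow> 0) at_top"

lemma short_trapped_flow:
  assumes "y \<in> short_trapped K l" "s \<ge> 0" shows "flow s y \<in> short_trapped K l"
proof -
  have 1: "flow t (flow s y) \<in> K" if "t \<ge> 0" for t
    using assms that unfolding short_trapped_def by (simp add: flow_add[symmetric])
  have 2: "(\<Sum>i<N. norm (flow (\<tau> (Suc i)) (flow s y) - flow (\<tau> i) (flow s y))) \<le> l"
    if t: "mono \<tau>" "\<tau> 0 \<ge> 0" for \<tau> :: "nat \<Rightarrow> real" and N
  proof -
    have "mono (\<lambda>i. \<tau> i + s)" "\<tau> 0 + s \<ge> 0" using t assms(2) by (auto simp: mono_def)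
    then show ?thesis using assms(1) unfolding short_trapped_def by (auto simp: flow_add[symmetric])
  qed
  show ?thesis unfolding short_trapped_def using 1 2 by blast
qed

lemma ends_flow:
  assumes "ends K y" shows "ends K (flow s y)"
proof -
  obtain n l :: nat where nl: "flow (real n) y \<in> short_trapped K (real l)" using assms unfolding ends_def by blast
  obtain m :: nat where m: "real n - s \<le> real m" using real_arch_simple by blast
  have "flow (real m) (flow s y) = flow (real m + s - real n) (flow (real n) y)" by (simp add: flow_add[symmetric])
  then have 1: "flow (real m) (flow s y) \<in> short_trapped K (real l)" using short_trapped_flow[OF nl] m by simp
  have "((\<lambda>t. V (flow t y)) \<longlongrightarrow> 0) at_top" using assms unfolding ends_def by blast
  moreover have "filterlim (\<lambda>t. t + s) at_top at_top"
    by (rule filterlim_tendsto_add_at_top[OF tendsto_const filterlim_ident, of s, simplified add.commute[of s]])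
  ultimately have "((\<lambda>t. V (flow (t + s) y)) \<longlongrightarrow> 0) at_top" by (rule filterlim_compose)
  then show ?thesis using 1 unfolding ends_def by (auto simp: flow_add)
qed

text \<open>The norm of \<open>V\<close> is bounded below on every bounded piece of an orbit, and tends to \<open>0\<close> along \<open>f\<close>
  as \<open>s\<close> decreases to \<open>s0\<close>: the orbit is not periodic and the time coordinate of \<open>f\<close> is unbounded.\<close>

lemma path_to_zero_time:
  fixes s0 s1 :: real and f :: "real \<Rightarrow> 'a"
  assumes s01: "s0 < s1" and f: "continuous_on {s0..s1} f" and z0: "V (f s0) = 0"
    and nz: "\<And>s. s \<in> {s0<..s1} \<Longrightarrow> V (f s) \<noteq> 0"
    and loc: "\<And>s \<eta>. s \<in> {s0<..s1} \<Longrightarrow> \<eta> > 0 \<Longrightarrow> \<exists>\<kappa>>0. \<forall>s'\<in>{s0<..s1}. \<bar>s' - s\<bar> < \<kappa> \<longrightarrow> (\<exists>\<theta>. \<bar>\<theta>\<bar> < \<eta> \<and> f s' = flow \<theta> (f s))"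
  obtains T and \<sigma> :: real where "continuous_on {s0<..s1} T" "\<forall>s\<in>{s0<..s1}. f s = flow (T s) (f s1)" "T s1 = 0"
    "\<sigma> = 1 \<or> \<sigma> = -1" "\<forall>R. \<exists>s'\<in>{s0<..s1}. \<forall>s\<in>{s0<..s'}. \<sigma> * T s > R"
proof -
  define z where "z = f s1"
  define S where "S = {s0<..s1}"
  have s1S: "s1 \<in> S" using s01 by (simp add: S_def)
  have orbit: "\<exists>\<tau>. f s = flow \<tau> z" if s: "s \<in> S" for s
  proof (rule connected_induction_simple[where P = "\<lambda>s. \<exists>\<tau>. f s = flow \<tau> z", OF _ s1S s])
    show "connected S" unfolding S_def by (rule convex_connected) auto
    show "\<exists>\<tau>. f s1 = flow \<tau> z" by (intro exI[of _ 0]) (simp add: z_def)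
    fix a assume a: "a \<in> S"
    obtain \<kappa> where k: "\<kappa> > 0" "\<And>s'. s' \<in> S \<Longrightarrow> \<bar>s' - a\<bar> < \<kappa> \<Longrightarrow> \<exists>\<theta>. f s' = flow \<theta> (f a)"
      using loc[of a 1] a unfolding S_def by (metis zero_less_one)
    show "\<exists>W. openin (top_of_set S) W \<and> a \<in> W \<and> (\<forall>x\<in>W. \<forall>y\<in>W. (\<exists>\<tau>. f x = flow \<tau> z) \<longrightarrow> (\<exists>\<tau>. f y = flow \<tau> z))"
    proof (intro exI[of _ "S \<inter> ball a \<kappa>"] conjI ballI impI)
      show "openin (top_of_set S) (S \<inter> ball a \<kappa>)" by (rule openin_open_Int) simp
      fix x y assume xy: "x \<in> S \<inter> ball a \<kappa>" "y \<in> S \<inter> ball a \<kappa>" "\<exists>\<tau>. f x = flow \<tau> z"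
      obtain \<tau> where t: "f x = flow \<tau> z" using xy(3) by blast
      obtain \<theta>1 where 1: "f x = flow \<theta>1 (f a)" using k(2)[of x] xy(1) by (auto simp: dist_real_def abs_minus_commute)
      obtain \<theta>2 where 2: "f y = flow \<theta>2 (f a)" using k(2)[of y] xy(2) by (auto simp: dist_real_def abs_minus_commute)
      have "f a = flow (- \<theta>1) (f x)" unfolding 1 by (simp add: flow_inverse)
      then have "f y = flow (\<theta>2 + (- \<theta>1 + \<tau>)) z" using 2 t by (simp only: flow_add)
      then show "\<exists>\<tau>. f y = flow \<tau> z" by blast
    qed (use a k in auto)
  qed
  have Vz: "V (flow t z) \<noteq> 0" for t
  proof
    assume "V (flow t z) = 0"
    then have "flow (- t) (flow t z) = flow t z" by (rule flow_zero)
    then have "flow t z = z" by (simp add: flow_inverse)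
    then show False using \<open>V (flow t z) = 0\<close> nz[of s1] s1S by (simp add: z_def S_def)
  qed
  have cVf: "continuous_on {s0..s1} (\<lambda>s. V (f s))"
    by (rule continuous_on_compose2[OF V_continuous[of UNIV] f]) auto
  have near: "\<exists>s'\<in>S. \<forall>s\<in>{s0<..s'}. norm (V (f s)) < e" if e: "e > 0" for e
  proof -
    obtain d where d: "d > 0" "\<And>s. s \<in> {s0..s1} \<Longrightarrow> dist s s0 < d \<Longrightarrow> dist (V (f s)) (V (f s0)) < e"
      using cVf[unfolded continuous_on_iff, rule_format, of s0 e] e s01 by auto
    show ?thesis
    proof (intro bexI[of _ "min s1 (s0 + d/2)"] ballI)
      fix s assume "s \<in> {s0<..min s1 (s0 + d/2)}"
      then show "norm (V (f s)) < e" using d(2)[of s] d(1) z0 by (auto simp: dist_real_def)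
    qed (use s01 d in \<open>auto simp: S_def\<close>)
  qed
  \<comment> \<open>For times of modulus at most \<open>\<bar>R\<bar>\<close> the norm of the field
    on the orbit has a positive minimum, and the field along the path is smaller than that close to
    \<open>s0\<close>.\<close>
  have star: "\<exists>s'\<in>S. \<forall>s\<in>{s0<..s'}. \<forall>\<tau>. f s = flow \<tau> z \<longrightarrow> \<bar>\<tau>\<bar> > R" for R
  proof -
    have "continuous_on {- \<bar>R\<bar>..\<bar>R\<bar>} (\<lambda>t. norm (V (flow t z)))"
      by (intro continuous_on_norm continuous_on_compose2[OF V_continuous[of UNIV] flow_continuous_time]) auto
    moreover have "{- \<bar>R\<bar>..\<bar>R\<bar>} \<noteq> {}" by auto
    ultimately obtain t0 where t0: "t0 \<in> {- \<bar>R\<bar>..\<bar>R\<bar>}" "\<forall>t\<in>{- \<bar>R\<bar>..\<bar>R\<bar>}. norm (V (flow t0 z)) \<le> norm (V (flow t z))"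
      using continuous_attains_inf[OF compact_Icc, of "- \<bar>R\<bar>" "\<bar>R\<bar>" "\<lambda>t. norm (V (flow t z))"] by blast
    obtain s' where s': "s' \<in> S" "\<forall>s\<in>{s0<..s'}. norm (V (f s)) < norm (V (flow t0 z))"
      using near[of "norm (V (flow t0 z))"] Vz by auto
    show ?thesis
    proof (intro bexI[OF _ s'(1)] ballI allI impI)
      fix s \<tau> assume s: "s \<in> {s0<..s'}" and eq: "f s = flow \<tau> z"
      have "norm (V (flow \<tau> z)) < norm (V (flow t0 z))" using bspec[OF s'(2) s] unfolding eq .
      then have "\<tau> \<notin> {- \<bar>R\<bar>..\<bar>R\<bar>}" using t0(2) not_less by blast
      then show "\<bar>\<tau>\<bar> > R" by auto
    qed
  qed
  \<comment> \<open>A period \<open>P\<close> would allow every time to be reduced to one between 0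
    and \<open>P\<close>, against \<open>star\<close> with \<open>R = P\<close>.\<close>
  have inj: "t = t'" if eq: "flow t z = flow t' z" for t t'
  proof (rule ccontr)
    assume ne: "t \<noteq> t'"
    define P where "P = \<bar>t - t'\<bar>"
    have P: "P > 0" using ne by (simp add: P_def)
    have a: "flow (t - t') z = z"
    proof -
      have "flow (t - t') z = flow (- t') (flow t z)" by (simp add: flow_add[symmetric])
      then show ?thesis unfolding eq by (simp add: flow_inverse)
    qed
    have b: "flow (- (t - t')) z = z" using arg_cong[OF a, of "flow (- (t - t'))"] unfolding flow_inverse by simp
    have per: "flow P z = z" using a b unfolding P_def abs_real_def by (cases "t - t' < 0") auto
    have pern: "flow (real n * P) z = z" for n :: nat
      by (induction n) (auto simp: algebra_simps flow_add per)
    have peri: "flow (of_int k * P) z = z" for k :: int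
    proof (cases "k \<ge> 0")
      case True then show ?thesis using pern[of "nat k"] by simp
    next
      case False
      have "flow (of_int k * P) z = flow (- (real (nat (- k)) * P)) (flow (real (nat (- k)) * P) z)"
        using False pern[of "nat (- k)"] by simp
      then show ?thesis by (simp only: flow_inverse)
    qed
    obtain s' where s': "s' \<in> S" "\<forall>s\<in>{s0<..s'}. \<forall>\<tau>. f s = flow \<tau> z \<longrightarrow> \<bar>\<tau>\<bar> > P" using star[of P] by blast
    obtain \<tau> where tau: "f s' = flow \<tau> z" using orbit[OF s'(1)] by blast
    define k where "k = \<lfloor>\<tau> / P\<rfloor>"
    have "f s' = flow (\<tau> - of_int k * P) (flow (of_int k * P) z)" using tau by (simp add: flow_add[symmetric])
    then have "f s' = flow (\<tau> - of_int k * P) z" by (simp add: peri)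
    then have "\<bar>\<tau> - of_int k * P\<bar> > P" using s' by (auto simp: S_def)
    moreover have "of_int k * P \<le> \<tau>" "\<tau> < (of_int k + 1) * P"
    proof -
      have 1: "of_int k \<le> \<tau> / P" "\<tau> / P < of_int k + 1" unfolding k_def by linarith+
      show "of_int k * P \<le> \<tau>" using 1(1) P by (simp only: pos_le_divide_eq)
      show "\<tau> < (of_int k + 1) * P" using 1(2) P by (simp only: pos_divide_less_eq)
    qed
    ultimately show False by (simp add: algebra_simps)
  qed
  define T where "T s = (SOME \<tau>. f s = flow \<tau> z)" for s
  have T: "f s = flow (T s) z" if "s \<in> S" for s unfolding T_def by (rule someI_ex[OF orbit[OF that]])
  have cT: "continuous_on S T" unfolding continuous_on_iff
  proof (intro ballI allI impI)
    fix s e :: real assume s: "s \<in> S" and e: "e > 0"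
    obtain \<kappa> where k: "\<kappa> > 0" "\<forall>s'\<in>S. \<bar>s' - s\<bar> < \<kappa> \<longrightarrow> (\<exists>\<theta>. \<bar>\<theta>\<bar> < e \<and> f s' = flow \<theta> (f s))"
      using loc[of s e] s e unfolding S_def by blast
    show "\<exists>d>0. \<forall>x'\<in>S. dist x' s < d \<longrightarrow> dist (T x') (T s) < e"
    proof (intro exI[of _ \<kappa>] conjI k(1) ballI impI)
      fix x assume x: "x \<in> S" "dist x s < \<kappa>"
      then obtain \<theta> where th: "\<bar>\<theta>\<bar> < e" "f x = flow \<theta> (f s)" using k(2) by (auto simp: dist_real_def)
      have "flow (T x) z = flow (\<theta> + T s) z" using T[OF x(1)] T[OF s] th(2) by (simp add: flow_add)
      then have "T x = \<theta> + T s" by (rule inj)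
      then show "dist (T x) (T s) < e" using th(1) by (simp add: dist_real_def)
    qed
  qed
  have T1: "T s1 = 0" by (rule inj) (use T[OF s1S] in \<open>simp add: z_def\<close>)
  obtain ss where ss: "ss \<in> S" "\<And>s. s \<in> {s0<..ss} \<Longrightarrow> \<bar>T s\<bar> > 1"
    using star[of 1] T unfolding S_def by fastforce
  define \<sigma> where "\<sigma> = sgn (T ss)"
  have Tss: "\<bar>T ss\<bar> > 1" using ss by (auto simp: S_def)
  then have sg: "\<sigma> = 1 \<or> \<sigma> = -1" unfolding \<sigma>_def sgn_if by auto
  \<comment> \<open>To change sign, \<open>T\<close> would have to pass through 0, where its modulus
    is not above 1.\<close>
  have sp: "\<sigma> * T s > 0" if s: "s \<in> {s0<..ss}" for s
  proof (rule ccontr)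
    assume "\<not> \<sigma> * T s > 0"
    moreover have "\<sigma> * T ss > 0" using Tss unfolding \<sigma>_def sgn_if by (cases "T ss > 0") auto
    moreover have "continuous_on {s..ss} (\<lambda>s. \<sigma> * T s)"
      by (intro continuous_intros continuous_on_subset[OF cT]) (use s ss(1) in \<open>auto simp: S_def\<close>)
    ultimately obtain r where r: "r \<ge> s" "r \<le> ss" "\<sigma> * T r = 0"
      using IVT'[of "\<lambda>s. \<sigma> * T s" s 0 ss] s by auto
    then have "T r = 0" using sg by auto
    then show False using ss(2)[of r] r s by auto
  qed
  have big: "\<exists>s'\<in>{s0<..s1}. \<forall>s\<in>{s0<..s'}. \<sigma> * T s > R" for R
  proof -
    obtain s' where s': "s' \<in> S" "\<forall>s\<in>{s0<..s'}. \<forall>\<tau>. f s = flow \<tau> z \<longrightarrow> \<bar>\<tau>\<bar> > R" using star[of R] by blast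
    show ?thesis
    proof (intro bexI[of _ "min s' ss"] ballI)
      fix s assume s: "s \<in> {s0<..min s' ss}"
      have "s \<in> S" using s s' by (auto simp: S_def)
      moreover have "s \<in> {s0<..s'}" using s by simp
      ultimately have "\<bar>T s\<bar> > R" using s'(2) T[of s] by blast
      moreover have "\<sigma> * T s > 0" using sp s by auto
      ultimately show "\<sigma> * T s > R" using sg by (elim disjE) simp_all
    qed (use s'(1) ss(1) in \<open>auto simp: S_def\<close>)
  qed
  have "\<forall>s\<in>{s0<..s1}. f s = flow (T s) (f s1)" using T unfolding S_def z_def by blast
  moreover have "\<forall>R. \<exists>s'\<in>{s0<..s1}. \<forall>s\<in>{s0<..s'}. \<sigma> * T s > R" using big by blast
  ultimately show ?thesis by (rule that[OF cT[unfolded S_def] _ T1 sg])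
qed

text \<open>The path may run back and forth on the orbit. For \<open>t \<ge> 0\<close> let
  \<open>h t\<close> be the last parameter with time coordinate \<open>t\<close>; it exists because
  the time is 0 at \<open>s1\<close> and unbounded towards \<open>s0\<close>. Since \<open>h\<close>
  is antitone, increasing times on the orbit correspond to decreasing parameters of the path, so the
  polygon on the orbit is a polygon of the path over disjoint intervals and \<open>var\<close>
  bounds its length.\<close>

lemma path_to_zero_trapped:
  fixes s0 s1 \<sigma> :: real and f :: "real \<Rightarrow> 'a" and T :: "real \<Rightarrow> real"
  assumes s01: "s0 < s1" and f: "continuous_on {s0..s1} f" and z0: "V (f s0) = 0"
    and fK: "\<forall>s\<in>{s0..s1}. f s \<in> K"
    and var: "\<forall>D. finite D \<longrightarrow> (\<forall>(s, t)\<in>D. s0 \<le> s \<and> t \<le> s1 \<and> s \<le> t) \<longrightarrow>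
        disjoint_family_on (\<lambda>(s, t). {s<..<t}) D \<longrightarrow> (\<Sum>(s, t)\<in>D. norm (f t - f s)) \<le> 1"
    and T: "continuous_on {s0<..s1} T" "\<forall>s\<in>{s0<..s1}. f s = flow (\<sigma> * T s) (f s1)" "T s1 = 0"
    and big: "\<forall>R. \<exists>s'\<in>{s0<..s1}. \<forall>s\<in>{s0<..s'}. T s > R"
    and fl: "flow' = (\<lambda>t. flow (\<sigma> * t))"
  shows "\<And>t. t \<ge> 0 \<Longrightarrow> flow' t (f s1) \<in> K"
    and "\<And>(\<tau>::nat \<Rightarrow> real) N. mono \<tau> \<Longrightarrow> \<tau> 0 \<ge> 0 \<Longrightarrow> (\<Sum>i<N. norm (flow' (\<tau> (Suc i)) (f s1) - flow' (\<tau> i) (f s1))) \<le> 1"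
    and "((\<lambda>t. V (flow' t (f s1))) \<longlongrightarrow> 0) at_top"
proof -
  have last: "\<exists>s\<in>{s0<..s1}. T s = t \<and> (\<forall>r\<in>{s<..s1}. T r < t)" if t: "t \<ge> 0" for t
  proof -
    obtain s' where s1: "s' \<in> {s0<..s1}" "\<forall>s\<in>{s0<..s'}. T s > t" using big by blast
    then have s': "s' \<in> {s0<..s1}" "T s' > t" by auto
    have cT: "continuous_on {s'..s1} T" by (rule continuous_on_subset[OF T(1)]) (use s' in auto)
    define Q where "Q = {s'..s1} \<inter> T -` {t..}"
    have cQ: "closed Q" unfolding Q_def by (rule continuous_closed_preimage[OF cT]) auto
    have Qne: "s' \<in> Q" using s' by (auto simp: Q_def)
    have bQ: "bdd_above Q" by (rule bdd_aboveI[of _ s1]) (auto simp: Q_def)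
    define s where "s = Sup Q"
    have sQ: "s \<in> Q" unfolding s_def by (rule closed_contains_Sup[OF _ bQ cQ]) (use Qne in auto)
    have after: "T r < t" if r: "r \<in> {s<..s1}" for r
    proof (rule ccontr)
      assume "\<not> T r < t"
      then have "r \<in> Q" using r sQ by (auto simp: Q_def)
      then show False using cSup_upper[OF _ bQ] r by (fastforce simp: s_def)
    qed
    have "T s = t"
    proof (rule ccontr)
      assume "T s \<noteq> t"
      then have gt: "T s > t" using sQ by (auto simp: Q_def)
      have "continuous_on {s..s1} T" by (rule continuous_on_subset[OF cT]) (use sQ in \<open>auto simp: Q_def\<close>)
      then obtain r where r: "r \<ge> s" "r \<le> s1" "T r = t"
        using IVT2'[of T s1 t s] gt T(3) t sQ by (auto simp: Q_def)
      then have "r > s" using gt by (cases "r = s") auto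
      then show False using after[of r] r by auto
    qed
    then show ?thesis using after sQ s' by (intro bexI[of _ s]) (auto simp: Q_def)
  qed
  then obtain h where h: "\<And>t. t \<ge> 0 \<Longrightarrow> h t \<in> {s0<..s1}" "\<And>t. t \<ge> 0 \<Longrightarrow> T (h t) = t" "\<And>t r. t \<ge> 0 \<Longrightarrow> r \<in> {h t<..s1} \<Longrightarrow> T r < t"
    by metis
  have fh: "flow' t (f s1) = f (h t)" if "t \<ge> 0" for t using bspec[OF T(2) h(1)[OF that]] h(2)[OF that] by (simp add: fl)
  show K: "flow' t (f s1) \<in> K" if "t \<ge> 0" for t using fh[OF that] bspec[OF fK, of "h t"] h(1)[OF that] by simp
  have anti: "h t' \<le> h t" if "0 \<le> t" "t \<le> t'" for t t'
  proof (rule ccontr)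
    assume "\<not> h t' \<le> h t"
    then have "h t' \<in> {h t<..s1}" using h(1)[of t'] that by auto
    then have "T (h t') < t" using h(3) that by blast
    then show False using h(2)[of t'] that by simp
  qed
  show "(\<Sum>i<N. norm (flow' (\<tau> (Suc i)) (f s1) - flow' (\<tau> i) (f s1))) \<le> 1" if m: "mono \<tau>" and t0: "\<tau> 0 \<ge> 0" for \<tau> :: "nat \<Rightarrow> real" and N
  proof -
    have tp: "\<tau> i \<ge> 0" for i using monoD[OF m, of 0 i] t0 by simp
    define s where "s i = h (\<tau> i)" for i
    have sa: "s j \<le> s i" if "i \<le> j" for i j unfolding s_def by (rule anti[OF tp monoD[OF m that]])
    have sI: "s i \<in> {s0<..s1}" for i unfolding s_def by (rule h(1)[OF tp])
    \<comment> \<open>Steps with equal parameters contribute 0 and are dropped; as degenerate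
      intervals they could occur repeatedly and make \<open>e\<close> non-injective.\<close>
    define I where "I = {i. i < N \<and> s (Suc i) < s i}"
    define e where "e i = (s (Suc i), s i)" for i
    have inj: "inj_on e I"
    proof (rule linorder_inj_onI')
      fix i j assume "i \<in> I" "j \<in> I" "i < j"
      then have "s j \<le> s (Suc i)" "s (Suc i) < s i" using sa[of "Suc i" j] by (auto simp: I_def)
      then show "e i \<noteq> e j" by (auto simp: e_def)
    qed
    have "(\<Sum>i<N. norm (flow' (\<tau> (Suc i)) (f s1) - flow' (\<tau> i) (f s1))) = (\<Sum>i<N. norm (f (s i) - f (s (Suc i))))"
      by (intro sum.cong refl) (simp add: fh[OF tp] s_def norm_minus_commute)
    also have "\<dots> = (\<Sum>i\<in>I. norm (f (s i) - f (s (Suc i))))"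
    proof (rule sum.mono_neutral_right)
      show "\<forall>i\<in>{..<N} - I. norm (f (s i) - f (s (Suc i))) = 0"
      proof
        fix i assume "i \<in> {..<N} - I"
        then have "s (Suc i) = s i" using sa[of i "Suc i"] by (auto simp: I_def)
        then show "norm (f (s i) - f (s (Suc i))) = 0" by simp
      qed
    qed (auto simp: I_def)
    also have "\<dots> = (\<Sum>(s, t)\<in>e ` I. norm (f t - f s))"
      by (subst sum.reindex[OF inj]) (simp add: e_def)
    also have "\<dots> \<le> 1"
    proof (rule var[THEN spec, THEN mp, THEN mp, THEN mp])
      show "finite (e ` I)" by (auto simp: I_def)
      show "\<forall>(s, t)\<in>e ` I. s0 \<le> s \<and> t \<le> s1 \<and> s \<le> t"
      proof clarify
        fix a b i assume "(a, b) = e i" "i \<in> I"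
        then show "s0 \<le> a \<and> b \<le> s1 \<and> a \<le> b" using sI[of i] sI[of "Suc i"] by (auto simp: e_def I_def)
      qed
      show "disjoint_family_on (\<lambda>(s, t). {s<..<t}) (e ` I)"
        unfolding disjoint_family_on_def
      proof (intro ballI impI)
        fix m n assume mn: "m \<in> e ` I" "n \<in> e ` I" "m \<noteq> n"
        then obtain i j where ij: "m = e i" "n = e j" "i \<noteq> j" by auto
        have "{s (Suc i)<..<s i} \<inter> {s (Suc j)<..<s j} = {}"
        proof (cases "i < j")
          case True then show ?thesis using sa[of "Suc i" j] by auto
        next
          case False then show ?thesis using sa[of "Suc j" i] ij(3) by auto
        qed
        then show "(case m of (s, t) \<Rightarrow> {s<..<t}) \<inter> (case n of (s, t) \<Rightarrow> {s<..<t}) = {}"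
          unfolding ij(1,2) e_def by simp
      qed
    qed
    finally show ?thesis .
  qed
  have cVf: "continuous_on {s0..s1} (\<lambda>s. V (f s))"
    by (rule continuous_on_compose2[OF V_continuous[of UNIV] f]) auto
  show "((\<lambda>t. V (flow' t (f s1))) \<longlongrightarrow> 0) at_top"
  proof (rule tendstoI)
    fix e :: real assume e: "e > 0"
    obtain d where d: "d > 0" "\<And>s. s \<in> {s0..s1} \<Longrightarrow> dist s s0 < d \<Longrightarrow> dist (V (f s)) (V (f s0)) < e"
      using cVf[unfolded continuous_on_iff, rule_format, of s0 e] e s01 by auto
    define s' where "s' = min s1 (s0 + d / 2)"
    have "compact (T ` {s'..s1})"
      by (intro compact_continuous_image continuous_on_subset[OF T(1)]) (use d s01 in \<open>auto simp: s'_def\<close>)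
    then obtain R where R: "\<forall>x\<in>T ` {s'..s1}. norm x \<le> R" using compact_imp_bounded bounded_iff by blast
    show "\<forall>\<^sub>F t in at_top. dist (V (flow' t (f s1))) 0 < e"
      unfolding eventually_at_top_dense
    proof (intro exI[of _ "max R 0"] allI impI)
      fix t assume "max R 0 < t"
      then have t: "t > R" "t \<ge> 0" by auto
      have "h t \<notin> {s'..s1}"
      proof
        assume "h t \<in> {s'..s1}"
        then have "norm (T (h t)) \<le> R" using R by blast
        then show False using h(2)[OF t(2)] t by simp
      qed
      then have "h t \<in> {s0..s1}" "dist (h t) s0 < d" using h(1)[OF t(2)] d(1) by (auto simp: s'_def dist_real_def min_def split: if_splits)
      then show "dist (V (flow' t (f s1))) 0 < e" using d(2) fh[OF t(2)] z0 by simp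
    qed
  qed
qed

text \<open>Replacing \<open>T\<close> by \<open>\<sigma> * T\<close> treats both directions in
  which the orbit can approach the zero; for \<sigma> = -1 the conclusion concerns
  \<open>- V\<close>.\<close>

lemma path_to_zero_ends:
  fixes s0 s1 :: real and f :: "real \<Rightarrow> 'a"
  assumes s01: "s0 < s1" and f: "continuous_on {s0..s1} f" and z0: "V (f s0) = 0"
    and nz: "\<And>s. s \<in> {s0<..s1} \<Longrightarrow> V (f s) \<noteq> 0"
    and fK: "\<forall>s\<in>{s0..s1}. f s \<in> K"
    and var: "\<forall>D. finite D \<longrightarrow> (\<forall>(s, t)\<in>D. s0 \<le> s \<and> t \<le> s1 \<and> s \<le> t) \<longrightarrow>
        disjoint_family_on (\<lambda>(s, t). {s<..<t}) D \<longrightarrow> (\<Sum>(s, t)\<in>D. norm (f t - f s)) \<le> 1"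
    and loc: "\<And>s \<eta>. s \<in> {s0<..s1} \<Longrightarrow> \<eta> > 0 \<Longrightarrow> \<exists>\<kappa>>0. \<forall>s'\<in>{s0<..s1}. \<bar>s' - s\<bar> < \<kappa> \<longrightarrow> (\<exists>\<theta>. \<bar>\<theta>\<bar> < \<eta> \<and> f s' = flow \<theta> (f s))"
  shows "ends K (f s1) \<or> lipschitz_field.ends (\<lambda>x. - V x) K (f s1)"
proof -
  obtain T and \<sigma> :: real where T: "continuous_on {s0<..s1} T" "\<forall>s\<in>{s0<..s1}. f s = flow (T s) (f s1)" "T s1 = 0"
    "\<sigma> = 1 \<or> \<sigma> = -1" "\<forall>R. \<exists>s'\<in>{s0<..s1}. \<forall>s\<in>{s0<..s'}. \<sigma> * T s > R"
    by (rule path_to_zero_time[OF s01 f z0 nz loc])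
  define T' where "T' s = \<sigma> * T s" for s
  have ss: "\<sigma> * \<sigma> = 1" using T(4) by auto
  have T': "continuous_on {s0<..s1} T'" "\<forall>s\<in>{s0<..s1}. f s = flow (\<sigma> * T' s) (f s1)" "T' s1 = 0"
  proof -
    show "continuous_on {s0<..s1} T'" unfolding T'_def by (rule continuous_on_mult_left[OF T(1)])
    show "\<forall>s\<in>{s0<..s1}. f s = flow (\<sigma> * T' s) (f s1)"
      using T(2) unfolding T'_def mult.assoc[symmetric] ss mult_1 .
    show "T' s1 = 0" using T(3) by (simp add: T'_def)
  qed
  have T'4: "\<forall>R. \<exists>s'\<in>{s0<..s1}. \<forall>s\<in>{s0<..s'}. T' s > R" using T(5) unfolding T'_def by blast
  note P = path_to_zero_trapped[OF s01 f z0 fK var T' T'4]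
  interpret n: lipschitz_field "\<lambda>x. - V x" L M by (rule lipschitz_field_uminus) unfold_locales
  show ?thesis using T(4)
  proof
    assume s: "\<sigma> = 1"
    have fl: "flow = (\<lambda>t. flow (\<sigma> * t))" using s by simp
    have "f s1 \<in> short_trapped K (real 1)" unfolding short_trapped_def of_nat_1
    proof (intro CollectI conjI allI impI)
      show "flow t (f s1) \<in> K" if "t \<ge> 0" for t using that by (rule P(1)[OF fl])
      fix \<tau> :: "nat \<Rightarrow> real" and N assume "mono \<tau>" "\<tau> 0 \<ge> 0"
      then show "(\<Sum>i<N. norm (flow (\<tau> (Suc i)) (f s1) - flow (\<tau> i) (f s1))) \<le> 1" by (rule P(2)[OF fl])
    qed
    then have "\<exists>n l::nat. flow (real n) (f s1) \<in> short_trapped K (real l)" by (intro exI[of _ 0] exI[of _ 1]) simp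
    moreover have "((\<lambda>t. V (flow t (f s1))) \<longlongrightarrow> 0) at_top" by (rule P(3)[OF fl])
    ultimately show ?thesis unfolding ends_def by blast
  next
    assume s: "\<sigma> = -1"
    have fl: "n.flow = (\<lambda>t. flow (\<sigma> * t))"
    proof (intro ext)
      fix t y show "n.flow t y = flow (\<sigma> * t) y" unfolding s using flow_uminus[OF lipschitz_field_axioms, of t y] by simp
    qed
    have "f s1 \<in> n.short_trapped K (real 1)" unfolding n.short_trapped_def of_nat_1
    proof (intro CollectI conjI allI impI)
      show "n.flow t (f s1) \<in> K" if "t \<ge> 0" for t using that by (rule P(1)[OF fl])
      fix \<tau> :: "nat \<Rightarrow> real" and N assume "mono \<tau>" "\<tau> 0 \<ge> 0"
      then show "(\<Sum>i<N. norm (n.flow (\<tau> (Suc i)) (f s1) - n.flow (\<tau> i) (f s1))) \<le> 1" by (rule P(2)[OF fl])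
    qed
    then have "\<exists>n' l::nat. n.flow (real n') (f s1) \<in> n.short_trapped K (real l)" by (intro exI[of _ 0] exI[of _ 1]) simp
    moreover have "((\<lambda>t. - V (n.flow t (f s1))) \<longlongrightarrow> - 0) at_top" by (rule tendsto_minus, rule P(3)[OF fl])
    ultimately have "n.ends K (f s1)" unfolding n.ends_def minus_zero by (rule conjI)
    then show ?thesis by (rule disjI2)
  qed
qed

end

text \<open>Flowing for an integer time leads into \<open>trapped\<close>. Flowing back preserves
  null sets, and integers make the union countable.\<close>

lemma (in C1_lipschitz_field) ends_negligible: "negligible {y. ends K y}"
proof -
  have "negligible (\<Union>n::nat. \<Union>l::nat. flow (- real n) ` {y \<in> trapped (real l). ((\<lambda>t. V (flow t y)) \<longlongrightarrow> 0) at_top})"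
    by (intro negligible_countable_Union) (auto intro!: flow_negligible trapped_negligible negligible_countable_Union)
  moreover have "{y. ends K y} \<subseteq> (\<Union>n::nat. \<Union>l::nat. flow (- real n) ` {y \<in> trapped (real l). ((\<lambda>t. V (flow t y)) \<longlongrightarrow> 0) at_top})"
  proof clarify
    fix y assume e: "ends K y"
    then obtain n l :: nat where nl: "flow (real n) y \<in> short_trapped K (real l)" unfolding ends_def by blast
    have "ends K (flow (real n) y)" by (rule ends_flow[OF e])
    then have lim: "((\<lambda>t. V (flow t (flow (real n) y))) \<longlongrightarrow> 0) at_top" unfolding ends_def by blast
    have "flow (real n) y \<in> trapped (real l)" unfolding trapped_def
    proof (intro CollectI conjI allI impI)
      show "flow t (flow (real n) y) \<in> K" if "t \<ge> 0" for t using nl that unfolding short_trapped_def by blast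
      fix h :: real and N assume h: "h > 0"
      have "mono (\<lambda>i. real i * h)" "real 0 * h \<ge> 0" using h by (auto simp: mono_def)
      then show "(\<Sum>i<N. norm (flow (real (Suc i) * h) (flow (real n) y) - flow (real i * h) (flow (real n) y))) \<le> real l"
        using nl unfolding short_trapped_def by blast
    qed
    moreover have "y = flow (- real n) (flow (real n) y)" by (simp add: flow_inverse)
    ultimately show "y \<in> (\<Union>n::nat. \<Union>l::nat. flow (- real n) ` {y \<in> trapped (real l). ((\<lambda>t. V (flow t y)) \<longlongrightarrow> 0) at_top})"
      using lim by blast
  qed
  ultimately show ?thesis by (rule negligible_subset)
qed

section \<open>The characteristic field on balls\<close>

text \<open>The nearest point of the ball supplies a globally Lipschitz extension of the
  characteristic field; \<open>ufield\<close> treats the rescaled field in the same way.\<close>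

definition zfield :: "(real^4 \<Rightarrow> real^4) \<Rightarrow> real^4 \<Rightarrow> real \<Rightarrow> real^4 \<Rightarrow> real^4" where
  "zfield al p r x = charfield al (closest_point (cball p r) x)"

definition ufield :: "(real^4 \<Rightarrow> real^4) \<Rightarrow> 4 \<Rightarrow> real^4 \<Rightarrow> real \<Rightarrow> real^4 \<Rightarrow> real^4" where
  "ufield al l p r x = (let y = closest_point (cball p r) x in inverse (charfield al y $ l) *\<^sub>R charfield al y)"

lemma zfield_eq: "x \<in> cball p r \<Longrightarrow> zfield al p r x = charfield al x"
  by (simp add: zfield_def closest_point_self)

lemma ufield_eq: "x \<in> cball p r \<Longrightarrow> ufield al l p r x = inverse (charfield al x $ l) *\<^sub>R charfield al x"
  by (simp add: ufield_def closest_point_self)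

lemma ufield_flow_box:
  assumes S: "open S" "smooth_on S al" "cball p r \<subseteq> S" "r > 0" and nz: "\<And>y. y \<in> cball p r \<Longrightarrow> charfield al y $ l \<noteq> 0"
  shows "\<exists>L M. flow_box (ufield al l p r) L M l"
proof -
  define T where "T = S \<inter> (\<lambda>y. charfield al y $ l) -` (- {0})"
  have sZ: "smooth_on S (charfield al)" by (rule smooth_on_charfield[OF S(1,2)])
  have oT: "open T" unfolding T_def
    by (rule continuous_open_preimage[OF smooth_on_continuous[OF smooth_on_component[OF S(1) sZ]] S(1)]) auto
  have sub: "cball p r \<subseteq> T" using S(3) nz by (auto simp: T_def)
  have sT: "smooth_on T (charfield al)" by (rule smooth_on_subset[OF sZ]) (auto simp: T_def)
  have "smooth_on T (\<lambda>y. inverse (charfield al y $ l) *\<^sub>R charfield al y)"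
    by (intro smooth_on_scaleR smooth_on_inverse smooth_on_component oT sT) (auto simp: T_def)
  from closest_point_field[OF this sub S(4)] obtain L M
    where LM: "lipschitz_field (\<lambda>x. inverse (charfield al (closest_point (cball p r) x) $ l) *\<^sub>R charfield al (closest_point (cball p r) x)) L M" .
  have eq: "ufield al l p r = (\<lambda>x. inverse (charfield al (closest_point (cball p r) x) $ l) *\<^sub>R charfield al (closest_point (cball p r) x))"
    by (simp add: ufield_def fun_eq_iff Let_def)
  have "flow_box (ufield al l p r) L M l"
  proof (rule flow_box.intro[OF LM[folded eq]], rule flow_box_axioms.intro)
    fix x
    have "closest_point (cball p r) x \<in> cball p r" by (rule closest_point_in_set) (use S(4) in auto)
    from nz[OF this] show "ufield al l p r x $ l = 1" by (simp add: ufield_def Let_def)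
  qed
  then show ?thesis by blast
qed

text \<open>For small times the orbit of \<open>V\<close> through \<open>z\<close> stays in
  \<open>B\<close> and hence in the plaque of \<open>z\<close>, since \<open>V\<close> is a multiple
  of \<open>U\<close> there. Its \<open>l\<close>-th coordinate has nonzero derivative at time 0, so
  it takes all values close to \<open>z $ l\<close>, and two points of one plaque with the same
  coordinate coincide.\<close>

lemma (in flow_box) reparametrize:
  assumes V: "lipschitz_field V L' M'" and B: "open B" "z \<in> B"
    and VU: "\<And>x. x \<in> B \<Longrightarrow> V x $ l \<noteq> 0 \<and> U x = inverse (V x $ l) *\<^sub>R V x" and eta: "\<eta> > 0"
  shows "\<exists>\<kappa>>0. \<forall>w. dist w z < \<kappa> \<longrightarrow> plaque w = plaque z \<longrightarrow> (\<exists>\<theta>. \<bar>\<theta>\<bar> < \<eta> \<and> w = lipschitz_field.flow V \<theta> z)"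
proof -
  interpret v: lipschitz_field V L' M' by (rule V)
  obtain e where e: "e > 0" "ball z e \<subseteq> B" using B open_contains_ball by blast
  define m where "m = min \<eta> (e / (M' + 1))"
  have M1: "M' + 1 > 0" using v.M_nonneg by simp
  have m: "m > 0" using eta e M1 by (simp add: m_def)
  have inB: "v.flow t z \<in> B" if "\<bar>t\<bar> < m" for t
  proof -
    have "norm (v.flow t z - z) \<le> M' * \<bar>t\<bar>" using v.flow_time_lip[of t z 0] by simp
    also have "\<dots> \<le> (M' + 1) * \<bar>t\<bar>" by (simp add: mult_right_mono)
    also have "\<dots> < (M' + 1) * (e / (M' + 1))" using that M1 by (intro mult_strict_left_mono) (auto simp: m_def)
    also have "\<dots> = e" using M1 by simp
    finally show ?thesis using e(2) by (auto simp: dist_norm norm_minus_commute)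
  qed
  \<comment> \<open>The factor \<open>a\<close> makes the derivative of \<open>g\<close> at 0 a
    square, which avoids distinguishing the sign of \<open>V z $ l\<close>.\<close>
  define a where "a = V z $ l"
  have a: "a \<noteq> 0" using VU[OF B(2)] by (simp add: a_def)
  define g where "g t = v.flow t z $ l * a" for t
  have gd: "(g has_real_derivative V (v.flow t z) $ l * a) (at t)" for t
  proof -
    have "((\<lambda>t. v.flow t z $ l) has_derivative (\<lambda>h. (h *\<^sub>R V (v.flow t z)) $ l)) (at t)"
      using v.flow_deriv[of z t] unfolding has_vector_derivative_def by (rule bounded_linear.has_derivative[OF bounded_linear_vec_nth])
    then have "((\<lambda>t. v.flow t z $ l) has_real_derivative V (v.flow t z) $ l) (at t)"
      by (rule has_derivative_imp_has_field_derivative) simp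
    then show ?thesis unfolding g_def by (rule DERIV_cmult_right)
  qed
  have pos: "V (v.flow 0 z) $ l * a > 0" using a by (auto simp: a_def[symmetric] zero_less_mult_iff)
  obtain d1 where d1: "d1 > 0" "\<forall>h>0. h < d1 \<longrightarrow> g 0 < g (0 + h)" using DERIV_pos_inc_right[OF gd pos] by blast
  obtain d2 where d2: "d2 > 0" "\<forall>h>0. h < d2 \<longrightarrow> g (0 - h) < g 0" using DERIV_pos_inc_left[OF gd pos] by blast
  define h where "h = min (m / 2) (min (d1 / 2) (d2 / 2))"
  have h: "h > 0" "h < m" "h < d1" "h < d2" using m d1(1) d2(1) by (auto simp: h_def)
  have gh: "g 0 < g h" "g (- h) < g 0" using d1(2) d2(2) h by auto
  define \<kappa> where "\<kappa> = min (g h - g 0) (g 0 - g (- h)) / \<bar>a\<bar>"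
  have cg: "continuous_on T g" for T using gd by (meson DERIV_isCont continuous_at_imp_continuous_on)
  show ?thesis
  proof (rule exI[of _ \<kappa>], intro conjI allI impI)
    show "\<kappa> > 0" using gh a by (simp add: \<kappa>_def)
    fix w assume w: "dist w z < \<kappa>" and pw: "plaque w = plaque z"
    have "\<bar>w $ l - z $ l\<bar> < \<kappa>" using w component_le_norm_cart[of "w - z" l] by (simp add: dist_norm)
    then have "\<bar>w $ l - z $ l\<bar> * \<bar>a\<bar> < \<kappa> * \<bar>a\<bar>" using a by simp
    also have "\<dots> = min (g h - g 0) (g 0 - g (- h))" using a by (simp add: \<kappa>_def)
    finally have "\<bar>w $ l * a - z $ l * a\<bar> < min (g h - g 0) (g 0 - g (- h))" by (simp add: abs_mult[symmetric] left_diff_distrib)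
    moreover have "g 0 = z $ l * a" by (simp add: g_def)
    ultimately have "g (- h) \<le> w $ l * a" "w $ l * a \<le> g h" by auto
    then obtain \<theta> where th: "- h \<le> \<theta>" "\<theta> \<le> h" "g \<theta> = w $ l * a"
      using IVT'[of g "- h" "w $ l * a" h] h(1) cg by auto
    have tm: "\<bar>\<theta>\<bar> < m" using th h by auto
    have wl: "v.flow \<theta> z $ l = w $ l" using th(3) a by (simp add: g_def)
    have der: "\<exists>u. ((\<lambda>t. v.flow t z) has_vector_derivative u) (at t) \<and> u = (u $ l) *\<^sub>R U (v.flow t z)" if t: "\<bar>t\<bar> < m" for t
    proof (intro exI conjI)
      show "((\<lambda>t. v.flow t z) has_vector_derivative V (v.flow t z)) (at t)" by (rule v.flow_deriv)
      show "V (v.flow t z) = (V (v.flow t z) $ l) *\<^sub>R U (v.flow t z)" using VU[OF inB[OF t]] by simp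
    qed
    have "plaque (v.flow \<theta> z) = plaque z"
    proof (cases "\<theta> \<ge> 0")
      case True
      have "plaque (v.flow \<theta> z) = plaque (v.flow 0 z)"
        by (rule plaque_constant_deriv[OF True]) (rule der, use tm in auto)
      then show ?thesis by simp
    next
      case False
      then have "plaque (v.flow 0 z) = plaque (v.flow \<theta> z)"
        by (intro plaque_constant_deriv) (auto intro!: der, use tm in auto)
      then show ?thesis by simp
    qed
    then have "v.flow \<theta> z = flow (v.flow \<theta> z $ l - w $ l) w" using pw by (intro plaque_eq_imp) simp
    then have "w = v.flow \<theta> z" by (simp add: wl)
    moreover have "\<bar>\<theta>\<bar> < \<eta>" using tm by (simp add: m_def)
    ultimately show "\<exists>\<theta>. \<bar>\<theta>\<bar> < \<eta> \<and> w = v.flow \<theta> z" by blast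
  qed
qed

text \<open>Both time directions satisfy the hypotheses of the volume estimate: reversal changes the
  sign of the Jacobian but not the bound on its trace.\<close>

lemma zfield_ends_negligible:
  assumes S: "open S" "smooth_on S al" "\<And>z. z \<in> S \<Longrightarrow> al z \<noteq> 0" "cball p r \<subseteq> S" "r > 0" "r' < r"
    and null: "negligible {z\<in>S. charfield al z = 0}"
  shows "negligible {y. lipschitz_field.ends (zfield al p r) (cball p r') y \<or>
      lipschitz_field.ends (\<lambda>x. - zfield al p r x) (cball p r') y}"
proof -
  have sZ: "smooth_on S (charfield al)" by (rule smooth_on_charfield[OF S(1,2)])
  obtain L M where LM: "lipschitz_field (zfield al p r) L M"
    using closest_point_field[OF sZ S(4,5)] unfolding zfield_def by blast
  obtain C where C: "C \<ge> 0" "\<And>z. z \<in> cball p r \<Longrightarrow> \<bar>trace (jac (charfield al) z)\<bar> \<le> C * norm (charfield al z)"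
    using charfield_divergence_bound[OF S(1,2,3) compact_cball S(4)] by blast
  have eq: "zfield al p r x = charfield al x" if "x \<in> ball p r" for x using that by (intro zfield_eq) auto
  have bS: "ball p r \<subseteq> S" using S(4) ball_subset_cball by blast
  have der: "(zfield al p r has_derivative (*v) (jac (charfield al) x)) (at x)" if x: "x \<in> ball p r" for x
    by (rule has_derivative_transform_within_open[OF jac_has_derivative[OF sZ] open_ball x])
      (use x bS eq in auto)
  have cJ: "continuous_on (ball p r) (jac (charfield al))" using jac_continuous[OF S(1) sZ] bS by (rule continuous_on_subset)
  have nul: "negligible {x \<in> ball p r. zfield al p r x = 0}" by (rule negligible_subset[OF null]) (use bS eq in auto)
  have 1: "C1_lipschitz_field (zfield al p r) L M (ball p r) (cball p r') (jac (charfield al)) C"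
    by (rule C1_lipschitz_field.intro[OF LM], rule C1_lipschitz_field_axioms.intro)
      (use S(6) der cJ C eq nul in auto)
  have tr: "trace (- X) = - trace X" for X :: "real^4^4" by (simp add: trace_def sum_negf)
  have nd: "((\<lambda>x. - zfield al p r x) has_derivative (*v) (- jac (charfield al) x)) (at x)" if x: "x \<in> ball p r" for x
  proof -
    have "(\<lambda>h. - (jac (charfield al) x *v h)) = (*v) (- jac (charfield al) x)"
      by (rule ext) (simp add: vec_eq_iff matrix_vector_mult_def sum_negf)
    then show ?thesis using has_derivative_minus[OF der[OF x]] by simp
  qed
  have 2: "C1_lipschitz_field (\<lambda>x. - zfield al p r x) L M (ball p r) (cball p r') (\<lambda>x. - jac (charfield al) x) C"
    by (rule C1_lipschitz_field.intro[OF lipschitz_field_uminus[OF LM]], rule C1_lipschitz_field_axioms.intro)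
      (use S(6) nd cJ C eq nul tr in \<open>auto intro!: continuous_on_minus\<close>)
  have "{y. lipschitz_field.ends (zfield al p r) (cball p r') y \<or> lipschitz_field.ends (\<lambda>x. - zfield al p r x) (cball p r') y}
     = {y. lipschitz_field.ends (zfield al p r) (cball p r') y} \<union> {y. lipschitz_field.ends (\<lambda>x. - zfield al p r x) (cball p r') y}"
    by blast
  then show ?thesis
    using negligible_Un[OF C1_lipschitz_field.ends_negligible[OF 1] C1_lipschitz_field.ends_negligible[OF 2]] by simp
qed

section \<open>Plaques in the manifold\<close>

context corank_one
begin

text \<open>A flow box is given by a chart, an annihilating one-form on an open set of coordinates, a
  coordinate direction, and the centre and radius of a ball of coordinates.\<close>

definition ubox :: "('m, real^4) chart \<times> (real^4) set \<times> (real^4 \<Rightarrow> real^4) \<times> 4 \<times> (real^4) \<times> real \<Rightarrow> bool" where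
  "ubox = (\<lambda>(c, U, al, l, p, r). box c U al \<and> cball p r \<subseteq> U \<and> r > 0 \<and> (\<forall>y\<in>cball p r. charfield al y $ l \<noteq> 0))"

definition dom_box :: "('m, real^4) chart \<times> (real^4) set \<times> (real^4 \<Rightarrow> real^4) \<times> 4 \<times> (real^4) \<times> real \<Rightarrow> 'm set" where
  "dom_box = (\<lambda>(c, U, al, l, p, r). {x\<in>fst c. snd c x \<in> ball p r})"

definition plq :: "('m, real^4) chart \<times> (real^4) set \<times> (real^4 \<Rightarrow> real^4) \<times> 4 \<times> (real^4) \<times> real \<Rightarrow> 'm \<Rightarrow> real^4" where
  "plq = (\<lambda>(c, U, al, l, p, r) x. flow_box.plaque (ufield al l p r) l (snd c x))"

lemma uboxD:
  assumes "ubox (c, U, al, l, p, r)"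
  shows "box c U al" "cball p r \<subseteq> U" "r > 0" "\<And>y. y \<in> cball p r \<Longrightarrow> charfield al y $ l \<noteq> 0"
  using assms by (auto simp: ubox_def)

lemma ubox_flow_box:
  assumes "ubox (c, U, al, l, p, r)" shows "\<exists>L M. flow_box (ufield al l p r) L M l"
  using ufield_flow_box[OF boxD(2)[OF uboxD(1)[OF assms]] boxD(4)[OF uboxD(1)[OF assms]] uboxD(2,3)[OF assms]]
    uboxD(4)[OF assms] by blast

lemma dom_box_open: "ubox k \<Longrightarrow> open (dom_box k)"
  using chart_preimage_open[OF _ open_ball] by (cases k) (auto simp: dom_box_def ubox_def box_def simp del: mem_ball)

lemma dom_box_chart: "ubox (c, U, al, l, p, r) \<Longrightarrow> x \<in> dom_box (c, U, al, l, p, r) \<Longrightarrow> c \<in> A \<and> x \<in> fst c \<and> snd c x \<in> U \<and> snd c x \<in> ball p r \<and> snd c x \<in> cball p r"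
  by (auto simp: dom_box_def ubox_def box_def)

lemma dom_box_Sing:
  assumes "ubox k" "x \<in> dom_box k" shows "x \<notin> Sing"
proof -
  obtain c U al l p r where k: "k = (c, U, al, l, p, r)" by (cases k)
  note D = uboxD[OF assms(1)[unfolded k]] and X = dom_box_chart[OF assms[unfolded k]]
  have "charfield al (snd c x) \<noteq> 0" using D(4)[of "snd c x"] X by auto
  then show ?thesis using Sing_iff[OF D(1)] X by blast
qed

lemma ubox_exists:
  assumes b: "box c U al" and x: "x \<in> fst c" "snd c x \<in> U" "x \<notin> Sing"
  shows "\<exists>l p r. ubox (c, U, al, l, p, r) \<and> x \<in> dom_box (c, U, al, l, p, r)"
proof -
  note B = boxD[OF b]
  have "charfield al (snd c x) \<noteq> 0" using Sing_iff[OF b x(1,2)] x(3) by blast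
  then obtain l where l: "charfield al (snd c x) $ l \<noteq> 0" by (auto simp: vec_eq_iff)
  define T where "T = U \<inter> (\<lambda>y. charfield al y $ l) -` (- {0})"
  have "open T" unfolding T_def
    by (rule continuous_open_preimage[OF smooth_on_continuous[OF smooth_on_component[OF B(2) smooth_on_charfield[OF B(2,4)]]] B(2)]) auto
  moreover have "snd c x \<in> T" using x(2) l by (simp add: T_def)
  ultimately obtain r where r: "r > 0" "cball (snd c x) r \<subseteq> T" using open_contains_cball by blast
  have "ubox (c, U, al, l, snd c x, r)" using b r by (auto simp: ubox_def T_def)
  moreover have "x \<in> dom_box (c, U, al, l, snd c x, r)" using x r by (simp add: dom_box_def)
  ultimately show ?thesis by blast
qed

lemma ufield_velocity:
  assumes k: "ubox (c, U, al, l, p, r)" and x: "x \<in> dom_box (c, U, al, l, p, r)" and v: "char_at x v"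
  shows "v c = (v c $ l) *\<^sub>R ufield al l p r (snd c x)"
proof -
  note D = uboxD[OF k] and X = dom_box_chart[OF k x]
  have vt: "v \<in> tangent_space A x" using v by (simp add: char_at_def)
  have "characteristic (al (snd c x)) (jac al (snd c x)) (v c)"
    using char_at_iff[OF D(1) _ _ vt] X v by blast
  moreover have "al (snd c x) \<noteq> 0" using boxD(5)[OF D(1)] X by blast
  moreover have "charvec (al (snd c x)) (jac al (snd c x)) $ l \<noteq> 0" using D(4) X by (simp add: charfield_def)
  ultimately have "v c = (v c $ l / charvec (al (snd c x)) (jac al (snd c x)) $ l) *\<^sub>R charvec (al (snd c x)) (jac al (snd c x))"
    by (rule characteristic_multiple)
  also have "\<dots> = (v c $ l) *\<^sub>R ufield al l p r (snd c x)"
    using X by (simp add: ufield_eq charfield_def divide_inverse)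
  finally show ?thesis .
qed

lemma ufield_char_at:
  assumes k: "ubox (c, U, al, l, p, r)" and x: "x \<in> dom_box (c, U, al, l, p, r)"
  shows "char_at x (coord_vector A c x (ufield al l p r (snd c x)))"
proof -
  note D = uboxD[OF k] and X = dom_box_chart[OF k x]
  have c: "c \<in> A" "x \<in> fst c" using X by auto
  have ch: "characteristic (al (snd c x)) (jac al (snd c x)) (charvec (al (snd c x)) (jac al (snd c x)))"
    by (rule characteristic_charvec)
  have "characteristic (al (snd c x)) (jac al (snd c x)) (coord_vector A c x (ufield al l p r (snd c x)) c)"
    using ch X unfolding coord_vector_self[OF c] characteristic_def
    by (simp add: ufield_eq charfield_def dform_scaleR_left)
  then show ?thesis using char_at_iff[OF D(1) _ _ coord_vector_tangent[OF c]] X by blast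
qed

text \<open>A short piece of the orbit of \<open>ufield\<close> for \<open>k'\<close> through
  \<open>x\<close> stays in both domains and is tangent to characteristic vectors, so the plaque map
  of \<open>k\<close> is constant on it. A point near \<open>x\<close> on the same
  \<open>k'\<close>-plaque lies on this piece, because its flow time is the difference of the
  \<open>l'\<close>-th coordinates, which is small.\<close>

lemma plq_compatible:
  assumes k: "ubox k" and k': "ubox k'" and x: "x \<in> dom_box k" "x \<in> dom_box k'"
  shows "\<exists>G. open G \<and> x \<in> G \<and> (\<forall>y\<in>G \<inter> dom_box k'. plq k' y = plq k' x \<longrightarrow> y \<in> dom_box k \<and> plq k y = plq k x)"
proof -
  obtain c U al l p r where K: "k = (c, U, al, l, p, r)" by (cases k)
  obtain c' U' al' l' p' r' where K': "k' = (c', U', al', l', p', r')" by (cases k')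
  obtain L M where fb: "flow_box (ufield al l p r) L M l" using ubox_flow_box k unfolding K by blast
  obtain L' M' where fb': "flow_box (ufield al' l' p' r') L' M' l'" using ubox_flow_box k' unfolding K' by blast
  interpret f: flow_box "ufield al l p r" L M l by (rule fb)
  interpret f': flow_box "ufield al' l' p' r'" L' M' l' by (rule fb')
  note D = uboxD[OF k[unfolded K]] and D' = uboxD[OF k'[unfolded K']]
  note X = dom_box_chart[OF k[unfolded K]] and X' = dom_box_chart[OF k'[unfolded K']]
  have c: "c \<in> A" "c' \<in> A" using boxD(1)[OF D(1)] boxD(1)[OF D'(1)] by auto
  have xc: "x \<in> fst c'" using X' x K' by auto
  define z where "z = snd c' x"
  define O' where "O' = snd c' ` ((dom_box k \<inter> dom_box k') \<inter> fst c')"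
  have oO: "open O'" unfolding O'_def by (rule chart_image_open_sub[OF c(2)]) (intro open_Int dom_box_open k k')
  have zO: "z \<in> O'" unfolding O'_def z_def using x xc by blast
  have "open ((\<lambda>t. f'.flow t z) -` O')"
    using f'.flow_continuous_time[of UNIV z] oO continuous_on_open_vimage[OF open_UNIV, of "\<lambda>t. f'.flow t z"] by simp
  moreover have "0 \<in> (\<lambda>t. f'.flow t z) -` O'" using zO by simp
  ultimately obtain \<eta> where eta: "\<eta> > 0" "ball 0 \<eta> \<subseteq> (\<lambda>t. f'.flow t z) -` O'" using open_contains_ball by blast
  define \<sigma> where "\<sigma> t = chart_inv c' (f'.flow t z)" for t
  have sig: "\<sigma> t \<in> dom_box k \<and> \<sigma> t \<in> dom_box k' \<and> \<sigma> t \<in> fst c' \<and> snd c' (\<sigma> t) = f'.flow t z" if t: "\<bar>t\<bar> < \<eta>" for t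
  proof -
    have "f'.flow t z \<in> O'" using t eta(2) by auto
    then obtain y where y: "y \<in> dom_box k" "y \<in> dom_box k'" "y \<in> fst c'" "f'.flow t z = snd c' y" unfolding O'_def by blast
    then have "\<sigma> t = y" using c by (simp add: \<sigma>_def)
    then show ?thesis using y by simp
  qed
  have der: "\<exists>v. ((snd c \<circ> \<sigma>) has_vector_derivative v) (at t) \<and> v = (v $ l) *\<^sub>R ufield al l p r ((snd c \<circ> \<sigma>) t)" if t: "\<bar>t\<bar> < \<eta>" for t
  proof -
    note s = sig[OF t]
    have sc: "\<sigma> t \<in> fst c" using s X K by auto
    define e where "e = ufield al' l' p' r' (snd c' (\<sigma> t))"
    define v where "v = coord_vector A c' (\<sigma> t) e"
    have "((\<lambda>t. f'.flow t z) has_vector_derivative e) (at t)" using f'.flow_deriv[of z t] s by (simp add: e_def)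
    then have "((snd c' \<circ> \<sigma>) has_vector_derivative e) (at t)"
      by (rule has_vector_derivative_transform_within_open[of _ _ _ "ball 0 \<eta>"]) (use t sig in auto)
    then have "((snd c \<circ> \<sigma>) has_vector_derivative dtrans c' c (\<sigma> t) e) (at t)"
      by (intro curve_chart_change[where \<gamma> = \<sigma> and I = "ball 0 \<eta>", OF c(2,1)]) (use s sc t sig in auto)
    moreover have "dtrans c' c (\<sigma> t) e = v c" using coord_vector_nth[OF c(1) sc] by (simp add: v_def)
    ultimately have d: "((snd c \<circ> \<sigma>) has_vector_derivative v c) (at t)" by simp
    have "char_at (\<sigma> t) v" unfolding v_def e_def by (rule ufield_char_at[OF k'[unfolded K']]) (use s K' in simp)
    then have "v c = (v c $ l) *\<^sub>R ufield al l p r (snd c (\<sigma> t))"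
      by (rule ufield_velocity[OF k[unfolded K], rotated]) (use s K in simp)
    then show ?thesis using d by (intro exI[of _ "v c"]) simp
  qed
  have pk: "f.plaque (snd c (\<sigma> t)) = f.plaque (snd c (\<sigma> 0))" if t: "\<bar>t\<bar> < \<eta>" for t
  proof (cases "t \<ge> 0")
    case True
    have "f.plaque ((snd c \<circ> \<sigma>) t) = f.plaque ((snd c \<circ> \<sigma>) 0)"
      by (rule f.plaque_constant_deriv[OF True]) (rule der, use t in auto)
    then show ?thesis by simp
  next
    case False
    then have "f.plaque ((snd c \<circ> \<sigma>) 0) = f.plaque ((snd c \<circ> \<sigma>) t)"
      by (intro f.plaque_constant_deriv) (auto intro!: der[unfolded o_def], use t in auto)
    then show ?thesis by simp
  qed
  have s0: "\<sigma> 0 = x" using c xc by (simp add: \<sigma>_def z_def)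
  define G where "G = {y\<in>fst c'. snd c' y \<in> ball z \<eta>}"
  show ?thesis
  proof (intro exI[of _ G] conjI ballI impI)
    show "open G" unfolding G_def by (rule chart_preimage_open[OF c(2) open_ball])
    show "x \<in> G" using xc eta by (simp add: G_def z_def)
    fix y assume y: "y \<in> G \<inter> dom_box k'" and eq: "plq k' y = plq k' x"
    have yc: "y \<in> fst c'" "dist z (snd c' y) < \<eta>" using y by (auto simp: G_def)
    define t where "t = snd c' y $ l' - z $ l'"
    have "f'.plaque (snd c' y) = f'.plaque z" using eq by (simp add: plq_def K' z_def)
    then have yt: "snd c' y = f'.flow t z" unfolding t_def by (rule f'.plaque_eq_imp)
    have "\<bar>t\<bar> < \<eta>" using yc(2) component_le_norm_cart[of "snd c' y - z" l'] by (simp add: t_def dist_norm norm_minus_commute)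
    note t = sig[OF this] pk[OF this]
    have "\<sigma> t = y" using c yc(1) yt by (simp add: \<sigma>_def flip: yt)
    then show "y \<in> dom_box k" "plq k y = plq k x" using t s0 by (auto simp: plq_def K)
  qed
qed

text \<open>At almost every time the velocity is characteristic, hence a multiple of
  \<open>ufield\<close>, and \<open>plaque_constant\<close> applies in the chart.\<close>

lemma plq_singular_path:
  assumes sing: "singular_path A \<Delta> \<gamma>" and k: "ubox k" and s: "s \<in> {0..1}" "\<gamma> s \<in> dom_box k"
  shows "\<exists>\<delta>>0. \<forall>t\<in>{0..1}. \<bar>t - s\<bar> < \<delta> \<longrightarrow> \<gamma> t \<in> dom_box k \<and> plq k (\<gamma> t) = plq k (\<gamma> s)"
proof -
  obtain c U al l p r where K: "k = (c, U, al, l, p, r)" by (cases k)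
  obtain L M where fb: "flow_box (ufield al l p r) L M l" using ubox_flow_box k unfolding K by blast
  interpret f: flow_box "ufield al l p r" L M l by (rule fb)
  have X: "c \<in> A" "\<gamma> s \<in> fst c" "snd c (\<gamma> s) \<in> ball p r" using dom_box_chart[of c U al l p r "\<gamma> s"] k s(2) K by auto
  obtain \<delta> N where d: "\<delta> > 0" and N: "negligible N"
    and inc: "\<And>t. t \<in> {0..1} \<Longrightarrow> \<bar>t - s\<bar> \<le> \<delta> \<Longrightarrow> \<gamma> t \<in> fst c \<and> snd c (\<gamma> t) \<in> ball p r"
    and ac: "abs_continuous_on ({0..1} \<inter> {s - \<delta>..s + \<delta>}) (snd c \<circ> \<gamma>)"
    and ch: "\<And>t. 0 < t \<Longrightarrow> t < 1 \<Longrightarrow> \<bar>t - s\<bar> < \<delta> \<Longrightarrow> t \<notin> N \<Longrightarrow>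
       ((snd c \<circ> \<gamma>) has_vector_derivative velocity A \<gamma> t c) (at t) \<and> char_at (\<gamma> t) (velocity A \<gamma> t)"
    using singular_path_local[OF sing s(1) X(1,2) open_ball X(3)] by blast
  have dom: "\<gamma> t \<in> dom_box k" if "t \<in> {0..1}" "\<bar>t - s\<bar> < \<delta>" for t
    using inc[of t] that by (simp add: dom_box_def K)
  have const: "f.plaque ((snd c \<circ> \<gamma>) b) = f.plaque ((snd c \<circ> \<gamma>) a)"
    if ab: "a \<le> b" "0 \<le> a" "b \<le> 1" "\<bar>a - s\<bar> < \<delta>" "\<bar>b - s\<bar> < \<delta>" for a b
  proof (rule f.plaque_constant[OF _ ab(1) N])
    show "abs_continuous_on {a..b} (snd c \<circ> \<gamma>)" by (rule abs_continuous_on_subset[OF ac]) (use ab in auto)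
    fix t assume t: "t \<in> {a<..<b} - N"
    then have tt: "0 < t" "t < 1" "\<bar>t - s\<bar> < \<delta>" "t \<notin> N" using ab by auto
    have "velocity A \<gamma> t c = (velocity A \<gamma> t c $ l) *\<^sub>R ufield al l p r (snd c (\<gamma> t))"
      by (rule ufield_velocity[OF k[unfolded K]]) (use dom[of t] tt ch[OF tt] K in auto)
    then show "\<exists>v. ((snd c \<circ> \<gamma>) has_vector_derivative v) (at t) \<and> v = (v $ l) *\<^sub>R ufield al l p r ((snd c \<circ> \<gamma>) t)"
      using ch[OF tt] by (intro exI[of _ "velocity A \<gamma> t c"]) simp
  qed
  have "plq k (\<gamma> t) = plq k (\<gamma> s)" if t: "t \<in> {0..1}" "\<bar>t - s\<bar> < \<delta>" for t
    using const[of s t] const[of t s] t s(1) d by (cases "s \<le> t") (auto simp: plq_def K)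
  then show ?thesis using d dom by (intro exI[of _ \<delta>]) blast
qed

end

section \<open>Sets of measure zero saturated by plaques\<close>

lemma measure_zero_subset: "measure_zero A T \<Longrightarrow> S \<subseteq> T \<Longrightarrow> measure_zero A S"
  unfolding measure_zero_def by (meson Int_mono image_mono negligible_subset order_refl)

lemma measure_zero_countable_Union:
  assumes "countable F" "\<And>S. S \<in> F \<Longrightarrow> measure_zero A S" shows "measure_zero A (\<Union>F)"
  unfolding measure_zero_def
proof
  fix c assume c: "c \<in> A"
  have "negligible (\<Union>S\<in>F. snd c ` (S \<inter> fst c))"
    using assms c by (intro negligible_countable_Union countable_image) (auto simp: measure_zero_def)
  moreover have "snd c ` (\<Union>F \<inter> fst c) = (\<Union>S\<in>F. snd c ` (S \<inter> fst c))" by blast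
  ultimately show "negligible (snd c ` (\<Union>F \<inter> fst c))" by simp
qed

context corank_one
begin

text \<open>Transition maps are differentiable and so preserve null sets; one chart whose domain
  contains the set decides for all charts.\<close>

lemma measure_zero_chart:
  assumes c: "c \<in> A" and S: "S \<subseteq> fst c" "negligible (snd c ` S)" shows "measure_zero A S"
  unfolding measure_zero_def
proof
  fix c' assume c': "c' \<in> A"
  have "negligible (transition c c' ` (snd c ` (S \<inter> fst c')))"
  proof (rule negligible_differentiable_image_negligible)
    show "negligible (snd c ` (S \<inter> fst c'))" by (rule negligible_subset[OF S(2)]) blast
    show "transition c c' differentiable_on snd c ` (S \<inter> fst c')"
      unfolding differentiable_on_def
    proof clarify
      fix x assume "x \<in> S" "x \<in> fst c'"
      then have "(transition c c' has_derivative dtrans c c' x) (at (snd c x))"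
        using S(1) by (intro dtrans_has_derivative c c') auto
      then show "transition c c' differentiable at (snd c x) within snd c ` (S \<inter> fst c')"
        using has_derivative_at_withinI unfolding differentiable_def by blast
    qed
  qed simp
  moreover have "transition c c' ` (snd c ` (S \<inter> fst c')) = snd c' ` (S \<inter> fst c')"
    unfolding image_image by (rule image_cong) (use S(1) c in \<open>auto simp: transition_eq\<close>)
  ultimately show "negligible (snd c' ` (S \<inter> fst c'))" by simp
qed

lemma countable_subcover:
  assumes "\<And>i. i \<in> I \<Longrightarrow> open (Q i :: 'm set)"
  obtains J where "countable J" "J \<subseteq> I" "(\<Union>i\<in>J. Q i) = (\<Union>i\<in>I. Q i)"
proof -
  obtain F where F: "F \<subseteq> Q ` I" "countable F" "\<Union>F = \<Union>(Q ` I)"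
    using Lindelof[of "Q ` I"] assms by auto
  then obtain J where "countable J" "J \<subseteq> I" "F = Q ` J" using countable_subset_image by metis
  then show ?thesis using that F(3) by simp
qed

definition zbox :: "('m, real^4) chart \<times> (real^4) set \<times> (real^4 \<Rightarrow> real^4) \<times> (real^4) \<times> real \<Rightarrow> bool" where
  "zbox = (\<lambda>(c, U, al, p, r). box c U al \<and> cball p r \<subseteq> U \<and> r > 0)"

text \<open>Unlike the domains of flow boxes, these balls may meet \<open>Sing\<close>. Half the
  radius leaves a compact ball inside the open ball on which \<open>zfield\<close> is smooth, as the
  pair \<open>K\<close>, \<open>B\<close> of the volume estimate demands.\<close>

definition zbox_core :: "('m, real^4) chart \<times> (real^4) set \<times> (real^4 \<Rightarrow> real^4) \<times> (real^4) \<times> real \<Rightarrow> 'm set" where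
  "zbox_core = (\<lambda>(c, U, al, p, r). {x\<in>fst c. snd c x \<in> ball p (r / 2)})"

definition end_set :: "('m, real^4) chart \<times> (real^4) set \<times> (real^4 \<Rightarrow> real^4) \<times> (real^4) \<times> real \<Rightarrow> 'm set" where
  "end_set = (\<lambda>(c, U, al, p, r). {x\<in>zbox_core (c, U, al, p, r). x \<notin> Sing \<and>
     (lipschitz_field.ends (zfield al p r) (cball p (r / 2)) (snd c x) \<or>
      lipschitz_field.ends (\<lambda>x. - zfield al p r x) (cball p (r / 2)) (snd c x))})"

lemma zboxD:
  assumes "zbox (c, U, al, p, r)" shows "box c U al" "cball p r \<subseteq> U" "r > 0"
  using assms by (auto simp: zbox_def)

lemma zbox_core_open: "zbox b \<Longrightarrow> open (zbox_core b)"
  using chart_preimage_open[OF _ open_ball] by (cases b) (auto simp: zbox_def zbox_core_def box_def simp del: mem_ball)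

lemma zbox_exists: "\<exists>b. zbox b \<and> x \<in> zbox_core b"
proof -
  obtain c where c: "c \<in> A" "x \<in> fst c" using chart_cover by blast
  obtain U al where b: "box c U al" "snd c x \<in> U" by (rule box_exists[OF c])
  obtain r where "r > 0" "cball (snd c x) r \<subseteq> U" using boxD(2)[OF b(1)] b(2) open_contains_cball by blast
  then have "zbox (c, U, al, snd c x, r)" "x \<in> zbox_core (c, U, al, snd c x, r)"
    using b c by (auto simp: zbox_def zbox_core_def)
  then show ?thesis by blast
qed

lemma zfield_lipschitz:
  assumes "zbox (c, U, al, p, r)" shows "\<exists>L M. lipschitz_field (zfield al p r) L M"
proof -
  note Z = zboxD[OF assms]
  note B = boxD[OF Z(1)]
  show ?thesis using closest_point_field[OF smooth_on_charfield[OF B(2,4)] Z(2,3)] unfolding zfield_def by blast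
qed

lemma end_set_measure_zero:
  assumes "zbox b" shows "measure_zero A (end_set b)"
proof -
  obtain c U al p r where b: "b = (c, U, al, p, r)" by (cases b)
  note Z = zboxD[OF assms[unfolded b]]
  note B = boxD[OF Z(1)]
  have "negligible {y. lipschitz_field.ends (zfield al p r) (cball p (r / 2)) y \<or>
      lipschitz_field.ends (\<lambda>x. - zfield al p r x) (cball p (r / 2)) y}"
    by (rule zfield_ends_negligible[OF B(2,4,5) Z(2,3) _ charfield_zero_negligible[OF Z(1)]]) (use Z(3) in auto)
  then have "negligible (snd c ` end_set b)" by (rule negligible_subset) (auto simp: end_set_def b)
  then show ?thesis by (intro measure_zero_chart[OF B(1)]) (auto simp: end_set_def zbox_core_def b)
qed

lemma Sing_measure_zero: "measure_zero A Sing"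
proof -
  obtain J where J: "countable J" "J \<subseteq> {b. zbox b}" "(\<Union>b\<in>J. zbox_core b) = (\<Union>b\<in>{b. zbox b}. zbox_core b)"
    by (rule countable_subcover[of "{b. zbox b}" zbox_core]) (auto intro: zbox_core_open)
  have "measure_zero A (Sing \<inter> zbox_core b)" if b: "b \<in> J" for b
  proof -
    obtain c U al p r where eq: "b = (c, U, al, p, r)" by (cases b)
    have "zbox (c, U, al, p, r)" using b J(2) eq by auto
    note Z = zboxD[OF this]
    have sub: "snd c x \<in> U" if "x \<in> zbox_core b" for x using that Z(2,3) by (auto simp: zbox_core_def eq subset_iff)
    have ch: "x \<in> fst c" if "x \<in> zbox_core b" for x using that by (auto simp: zbox_core_def eq)
    have "negligible (snd c ` (Sing \<inter> zbox_core b))"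
      by (rule negligible_subset[OF charfield_zero_negligible[OF Z(1)]]) (use sub ch Sing_iff[OF Z(1)] in blast)
    then show ?thesis by (intro measure_zero_chart[OF boxD(1)[OF Z(1)]]) (use ch in auto)
  qed
  then have "measure_zero A (\<Union>b\<in>J. Sing \<inter> zbox_core b)"
    using J(1) by (intro measure_zero_countable_Union) auto
  moreover have "Sing \<subseteq> (\<Union>b\<in>J. Sing \<inter> zbox_core b)"
    using zbox_exists J(3) by blast
  ultimately show ?thesis by (rule measure_zero_subset)
qed

text \<open>Translates equality of plaques near a point into motion along the characteristic field,
  for a time that can be made short.\<close>

lemma zbox_orbit:
  assumes z: "zbox (c, U, al, p, r)" and k: "ubox (c, U, al, l, p', r')" and u: "u \<in> dom_box (c, U, al, l, p', r')" "snd c u \<in> ball p r"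
    and eta: "\<eta> > 0"
  shows "\<exists>\<kappa>>0. \<forall>w. dist (snd c w) (snd c u) < \<kappa> \<longrightarrow> plq (c, U, al, l, p', r') w = plq (c, U, al, l, p', r') u \<longrightarrow>
     (\<exists>\<theta>. \<bar>\<theta>\<bar> < \<eta> \<and> snd c w = lipschitz_field.flow (zfield al p r) \<theta> (snd c u))"
proof -
  obtain L M where V: "lipschitz_field (zfield al p r) L M" using zfield_lipschitz[OF z] by blast
  obtain L' M' where fb: "flow_box (ufield al l p' r') L' M' l" using ubox_flow_box[OF k] by blast
  interpret f: flow_box "ufield al l p' r'" L' M' l by (rule fb)
  have uB: "snd c u \<in> ball p r \<inter> ball p' r'" using u by (auto simp: dom_box_def)
  have "zfield al p r x $ l \<noteq> 0 \<and> ufield al l p' r' x = inverse (zfield al p r x $ l) *\<^sub>R zfield al p r x"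
    if "x \<in> ball p r \<inter> ball p' r'" for x
    using that uboxD(4)[OF k, of x] by (simp add: zfield_eq ufield_eq)
  from f.reparametrize[OF V open_Int[OF open_ball open_ball] uB this eta]
  obtain \<kappa> where "\<kappa> > 0" "\<forall>w. dist w (snd c u) < \<kappa> \<longrightarrow> f.plaque w = f.plaque (snd c u) \<longrightarrow>
      (\<exists>\<theta>. \<bar>\<theta>\<bar> < \<eta> \<and> w = lipschitz_field.flow (zfield al p r) \<theta> (snd c u))" by blast
  then show ?thesis by (intro exI[of _ \<kappa>]) (simp add: plq_def)
qed

text \<open>This provides the short orbit pieces that \<open>saturation_negligible\<close> asks for,
  and unions as well as saturations inherit it.\<close>

definition locally_saturated :: "'m set \<Rightarrow> bool" where
  "locally_saturated S \<longleftrightarrow> (\<forall>k. ubox k \<longrightarrow> (\<forall>u\<in>S \<inter> dom_box k.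
     \<exists>G. open G \<and> u \<in> G \<and> (\<forall>w\<in>G \<inter> dom_box k. plq k w = plq k u \<longrightarrow> w \<in> S)))"

definition saturation where
  "saturation k S = {w\<in>dom_box k. \<exists>u\<in>S \<inter> dom_box k. plq k w = plq k u}"

lemma locally_saturated_Union:
  assumes "\<And>S. S \<in> F \<Longrightarrow> locally_saturated S" shows "locally_saturated (\<Union>F)"
  unfolding locally_saturated_def
proof (intro allI impI ballI)
  fix k u assume k: "ubox k" and u: "u \<in> \<Union>F \<inter> dom_box k"
  then obtain S where S: "S \<in> F" "u \<in> S \<inter> dom_box k" by blast
  then obtain G where "open G" "u \<in> G" "\<forall>w\<in>G \<inter> dom_box k. plq k w = plq k u \<longrightarrow> w \<in> S"
    using assms[OF S(1)] k unfolding locally_saturated_def by meson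
  then show "\<exists>G. open G \<and> u \<in> G \<and> (\<forall>w\<in>G \<inter> dom_box k. plq k w = plq k u \<longrightarrow> w \<in> \<Union>F)"
    using S(1) by (intro exI[of _ G]) blast
qed

lemma locally_saturated_saturation:
  assumes k: "ubox k" shows "locally_saturated (saturation k S)"
  unfolding locally_saturated_def
proof (intro allI impI ballI)
  fix k' w assume k': "ubox k'" and w: "w \<in> saturation k S \<inter> dom_box k'"
  then obtain u where u: "u \<in> S \<inter> dom_box k" "plq k w = plq k u" and wk: "w \<in> dom_box k" "w \<in> dom_box k'"
    by (auto simp: saturation_def)
  obtain G where G: "open G" "w \<in> G" "\<forall>y\<in>G \<inter> dom_box k'. plq k' y = plq k' w \<longrightarrow> y \<in> dom_box k \<and> plq k y = plq k w"
    using plq_compatible[OF k k' wk] by blast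
  show "\<exists>G. open G \<and> w \<in> G \<and> (\<forall>y\<in>G \<inter> dom_box k'. plq k' y = plq k' w \<longrightarrow> y \<in> saturation k S)"
    by (rule exI[of _ G], use G(1,2) in simp, intro ballI impI)
      (use G(3) u in \<open>auto simp: saturation_def intro!: bexI[of _ u]\<close>)
qed

text \<open>Near a point outside \<open>Sing\<close> plaques are pieces of orbits of the
  characteristic field, and \<open>ends\<close> is invariant under its flow.\<close>

lemma locally_saturated_end_set:
  assumes z: "zbox b" shows "locally_saturated (end_set b)"
  unfolding locally_saturated_def
proof (intro allI impI ballI)
  fix k' u assume k': "ubox k'" and u: "u \<in> end_set b \<inter> dom_box k'"
  obtain c U al p r where b: "b = (c, U, al, p, r)" by (cases b)
  note Z = zboxD[OF z[unfolded b]]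
  obtain L M where V: "lipschitz_field (zfield al p r) L M" using zfield_lipschitz[OF z[unfolded b]] by blast
  interpret v: lipschitz_field "zfield al p r" L M by (rule V)
  interpret n: lipschitz_field "\<lambda>x. - zfield al p r x" L M by (rule lipschitz_field_uminus[OF V])
  have uE: "u \<in> fst c" "snd c u \<in> ball p (r / 2)" "u \<notin> Sing" "v.ends (cball p (r/2)) (snd c u) \<or> n.ends (cball p (r/2)) (snd c u)"
    using u by (auto simp: end_set_def zbox_core_def b)
  have ur: "snd c u \<in> ball p r" using uE(2) Z(3) by simp
  have "snd c u \<in> U" using ur Z(2) ball_subset_cball by blast
  then obtain l p' r' where k: "ubox (c, U, al, l, p', r')" "u \<in> dom_box (c, U, al, l, p', r')"
    using ubox_exists[OF Z(1) uE(1) _ uE(3)] by blast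
  define k where "k = (c, U, al, l, p', r')"
  note kk = k[folded k_def]
  obtain G where G: "open G" "u \<in> G" "\<forall>y\<in>G \<inter> dom_box k'. plq k' y = plq k' u \<longrightarrow> y \<in> dom_box k \<and> plq k y = plq k u"
    using plq_compatible[OF kk(1) k' kk(2)] u by blast
  obtain \<kappa> where kap: "\<kappa> > 0" "\<forall>w. dist (snd c w) (snd c u) < \<kappa> \<longrightarrow> plq k w = plq k u \<longrightarrow> (\<exists>\<theta>. \<bar>\<theta>\<bar> < 1 \<and> snd c w = v.flow \<theta> (snd c u))"
    using zbox_orbit[OF z[unfolded b] k ur, of 1] unfolding k_def by auto
  define G' where "G' = G \<inter> {w\<in>fst c. snd c w \<in> ball (snd c u) \<kappa> \<inter> ball p (r / 2)}"
  show "\<exists>G. open G \<and> u \<in> G \<and> (\<forall>w\<in>G \<inter> dom_box k'. plq k' w = plq k' u \<longrightarrow> w \<in> end_set b)"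
  proof (intro exI[of _ G'] conjI ballI impI)
    show "open G'" unfolding G'_def
      by (intro open_Int G(1) chart_preimage_open[OF boxD(1)[OF Z(1)]] open_ball)
    show "u \<in> G'" using G(2) uE kap(1) by (simp add: G'_def)
    fix w assume w: "w \<in> G' \<inter> dom_box k'" and eq: "plq k' w = plq k' u"
    have wk: "w \<in> dom_box k" "plq k w = plq k u" using G(3) w eq by (auto simp: G'_def)
    have wc: "w \<in> fst c" "dist (snd c w) (snd c u) < \<kappa>" "snd c w \<in> ball p (r/2)" using w by (auto simp: G'_def dist_commute)
    obtain \<theta> where th: "snd c w = v.flow \<theta> (snd c u)" using kap(2) wc(2) wk(2) by blast
    have "snd c w = n.flow (- \<theta>) (snd c u)" using flow_uminus[OF V, of "- \<theta>" "snd c u"] th by simp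
    then have "v.ends (cball p (r/2)) (snd c w) \<or> n.ends (cball p (r/2)) (snd c w)"
      using uE(4) th v.ends_flow n.ends_flow by metis
    moreover have "w \<notin> Sing" by (rule dom_box_Sing[OF kk(1) wk(1)])
    ultimately show "w \<in> end_set b" using wc by (auto simp: end_set_def zbox_core_def b)
  qed
qed

text \<open>In the coordinates of the box, local saturation says that short pieces of orbits of
  \<open>ufield\<close> stay in the set, which reduces the sliding to rational times.\<close>

lemma saturation_measure_zero:
  assumes k: "ubox k" and S: "measure_zero A S" "locally_saturated S"
  shows "measure_zero A (saturation k S)"
proof -
  obtain c U al l p r where K: "k = (c, U, al, l, p, r)" by (cases k)
  obtain L M where fb: "flow_box (ufield al l p r) L M l" using ubox_flow_box k unfolding K by blast
  interpret f: flow_box "ufield al l p r" L M l by (rule fb)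
  have c: "c \<in> A" using boxD(1)[OF uboxD(1)[OF k[unfolded K]]] .
  define S' where "S' = snd c ` (S \<inter> dom_box k)"
  have dk: "dom_box k \<subseteq> fst c" by (auto simp: dom_box_def K)
  have nS: "negligible S'"
  proof (rule negligible_subset)
    show "negligible (snd c ` (S \<inter> fst c))" using S(1) c by (auto simp: measure_zero_def)
    show "S' \<subseteq> snd c ` (S \<inter> fst c)" using dk by (auto simp: S'_def)
  qed
  have loc: "\<exists>\<delta>>0. \<forall>t. \<bar>t\<bar> < \<delta> \<longrightarrow> f.flow t z \<in> S'" if zS: "z \<in> S'" for z
  proof -
    obtain u where u: "u \<in> S \<inter> dom_box k" "z = snd c u" using zS by (auto simp: S'_def)
    obtain G where G: "open G" "u \<in> G" "\<forall>w\<in>G \<inter> dom_box k. plq k w = plq k u \<longrightarrow> w \<in> S"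
      using S(2) k u(1) unfolding locally_saturated_def by meson
    define W where "W = snd c ` ((G \<inter> dom_box k) \<inter> fst c)"
    have oW: "open W" unfolding W_def by (rule chart_image_open_sub[OF c]) (intro open_Int G dom_box_open k)
    have "open ((\<lambda>t. f.flow t z) -` W)"
      using f.flow_continuous_time[of UNIV z] oW continuous_on_open_vimage[OF open_UNIV, of "\<lambda>t. f.flow t z"] by simp
    moreover have "0 \<in> (\<lambda>t. f.flow t z) -` W" using u G(2) dk by (auto simp: W_def)
    ultimately obtain \<delta> where d: "\<delta> > 0" "ball 0 \<delta> \<subseteq> (\<lambda>t. f.flow t z) -` W" using open_contains_ball by blast
    have "f.flow t z \<in> S'" if t: "\<bar>t\<bar> < \<delta>" for t
    proof -
      have "f.flow t z \<in> W" using d(2) t by auto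
      then obtain w where w: "w \<in> G \<inter> dom_box k" "f.flow t z = snd c w" by (auto simp: W_def)
      have "plq k w = plq k u" using f.plaque_flow[of t z] w(2) u(2) by (simp add: plq_def K)
      then show ?thesis using G(3) w by (auto simp: S'_def)
    qed
    then show ?thesis using d(1) by blast
  qed
  have "negligible (snd c ` saturation k S)"
    by (rule negligible_subset[OF f.saturation_negligible[OF nS loc]]) (auto simp: saturation_def S'_def plq_def K)
  then show ?thesis by (intro measure_zero_chart[OF c]) (use dk in \<open>auto simp: saturation_def\<close>)
qed

lemma plaque_measure_zero:
  assumes k: "ubox k" shows "measure_zero A (saturation k {x})"
proof -
  obtain c U al l p r where K: "k = (c, U, al, l, p, r)" by (cases k)
  obtain L M where fb: "flow_box (ufield al l p r) L M l" using ubox_flow_box k unfolding K by blast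
  interpret f: flow_box "ufield al l p r" L M l by (rule fb)
  have c: "c \<in> A" using boxD(1)[OF uboxD(1)[OF k[unfolded K]]] .
  have "negligible (snd c ` saturation k {x})"
    by (rule negligible_subset[OF f.orbit_negligible[of "snd c x"]]) (auto simp: saturation_def plq_def K)
  then show ?thesis by (intro measure_zero_chart[OF c]) (auto simp: saturation_def dom_box_def K)
qed

end

section \<open>End-points of singular paths\<close>

context corank_one
begin

text \<open>Saturating in one box can spoil saturation in another, so all boxes of \<open>J\<close>
  are applied over and over. Every finite stage is null and locally saturated, and the union of the
  stages is closed under saturation.\<close>

lemma saturation_closure:
  assumes J: "countable J" "J \<subseteq> {k. ubox k}" and S: "measure_zero A S" "locally_saturated S"
  obtains \<Omega> where "S \<subseteq> \<Omega>" "measure_zero A \<Omega>" "\<forall>k\<in>J. saturation k \<Omega> \<subseteq> \<Omega>"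
proof -
  define F where "F T = \<Union>(insert T ((\<lambda>k. saturation k T) ` J))" for T
  define X where "X n = (F ^^ n) S" for n
  have X: "X 0 = S" "X (Suc n) = F (X n)" for n by (simp_all add: X_def)
  have good: "measure_zero A (X n) \<and> locally_saturated (X n)" for n
  proof (induction n)
    case 0 then show ?case using S X by simp
  next
    case (Suc n)
    have "measure_zero A (F (X n))" unfolding F_def
      by (rule measure_zero_countable_Union) (use J Suc saturation_measure_zero in auto)
    moreover have "locally_saturated (F (X n))" unfolding F_def
      by (rule locally_saturated_Union) (use J Suc locally_saturated_saturation in auto)
    ultimately show ?case by (simp add: X)
  qed
  have sub: "saturation k (\<Union>(range X)) \<subseteq> \<Union>(range X)" if k: "k \<in> J" for k
  proof
    fix w assume "w \<in> saturation k (\<Union>(range X))"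
    then obtain n where "w \<in> saturation k (X n)" unfolding saturation_def by blast
    then have "w \<in> X (Suc n)" using k unfolding X F_def by blast
    then show "w \<in> \<Union>(range X)" by blast
  qed
  show ?thesis
  proof (rule that[of "\<Union>(range X)"])
    show "S \<subseteq> \<Union>(range X)" using X(1) by blast
    show "measure_zero A (\<Union>(range X))" by (rule measure_zero_countable_Union) (use good in auto)
  qed (use sub in blast)
qed

text \<open>Around each time the path stays in a single plaque of a single box, so membership in
  \<Omega> is locally constant in time and the interval is connected.\<close>

lemma singular_path_stays:
  assumes sing: "singular_path A \<Delta> \<gamma>" and a: "0 \<le> a" "a \<le> 1" and off: "\<And>t. t \<in> {a..1} \<Longrightarrow> \<gamma> t \<notin> Sing"
    and J: "J \<subseteq> {k. ubox k}" "- Sing \<subseteq> (\<Union>k\<in>J. dom_box k)" and sat: "\<forall>k\<in>J. saturation k \<Omega> \<subseteq> \<Omega>" and start: "\<gamma> a \<in> \<Omega>"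
  shows "\<gamma> 1 \<in> \<Omega>"
proof (rule connected_induction_simple[where P = "\<lambda>t. \<gamma> t \<in> \<Omega>" and S = "{a..1}", OF _ _ _ start])
  fix s assume s: "s \<in> {a..1}"
  obtain k where k: "k \<in> J" "\<gamma> s \<in> dom_box k" using J(2) off[OF s] by blast
  have uk: "ubox k" using k(1) J(1) by blast
  have s01: "s \<in> {0..1}" using s a by auto
  obtain \<delta> where d: "\<delta> > 0" "\<forall>t\<in>{0..1}. \<bar>t - s\<bar> < \<delta> \<longrightarrow> \<gamma> t \<in> dom_box k \<and> plq k (\<gamma> t) = plq k (\<gamma> s)"
    using plq_singular_path[OF sing uk s01 k(2)] by blast
  show "\<exists>T. openin (top_of_set {a..1}) T \<and> s \<in> T \<and> (\<forall>x\<in>T. \<forall>y\<in>T. \<gamma> x \<in> \<Omega> \<longrightarrow> \<gamma> y \<in> \<Omega>)"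
  proof (intro exI[of _ "{a..1} \<inter> ball s \<delta>"] conjI ballI impI)
    show "openin (top_of_set {a..1}) ({a..1} \<inter> ball s \<delta>)" by (rule openin_open_Int) simp
    show "s \<in> {a..1} \<inter> ball s \<delta>" using s d(1) by simp
    fix x y assume xy: "x \<in> {a..1} \<inter> ball s \<delta>" "y \<in> {a..1} \<inter> ball s \<delta>" "\<gamma> x \<in> \<Omega>"
    have near: "\<gamma> t \<in> dom_box k \<and> plq k (\<gamma> t) = plq k (\<gamma> s)" if "t \<in> {a..1} \<inter> ball s \<delta>" for t
      using d(2) that a by (auto simp: dist_real_def abs_minus_commute)
    have "\<gamma> y \<in> saturation k \<Omega>" unfolding saturation_def using near[OF xy(1)] near[OF xy(2)] xy(3)
      by (intro CollectI conjI bexI[of _ "\<gamma> x"]) auto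
    then show "\<gamma> y \<in> \<Omega>" using sat k(1) by blast
  qed
qed (use a in auto)

text \<open>Just after \<open>s0\<close> the path moves along one orbit of the field, away from a
  zero and with small variation. Read backwards towards \<open>s0\<close>, this is the situation of
  \<open>path_to_zero_ends\<close>.\<close>

lemma leaving_Sing_end_set:
  assumes sing: "singular_path A \<Delta> \<gamma>" and s0: "0 \<le> s0" "s0 < 1" "\<gamma> s0 \<in> Sing" and off: "\<And>t. t \<in> {s0<..1} \<Longrightarrow> \<gamma> t \<notin> Sing"
    and z: "zbox b" "\<gamma> s0 \<in> zbox_core b"
  shows "\<exists>s1\<in>{s0<..1}. \<gamma> s1 \<in> end_set b"
proof -
  obtain c U al p r where b: "b = (c, U, al, p, r)" by (cases b)
  note Z = zboxD[OF z(1)[unfolded b]]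
  have c: "c \<in> A" by (rule boxD(1)[OF Z(1)])
  obtain L M where V: "lipschitz_field (zfield al p r) L M" using zfield_lipschitz[OF z(1)[unfolded b]] by blast
  interpret v: lipschitz_field "zfield al p r" L M by (rule V)
  have x0: "\<gamma> s0 \<in> fst c" "snd c (\<gamma> s0) \<in> ball p (r / 2)" using z(2) by (auto simp: zbox_core_def b)
  have s01: "s0 \<in> {0..1}" using s0 by auto
  obtain \<delta> N where d: "\<delta> > 0" and "negligible N"
    and inc: "\<And>t. t \<in> {0..1} \<Longrightarrow> \<bar>t - s0\<bar> \<le> \<delta> \<Longrightarrow> \<gamma> t \<in> fst c \<and> snd c (\<gamma> t) \<in> ball p (r / 2)"
    and ac: "abs_continuous_on ({0..1} \<inter> {s0 - \<delta>..s0 + \<delta>}) (snd c \<circ> \<gamma>)"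
    and "\<And>t. 0 < t \<Longrightarrow> t < 1 \<Longrightarrow> \<bar>t - s0\<bar> < \<delta> \<Longrightarrow> t \<notin> N \<Longrightarrow>
       ((snd c \<circ> \<gamma>) has_vector_derivative velocity A \<gamma> t c) (at t) \<and> char_at (\<gamma> t) (velocity A \<gamma> t)"
    using singular_path_local[OF sing s01 c x0(1) open_ball x0(2)] by blast
  obtain \<delta>' where d': "\<delta>' > 0" and var: "\<forall>c' d D. {c'..d} \<subseteq> {0..1} \<inter> {s0 - \<delta>..s0 + \<delta>} \<longrightarrow> c' \<le> d \<longrightarrow> d - c' < \<delta>' \<longrightarrow> finite D \<longrightarrow>
      (\<forall>(s, t)\<in>D. c' \<le> s \<and> t \<le> d \<and> s \<le> t) \<longrightarrow> disjoint_family_on (\<lambda>(s, t). {s<..<t}) D \<longrightarrow>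
      (\<Sum>(s, t)\<in>D. norm ((snd c \<circ> \<gamma>) t - (snd c \<circ> \<gamma>) s)) < 1"
    by (rule abs_continuous_on_short_variation[OF ac zero_less_one])
  \<comment> \<open>The interval after \<open>s0\<close> is taken so short that the path stays in
    the half ball and has variation below 1, the length bound that \<open>path_to_zero_ends\<close>
    expects.\<close>
  define m where "m = min (min \<delta> \<delta>') (1 - s0)"
  have m: "m > 0" "m \<le> \<delta>" "m \<le> \<delta>'" "m \<le> 1 - s0" using d d' s0(2) by (auto simp: m_def)
  define s1 where "s1 = s0 + m / 2"
  have s1: "s0 < s1" "s1 \<le> 1" "s1 - s0 < \<delta>" "s1 - s0 < \<delta>'"
    using m by (auto simp: s1_def)
  define f where "f = snd c \<circ> \<gamma>"
  have inI: "{s0..s1} \<subseteq> {0..1} \<inter> {s0 - \<delta>..s0 + \<delta>}" using s1 s0(1) d by auto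
  have loc: "\<gamma> t \<in> fst c \<and> f t \<in> ball p (r / 2) \<and> f t \<in> cball p r \<and> f t \<in> U" if t: "t \<in> {s0..s1}" for t
  proof -
    have "\<gamma> t \<in> fst c \<and> snd c (\<gamma> t) \<in> ball p (r / 2)" using inc[of t] t s1 s0 by auto
    moreover have "f t \<in> cball p r" if "f t \<in> ball p (r / 2)" using that Z(3) by simp
    ultimately show ?thesis using Z(2) by (auto simp: f_def)
  qed
  have zero: "zfield al p r (f t) = 0 \<longleftrightarrow> \<gamma> t \<in> Sing" if "t \<in> {s0..s1}" for t
    using Sing_iff[OF Z(1), of "\<gamma> t"] loc[OF that] by (simp add: zfield_eq f_def)
  have cf: "continuous_on {s0..s1} f" unfolding f_def
    by (rule continuous_on_subset[OF abs_continuous_on_continuous[OF abs_continuous_on_subset[OF ac inI]] order_refl])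
  have offs: "\<gamma> t \<notin> Sing" if "t \<in> {s0<..s1}" for t using off[of t] that s1 by auto
  have orbit: "\<exists>\<kappa>>0. \<forall>s'\<in>{s0<..s1}. \<bar>s' - s\<bar> < \<kappa> \<longrightarrow> (\<exists>\<theta>. \<bar>\<theta>\<bar> < \<eta> \<and> f s' = v.flow \<theta> (f s))"
    if s: "s \<in> {s0<..s1}" and eta: "\<eta> > 0" for s \<eta>
  proof -
    have ss: "s \<in> {s0..s1}" "s \<in> {0..1}" using s s0 s1 by auto
    note ls = loc[OF ss(1)]
    obtain l p' r' where k: "ubox (c, U, al, l, p', r')" "\<gamma> s \<in> dom_box (c, U, al, l, p', r')"
      using ubox_exists[OF Z(1) _ _ offs[OF s]] ls unfolding f_def by auto
    have "snd c (\<gamma> s) \<in> ball p r" using ls Z(3) by (simp add: f_def)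
    from zbox_orbit[OF z(1)[unfolded b] k this eta]
    obtain \<kappa>1 where k1: "\<kappa>1 > 0" "\<forall>w. dist (snd c w) (snd c (\<gamma> s)) < \<kappa>1 \<longrightarrow> plq (c, U, al, l, p', r') w = plq (c, U, al, l, p', r') (\<gamma> s) \<longrightarrow>
       (\<exists>\<theta>. \<bar>\<theta>\<bar> < \<eta> \<and> snd c w = v.flow \<theta> (snd c (\<gamma> s)))" by blast
    obtain \<kappa>2 where k2: "\<kappa>2 > 0" "\<forall>t\<in>{0..1}. \<bar>t - s\<bar> < \<kappa>2 \<longrightarrow> \<gamma> t \<in> dom_box (c, U, al, l, p', r') \<and>
       plq (c, U, al, l, p', r') (\<gamma> t) = plq (c, U, al, l, p', r') (\<gamma> s)"
      using plq_singular_path[OF sing k(1) ss(2) k(2)] by blast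
    obtain \<kappa>3 where k3: "\<kappa>3 > 0" "\<forall>t\<in>{s0..s1}. dist t s < \<kappa>3 \<longrightarrow> dist (f t) (f s) < \<kappa>1"
      using cf[unfolded continuous_on_iff, rule_format, OF ss(1) k1(1)] by blast
    show ?thesis
    proof (rule exI[of _ "min \<kappa>2 \<kappa>3"], intro conjI ballI impI)
      show "min \<kappa>2 \<kappa>3 > 0" using k2(1) k3(1) by simp
      fix t assume t: "t \<in> {s0<..s1}" "\<bar>t - s\<bar> < min \<kappa>2 \<kappa>3"
      have "t \<in> {0..1}" using t s0 s1 by auto
      then have "plq (c, U, al, l, p', r') (\<gamma> t) = plq (c, U, al, l, p', r') (\<gamma> s)" using k2(2) t by auto
      moreover have "dist (snd c (\<gamma> t)) (snd c (\<gamma> s)) < \<kappa>1" using k3(2) t by (auto simp: f_def dist_real_def)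
      ultimately show "\<exists>\<theta>. \<bar>\<theta>\<bar> < \<eta> \<and> f t = v.flow \<theta> (f s)" using k1(2) by (simp add: f_def)
    qed
  qed
  have "v.ends (cball p (r / 2)) (f s1) \<or> lipschitz_field.ends (\<lambda>x. - zfield al p r x) (cball p (r / 2)) (f s1)"
  proof (rule v.path_to_zero_ends[OF s1(1) cf])
    show "zfield al p r (f s0) = 0" using zero[of s0] s0(3) s1(1) by simp
    show "zfield al p r (f s) \<noteq> 0" if "s \<in> {s0<..s1}" for s using zero[of s] offs[OF that] that by simp
    show "\<forall>s\<in>{s0..s1}. f s \<in> cball p (r / 2)" using loc ball_subset_cball by blast
    show "\<forall>D. finite D \<longrightarrow> (\<forall>(s, t)\<in>D. s0 \<le> s \<and> t \<le> s1 \<and> s \<le> t) \<longrightarrow> disjoint_family_on (\<lambda>(s, t). {s<..<t}) D \<longrightarrow>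
        (\<Sum>(s, t)\<in>D. norm (f t - f s)) \<le> 1"
      using var[THEN spec, THEN spec, THEN spec, THEN mp, OF inI] s1(1,4) unfolding f_def by (simp add: less_imp_le)
  qed (rule orbit)
  then have "\<gamma> s1 \<in> end_set b" using loc[of s1] offs[of s1] s1(1) by (auto simp: end_set_def zbox_core_def b f_def)
  then show ?thesis using s1 by auto
qed

lemma singular_path_off_Sing:
  assumes sing: "singular_path A \<Delta> \<gamma>" and s: "s \<in> {0..1}" "\<gamma> s \<notin> Sing"
  shows "\<exists>\<delta>>0. \<forall>t\<in>{0..1}. \<bar>t - s\<bar> < \<delta> \<longrightarrow> \<gamma> t \<notin> Sing"
proof -
  obtain c where c: "c \<in> A" "\<gamma> s \<in> fst c" using chart_cover by blast
  obtain U al where b: "box c U al" "snd c (\<gamma> s) \<in> U" by (rule box_exists[OF c])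
  obtain l p r where k: "ubox (c, U, al, l, p, r)" "\<gamma> s \<in> dom_box (c, U, al, l, p, r)"
    using ubox_exists[OF b(1) c(2) b(2) s(2)] by blast
  show ?thesis using plq_singular_path[OF sing k(1) s(1) k(2)] dom_box_Sing[OF k(1)] by meson
qed

lemma Abn_measure_zero: "measure_zero A (Abn A \<Delta> x)"
proof -
  obtain J where J: "countable J" "J \<subseteq> {k. ubox k}" "(\<Union>k\<in>J. dom_box k) = (\<Union>k\<in>{k. ubox k}. dom_box k)"
    by (rule countable_subcover[of "{k. ubox k}" dom_box]) (auto intro: dom_box_open)
  obtain I where I: "countable I" "I \<subseteq> {b. zbox b}" "(\<Union>b\<in>I. zbox_core b) = (\<Union>b\<in>{b. zbox b}. zbox_core b)"
    by (rule countable_subcover[of "{b. zbox b}" zbox_core]) (auto intro: zbox_core_open)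
  have Jcov: "- Sing \<subseteq> (\<Union>k\<in>J. dom_box k)"
  proof
    fix y assume y: "y \<in> - Sing"
    obtain c where c: "c \<in> A" "y \<in> fst c" using chart_cover by blast
    obtain U al where b: "box c U al" "snd c y \<in> U" by (rule box_exists[OF c])
    obtain l p r where "ubox (c, U, al, l, p, r)" "y \<in> dom_box (c, U, al, l, p, r)"
      using ubox_exists[OF b(1) c(2) b(2)] y by blast
    then show "y \<in> (\<Union>k\<in>J. dom_box k)" unfolding J(3) by blast
  qed
  \<comment> \<open>The null set is fixed before the path. It has to contain the plaques through
    \<open>x\<close>, for paths that never meet \<open>Sing\<close>, and the end sets of countably
    many balls, for paths that leave \<open>Sing\<close> for the last time.\<close>
  define F where "F = end_set ` I \<union> (\<lambda>k. saturation k {x}) ` J"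
  have mF: "measure_zero A (\<Union>F)"
    by (rule measure_zero_countable_Union) (use I J in \<open>auto simp: F_def intro!: end_set_measure_zero plaque_measure_zero\<close>)
  have lF: "locally_saturated (\<Union>F)"
    by (rule locally_saturated_Union) (use I J in \<open>auto simp: F_def intro!: locally_saturated_end_set locally_saturated_saturation\<close>)
  obtain \<Omega> where \<Omega>: "\<Union>F \<subseteq> \<Omega>" "measure_zero A \<Omega>" "\<forall>k\<in>J. saturation k \<Omega> \<subseteq> \<Omega>"
    by (rule saturation_closure[OF J(1,2) mF lF])
  have "\<gamma> 1 \<in> Sing \<union> \<Omega>" if sing: "singular_path A \<Delta> \<gamma>" and x: "\<gamma> 0 = x" for \<gamma>
  proof (cases "\<gamma> 1 \<in> Sing")
    case False
    define T where "T = {t\<in>{0..1}. \<gamma> t \<in> Sing}"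
    have "\<gamma> 1 \<in> \<Omega>"
    proof (cases "T = {}")
      case True
      then have off: "\<gamma> t \<notin> Sing" if "t \<in> {0..1}" for t using that by (auto simp: T_def)
      have "x \<in> - Sing" using off[of 0] x by simp
      then obtain k where k: "k \<in> J" "x \<in> dom_box k" using Jcov by blast
      then have "x \<in> saturation k {x}" by (simp add: saturation_def)
      then have "\<gamma> 0 \<in> \<Omega>" using \<Omega>(1) k(1) x by (auto simp: F_def)
      then show ?thesis by (intro singular_path_stays[OF sing order_refl zero_le_one _ J(2) Jcov \<Omega>(3)] off)
    next
      case ne: False
      have bT: "bdd_above T" by (rule bdd_aboveI[of _ 1]) (auto simp: T_def)
      \<comment> \<open>The last time in \<open>Sing\<close>: the supremum is attained because the
        times off \<open>Sing\<close> form an open set in the unit interval.\<close>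
      define s0 where "s0 = Sup T"
      have up: "t \<le> s0" if "t \<in> T" for t unfolding s0_def by (rule cSup_upper[OF that bT])
      have s01: "s0 \<in> {0..1}"
      proof -
        obtain t where "t \<in> T" using ne by blast
        then have "0 \<le> s0" using up[of t] by (auto simp: T_def)
        moreover have "s0 \<le> 1" unfolding s0_def by (rule cSup_least[OF ne]) (auto simp: T_def)
        ultimately show ?thesis by simp
      qed
      have s0T: "\<gamma> s0 \<in> Sing"
      proof (rule ccontr)
        assume "\<gamma> s0 \<notin> Sing"
        then obtain \<delta> where d: "\<delta> > 0" "\<forall>t\<in>{0..1}. \<bar>t - s0\<bar> < \<delta> \<longrightarrow> \<gamma> t \<notin> Sing"
          using singular_path_off_Sing[OF sing s01] by blast
        obtain t where t: "t \<in> T" "s0 - \<delta> < t"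
          using less_cSup_iff[OF ne bT, of "s0 - \<delta>"] d(1) unfolding s0_def by auto
        then show False using d up[OF t(1)] by (auto simp: T_def)
      qed
      then have s1: "s0 < 1" using False s01 by (cases "s0 = 1") auto
      have off: "\<gamma> t \<notin> Sing" if "t \<in> {s0<..1}" for t using up[of t] that s01 by (auto simp: T_def)
      obtain b where b: "b \<in> I" "\<gamma> s0 \<in> zbox_core b" using zbox_exists[of "\<gamma> s0"] I(3) by blast
      have "zbox b" using b(1) I(2) by blast
      then obtain r where r: "r \<in> {s0<..1}" "\<gamma> r \<in> end_set b"
        using leaving_Sing_end_set[OF sing _ s1 s0T off _ b(2)] s01 by auto
      have "\<gamma> r \<in> \<Omega>" using \<Omega>(1) r(2) b(1) by (auto simp: F_def)
      moreover have "\<gamma> t \<notin> Sing" if "t \<in> {r..1}" for t using off[of t] that r(1) by auto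
      ultimately show ?thesis
        by (intro singular_path_stays[OF sing _ _ _ J(2) Jcov \<Omega>(3), of r]) (use r(1) s01 in auto)
    qed
    then show ?thesis by blast
  qed simp
  then have "Abn A \<Delta> x \<subseteq> \<Union>{Sing, \<Omega>}" by (auto simp: Abn_def)
  moreover have "measure_zero A (\<Union>{Sing, \<Omega>})"
    by (rule measure_zero_countable_Union) (use Sing_measure_zero \<Omega>(2) in auto)
  ultimately show ?thesis by (rule measure_zero_subset[rotated])
qed

end

theorem corollary1p4:
  fixes A :: "('m::{t2_space, second_countable_topology}, real ^ 4) chart set"
    and \<Delta> :: "'m \<Rightarrow> ('m, real ^ 4) tvec set"
  assumes "smooth_atlas A"
    and "connected (UNIV :: 'm set)"
    and "distribution A 3 \<Delta>"
    and "totally_nonholonomic A \<Delta>"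
  shows "sard_conjecture A \<Delta>"
proof -
  interpret corank_one A \<Delta>
    using assms by unfold_locales
  show ?thesis unfolding sard_conjecture_def using Abn_measure_zero by blast
qed

end
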